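(* Suppose Assumptions 1 and 2 (stated in the context) hold, and let $\hat\mu_{\mathrm d}(x)$ be the debiased Mondrian random forest estimator of debiasing order $J\ge0$ with base lifetime $\lambda=\lambda_n$ and $B=B_n$ trees in each forest. Then $$\mathbb{E}\left[\big(\hat\mu_{\mathrm d}(x)-\mu(x)\big)^2\right]\lesssim\frac{\lambda^d}{n}+\frac{1}{\lambda^{2((2J+2)\wedge\beta)}}+\frac{1}{\lambda^{2(1\wedge\beta)}B}.$$ Thus, if $J\ge\lfloor\underline\beta/2\rfloor$, $\lambda\asymp n^{\frac{1}{d+2\beta}}$ and $B\gtrsim n^{\frac{2\beta-2(1\wedge\beta)}{d+2\beta}}$, then $$\mathbb{E}\left[\big(\hat\mu_{\mathrm d}(x)-\mu(x)\big)^2\right]\lesssim n^{-\frac{2\beta}{d+2\beta}}.$$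
   Context: Notation. $\mathbb{N}=\{0,1,2,\dots\}$; $a\wedge b$ and $a\vee b$ are minimum and maximum. For non-negative sequences, $a_n\lesssim b_n$ (equivalently $b_n\gtrsim a_n$) means $a_n/b_n$ is bounded over $n\ge1$ (the bound may depend on fixed quantities such as $d$, $x$, $J$, $a_r$, the law of the data and the sequences $\lambda_n,B_n$, but not on $n$); $a_n\asymp b_n$ means $a_n\lesssim b_n\lesssim a_n$. $\mathbb{I}$ denotes an indicator. Hölder classes. For $\beta>0$ let $\underline{\beta}=\lceil\beta-1\rceil$ be the largest integer strictly less than $\beta$. Write $g\in\mathcal{H}^\beta$ if $g:[0,1]^d\to\mathbb{R}$ is $\underline\beta$ times differentiable and, for some $C>0$, $\max_{|\nu|=\underline\beta}|\partial^\nu g(x)-\partial^\nu g(x')|\le C\|x-x'\|_2^{\beta-\underline\beta}$ for all $x,x'\in[0,1]^d$ ($\nu\in\mathbb{N}^d$ a multi-index). Assumption 1 (data). Fix $d\ge1$. $(X_i,Y_i)$, $1\le i\le n$, are i.i.d. from a distribution on $\mathbb{R}^d\times\mathbb{R}$; $\mathbf{X}=(X_1,\dots,X_n)$. $X_i$ has a Lebesgue density $f$ on $[0,1]^d$, bounded away from zero, with $f\in\mathcal{H}^{\beta_f}$ for some $\beta_f>0$. $\mathbb{E}[Y_i^2\mid X_i]$ is bounded, $\mu(X_i)=\mathbb{E}[Y_i\mid X_i]$ with $\mu\in\mathcal{H}^{\beta_\mu}$, $\beta_\mu>0$. With $\varepsilon_i=Y_i-\mu(X_i)$, $\sigma^2(X_i)=\mathbb{E}[\varepsilon_i^2\mid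 X_i]$ is bounded away from zero with $\sigma^2\in\mathcal{H}^{\beta_\sigma}$, $\beta_\sigma>0$. Set $\beta=\beta_\mu\wedge(\beta_f+1)$. Mondrian process $\mathcal{M}([0,1]^d,\lambda)$. For a rectangle $D=\prod_j[l_j,u_j]\subseteq[0,1]^d$ let $|D_j|=u_j-l_j$, $|D|=\prod_j|D_j|$, $|D|_1=\sum_j|D_j|$. Start at time $0$ with the trivial partition of $[0,1]^d$. For each cell $D$, formed at time $t_D$, sample $E_D\sim\mathrm{Exp}(|D|_1)$ (rate $|D|_1$) independently. If $t_D+E_D\le\lambda$, split $D$: choose coordinate $K$ with $\mathbb{P}(K=j)=|D_j|/|D|_1$ and location $S\sim\mathrm{Unif}[l_K,u_K]$, producing cells $\{x\in D:x_K\le S\}$ and $\{x\in D:x_K>S\}$, each formed at time $t_D+E_D$. The output $T$ is the partition consisting of the cells not split (those with $t_D+E_D>\lambda$); $T(x)$ is the cell containing $x$. Debiased Mondrian random forest. Fix an integer $J\ge0$ and distinct constants $a_0,\dots,a_J>0$ (not depending on $n$). Let $\omega_0,\dots,\omega_J\in\mathbb{R}$ be the unique solution of $\sum_{r=0}^J\omega_r=1$ and $\sum_{r=0}^J\omega_ra_r^{-2s}=0$ for $1\le s\le J$. Let $T_{br}\sim\mathcal{M}([0,1]^d,a_r\lambda)$, $1\le b\le B$, $0\le r\le J$, be mutually independent and independent of the data; $\mathbf{T}$ is the collection of all these trees. With $N_{br}(x)=\sum_{i=1}^n\mathbb{I}\{X_i\in T_{br}(x)\}$ and $0/0=0$, $\hat\mu_{\mathrm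 d}(x)=\sum_{r=0}^J\omega_r\frac1B\sum_{b=1}^B\frac{\sum_{i=1}^nY_i\,\mathbb{I}\{X_i\in T_{br}(x)\}}{N_{br}(x)}$. Assumption 2 (estimator). $x\in(0,1)^d$ is a fixed point; $\lambda=\lambda_n>0$ and $B=B_n\ge1$ satisfy $\lambda\gtrsim(\log n)^3$, $n/\lambda^d\to\infty$, and $B\gtrsim(\log n)^d$. The dimension $d$ does not depend on $n$. *)

theory Defs
  imports "HOL-Probability.Probability"
begin

definition lesssim :: "(nat \<Rightarrow> real) \<Rightarrow> (nat \<Rightarrow> real) \<Rightarrow> bool"  (infix \<open>\<lesssim>\<close> 50)
  where "a \<lesssim> b \<longleftrightarrow> bdd_above ((\<lambda>n. a n / b n) ` {1..})"

definition asymp_same :: "(nat \<Rightarrow> real) \<Rightarrow> (nat \<Rightarrow> real) \<Rightarrow> bool"  (infix \<open>\<asymp>\<close> 50)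
  where "a \<asymp> b \<longleftrightarrow> a \<lesssim> b \<and> b \<lesssim> a"

abbreviation unit_cube :: "(real ^ 'd) set"
  where "unit_cube \<equiv> cbox 0 1"

text \<open>For \<open>\<beta> > 0\<close> this is the largest integer strictly less than \<open>\<beta>\<close>.\<close>

definition holder_order :: "real \<Rightarrow> nat"
  where "holder_order \<beta> = nat \<lceil>\<beta> - 1\<rceil>"

text \<open>
  \<open>G \<nu>\<close> is the partial derivative of \<open>g\<close> with multi-index \<open>\<nu>\<close>, for all \<open>\<nu>\<close> of order at most \<open>k\<close>.
  Derivatives are taken within the closed cube, so they are one-sided on its boundary; the cube is
  nondegenerate, hence they are unique and the values of \<open>g\<close> outside the cube are irrelevant.
\<close>

definition partials_upto ::
    "nat \<Rightarrow> (real ^ 'd \<Rightarrow> real) \<Rightarrow> (('d \<Rightarrow> nat) \<Rightarrow> real ^ 'd \<Rightarrow> real) \<Rightarrow> bool"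
  where "partials_upto k g G \<longleftrightarrow>
    (\<forall>x\<in>unit_cube. G (\<lambda>_. 0) x = g x) \<and>
    (\<forall>\<nu>. sum \<nu> UNIV < k \<longrightarrow> (\<forall>x\<in>unit_cube.
       (G \<nu> has_derivative (\<lambda>h. \<Sum>j\<in>UNIV. G (\<nu>(j := Suc (\<nu> j))) x * h $ j))
         (at x within unit_cube)))"

definition holder_class :: "real \<Rightarrow> (real ^ 'd \<Rightarrow> real) set"
  where "holder_class \<beta> = {g. \<exists>G. partials_upto (holder_order \<beta>) g G \<and>
    (\<exists>C>0. \<forall>\<nu>. sum \<nu> UNIV = holder_order \<beta> \<longrightarrow> (\<forall>x\<in>unit_cube. \<forall>x'\<in>unit_cube.
       \<bar>G \<nu> x - G \<nu> x'\<bar> \<le> C * norm (x - x') powr (\<beta> - holder_order \<beta>)))}"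

text \<open>
  Cells are sets; the endpoints of the sides of the bounding rectangle are recovered as infima and
  suprema of coordinates.
\<close>

definition side_lower :: "(real ^ 'd) set \<Rightarrow> 'd \<Rightarrow> real"
  where "side_lower D j = (INF x\<in>D. x $ j)"

definition side_upper :: "(real ^ 'd) set \<Rightarrow> 'd \<Rightarrow> real"
  where "side_upper D j = (SUP x\<in>D. x $ j)"

definition side_length :: "(real ^ 'd) set \<Rightarrow> 'd \<Rightarrow> real"
  where "side_length D j = side_upper D j - side_lower D j"

definition side_sum :: "(real ^ 'd) set \<Rightarrow> real"
  where "side_sum D = (\<Sum>j\<in>UNIV. side_length D j)"

text \<open>
  The random choices made at a cell \<open>D\<close> are realised from a standard exponential variable \<open>e\<close> and
  two standard uniform variables \<open>u\<close>, \<open>v\<close>. The coordinate is chosen by inverting the distribution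
  function of the probabilities \<open>side_length D j / side_sum D\<close>, the coordinates being enumerated
  by \<open>to_nat\<close>. The lemmas \<open>split_wait_law\<close>, \<open>split_coord_law\<close> and \<open>split_location_law\<close> below
  state that the resulting laws are the intended ones.
\<close>

definition split_wait :: "(real ^ 'd) set \<Rightarrow> real \<Rightarrow> real"
  where "split_wait D e = e / side_sum D"

definition split_coord :: "(real ^ 'd) set \<Rightarrow> real \<Rightarrow> 'd"
  where "split_coord D u = (THE k.
    (\<Sum>j | to_nat j < to_nat k. side_length D j) \<le> u * side_sum D \<and>
    u * side_sum D < (\<Sum>j | to_nat j \<le> to_nat k. side_length D j))"

definition split_location :: "(real ^ 'd) set \<Rightarrow> 'd \<Rightarrow> real \<Rightarrow> real"
  where "split_location D k v = side_lower D k + v * side_length D k"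

type_synonym mark = "real \<times> real \<times> real"

abbreviation std_uniform :: "real measure"
  where "std_uniform \<equiv> uniform_measure lborel {0..1}"

text \<open>
  Every potential node of the tree carries an independent mark. A node is addressed by the list of
  turns leading to it from the root, most recent turn first.
\<close>

definition mark_law :: "mark measure"
  where "mark_law = density lborel (exponential_density 1) \<Otimes>\<^sub>M (std_uniform \<Otimes>\<^sub>M std_uniform)"

definition marks_law :: "(bool list \<Rightarrow> mark) measure"
  where "marks_law = Pi\<^sub>M UNIV (\<lambda>_. mark_law)"

text \<open>\<open>mondrian_cell \<lambda> \<xi> w D t\<close>: the cell \<open>D\<close> is formed at node \<open>w\<close> at time \<open>t\<close>.\<close>

inductive mondrian_cell ::
    "real \<Rightarrow> (bool list \<Rightarrow> mark) \<Rightarrow> bool list \<Rightarrow> (real ^ 'd) set \<Rightarrow> real \<Rightarrow> bool"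
  for lifetime :: real and \<xi> :: "bool list \<Rightarrow> mark"
  where
    root: "mondrian_cell lifetime \<xi> [] unit_cube 0"
  | lower: "\<lbrakk>mondrian_cell lifetime \<xi> w D t; \<xi> w = (e, u, v); t + split_wait D e \<le> lifetime;
       k = split_coord D u; s = split_location D k v\<rbrakk>
      \<Longrightarrow> mondrian_cell lifetime \<xi> (False # w) {x \<in> D. x $ k \<le> s} (t + split_wait D e)"
  | upper: "\<lbrakk>mondrian_cell lifetime \<xi> w D t; \<xi> w = (e, u, v); t + split_wait D e \<le> lifetime;
       k = split_coord D u; s = split_location D k v\<rbrakk>
      \<Longrightarrow> mondrian_cell lifetime \<xi> (True # w) {x \<in> D. x $ k > s} (t + split_wait D e)"

text \<open>
  For \<open>\<xi>\<close> distributed according to \<open>marks_law\<close>, this is the random partition produced by the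
  Mondrian process on the unit cube with the given lifetime.
\<close>

definition mondrian :: "real \<Rightarrow> (bool list \<Rightarrow> mark) \<Rightarrow> (real ^ 'd) set set"
  where "mondrian lifetime \<xi> =
    {D. \<exists>w t. mondrian_cell lifetime \<xi> w D t \<and> t + split_wait D (fst (\<xi> w)) > lifetime}"

text \<open>
  At most one cell of \<open>mondrian lifetime \<xi>\<close> contains \<open>x\<close>. The union returns this cell, and the empty
  set on the null event that there is none.
\<close>

definition cell_of :: "(real ^ 'd) set set \<Rightarrow> real ^ 'd \<Rightarrow> (real ^ 'd) set"
  where "cell_of T x = \<Union> {D \<in> T. x \<in> D}"

definition debiasing_weights :: "nat \<Rightarrow> (nat \<Rightarrow> real) \<Rightarrow> (nat \<Rightarrow> real) \<Rightarrow> bool"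
  where "debiasing_weights J a \<omega> \<longleftrightarrow>
    (\<Sum>r\<le>J. \<omega> r) = 1 \<and> (\<forall>s\<in>{1..J}. (\<Sum>r\<le>J. \<omega> r * (1 / a r ^ (2 * s))) = 0)"

text \<open>
  The sample is \<open>z 1, \<dots>, z n\<close> with \<open>z i = (X i, Y i)\<close>, and \<open>T (b, r)\<close> is the \<open>b\<close>-th tree of the
  \<open>r\<close>-th forest. Division by zero yields zero, in particular \<open>0 / 0 = 0\<close>.
\<close>

definition tree_estimate ::
    "nat \<Rightarrow> (nat \<Rightarrow> (real ^ 'd) \<times> real) \<Rightarrow> (real ^ 'd) set set \<Rightarrow> real ^ 'd \<Rightarrow> real"
  where "tree_estimate n z T x =
    (\<Sum>i=1..n. snd (z i) * indicator (cell_of T x) (fst (z i))) /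
    (\<Sum>i=1..n. indicator (cell_of T x) (fst (z i)))"

definition debiased_estimate ::
    "nat \<Rightarrow> (nat \<Rightarrow> real) \<Rightarrow> nat \<Rightarrow> nat \<Rightarrow> (nat \<Rightarrow> (real ^ 'd) \<times> real) \<Rightarrow>
     (nat \<times> nat \<Rightarrow> (real ^ 'd) set set) \<Rightarrow> real ^ 'd \<Rightarrow> real"
  where "debiased_estimate J \<omega> B n z T x =
    (\<Sum>r\<le>J. \<omega> r * (1 / real B * (\<Sum>b=1..B. tree_estimate n z (T (b, r)) x)))"

text \<open>
  Joint law of the data (\<open>n\<close> i.i.d. draws from \<open>P\<close>) and of the marks of all trees: everything is
  mutually independent.
\<close>

definition forest_law ::
    "((real ^ 'd) \<times> real) measure \<Rightarrow> nat \<Rightarrow> nat \<Rightarrow> nat \<Rightarrow>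
     ((nat \<Rightarrow> (real ^ 'd) \<times> real) \<times> (nat \<times> nat \<Rightarrow> bool list \<Rightarrow> mark)) measure"
  where "forest_law P J B n =
    Pi\<^sub>M {1..n} (\<lambda>_. P) \<Otimes>\<^sub>M Pi\<^sub>M ({1..B} \<times> {..J}) (\<lambda>_. marks_law)"

definition debiased_forest ::
    "nat \<Rightarrow> (nat \<Rightarrow> real) \<Rightarrow> (nat \<Rightarrow> real) \<Rightarrow> real \<Rightarrow> nat \<Rightarrow> nat \<Rightarrow> real ^ 'd \<Rightarrow>
     (nat \<Rightarrow> (real ^ 'd) \<times> real) \<times> (nat \<times> nat \<Rightarrow> bool list \<Rightarrow> mark) \<Rightarrow> real"
  where "debiased_forest J a \<omega> lifetime B n x = (\<lambda>(z, \<Xi>).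
    debiased_estimate J \<omega> B n z (\<lambda>(b, r). mondrian (a r * lifetime) (\<Xi> (b, r))) x)"

definition forest_sq_error ::
    "nat \<Rightarrow> (nat \<Rightarrow> real) \<Rightarrow> (nat \<Rightarrow> real) \<Rightarrow> real \<Rightarrow> nat \<Rightarrow> nat \<Rightarrow> (real ^ 'd \<Rightarrow> real) \<Rightarrow> real ^ 'd \<Rightarrow>
     (nat \<Rightarrow> (real ^ 'd) \<times> real) \<times> (nat \<times> nat \<Rightarrow> bool list \<Rightarrow> mark) \<Rightarrow> real"
  where "forest_sq_error J a \<omega> lifetime B n \<mu> x Z =
    (debiased_forest J a \<omega> lifetime B n x Z - \<mu> x)\<^sup>2"

abbreviation sigma_X :: "((real ^ 'd) \<times> real) measure \<Rightarrow> ((real ^ 'd) \<times> real) measure"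
  where "sigma_X P \<equiv> vimage_algebra (space P) fst borel"

lemma split_wait_law:
  fixes D :: "(real ^ 'd) set"
  assumes "side_sum D > 0"
  shows "distributed (density lborel (exponential_density 1)) lborel (split_wait D)
           (exponential_density (side_sum D))"
proof -
  interpret E: prob_space "density lborel (exponential_density 1)"
    by (rule prob_space_exponential_density) simp
  have "distributed (density lborel (exponential_density 1)) lborel (\<lambda>x. x) (exponential_density 1)"
    by (auto simp: distributed_def intro!: distr_id2)
  from E.exponential_distributedD_le[OF this]
  have cdf: "E.prob {e. e \<le> a} = 1 - exp (- a)" if "0 \<le> a" for a
    using that by simp
  have "(split_wait D e \<le> a) = (e \<le> a * side_sum D)" for e a
    using assms by (simp add: split_wait_def pos_divide_le_eq)
  with cdf assms show ?thesis
    by (subst E.exponential_distributed_iff) (auto simp: split_wait_def[abs_def] algebra_simps)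
qed

lemma split_location_law:
  fixes D :: "(real ^ 'd) set"
  assumes "side_length D k > 0"
  shows "distr std_uniform lborel (split_location D k) =
           uniform_measure lborel {side_lower D k..side_upper D k}"
proof -
  interpret U: prob_space std_uniform
    by (rule prob_space_uniform_measure) auto
  have "distributed std_uniform lborel (\<lambda>x. x) (indicator {0..1})"
    by (auto simp: distributed_def uniform_measure_def divide_ennreal_def intro!: distr_id2)
  from U.distributed_affine[OF this, of "side_length D k" "side_lower D k"] assms
  have "distr std_uniform lborel (split_location D k) =
      density lborel (\<lambda>s. indicator {0..1} ((s - side_lower D k) / side_length D k) /
        ennreal (side_length D k))"
    by (simp add: distributed_def split_location_def[abs_def] algebra_simps)
  also have "\<dots> = uniform_measure lborel {side_lower D k..side_upper D k}"
    unfolding uniform_measure_def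
  proof (rule arg_cong[where f="density lborel"], rule ext)
    fix s
    show "indicator {0..1} ((s - side_lower D k) / side_length D k) / ennreal (side_length D k) =
      indicator {side_lower D k..side_upper D k} s / emeasure lborel {side_lower D k..side_upper D k}"
      using assms by (auto simp: side_length_def indicator_def field_simps)
  qed
  finally show ?thesis .
qed

lemma split_coord_law:
  fixes D :: "(real ^ 'd) set"
  assumes nonneg: "\<And>j. side_length D j \<ge> 0" and pos: "side_sum D > 0"
  shows "measure std_uniform {u. split_coord D u = k} = side_length D k / side_sum D"
proof -
  define F where "F k = (\<Sum>j | to_nat j < to_nat k. side_length D j)" for k :: 'd
  define H where "H k = (\<Sum>j | to_nat j \<le> to_nat k. side_length D j)" for k :: 'd
  have HF: "H k = F k + side_length D k" for k
  proof -
    have "{j :: 'd. to_nat j \<le> to_nat k} = insert k {j. to_nat j < to_nat k}"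
      by (auto simp: le_less)
    then show ?thesis by (simp add: F_def H_def)
  qed
  have HF': "H i \<le> F k" if "to_nat i < to_nat k" for i k
    unfolding F_def H_def using that by (intro sum_mono2) (auto simp: nonneg)
  have F0: "F k \<ge> 0" and H1: "H k \<le> side_sum D" for k
    unfolding F_def H_def side_sum_def by (auto intro!: sum_nonneg sum_mono2 simp: nonneg)
  have uniq: "i = k" if "F i \<le> y" "y < H i" "F k \<le> y" "y < H k" for i k y
    using that HF'[of i k] HF'[of k i]
    by (metis inj_eq inj_to_nat linorder_cases not_le order.strict_trans2 order_trans)
  have ex: "\<exists>k. F k \<le> y \<and> y < H k" if "0 \<le> y" "y < side_sum D" for y
  proof -
    let ?m = "Max (range (to_nat :: 'd \<Rightarrow> nat))"
    have "?m \<in> range (to_nat :: 'd \<Rightarrow> nat)" by (intro Max_in) auto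
    then obtain m :: 'd where m: "?m = to_nat m" by (rule imageE)
    have "to_nat j \<le> to_nat m" for j :: 'd by (auto simp flip: m)
    then have "H m = side_sum D" by (simp add: H_def side_sum_def)
    then have "y < H m" using that by simp
    then obtain k where k: "y < H k" "\<And>i. y < H i \<Longrightarrow> to_nat k \<le> to_nat i"
      using ex_has_least_nat[of "\<lambda>k. y < H k" m to_nat] by blast
    have "F k \<le> y"
    proof (cases "{j :: 'd. to_nat j < to_nat k} = {}")
      case True
      then show ?thesis using that by (simp add: F_def)
    next
      case False
      let ?S = "to_nat ` {j :: 'd. to_nat j < to_nat k}"
      have "Max ?S \<in> ?S" using False by (intro Max_in) auto
      then obtain p :: 'd where p: "Max ?S = to_nat p" "to_nat p < to_nat k"
        by (metis (mono_tags) imageE mem_Collect_eq)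
      have "to_nat j \<le> to_nat p" if "to_nat j < to_nat k" for j :: 'd
        using that by (auto simp flip: p(1) intro!: Max_ge)
      then have "{j :: 'd. to_nat j < to_nat k} = {j. to_nat j \<le> to_nat p}"
        using p(2) by (auto intro: le_less_trans)
      then have "F k = H p" by (simp add: F_def H_def)
      then show ?thesis using k(2)[of p] p(2) by force
    qed
    with k show ?thesis by blast
  qed
  have eq: "split_coord D u = k \<longleftrightarrow> F k \<le> u * side_sum D \<and> u * side_sum D < H k"
    if "0 \<le> u" "u < 1" for u k
  proof -
    have "\<exists>k. F k \<le> u * side_sum D \<and> u * side_sum D < H k"
      using that pos by (intro ex) auto
    then obtain i where i: "F i \<le> u * side_sum D" "u * side_sum D < H i" by blast
    then have "split_coord D u = i"
      unfolding split_coord_def F_def[symmetric] H_def[symmetric]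
      by (intro the_equality) (auto intro: uniq)
    with i show ?thesis using uniq by blast
  qed
  let ?I = "{F k / side_sum D..<H k / side_sum D}"
  have I: "?I \<subseteq> {0..<1}"
    using F0[of k] H1[of k] pos by (auto simp: field_simps intro: less_le_trans)
  let ?A = "{u. split_coord D u = k}"
  have mem: "u \<in> ?A \<longleftrightarrow> u \<in> ?I" if "0 \<le> u" "u < 1" for u
    using eq[OF that, of k] pos by (simp add: pos_divide_le_eq pos_less_divide_eq)
  have out: "split_coord D u = split_coord D 1" if "u \<notin> {0..<1}" for u
  proof -
    have none: "\<not> (F k \<le> y * side_sum D \<and> y * side_sum D < H k)" if "y \<notin> {0..<1}" for y k
    proof
      assume a: "F k \<le> y * side_sum D \<and> y * side_sum D < H k"
      then have "0 \<le> y * side_sum D" "y * side_sum D < 1 * side_sum D"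
        using F0[of k] H1[of k] by linarith+
      then have "0 \<le> y" "y < 1"
        using pos by (auto simp: zero_le_mult_iff dest: mult_right_less_imp_less)
      then show False using that by simp
    qed
    have "(\<lambda>k. F k \<le> u * side_sum D \<and> u * side_sum D < H k) =
        (\<lambda>k. F k \<le> 1 * side_sum D \<and> 1 * side_sum D < H k)"
      using none[OF that] none[of 1] by (intro ext) auto
    then show ?thesis
      unfolding split_coord_def F_def[symmetric] H_def[symmetric] by (rule arg_cong)
  qed
  have "?A = ?I \<union> (if split_coord D 1 = k then - {0..<1} else {})"
  proof (rule set_eqI)
    fix u
    show "u \<in> ?A \<longleftrightarrow> u \<in> ?I \<union> (if split_coord D 1 = k then - {0..<1} else {})"
      using mem[of u] out[of u] subsetD[OF I, of u] by (cases "u \<in> {0..<1}") auto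
  qed
  then have [measurable]: "?A \<in> sets borel" by simp
  have "measure std_uniform ?A = measure lborel ({0..1} \<inter> ?A)"
    by (simp add: measure_uniform_measure)
  also have "\<dots> = measure lborel ?I"
  proof (rule measure_eq_AE)
    show "AE u in lborel. (u \<in> {0..1} \<inter> ?A) = (u \<in> ?I)"
      using AE_lborel_singleton[of 1]
    proof eventually_elim
      case (elim u)
      then show ?case using mem[of u] I by (cases "0 \<le> u \<and> u < 1") (auto simp: subset_iff)
    qed
  qed auto
  also have "\<dots> = side_length D k / side_sum D"
    using pos nonneg[of k] by (simp add: HF divide_right_mono flip: diff_divide_distrib)
  finally show ?thesis .
qed

end

theory Submission
  imports Defs
begin

text \<open>
  For \<open>p \<le> x \<le> q\<close> the cell of \<open>x\<close> contains the box \<open>[p, q]\<close> with probability \<open>exp (- \<lambda> |q - p|\<^sub>1)\<close>, because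
  a cell containing that box is cut through it at rate \<open>|q - p|\<^sub>1\<close>. Hence the distances of \<open>x\<close> from
  the faces of its cell are independent exponential variables with parameter \<open>\<lambda>\<close>, clipped at the
  boundary of the cube.

  Given the cell, the number of data points in it is binomial, and the mean square distance of the
  local average from the conditional mean \<open>E(\<mu>(X) | X \<in> cell)\<close> is at most a constant times
  \<open>1 / (n |cell|)\<close>, whose expectation is of order \<open>\<lambda>\<^sup>d / n\<close>. The conditional means of different trees are
  independent, with second moment of order \<open>\<lambda>\<^sup>-\<^sup>2\<^sup>(\<^sup>1\<^sup>\<and>\<^sup>\<beta>\<^sup>)\<close> around \<open>\<mu>(x)\<close>, which is the term divided by \<open>B\<close>.
  Up to an error \<open>\<lambda>\<^sup>-\<^sup>\<beta>\<close> their mean bias is a polynomial in \<open>1 / \<lambda>\<close>: expand \<open>\<mu> f\<close> and \<open>f\<close> at \<open>x\<close> and divide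
  formally. Reflecting the box in \<open>x\<close> shows that the odd coefficients have mean zero, and the debiasing
  weights cancel the even ones up to degree \<open>2 J\<close>.
\<close>

section \<open>The recursion for the cell containing a point\<close>

text \<open>Two obstacles shape the proof. The trees share one sample, so their errors are
  dependent. Since the term \<open>\<lambda>^d / n\<close> is not divided by the number of trees,
  the sample part is treated tree by tree with a weighted Cauchy-Schwarz inequality; independence
  between trees serves only the conditional means, which are functions of the marks alone. Secondly,
  the density may be one order less smooth than \<beta>. What is expanded is the average of
  \<open>(\<mu> - \<mu> x) * f\<close>, whose first factor vanishes at x, so an error of order
  \<open>\<beta> - 1\<close> in the density is multiplied by a factor of order 1. This is the origin
  of \<open>\<beta>\<^sub>f + 1\<close>. Clipping at the boundary of the cube spoils the scaling and
  the symmetry of the cell, but it needs a rescaled size above the distance of x from the boundary,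
  and there all terms are trivially of order \<beta>. A partition is a random set of sets. To give
  its cell at x a law, only the branch containing x is followed, as a recursion on corners driven by
  the marks; that this recursion ends almost surely has to be proved as well.\<close>

lemma borel_measurable_vec:
  fixes f :: "'a \<Rightarrow> real ^ 'd"
  assumes "\<And>j. (\<lambda>w. f w $ j) \<in> borel_measurable M"
  shows "f \<in> borel_measurable M"
proof (subst borel_measurable_euclidean_space, safe)
  fix i :: "real ^ 'd" assume "i \<in> Basis"
  then obtain j where "i = axis j 1" by (auto simp: Basis_vec_def)
  then show "(\<lambda>w. f w \<bullet> i) \<in> borel_measurable M"
    using assms[of j] by (simp add: inner_axis)
qed

lemma measurable_nth_vec [measurable (raw)]:
  fixes f :: "'a \<Rightarrow> real ^ 'd"
  shows "f \<in> borel_measurable M \<Longrightarrow> (\<lambda>w. f w $ j) \<in> borel_measurable M"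
  by (rule measurable_compose[of f M borel "\<lambda>y. y $ j"], assumption)
    (intro borel_measurable_continuous_onI continuous_intros)

text \<open>The chosen element depends on w only through the truth vector of the predicates, which
  ranges over a finite type. Existence and uniqueness of a witness do not matter.\<close>

lemma measurable_The_finite:
  fixes Q :: "'d::finite \<Rightarrow> 'a \<Rightarrow> bool"
  assumes [measurable]: "\<And>k. Measurable.pred M (Q k)"
  shows "(\<lambda>w. THE k. Q k w) \<in> measurable M (count_space UNIV)"
proof -
  have "(\<lambda>w k. Q k w) \<in> measurable M (count_space (UNIV :: ('d \<Rightarrow> bool) set))"
  proof (subst measurable_count_space_eq2, simp, intro conjI ballI)
    fix q :: "'d \<Rightarrow> bool"
    have "(\<lambda>w k. Q k w) -` {q} \<inter> space M = {w \<in> space M. \<forall>k. Q k w = q k}" by (auto simp: fun_eq_iff)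
    then show "(\<lambda>w k. Q k w) -` {q} \<inter> space M \<in> sets M" by simp
  qed simp
  from measurable_compose[OF this, of The] show ?thesis by simp
qed

text \<open>
  Cells are half-open, except at the lower faces of the cube. There the lower corner is \<open>-1\<close>, so
  that all cells have the same form; \<open>low\<close> recovers the true lower corner.
\<close>

definition hrect :: "real ^ 'd \<Rightarrow> real ^ 'd \<Rightarrow> (real ^ 'd) set"
  where "hrect L U = {y. \<forall>j. 0 \<le> y $ j \<and> L $ j < y $ j \<and> y $ j \<le> U $ j}"

definition low :: "real ^ 'd \<Rightarrow> real ^ 'd" where "low L = (\<chi> j. max 0 (L $ j))"

definition extent :: "real ^ 'd \<Rightarrow> real ^ 'd \<Rightarrow> real"
  where "extent l u = (\<Sum>j\<in>UNIV. u $ j - l $ j)"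

text \<open>Together with \<open>loc_of\<close>, this is the splitting rule with the corners as
  vectors: measurability can be asked of a function of corners, not of a function of sets.\<close>

definition coord_of :: "real ^ 'd \<Rightarrow> real ^ 'd \<Rightarrow> real \<Rightarrow> 'd"
  where "coord_of l u r = (THE k.
    (\<Sum>j | to_nat j < to_nat k. u $ j - l $ j) \<le> r * extent l u \<and>
    r * extent l u < (\<Sum>j | to_nat j \<le> to_nat k. u $ j - l $ j))"

definition loc_of :: "real ^ 'd \<Rightarrow> real ^ 'd \<Rightarrow> 'd \<Rightarrow> real \<Rightarrow> real"
  where "loc_of l u k v = l $ k + v * (u $ k - l $ k)"

lemma unit_cube_hrect: "unit_cube = hrect (-1) (1 :: real ^ 'd)"
  by (auto simp: hrect_def mem_box_cart intro: less_le_trans[of _ 0])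

text \<open>The point x makes the rectangle nonempty, so that its projections are full intervals.
  The infimum is attained only on a side that starts at the boundary of the cube.\<close>

lemma side_hrect:
  assumes "x \<in> hrect L U"
  shows "side_lower (hrect L U) j = low L $ j" "side_upper (hrect L U) j = U $ j"
proof -
  have xj: "0 \<le> x $ j" "L $ j < x $ j" "x $ j \<le> U $ j" for j using assms by (auto simp: hrect_def)
  let ?I = "{t. 0 \<le> t \<and> L $ j < t \<and> t \<le> U $ j}"
  have I: "(\<lambda>y. y $ j) ` hrect L U = ?I"
  proof safe
    fix t assume t: "0 \<le> t" "L $ j < t" "t \<le> U $ j"
    have "(\<chi> i. if i = j then t else x $ i) \<in> hrect L U" using t xj by (auto simp: hrect_def)
    then show "t \<in> (\<lambda>y. y $ j) ` hrect L U" by (rule rev_image_eqI) simp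
  qed (auto simp: hrect_def)
  have "U $ j \<in> ?I" using xj[of j] by auto
  then show "side_upper (hrect L U) j = U $ j"
    unfolding side_upper_def I by (intro cSup_eq_maximum) auto
  show "side_lower (hrect L U) j = low L $ j"
  proof (cases "L $ j < 0")
    case True
    then have "0 \<in> ?I" using xj[of j] by auto
    then have "Inf ?I = 0" by (intro cInf_eq_minimum) auto
    with True show ?thesis unfolding side_lower_def I by (simp add: low_def)
  next
    case False
    then have "?I = {L $ j <.. U $ j}" by auto
    moreover have "L $ j < U $ j" using xj[of j] by auto
    ultimately have "Inf ?I = L $ j" by simp
    with False show ?thesis unfolding side_lower_def I by (simp add: low_def)
  qed
qed

lemma split_hrect:
  assumes "x \<in> hrect L U"
  shows "split_wait (hrect L U) e = e / extent (low L) U"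
    "split_coord (hrect L U) r = coord_of (low L) U r"
    "split_location (hrect L U) k v = loc_of (low L) U k v"
  by (simp_all add: split_wait_def side_sum_def side_length_def side_hrect[OF assms] extent_def
     split_coord_def coord_of_def split_location_def loc_of_def)

text \<open>Lower corner, upper corner and time of formation of a cell.\<close>

type_synonym 'd state = "(real ^ 'd) \<times> (real ^ 'd) \<times> real"

definition ring_time :: "('d::finite) state \<Rightarrow> mark \<Rightarrow> real"
  where "ring_time S m = (case S of (L, U, t) \<Rightarrow> t + fst m / extent (low L) U)"

definition split_k :: "('d::finite) state \<Rightarrow> mark \<Rightarrow> 'd"
  where "split_k S m = coord_of (low (fst S)) (fst (snd S)) (fst (snd m))"

definition split_s :: "('d::finite) state \<Rightarrow> mark \<Rightarrow> real"
  where "split_s S m = loc_of (low (fst S)) (fst (snd S)) (split_k S m) (snd (snd m))"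

definition turn :: "real ^ ('d::finite) \<Rightarrow> 'd state \<Rightarrow> mark \<Rightarrow> bool"
  where "turn x S m \<longleftrightarrow> x $ split_k S m > split_s S m"

text \<open>Maximum and minimum keep the corners right even if the cut falls outside the cell; so
  \<open>cell_child\<close> holds for every mark, not just almost every one.\<close>

definition child :: "bool \<Rightarrow> ('d::finite) state \<Rightarrow> mark \<Rightarrow> 'd state"
  where "child b S m = (if b
     then (\<chi> j. if j = split_k S m then max (fst S $ j) (split_s S m) else fst S $ j,
           fst (snd S), ring_time S m)
     else (fst S,
           \<chi> j. if j = split_k S m then min (fst (snd S) $ j) (split_s S m) else fst (snd S) $ j,
           ring_time S m))"

text \<open>
  The flag is True as long as the cell containing \<open>x\<close> may still be split. The marks are
  re-addressed at every step, so that the current node is always \<open>[]\<close>.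
\<close>

primrec run :: "real \<Rightarrow> real ^ 'd \<Rightarrow> nat \<Rightarrow> (bool list \<Rightarrow> mark) \<Rightarrow> 'd state \<Rightarrow> bool \<times> 'd state"
  where
    "run lifetime x 0 \<xi> S = (True, S)"
  | "run lifetime x (Suc n) \<xi> S = (if ring_time S (\<xi> []) \<le> lifetime
       then run lifetime x n (\<lambda>w. \<xi> (w @ [turn x S (\<xi> [])])) (child (turn x S (\<xi> [])) S (\<xi> []))
       else (False, S))"

abbreviation cell :: "('d::finite) state \<Rightarrow> (real ^ 'd) set" where "cell S \<equiv> hrect (fst S) (fst (snd S))"
abbreviation init :: "('d::finite) state" where "init \<equiv> (-1, 1, 0)"

section \<open>The recursion follows the branch of x in the inductive partition\<close>

lemma cell_child:
  "cell (child False S m) = {y \<in> cell S. y $ split_k S m \<le> split_s S m}"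
  "cell (child True S m) = {y \<in> cell S. y $ split_k S m > split_s S m}"
  by (auto simp: child_def hrect_def)

lemma child_mem:
  assumes "x \<in> cell S" shows "x \<in> cell (child (turn x S m) S m)"
  using assms by (cases "turn x S m") (auto simp: cell_child, auto simp: turn_def)

text \<open>The inductive definition reads the sides off the set, the recursion off the corners; the
  two agree because x shows that the cell is nonempty.\<close>

lemma mondrian_cell_step:
  assumes "mondrian_cell lifetime \<xi> w (cell S) (snd (snd S))" "x \<in> cell S"
    "ring_time S (\<xi> w) \<le> lifetime"
  shows "mondrian_cell lifetime \<xi> (b # w) (cell (child b S (\<xi> w))) (snd (snd (child b S (\<xi> w))))"
proof -
  obtain L U t where S: "S = (L, U, t)" by (cases S)
  obtain e u v where m: "\<xi> w = (e, u, v)" by (cases "\<xi> w")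
  note sp = split_hrect[of x L U]
  have x: "x \<in> hrect L U" using assms S by simp
  have rt: "ring_time S (\<xi> w) = t + split_wait (hrect L U) e"
    using sp(1)[OF x] by (simp add: ring_time_def S m)
  have k: "split_k S (\<xi> w) = split_coord (hrect L U) u"
    using sp(2)[OF x] by (simp add: split_k_def S m)
  have s: "split_s S (\<xi> w) = split_location (hrect L U) (split_coord (hrect L U) u) v"
    using sp(2,3)[OF x] by (simp add: split_k_def split_s_def S m)
  have c: "mondrian_cell lifetime \<xi> w (hrect L U) t" using assms by (simp add: S)
  show ?thesis
  proof (cases b)
    case True
    then show ?thesis
      using mondrian_cell.upper[OF c m _ refl refl] assms(3) rt
      by (simp add: cell_child k s S[symmetric]) (simp add: child_def S m k rt)
  next
    case False
    then show ?thesis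
      using mondrian_cell.lower[OF c m _ refl refl] assms(3) rt
      by (simp add: cell_child k s S[symmetric]) (simp add: child_def S m k rt)
  qed
qed

lemma run_mem: "x \<in> cell S \<Longrightarrow> x \<in> cell (snd (run lifetime x n \<xi> S))"
  by (induction n arbitrary: \<xi> S) (simp_all add: child_mem)

text \<open>Stated from an arbitrary node w with the marks shifted to it, because every step of
  \<open>run\<close> moves the root.\<close>

lemma run_sound:
  assumes "mondrian_cell lifetime \<xi> w (cell S) (snd (snd S))" "x \<in> cell S"
    "run lifetime x n (\<lambda>v. \<xi> (v @ w)) S = (False, S')"
  shows "cell S' \<in> mondrian lifetime \<xi>"
  using assms
proof (induction n arbitrary: w S)
  case (Suc n)
  show ?case
  proof (cases "ring_time S (\<xi> w) \<le> lifetime")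
    case True
    let ?b = "turn x S (\<xi> w)"
    show ?thesis
      using Suc.prems(3) True
      by (intro Suc.IH[of "?b # w", OF mondrian_cell_step[OF Suc.prems(1,2) True]
             child_mem[OF Suc.prems(2)]]) simp
  next
    case False
    then have "S' = S" using Suc.prems(3) by simp
    moreover obtain L U t where S: "S = (L, U, t)" by (cases S)
    moreover have "t + split_wait (cell S) (fst (\<xi> w)) > lifetime"
      using False Suc.prems(2) by (simp add: S ring_time_def split_hrect)
    ultimately show ?thesis using Suc.prems(1) by (auto simp: mondrian_def)
  qed
qed simp

text \<open>A cell below a split contains x only if it lies on the side to which x turns. Hence
  every cell containing x is on the single branch followed by \<open>run\<close>, at depth
  \<open>length w\<close>, and the run from the root continues there with the shifted marks.\<close>

lemma run_complete:
  assumes "mondrian_cell lifetime \<xi> w D t" "x \<in> D"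
  shows "\<exists>S. D = cell S \<and> t = snd (snd S) \<and>
    (\<forall>n. run lifetime x (length w + n) \<xi> init = run lifetime x n (\<lambda>v. \<xi> (v @ w)) S)"
  using assms
proof (induction)
  case root
  show ?case by (intro exI[of _ init]) (simp add: unit_cube_hrect)
next
  case (lower w D t e u v k s)
  then obtain S where S: "D = cell S" "t = snd (snd S)"
    "\<And>n. run lifetime x (length w + n) \<xi> init = run lifetime x n (\<lambda>v. \<xi> (v @ w)) S" by auto
  obtain L U where S': "S = (L, U, t)" using S(2) by (cases S) auto
  have x: "x \<in> hrect L U" using lower S(1) by (auto simp: S')
  have k: "k = split_k S (\<xi> w)" using lower by (simp add: S(1) S' split_hrect[OF x] split_k_def)
  then have s: "s = split_s S (\<xi> w)" using lower by (simp add: S(1) S' split_hrect[OF x] split_s_def)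
  have rt: "ring_time S (\<xi> w) = t + split_wait D e"
    using lower by (simp add: S(1) ring_time_def split_hrect[OF x] S')
  have tu: "turn x S (\<xi> w) = False" using lower by (simp add: turn_def k s)
  show ?case
  proof (intro exI conjI allI)
    show "{x \<in> D. x $ k \<le> s} = cell (child False S (\<xi> w))" by (simp add: cell_child k s S(1))
    show "t + split_wait D e = snd (snd (child False S (\<xi> w)))" by (simp add: child_def rt)
    fix n
    show "run lifetime x (length (False # w) + n) \<xi> init =
      run lifetime x n (\<lambda>v. \<xi> (v @ False # w)) (child False S (\<xi> w))"
    proof -
      have len: "length (False # w) + n = length w + Suc n" by simp
      have "ring_time S (\<xi> w) \<le> lifetime" using lower rt by simp
      then show ?thesis unfolding len S(3) using tu by simp
    qed
  qed
next
  case (upper w D t e u v k s)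
  then obtain S where S: "D = cell S" "t = snd (snd S)"
    "\<And>n. run lifetime x (length w + n) \<xi> init = run lifetime x n (\<lambda>v. \<xi> (v @ w)) S" by auto
  obtain L U where S': "S = (L, U, t)" using S(2) by (cases S) auto
  have x: "x \<in> hrect L U" using upper S(1) by (auto simp: S')
  have k: "k = split_k S (\<xi> w)" using upper by (simp add: S(1) S' split_hrect[OF x] split_k_def)
  then have s: "s = split_s S (\<xi> w)" using upper by (simp add: S(1) S' split_hrect[OF x] split_s_def)
  have rt: "ring_time S (\<xi> w) = t + split_wait D e"
    using upper by (simp add: S(1) ring_time_def split_hrect[OF x] S')
  have tu: "turn x S (\<xi> w) = True" using upper by (simp add: turn_def k s)
  show ?case
  proof (intro exI conjI allI)
    show "{x \<in> D. x $ k > s} = cell (child True S (\<xi> w))" by (simp add: cell_child k s S(1))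
    show "t + split_wait D e = snd (snd (child True S (\<xi> w)))" by (simp add: child_def rt)
    fix n
    show "run lifetime x (length (True # w) + n) \<xi> init =
      run lifetime x n (\<lambda>v. \<xi> (v @ True # w)) (child True S (\<xi> w))"
    proof -
      have len: "length (True # w) + n = length w + Suc n" by simp
      have "ring_time S (\<xi> w) \<le> lifetime" using upper rt by simp
      then show ?thesis unfolding len S(3) using tu by simp
    qed
  qed
qed

lemma run_stopped:
  "run lifetime x n \<xi> S = (False, S') \<Longrightarrow> n \<le> m \<Longrightarrow> run lifetime x m \<xi> S = (False, S')"
proof (induction n arbitrary: m \<xi> S)
  case (Suc n)
  then obtain m' where "m = Suc m'" by (cases m) auto
  with Suc show ?case by (auto split: if_splits)
qed simp

definition stops :: "real \<Rightarrow> real ^ 'd \<Rightarrow> (bool list \<Rightarrow> mark) \<Rightarrow> bool"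
  where "stops lifetime x \<xi> \<longleftrightarrow> (\<exists>n. \<not> fst (run lifetime x n \<xi> init))"

text \<open>A limit instead of a chosen stopping index: the states are eventually constant if the
  recursion stops, and pointwise limits preserve measurability.\<close>

definition last_state :: "real \<Rightarrow> real ^ 'd \<Rightarrow> (bool list \<Rightarrow> mark) \<Rightarrow> 'd state"
  where "last_state lifetime x \<xi> = lim (\<lambda>n. snd (run lifetime x n \<xi> init))"

lemma last_state_eq:
  assumes "run lifetime x n \<xi> init = (False, S)"
  shows "last_state lifetime x \<xi> = S"
proof -
  have "eventually (\<lambda>m. snd (run lifetime x m \<xi> init) = S) sequentially"
    unfolding eventually_sequentially using run_stopped[OF assms] by (metis snd_conv)
  then have "(\<lambda>n. snd (run lifetime x n \<xi> init)) \<longlonglongrightarrow> S" by (rule tendsto_eventually)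
  then show ?thesis unfolding last_state_def by (rule limI)
qed

text \<open>By \<open>run_complete\<close> each cell of the partition that contains x is the final
  cell of a stopped run, and stopped runs end in the same state, whatever their length. So the union
  in \<open>cell_of\<close> has one member or none.\<close>

lemma cell_of_mondrian:
  assumes "x \<in> unit_cube"
  shows "cell_of (mondrian lifetime \<xi>) x =
    (if stops lifetime x \<xi> then cell (last_state lifetime x \<xi>) else {})"
proof -
  have x0: "x \<in> cell init" using assms by (simp add: unit_cube_hrect)
  have *: "\<exists>n S. run lifetime x n \<xi> init = (False, S) \<and> D = cell S"
    if "D \<in> mondrian lifetime \<xi>" "x \<in> D" for D
  proof -
    from that obtain w t where w: "mondrian_cell lifetime \<xi> w D t"
      "t + split_wait D (fst (\<xi> w)) > lifetime" by (auto simp: mondrian_def)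
    from run_complete[OF w(1) that(2)] obtain S where S: "D = cell S" "t = snd (snd S)"
      "\<And>n. run lifetime x (length w + n) \<xi> init = run lifetime x n (\<lambda>v. \<xi> (v @ w)) S" by auto
    obtain L U where S': "S = (L, U, t)" using S(2) by (cases S) auto
    have "x \<in> hrect L U" using that(2) S(1) S' by simp
    then have "ring_time S (\<xi> w) > lifetime"
      using w(2) by (simp add: ring_time_def S(1) S' split_hrect)
    then have "run lifetime x (length w + 1) \<xi> init = (False, S)"
      unfolding S(3) by simp
    with S(1) show ?thesis by (intro exI conjI)
  qed
  show ?thesis
  proof (cases "stops lifetime x \<xi>")
    case True
    then obtain n where "\<not> fst (run lifetime x n \<xi> init)" unfolding stops_def by (rule exE)
    then obtain S where n: "run lifetime x n \<xi> init = (False, S)"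
      by (cases "run lifetime x n \<xi> init") simp
    define c where "c = cell S"
    have c1: "c \<in> mondrian lifetime \<xi>"
      unfolding c_def using mondrian_cell.root[of lifetime \<xi>] n x0
      by (intro run_sound[of lifetime \<xi> "[]" init x n]) (simp_all add: unit_cube_hrect)
    have c2: "x \<in> c" using run_mem[OF x0, of lifetime n \<xi>] n by (simp add: c_def)
    have c3: "D = c" if "D \<in> mondrian lifetime \<xi>" "x \<in> D" for D
    proof -
      from *[OF that] obtain n' S' where n': "run lifetime x n' \<xi> init = (False, S')" "D = cell S'" by (elim exE conjE)
      then have "S' = S" using last_state_eq[OF n] last_state_eq[OF n'(1)] by simp
      with n' show ?thesis by (simp add: c_def)
    qed
    have "{D \<in> mondrian lifetime \<xi>. x \<in> D} = {c}"
    proof (rule set_eqI)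
      fix D show "D \<in> {D \<in> mondrian lifetime \<xi>. x \<in> D} \<longleftrightarrow> D \<in> {c}"
        unfolding mem_Collect_eq singleton_iff using c1 c2 c3[of D] by iprover
    qed
    then have "cell_of (mondrian lifetime \<xi>) x = c" by (simp only: cell_of_def cSup_singleton)
    then show ?thesis using True last_state_eq[OF n] by (simp add: c_def)
  next
    case False
    have "\<not> (D \<in> mondrian lifetime \<xi> \<and> x \<in> D)" for D
    proof
      assume "D \<in> mondrian lifetime \<xi> \<and> x \<in> D"
      then have "D \<in> mondrian lifetime \<xi>" "x \<in> D" by simp_all
      from *[OF this] obtain n S where "run lifetime x n \<xi> init = (False, S)" by (elim exE conjE)
      then have "stops lifetime x \<xi>" unfolding stops_def by (intro exI[of _ n]) simp
      with False show False by simp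
    qed
    then have "{D \<in> mondrian lifetime \<xi>. x \<in> D} = {}" by simp
    then have "cell_of (mondrian lifetime \<xi>) x = {}" by (simp only: cell_of_def Sup_empty)
    then show ?thesis using False by simp
  qed
qed

section \<open>Measurability of the recursion\<close>

lemma sets_mark_law: "sets mark_law = sets (borel \<Otimes>\<^sub>M (borel \<Otimes>\<^sub>M borel))"
  unfolding mark_law_def by (intro sets_pair_measure_cong) (simp_all add: uniform_measure_def)

lemma sets_marks_law:
  "sets marks_law = sets (Pi\<^sub>M UNIV (\<lambda>_. borel \<Otimes>\<^sub>M (borel \<Otimes>\<^sub>M borel)))"
  unfolding marks_law_def by (intro sets_PiM_cong) (simp_all add: sets_mark_law)

lemma measurable_low [measurable]: "low \<in> borel_measurable borel"
  unfolding low_def[abs_def] by (rule borel_measurable_vec) simp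

lemma measurable_extent [measurable (raw)]:
  assumes [measurable]: "f \<in> borel_measurable M" "g \<in> borel_measurable M"
  shows "(\<lambda>w. extent (f w) (g w)) \<in> borel_measurable M"
  unfolding extent_def[abs_def] by measurable

abbreviation mark_space :: "mark measure" where "mark_space \<equiv> borel \<Otimes>\<^sub>M (borel \<Otimes>\<^sub>M borel)"
abbreviation state_space :: "('d::finite) state measure" where "state_space \<equiv> borel \<Otimes>\<^sub>M (borel \<Otimes>\<^sub>M borel)"

context
  fixes M :: "'a measure" and f :: "'a \<Rightarrow> ('d::finite) state" and g :: "'a \<Rightarrow> mark"
  assumes f [measurable]: "f \<in> measurable M state_space" and g [measurable]: "g \<in> measurable M mark_space"
begin

lemma measurable_ring_time [measurable (raw)]: "(\<lambda>w. ring_time (f w) (g w)) \<in> borel_measurable M"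
  unfolding ring_time_def split_beta by measurable

lemma measurable_split_k [measurable (raw)]:
  "(\<lambda>w. split_k (f w) (g w)) \<in> measurable M (count_space UNIV)"
  unfolding split_k_def coord_of_def by (rule measurable_The_finite) measurable

lemma measurable_split_s [measurable (raw)]: "(\<lambda>w. split_s (f w) (g w)) \<in> borel_measurable M"
proof -
  \<comment> \<open>The coordinate itself is random; summing over its finitely many values leaves a
    fixed index in each term.\<close>
  have "(\<lambda>w. split_s (f w) (g w)) = (\<lambda>w. \<Sum>k\<in>UNIV. if split_k (f w) (g w) = k
     then loc_of (low (fst (f w))) (fst (snd (f w))) k (snd (snd (g w))) else 0)"
    by (simp add: split_s_def fun_eq_iff)
  moreover have "\<dots> \<in> borel_measurable M"
    unfolding loc_of_def by measurable
  ultimately show ?thesis by (simp only:)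
qed

lemma measurable_turn [measurable (raw)]: "Measurable.pred M (\<lambda>w. turn x (f w) (g w))"
proof -
  have "(\<lambda>w. turn x (f w) (g w)) = (\<lambda>w. \<exists>k\<in>UNIV. split_k (f w) (g w) = k \<and> x $ k > split_s (f w) (g w))"
    by (simp add: turn_def fun_eq_iff)
  moreover have "Measurable.pred M \<dots>" by measurable
  ultimately show ?thesis by (simp only:)
qed

lemma measurable_child [measurable (raw)]: "(\<lambda>w. child b (f w) (g w)) \<in> measurable M state_space"
proof -
  have [measurable]: "(\<lambda>w. \<chi> j. if j = split_k (f w) (g w) then max (fst (f w) $ j) (split_s (f w) (g w))
      else fst (f w) $ j) \<in> borel_measurable M"
    by (rule borel_measurable_vec) (simp, measurable)
  have [measurable]: "(\<lambda>w. \<chi> j. if j = split_k (f w) (g w) then min (fst (snd (f w)) $ j) (split_s (f w) (g w))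
      else fst (snd (f w)) $ j) \<in> borel_measurable M"
    by (rule borel_measurable_vec) (simp, measurable)
  show ?thesis unfolding child_def by (cases b) simp_all
qed

end

declare measurable_ring_time [measurable del (raw)] measurable_split_k [measurable del (raw)]
  measurable_split_s [measurable del (raw)] measurable_turn [measurable del (raw)]
  measurable_child [measurable del (raw)]

lemma measurable_shift:
  "(\<lambda>\<xi> w. \<xi> (w @ [b])) \<in> measurable (Pi\<^sub>M UNIV (\<lambda>_. M)) (Pi\<^sub>M UNIV (\<lambda>_. M))"
  by (rule measurable_PiM_single') (auto simp: space_PiM)

text \<open>Marks and state are arbitrary measurable functions of w, since a step of the recursion
  changes both.\<close>

lemma measurable_run:
  assumes "f \<in> measurable M marks_law" "g \<in> measurable M (state_space :: ('d::finite) state measure)"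
  shows "(\<lambda>w. run lifetime x n (f w) (g w)) \<in> measurable M (count_space UNIV \<Otimes>\<^sub>M state_space)"
  using assms
proof (induction n arbitrary: f g)
  case 0
  show ?case unfolding run.simps by (intro measurable_Pair measurable_const 0) simp
next
  case (Suc n)
  note g = Suc.prems(2)
  have f: "f \<in> measurable M (Pi\<^sub>M UNIV (\<lambda>_. mark_space))"
    using Suc.prems(1) by (simp only: measurable_cong_sets[OF refl sets_marks_law])
  have f0: "(\<lambda>w. f w []) \<in> measurable M mark_space"
    by (rule measurable_compose[OF f measurable_component_singleton]) (rule UNIV_I)
  have sh: "(\<lambda>w v. f w (v @ [b])) \<in> measurable M marks_law" for b
    using measurable_compose[OF f measurable_shift[of b]]
    by (simp only: measurable_cong_sets[OF refl sets_marks_law])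
  have r: "(\<lambda>w. run lifetime x n (\<lambda>v. f w (v @ [b])) (child b (g w) (f w []))) \<in>
      measurable M (count_space UNIV \<Otimes>\<^sub>M state_space)" for b
    by (rule Suc.IH[OF sh measurable_child[OF g f0]])
  have eq: "(\<lambda>w. run lifetime x (Suc n) (f w) (g w)) = (\<lambda>w. if ring_time (g w) (f w []) \<le> lifetime
     then if turn x (g w) (f w [])
       then run lifetime x n (\<lambda>v. f w (v @ [True])) (child True (g w) (f w []))
       else run lifetime x n (\<lambda>v. f w (v @ [False])) (child False (g w) (f w []))
     else (False, g w))"
    by (rule ext) simp
  show ?case unfolding eq 
    by (intro measurable_If r measurable_Pair measurable_const g measurable_turn[OF g f0]
        predE[OF measurable_turn[OF g f0]] borel_measurable_le measurable_ring_time[OF g f0]) simp_all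
qed

lemma measurable_run_init:
  "(\<lambda>\<xi>. run lifetime x n \<xi> init) \<in> measurable marks_law (count_space UNIV \<Otimes>\<^sub>M state_space)"
  by (rule measurable_run[OF measurable_ident_sets[OF refl] measurable_const]) (simp add: space_pair_measure)

lemma measurable_stops [measurable]: "Measurable.pred marks_law (stops lifetime x)"
  unfolding stops_def[abs_def]
  by (intro pred_intros_countable pred_intros_logic
        measurable_compose[OF measurable_run_init measurable_fst])

lemma measurable_last_state [measurable]: "last_state lifetime x \<in> measurable marks_law state_space"
proof -
  have "(\<lambda>\<xi>. snd (run lifetime x n \<xi> init)) \<in> borel_measurable marks_law" for n
    using measurable_compose[OF measurable_run_init measurable_snd] by (simp only: borel_prod)
  then have "last_state lifetime x \<in> borel_measurable marks_law"
    unfolding last_state_def[abs_def] by (rule borel_measurable_lim_metric)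
  then show ?thesis by (simp only: borel_prod)
qed

section \<open>The law of the cell containing a point\<close>

text \<open>Branching property of the marks: the mark of the root is independent of the marks below
  one of its children, and these have the law of a fresh family.\<close>

lemma nn_integral_PiM_split:
  fixes N :: "'a measure" and b :: 'b
  assumes N: "prob_space N"
    and G: "case_prod G \<in> borel_measurable (N \<Otimes>\<^sub>M Pi\<^sub>M (UNIV :: 'b list set) (\<lambda>_. N))"
  shows "(\<integral>\<^sup>+\<xi>. G (\<xi> []) (\<lambda>w. \<xi> (w @ [b])) \<partial>Pi\<^sub>M UNIV (\<lambda>_. N)) =
    (\<integral>\<^sup>+m. \<integral>\<^sup>+\<xi>. G m \<xi> \<partial>Pi\<^sub>M UNIV (\<lambda>_. N) \<partial>N)"
proof -
  \<comment> \<open>Addresses list the most recent turn first, so a last entry b means that b was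
    the first turn: these are the nodes below child b.\<close>
  define I where "I = {w. \<exists>v. w = v @ [b]}"
  interpret N: prob_space N by fact
  interpret I: prob_space "Pi\<^sub>M I (\<lambda>_. N)" by (intro prob_space_PiM N)
  have nil: "[] \<notin> I" by (auto simp: I_def)
  have shiftI: "(\<lambda>\<omega> w. \<omega> (w @ [b])) \<in> measurable (Pi\<^sub>M K (\<lambda>_. N)) (Pi\<^sub>M UNIV (\<lambda>_. N))"
    if "I \<subseteq> K" for K
  proof (rule measurable_PiM_single')
    have wK: "w @ [b] \<in> K" for w using that by (auto simp: I_def)
    show "(\<lambda>\<omega>. \<omega> (w @ [b])) \<in> measurable (Pi\<^sub>M K (\<lambda>_. N)) N" for w
      by (rule measurable_component_singleton) (rule wK)
    show "(\<lambda>\<omega> w. \<omega> (w @ [b])) \<in> space (Pi\<^sub>M K (\<lambda>_. N)) \<rightarrow> (\<Pi>\<^sub>E i\<in>UNIV. space N)"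
      using wK by (auto simp: space_PiM PiE_iff)
  qed
  define H where "H \<omega> = G (\<omega> []) (\<lambda>w. \<omega> (w @ [b]))" for \<omega>
  have H: "H \<in> borel_measurable (Pi\<^sub>M K (\<lambda>_. N))" if "insert [] I \<subseteq> K" for K
  proof -
    have "(\<lambda>\<omega>. (\<omega> [], \<lambda>w. \<omega> (w @ [b]))) \<in>
        measurable (Pi\<^sub>M K (\<lambda>_. N)) (N \<Otimes>\<^sub>M Pi\<^sub>M (UNIV :: 'b list set) (\<lambda>_. N))"
      using that shiftI[of K] by (intro measurable_Pair measurable_component_singleton) auto
    from measurable_compose[OF this G] show ?thesis by (simp add: H_def[abs_def])
  qed
  \<comment> \<open>The integrand sees the root and the subtree I only, so all other coordinates can
    be projected away.\<close>
  have "(\<integral>\<^sup>+\<xi>. H \<xi> \<partial>Pi\<^sub>M UNIV (\<lambda>_. N)) =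
      (\<integral>\<^sup>+\<xi>. H (\<lambda>n\<in>insert [] I. \<xi> n) \<partial>Pi\<^sub>M UNIV (\<lambda>_. N))"
    by (intro nn_integral_cong) (auto simp: H_def I_def restrict_def)
  also have "\<dots> = (\<integral>\<^sup>+\<xi>. H \<xi> \<partial>distr (Pi\<^sub>M UNIV (\<lambda>_. N)) (Pi\<^sub>M (insert [] I) (\<lambda>_. N)) (\<lambda>\<xi>. \<lambda>n\<in>insert [] I. \<xi> n))"
    by (subst nn_integral_distr) (auto intro!: H measurable_restrict measurable_component_singleton)
  also have "\<dots> = (\<integral>\<^sup>+\<xi>. H \<xi> \<partial>Pi\<^sub>M (insert [] I) (\<lambda>_. N))"
    using distr_PiM_reindex[of UNIV "\<lambda>_. N" "\<lambda>x. x" "insert [] I"] N by (simp add: inj_on_def)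
  also have "\<dots> = (\<integral>\<^sup>+z. H ((snd z)([] := fst z)) \<partial>(N \<Otimes>\<^sub>M Pi\<^sub>M I (\<lambda>_. N)))"
  proof -
    have upd: "(\<lambda>(x, X). X([] := x)) \<in> measurable (N \<Otimes>\<^sub>M Pi\<^sub>M I (\<lambda>_. N)) (Pi\<^sub>M (insert [] I) (\<lambda>_. N))"
      by simp
    show ?thesis
      using N nn_integral_distr[OF upd, of H] H[OF order_refl]
      by (simp add: distr_pair_PiM_eq_PiM[of I "\<lambda>_. N" "[]"] split_beta)
  qed
  also have "\<dots> = (\<integral>\<^sup>+z. G (fst z) (\<lambda>w. snd z (w @ [b])) \<partial>(N \<Otimes>\<^sub>M Pi\<^sub>M I (\<lambda>_. N)))"
    by (simp add: H_def)
  also have "\<dots> = (\<integral>\<^sup>+m. \<integral>\<^sup>+\<omega>. G m (\<lambda>w. \<omega> (w @ [b])) \<partial>Pi\<^sub>M I (\<lambda>_. N) \<partial>N)"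
  proof (subst I.nn_integral_fst[symmetric])
    have "(\<lambda>z. (fst z, \<lambda>w. snd z (w @ [b]))) \<in>
        measurable (N \<Otimes>\<^sub>M Pi\<^sub>M I (\<lambda>_. N)) (N \<Otimes>\<^sub>M Pi\<^sub>M (UNIV :: 'b list set) (\<lambda>_. N))"
      by (intro measurable_Pair measurable_fst measurable_compose[OF measurable_snd shiftI]) auto
    from measurable_compose[OF this G]
    show "(\<lambda>z. G (fst z) (\<lambda>w. snd z (w @ [b]))) \<in> borel_measurable (N \<Otimes>\<^sub>M Pi\<^sub>M I (\<lambda>_. N))" by simp
  qed simp
  also have "\<dots> = (\<integral>\<^sup>+m. \<integral>\<^sup>+\<xi>. G m \<xi> \<partial>Pi\<^sub>M UNIV (\<lambda>_. N) \<partial>N)"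
  proof (intro nn_integral_cong)
    fix m assume m: "m \<in> space N"
    have Gm: "G m \<in> borel_measurable (Pi\<^sub>M UNIV (\<lambda>_. N))"
      using measurable_compose[OF measurable_Pair1'[OF m] G] by simp
    \<comment> \<open>Appending b is a bijection from all addresses onto I, and an i.i.d. family may
      be reindexed.\<close>
    have "distr (Pi\<^sub>M I (\<lambda>_. N)) (Pi\<^sub>M UNIV (\<lambda>_. N)) (\<lambda>\<omega> w. \<omega> (w @ [b])) = Pi\<^sub>M UNIV (\<lambda>_. N)"
      using distr_PiM_reindex[of I "\<lambda>_. N" "\<lambda>w. w @ [b]" UNIV] N by (auto simp: inj_on_def I_def restrict_UNIV)
    then show "(\<integral>\<^sup>+\<omega>. G m (\<lambda>w. \<omega> (w @ [b])) \<partial>Pi\<^sub>M I (\<lambda>_. N)) = (\<integral>\<^sup>+\<xi>. G m \<xi> \<partial>Pi\<^sub>M UNIV (\<lambda>_. N))"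
      using nn_integral_distr[OF shiftI[OF order_refl], of "G m"] Gm by (simp only: measurable_distr_eq1)
  qed
  finally show ?thesis by (simp add: H_def)
qed

lemma prob_space_std_uniform: "prob_space std_uniform"
  by (rule prob_space_uniform_measure) auto

lemma prob_space_exponential1: "prob_space (density lborel (exponential_density 1))"
  by (rule prob_space_exponential_density) simp

lemma prob_space_mark_law: "prob_space mark_law"
  unfolding mark_law_def
  by (intro prob_space_pair prob_space_std_uniform prob_space_exponential1)

lemma prob_space_marks_law: "prob_space marks_law"
  unfolding marks_law_def by (intro prob_space_PiM prob_space_mark_law)

text \<open>First-step analysis. The branch taken depends on the root mark, whereas the branching
  property concerns a fixed branch; the integrand is therefore divided into one part for each
  turn.\<close>

lemma nn_integral_run_Suc:
  fixes S :: "('d::finite) state"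
  assumes F [measurable]: "F \<in> borel_measurable (count_space UNIV \<Otimes>\<^sub>M (state_space :: 'd state measure))"
  shows "(\<integral>\<^sup>+\<xi>. F (run lifetime x (Suc n) \<xi> S) \<partial>marks_law) =
    (\<integral>\<^sup>+m. (if ring_time S m \<le> lifetime
       then \<integral>\<^sup>+\<xi>. F (run lifetime x n \<xi> (child (turn x S m) S m)) \<partial>marks_law
       else F (False, S)) \<partial>mark_law)"
proof -
  interpret marks: prob_space marks_law by (rule prob_space_marks_law)
  \<comment> \<open>A run that stops at once takes no turn; it is assigned to the branch
    \<open>True\<close> so that it is counted exactly once.\<close>
  define G :: "bool \<Rightarrow> mark \<Rightarrow> (bool list \<Rightarrow> mark) \<Rightarrow> ennreal" where
    "G b m \<xi> = (if ring_time S m \<le> lifetime \<and> turn x S m = b then F (run lifetime x n \<xi> (child b S m))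
      else if \<not> ring_time S m \<le> lifetime \<and> b then F (False, S) else 0)" for b m \<xi>
  have fst_m: "fst \<in> measurable (mark_law \<Otimes>\<^sub>M marks_law) mark_space"
    by (rule measurable_fst[of mark_law, unfolded measurable_cong_sets[OF refl sets_mark_law]])
  have S: "(\<lambda>_. S) \<in> measurable M state_space" for M :: "'z measure"
    by (intro measurable_const) (simp add: space_pair_measure)
  have rt: "(\<lambda>p. ring_time S (fst p)) \<in> borel_measurable (mark_law \<Otimes>\<^sub>M marks_law)"
    by (rule measurable_ring_time[OF S fst_m])
  have tu: "Measurable.pred (mark_law \<Otimes>\<^sub>M marks_law) (\<lambda>p. turn x S (fst p))"
    by (rule measurable_turn[OF S fst_m])
  have ru: "(\<lambda>p. F (run lifetime x n (snd p) (child b S (fst p)))) \<in> borel_measurable (mark_law \<Otimes>\<^sub>M marks_law)" for b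
    by (rule measurable_compose[OF measurable_run[OF measurable_snd measurable_child[OF S fst_m]] F])
  have G: "case_prod (G b) \<in> borel_measurable (mark_law \<Otimes>\<^sub>M marks_law)" for b
  proof -
    have p: "Measurable.pred (mark_law \<Otimes>\<^sub>M marks_law) (\<lambda>p. ring_time S (fst p) \<le> lifetime)"
      unfolding pred_def by (intro borel_measurable_le rt borel_measurable_const)
    have "Measurable.pred (mark_law \<Otimes>\<^sub>M marks_law) (\<lambda>p. turn x S (fst p) = b)"
      using tu by (cases b) simp_all
    then have "(\<lambda>p. G b (fst p) (snd p)) \<in> borel_measurable (mark_law \<Otimes>\<^sub>M marks_law)"
      unfolding G_def using p by (intro measurable_If ru measurable_const) (auto simp: pred_def)
    then show ?thesis by (simp add: split_beta')
  qed
  have Gs: "(\<lambda>\<xi>. G b (\<xi> []) (\<lambda>w. \<xi> (w @ [b]))) \<in> borel_measurable marks_law" for b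
  proof -
    have "(\<lambda>\<xi>. (\<xi> [], \<lambda>w. \<xi> (w @ [b]))) \<in> measurable marks_law (mark_law \<Otimes>\<^sub>M marks_law)"
      unfolding marks_law_def
      by (intro measurable_Pair measurable_component_singleton measurable_shift) simp
    from measurable_compose[OF this G] show ?thesis by simp
  qed
  have "(\<integral>\<^sup>+\<xi>. F (run lifetime x (Suc n) \<xi> S) \<partial>marks_law) =
    (\<integral>\<^sup>+\<xi>. G True (\<xi> []) (\<lambda>w. \<xi> (w @ [True])) + G False (\<xi> []) (\<lambda>w. \<xi> (w @ [False])) \<partial>marks_law)"
    by (intro nn_integral_cong) (auto simp: G_def)
  also have "\<dots> = (\<integral>\<^sup>+m. \<integral>\<^sup>+\<xi>. G True m \<xi> \<partial>marks_law \<partial>mark_law) + (\<integral>\<^sup>+m. \<integral>\<^sup>+\<xi>. G False m \<xi> \<partial>marks_law \<partial>mark_law)"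
    using nn_integral_PiM_split[OF prob_space_mark_law G[unfolded marks_law_def]]
    by (simp add: nn_integral_add[OF Gs Gs] marks_law_def[symmetric])
  also have "\<dots> = (\<integral>\<^sup>+m. (\<integral>\<^sup>+\<xi>. G True m \<xi> \<partial>marks_law) + (\<integral>\<^sup>+\<xi>. G False m \<xi> \<partial>marks_law) \<partial>mark_law)"
    using marks.borel_measurable_nn_integral[OF G] by (intro nn_integral_add[symmetric])
  also have "\<dots> = (\<integral>\<^sup>+m. (if ring_time S m \<le> lifetime
       then \<integral>\<^sup>+\<xi>. F (run lifetime x n \<xi> (child (turn x S m) S m)) \<partial>marks_law
       else F (False, S)) \<partial>mark_law)"
  proof (intro nn_integral_cong)
    fix m
    show "(\<integral>\<^sup>+\<xi>. G True m \<xi> \<partial>marks_law) + (\<integral>\<^sup>+\<xi>. G False m \<xi> \<partial>marks_law) =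
      (if ring_time S m \<le> lifetime
       then \<integral>\<^sup>+\<xi>. F (run lifetime x n \<xi> (child (turn x S m) S m)) \<partial>marks_law
       else F (False, S))"
      by (cases "turn x S m") (simp_all add: G_def marks.emeasure_space_1)
  qed
  finally show ?thesis .
qed

section \<open>The survival martingale\<close>

lemma low_nth [simp]: "low L $ j = max 0 (L $ j)" by (simp add: low_def)

definition covers :: "real ^ 'd \<Rightarrow> real ^ 'd \<Rightarrow> ('d::finite) state \<Rightarrow> bool"
  where "covers p q S \<longleftrightarrow> (\<forall>j. low (fst S) $ j \<le> p $ j \<and> q $ j \<le> fst (snd S) $ j)"

text \<open>
  Along \<open>run\<close> this is a martingale: a cell that is alive at time \<open>t\<close> is hit by a split separating
  \<open>p\<close> and \<open>q\<close> at rate \<open>extent p q\<close>, whatever its size.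
\<close>

definition survival :: "real \<Rightarrow> real ^ 'd \<Rightarrow> real ^ 'd \<Rightarrow> bool \<times> ('d::finite) state \<Rightarrow> real"
  where "survival lifetime p q = (\<lambda>(alive, S). of_bool (covers p q S) *
    (if alive then exp (- (max 0 (lifetime - snd (snd S)) * extent p q)) else 1))"

text \<open>In \<open>survival_step\<close>, a is the remaining time multiplied by the rate of the
  cell, c the probability that the cut spares the box, and \<open>exp (- r)\<close> the survival
  factor at the start. Waiting e shortens the remaining time, which gives the factor
  \<open>exp (e * (1 - c))\<close>.\<close>

lemma nn_integral_exponential_split:
  fixes a c r :: real
  assumes "0 \<le> a" "0 \<le> c"
  shows "(\<integral>\<^sup>+e. ennreal (exponential_density 1 e) *
      ennreal (if e \<le> a then exp (- r) * exp (e * (1 - c)) * c else 1) \<partial>lborel) =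
    ennreal (exp (- r) * (1 - exp (- a * c)) + exp (- a))"
proof -
  let ?f = "\<lambda>e. exp (- r) * exp (- (e * c)) * c"
  have "(\<integral>\<^sup>+e. ennreal (exponential_density 1 e) *
      ennreal (if e \<le> a then exp (- r) * exp (e * (1 - c)) * c else 1) \<partial>lborel) =
    (\<integral>\<^sup>+e. ennreal (?f e) * indicator {0..a} e + ennreal (exp (- e)) * indicator {a..} e \<partial>lborel)"
  proof (intro nn_integral_cong_AE)
    show "AE e in lborel. ennreal (exponential_density 1 e) *
      ennreal (if e \<le> a then exp (- r) * exp (e * (1 - c)) * c else 1) =
      ennreal (?f e) * indicator {0..a} e + ennreal (exp (- e)) * indicator {a..} e"
      using AE_lborel_singleton[of a]
    proof eventually_elim
      case (elim e)
      have "exp (- e) * (exp (- r) * exp (e * (1 - c)) * c) = ?f e"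
        by (simp add: mult_exp_exp algebra_simps)
      then show ?case
        using elim assms by (auto simp: exponential_density_def indicator_def mult.commute simp flip: ennreal_mult')
    qed
  qed
  also have "\<dots> = (\<integral>\<^sup>+e. ennreal (?f e) * indicator {0..a} e \<partial>lborel) +
      (\<integral>\<^sup>+e. ennreal (exp (- e)) * indicator {a..} e \<partial>lborel)"
    by (intro nn_integral_add) auto
  also have "(\<integral>\<^sup>+e. ennreal (?f e) * indicator {0..a} e \<partial>lborel) =
      ennreal (- exp (- r) * exp (- (a * c)) - - exp (- r) * exp (- (0 * c)))"
    using assms by (intro nn_integral_FTC_Icc[where F = "\<lambda>e. - exp (- r) * exp (- (e * c))"])
      (auto intro!: derivative_eq_intros)
  also have "(\<integral>\<^sup>+e. ennreal (exp (- e)) * indicator {a..} e \<partial>lborel) = ennreal (0 - (- exp (- a)))"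
  proof (rule nn_integral_FTC_atLeast[where F = "\<lambda>e. - exp (- e)"])
    show "((\<lambda>e. - exp (- e)) \<longlongrightarrow> (0::real)) at_top"
      using tendsto_minus[OF filterlim_compose[OF exp_at_bot filterlim_uminus_at_bot_at_top]] by simp
  qed (auto intro!: derivative_eq_intros)
  finally show ?thesis
    using assms by (simp add: algebra_simps flip: ennreal_plus)
qed

text \<open>The integral is the Laplace transform at 1 of a waiting time with rate D. It equals
  \<open>D / (D + 1)\<close>, which increases with D.\<close>

lemma exponential_transform_le:
  assumes "0 < D" "D \<le> K"
  shows "(\<integral>\<^sup>+e. ennreal (exponential_density 1 e) * ennreal (exp (- (e / D))) \<partial>lborel) \<le> ennreal (K / (K + 1))"
proof -
  define k where "k = 1 + 1 / D"
  have k: "0 < k" using assms by (simp add: k_def add_pos_pos)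
  have "(\<integral>\<^sup>+e. ennreal (exponential_density 1 e) * ennreal (exp (- (e / D))) \<partial>lborel) =
    (\<integral>\<^sup>+e. ennreal (exp (- (e * k))) * indicator {0..} e \<partial>lborel)"
  proof (intro nn_integral_cong)
    fix e
    have "exp (- e) * exp (- (e / D)) = exp (- (e * k))" by (simp add: k_def mult_exp_exp algebra_simps)
    then show "ennreal (exponential_density 1 e) * ennreal (exp (- (e / D))) =
        ennreal (exp (- (e * k))) * indicator {0..} e"
      by (auto simp: exponential_density_def indicator_def simp flip: ennreal_mult')
  qed
  also have "\<dots> = ennreal (0 - (- (1 / k) * exp (- (0 * k))))"
  proof (rule nn_integral_FTC_atLeast[where F = "\<lambda>e. - (1 / k) * exp (- (e * k))"])
    have "filterlim (\<lambda>e::real. e * k) at_top at_top"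
      using filterlim_tendsto_pos_mult_at_top[OF tendsto_const k filterlim_ident] by (simp add: mult.commute)
    then have "((\<lambda>e. exp (- (e * k))) \<longlongrightarrow> 0) at_top"
      by (intro filterlim_compose[OF exp_at_bot] filterlim_compose[OF filterlim_uminus_at_bot_at_top])
    from tendsto_mult_right_zero[OF this, of "- (1 / k)"]
    show "((\<lambda>e. - (1 / k) * exp (- (e * k))) \<longlongrightarrow> 0) at_top" .
    show "((\<lambda>e. - (1 / k) * exp (- (e * k))) has_real_derivative exp (- (e * k))) (at e)" for e
      using k by (auto intro!: derivative_eq_intros)
  qed auto
  also have "0 - (- (1 / k) * exp (- (0 * k))) = 1 / k" by simp
  also have "ennreal (1 / k) \<le> ennreal (K / (K + 1))"
    using assms by (intro ennreal_leI) (simp add: k_def field_simps)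
  finally show ?thesis .
qed

lemma nn_integral_mark_law:
  assumes [measurable]: "F \<in> borel_measurable mark_space"
  shows "(\<integral>\<^sup>+m. F m \<partial>mark_law) = (\<integral>\<^sup>+e. ennreal (exponential_density 1 e) *
     (\<integral>\<^sup>+u. \<integral>\<^sup>+v. F (e, u, v) \<partial>std_uniform \<partial>std_uniform) \<partial>lborel)"
proof -
  interpret U: prob_space std_uniform by (rule prob_space_uniform_measure) auto
  interpret UU: prob_space "std_uniform \<Otimes>\<^sub>M std_uniform"
    by (rule prob_space_pair) unfold_locales
  have su [measurable_cong]: "sets std_uniform = sets borel" by (simp add: uniform_measure_def)
  have uu: "sets (std_uniform \<Otimes>\<^sub>M std_uniform) = sets (borel \<Otimes>\<^sub>M borel)"
    by (intro sets_pair_measure_cong su)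
  have F1: "F \<in> borel_measurable (density lborel (exponential_density 1) \<Otimes>\<^sub>M (std_uniform \<Otimes>\<^sub>M std_uniform))"
    by (subst measurable_cong_sets[OF sets_pair_measure_cong[OF _ uu] refl, of _ borel]) (auto intro: assms)
  have Fe: "(\<lambda>p. F (e, p)) \<in> borel_measurable (std_uniform \<Otimes>\<^sub>M std_uniform)" for e
    by (subst measurable_cong_sets[OF uu refl]) measurable
  have "(\<integral>\<^sup>+m. F m \<partial>mark_law) =
      (\<integral>\<^sup>+e. \<integral>\<^sup>+p. F (e, p) \<partial>(std_uniform \<Otimes>\<^sub>M std_uniform) \<partial>density lborel (exponential_density 1))"
    unfolding mark_law_def by (rule UU.nn_integral_fst[symmetric, OF F1])
  also have "\<dots> = (\<integral>\<^sup>+e. ennreal (exponential_density 1 e) *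
      (\<integral>\<^sup>+p. F (e, p) \<partial>(std_uniform \<Otimes>\<^sub>M std_uniform)) \<partial>lborel)"
  proof (rule nn_integral_density)
    show "(\<lambda>e. \<integral>\<^sup>+p. F (e, p) \<partial>(std_uniform \<Otimes>\<^sub>M std_uniform)) \<in> borel_measurable lborel"
      using UU.borel_measurable_nn_integral_fst[OF F1] by simp
  qed simp
  also have "\<dots> = (\<integral>\<^sup>+e. ennreal (exponential_density 1 e) *
     (\<integral>\<^sup>+u. \<integral>\<^sup>+v. F (e, u, v) \<partial>std_uniform \<partial>std_uniform) \<partial>lborel)"
    by (simp add: U.nn_integral_fst[symmetric, OF Fe])
  finally show ?thesis .
qed

lemma cell_bounds:
  assumes "x \<in> hrect L U" "\<And>j. 0 < x $ j"
  shows "low L $ j < x $ j" "x $ j \<le> U $ j" "low L $ j < U $ j" "0 < extent (low L) U"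
proof -
  have *: "low L $ j < x $ j" "x $ j \<le> U $ j" for j using assms by (auto simp: hrect_def)
  then show "low L $ j < x $ j" "x $ j \<le> U $ j" by auto
  show "low L $ j < U $ j" using *[of j] by linarith
  have "0 < U $ j - low L $ j" for j using *[of j] by linarith
  then show "0 < extent (low L) U" unfolding extent_def by (intro sum_pos) auto
qed

lemma measurable_coord_of: "coord_of l u \<in> measurable borel (count_space UNIV)"
  unfolding coord_of_def[abs_def] by (rule measurable_The_finite) measurable

lemma coord_of_law:
  assumes "x \<in> hrect L U" "\<And>j. 0 < x $ j"
  shows "emeasure std_uniform {u. coord_of (low L) U u = k} =
    ennreal ((U $ k - low L $ k) / extent (low L) U)"
proof -
  interpret U: prob_space std_uniform by (rule prob_space_std_uniform)
  note b = cell_bounds[OF assms]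
  have sl: "side_length (hrect L U) j = U $ j - low L $ j" for j
    by (simp only: side_length_def side_hrect[OF assms(1)])
  then have ss: "side_sum (hrect L U) = extent (low L) U" by (simp only: side_sum_def extent_def)
  have "measure std_uniform {u. split_coord (hrect L U) u = k} = (U $ k - low L $ k) / extent (low L) U"
    using split_coord_law[of "hrect L U" k] b(3,4) by (simp only: sl ss) (simp add: less_imp_le)
  then show ?thesis by (simp add: U.emeasure_eq_measure split_hrect(2)[OF assms(1)])
qed

text \<open>The child that contains y is kept. A cut below y must therefore stay at or below p, and
  any other cut must be at or beyond q, so the values of v strictly between the images of p and q
  are lost.\<close>

lemma location_avoids:
  fixes l w p q y :: real
  assumes "0 < w" "l \<le> p" "p \<le> y" "y \<le> q" "q \<le> l + w"
  shows "emeasure std_uniform {v. if y > l + v * w then l + v * w \<le> p else q \<le> l + v * w} =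
    ennreal (1 - (q - p) / w)"
proof -
  let ?A = "{v. if y > l + v * w then l + v * w \<le> p else q \<le> l + v * w}"
  define a b where "a = (p - l) / w" and "b = (q - l) / w"
  have ab: "0 \<le> a" "a \<le> b" "b \<le> 1" using assms by (auto simp: a_def b_def field_simps)
  have le: "l + v * w \<le> p \<longleftrightarrow> v \<le> a" "q \<le> l + v * w \<longleftrightarrow> b \<le> v" for v
    using assms by (auto simp: a_def b_def field_simps)
  have A: "?A \<in> sets borel" by measurable
  have "emeasure std_uniform ?A = emeasure lborel ({0..1} \<inter> ?A)"
    using A by (simp add: emeasure_uniform_measure divide_ennreal_def)
  \<comment> \<open>Omitting the two end points makes the pieces disjoint even if
    \<open>p = q\<close>.\<close>
  also have "\<dots> = emeasure lborel ({0..<a} \<union> {b<..1})"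
  proof (rule emeasure_eq_AE)
    show "AE v in lborel. (v \<in> {0..1} \<inter> ?A) = (v \<in> {0..<a} \<union> {b<..1})"
      using AE_lborel_singleton[of a] AE_lborel_singleton[of b]
    proof eventually_elim
      case (elim v)
      have "v < a \<Longrightarrow> y > l + v * w" "b < v \<Longrightarrow> \<not> y > l + v * w"
        using assms by (auto simp: a_def b_def field_simps)
      with elim ab show ?case by (auto simp: le)
    qed
  qed (use A in auto)
  also have "\<dots> = emeasure lborel {0..<a} + emeasure lborel {b<..1}"
    using ab by (intro plus_emeasure[symmetric]) auto
  also have "\<dots> = ennreal (a + (1 - b))" using ab by (simp flip: ennreal_plus)
  also have "a + (1 - b) = 1 - (q - p) / w" using assms by (simp add: a_def b_def field_simps)
  finally show ?thesis .
qed

lemma covers_child: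
  assumes "covers p q S" "\<And>j. p $ j \<le> x $ j" "\<And>j. x $ j \<le> q $ j"
  shows "covers p q (child (turn x S m) S m) \<longleftrightarrow>
    (if x $ split_k S m > split_s S m then split_s S m \<le> p $ split_k S m
     else q $ split_k S m \<le> split_s S m)"
proof (cases "x $ split_k S m > split_s S m")
  case True
  then have "turn x S m" by (simp add: turn_def)
  with True assms show ?thesis by (auto simp: covers_def child_def)
next
  case False
  then have "\<not> turn x S m" by (simp add: turn_def)
  with False assms show ?thesis by (auto simp: covers_def child_def)
qed

lemma covers_childD: "covers p q (child b S m) \<Longrightarrow> covers p q S"
  unfolding covers_def child_def by (auto split: if_splits)

text \<open>A cut in direction k is chosen with probability proportional to the side length and then
  hits the box with probability equal to the ratio of the two side lengths. The side length of the
  cell cancels, and the box is hit with probability \<rho> / D. Since cuts arrive at rate D, the box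
  is hit at rate \<rho>.\<close>

lemma survival_step:
  fixes S :: "('d::finite) state"
  assumes x: "x \<in> cell S" "\<And>j. 0 < x $ j" and t: "snd (snd S) \<le> lifetime"
    and pq: "\<And>j. p $ j \<le> x $ j" "\<And>j. x $ j \<le> q $ j"
  shows "(\<integral>\<^sup>+m. ennreal (if ring_time S m \<le> lifetime then survival lifetime p q (True, child (turn x S m) S m)
      else survival lifetime p q (False, S)) \<partial>mark_law) = ennreal (survival lifetime p q (True, S))"
proof (cases "covers p q S")
  case False
  \<comment> \<open>A box that is already cut stays cut, so both sides are zero.\<close>
  then have "\<not> covers p q (child b S m)" for b m using covers_childD by blast
  then have "survival lifetime p q (alive, child b S m) = 0" for alive b m by (simp add: survival_def)
  moreover have "survival lifetime p q (alive, S) = 0" for alive using False by (simp add: survival_def)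
  ultimately show ?thesis by (simp cong: if_cong)
next
  case True
  obtain L U t where S: "S = (L, U, t)" by (cases S)
  define l where "l = low L"
  define D where "D = extent l U"
  define \<rho> where "\<rho> = extent p q"
  \<comment> \<open>The probability that the next cut misses the box.\<close>
  define c where "c = 1 - \<rho> / D"
  define a where "a = (lifetime - t) * D"
  define r where "r = (lifetime - t) * \<rho>"
  have xLU: "x \<in> hrect L U" using x S by simp
  note b = cell_bounds[OF xLU x(2), folded l_def]
  have D: "0 < D" using b(4) by (simp add: D_def)
  have lp: "l $ j \<le> p $ j" and qU: "q $ j \<le> U $ j" for j
    using True by (auto simp: covers_def S l_def)
  have tl: "t \<le> lifetime" using t S by simp
  have \<rho>D: "\<rho> \<le> D" unfolding \<rho>_def D_def extent_def
    using lp qU by (intro sum_mono diff_mono) auto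
  have c0: "0 \<le> c" using \<rho>D D by (simp add: c_def)
  have a0: "0 \<le> a" using tl D by (simp add: a_def)
  let ?g = "\<lambda>u v. if x $ coord_of l U u > loc_of l U (coord_of l U u) v
    then loc_of l U (coord_of l U u) v \<le> p $ coord_of l U u
    else q $ coord_of l U u \<le> loc_of l U (coord_of l U u) v"
  define F where "F m = ennreal (if ring_time S m \<le> lifetime
      then survival lifetime p q (True, child (turn x S m) S m)
      else survival lifetime p q (False, S))" for m
  have Feq: "F (e, u, v) = (if e \<le> a then ennreal (exp (- r) * exp (e * (1 - c))) * indicator {v. ?g u v} v else 1)"
    for e u v
  proof -
    have rt: "ring_time S (e, u, v) = t + e / D" by (simp add: ring_time_def S D_def l_def)
    have "t + e / D \<le> lifetime \<longleftrightarrow> e \<le> a" using D by (simp add: a_def field_simps)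
    moreover have "max 0 (lifetime - (t + e / D)) * \<rho> = r - e * (1 - c)" if "e \<le> a"
      using that D calculation by (simp add: r_def c_def field_simps)
    then have "exp (- (max 0 (lifetime - (t + e / D)) * \<rho>)) = exp (- r) * exp (e * (1 - c))" if "e \<le> a"
      using that by (simp add: mult_exp_exp)
    moreover have "snd (snd (child b' S m)) = ring_time S m" for b' m by (simp add: child_def)
    moreover have "covers p q (child (turn x S (e, u, v)) S (e, u, v)) \<longleftrightarrow> ?g u v"
      unfolding covers_child[OF True pq] split_s_def split_k_def by (simp add: S l_def)
    ultimately show ?thesis
      using True by (simp add: F_def survival_def rt \<rho>_def[symmetric])
  qed
  have S_m: "(\<lambda>_. S) \<in> measurable mark_space state_space"
    by (intro measurable_const) (simp add: space_pair_measure)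
  have id_m: "(\<lambda>m. m) \<in> measurable mark_space mark_space" by simp
  have coord [measurable]: "coord_of l U \<in> measurable borel (count_space UNIV)" by (rule measurable_coord_of)
  have F_m: "F \<in> borel_measurable mark_space"
  proof -
    have coords: "(\<lambda>m. coord_of l U (fst (snd m))) \<in> measurable mark_space (count_space UNIV)"
      by measurable
    have "(\<lambda>m. if fst m \<le> a then ennreal (exp (- r) * exp (fst m * (1 - c))) *
       (\<Sum>k\<in>UNIV. indicator {m. coord_of l U (fst (snd m)) = k} m *
          indicator {m. if x $ k > loc_of l U k (snd (snd m)) then loc_of l U k (snd (snd m)) \<le> p $ k
            else q $ k \<le> loc_of l U k (snd (snd m))} m) else 1) \<in> borel_measurable mark_space"
      using coords unfolding loc_of_def by measurable
    also have "(\<lambda>m. if fst m \<le> a then ennreal (exp (- r) * exp (fst m * (1 - c))) *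
       (\<Sum>k\<in>UNIV. indicator {m. coord_of l U (fst (snd m)) = k} m *
          indicator {m. if x $ k > loc_of l U k (snd (snd m)) then loc_of l U k (snd (snd m)) \<le> p $ k
            else q $ k \<le> loc_of l U k (snd (snd m))} m) else 1) = F"
    proof (rule ext)
      fix m :: mark
      obtain e u v where m: "m = (e, u, v)" by (cases m)
      have "(\<Sum>k\<in>UNIV. indicator {m. coord_of l U (fst (snd m)) = k} m * (h k :: ennreal)) = h (coord_of l U u)" for h
        by (simp add: m indicator_def of_bool_def if_distrib if_distribR cong: if_cong)
      then show "(if fst m \<le> a then ennreal (exp (- r) * exp (fst m * (1 - c))) *
       (\<Sum>k\<in>UNIV. indicator {m. coord_of l U (fst (snd m)) = k} m *
          indicator {m. if x $ k > loc_of l U k (snd (snd m)) then loc_of l U k (snd (snd m)) \<le> p $ k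
            else q $ k \<le> loc_of l U k (snd (snd m))} m) else 1) = F m"
        by (simp add: m Feq) (simp add: indicator_def)
    qed
    finally show ?thesis .
  qed
  interpret U: prob_space std_uniform by (rule prob_space_std_uniform)
  have inner: "(\<integral>\<^sup>+v. indicator {v. ?g u v} v \<partial>std_uniform) =
      ennreal (1 - (q $ coord_of l U u - p $ coord_of l U u) / (U $ coord_of l U u - l $ coord_of l U u))" for u
  proof -
    let ?k = "coord_of l U u"
    have A: "{v. ?g u v} \<in> sets std_uniform"
      unfolding loc_of_def by (simp add: uniform_measure_def) measurable
    show ?thesis
      unfolding nn_integral_indicator[OF A] unfolding loc_of_def
      by (rule location_avoids) (use b(3)[of ?k] lp[of ?k] qU[of ?k] pq[of ?k] in simp_all)
  qed
  have outer: "(\<integral>\<^sup>+u. \<integral>\<^sup>+v. indicator {v. ?g u v} v \<partial>std_uniform \<partial>std_uniform) = ennreal c"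
  proof -
    define h where "h k = 1 - (q $ k - p $ k) / (U $ k - l $ k)" for k
    have ratio: "(1 - y / z) * (z / D) = z / D - y / D" if "z \<noteq> 0" for y z
      using that by (simp add: left_diff_distrib diff_divide_distrib)
    have h0: "0 \<le> h k" for k using lp[of k] qU[of k] b(3)[of k] by (simp add: h_def field_simps)
    have cs: "{u. coord_of l U u = k} \<in> sets std_uniform" for k
      using measurable_sets[OF coord, of "{k}"] by (simp add: vimage_def uniform_measure_def)
    have "(\<integral>\<^sup>+u. \<integral>\<^sup>+v. indicator {v. ?g u v} v \<partial>std_uniform \<partial>std_uniform) =
        (\<integral>\<^sup>+u. (\<Sum>k\<in>UNIV. ennreal (h k) * indicator {u. coord_of l U u = k} u) \<partial>std_uniform)"
      unfolding inner by (intro nn_integral_cong) (simp add: h_def[symmetric] indicator_def of_bool_def if_distrib cong: if_cong)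
    also have "\<dots> = (\<Sum>k\<in>UNIV. \<integral>\<^sup>+u. ennreal (h k) * indicator {u. coord_of l U u = k} u \<partial>std_uniform)"
      by (rule nn_integral_sum) (rule borel_measurable_times_ennreal[OF borel_measurable_const borel_measurable_indicator[OF cs]])
    also have "\<dots> = (\<Sum>k\<in>UNIV. ennreal (h k) * ennreal ((U $ k - l $ k) / D))"
      by (simp only: nn_integral_cmult_indicator[OF cs] coord_of_law[OF xLU x(2), folded l_def, folded D_def])
    also have "\<dots> = ennreal (\<Sum>k\<in>UNIV. h k * ((U $ k - l $ k) / D))"
      using h0 b(3) D by (simp add: less_imp_le flip: ennreal_mult)
    \<comment> \<open>Here the side length of the cell in direction k cancels.\<close>
    also have "(\<Sum>k\<in>UNIV. h k * ((U $ k - l $ k) / D)) = (\<Sum>k\<in>UNIV. (U $ k - l $ k) / D - (q $ k - p $ k) / D)"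
    proof (intro sum.cong refl)
      fix k
      have "U $ k - l $ k \<noteq> 0" using b(3)[of k] by simp
      then show "h k * ((U $ k - l $ k) / D) = (U $ k - l $ k) / D - (q $ k - p $ k) / D"
        unfolding h_def by (rule ratio)
    qed
    also have "\<dots> = (\<Sum>k\<in>UNIV. U $ k - l $ k) / D - (\<Sum>k\<in>UNIV. q $ k - p $ k) / D"
      unfolding sum_divide_distrib by (rule sum_subtractf)
    also have "\<dots> = c"
      using D unfolding extent_def[symmetric] D_def[symmetric] \<rho>_def[symmetric] c_def by simp
    finally show ?thesis .
  qed
  have "(\<integral>\<^sup>+m. F m \<partial>mark_law) = (\<integral>\<^sup>+e. ennreal (exponential_density 1 e) *
      ennreal (if e \<le> a then exp (- r) * exp (e * (1 - c)) * c else 1) \<partial>lborel)"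
    unfolding nn_integral_mark_law[OF F_m]
  proof (intro nn_integral_cong arg_cong2[where f = "(*)"] refl)
    fix e
    have m1: "(\<lambda>v. indicator {v. ?g u v} v :: ennreal) \<in> borel_measurable std_uniform" for u
      unfolding loc_of_def by (simp add: uniform_measure_def) measurable
    have m2: "(\<lambda>u. \<integral>\<^sup>+v. indicator {v. ?g u v} v \<partial>std_uniform) \<in> borel_measurable std_uniform"
      unfolding inner by (simp add: uniform_measure_def) measurable
    show "(\<integral>\<^sup>+u. \<integral>\<^sup>+v. F (e, u, v) \<partial>std_uniform \<partial>std_uniform) =
        ennreal (if e \<le> a then exp (- r) * exp (e * (1 - c)) * c else 1)"
    proof (cases "e \<le> a")
      case True
      then have "(\<integral>\<^sup>+u. \<integral>\<^sup>+v. F (e, u, v) \<partial>std_uniform \<partial>std_uniform) =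
          ennreal (exp (- r) * exp (e * (1 - c))) * ennreal c"
        by (simp only: Feq if_True nn_integral_cmult[OF m1] nn_integral_cmult[OF m2] outer)
      then show ?thesis using True c0 by (simp add: ennreal_mult')
    qed (simp add: Feq U.emeasure_space_1)
  qed
  also have "\<dots> = ennreal (exp (- r) * (1 - exp (- a * c)) + exp (- a))"
    by (rule nn_integral_exponential_split[OF a0 c0])
  also have "exp (- r) * (1 - exp (- a * c)) + exp (- a) = exp (- r)"
  proof -
    \<comment> \<open>Hence \<open>exp (- r) * exp (- a * c)\<close> equals
      \<open>exp (- a)\<close>, and the contribution of cells not cut any more compensates the lost
      one.\<close>
    have "a * c = a - r" using D by (simp add: a_def c_def r_def field_simps)
    then show ?thesis by (simp add: right_diff_distrib mult_exp_exp)
  qed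
  also have "exp (- r) = survival lifetime p q (True, S)"
    using True tl by (simp add: survival_def S r_def \<rho>_def)
  finally show ?thesis by (simp add: F_def)
qed

lemma measurable_covers [measurable]: "Measurable.pred state_space (covers p q)"
  unfolding covers_def[abs_def] low_nth by measurable

lemma measurable_survival: "survival lifetime p q \<in> borel_measurable (count_space UNIV \<Otimes>\<^sub>M state_space)"
proof -
  have "(\<lambda>z. of_bool (covers p q (snd z)) * (if fst z then exp (- (max 0 (lifetime - snd (snd (snd z))) * extent p q)) else 1) :: real)
    \<in> borel_measurable (count_space UNIV \<Otimes>\<^sub>M state_space)"
    by measurable
  then show ?thesis by (simp add: survival_def[abs_def] split_beta')
qed

lemma run_survival:
  fixes S :: "('d::finite) state"
  assumes "x \<in> cell S" "\<And>j. 0 < x $ j" "snd (snd S) \<le> lifetime"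
    "\<And>j. p $ j \<le> x $ j" "\<And>j. x $ j \<le> q $ j"
  shows "(\<integral>\<^sup>+\<xi>. ennreal (survival lifetime p q (run lifetime x n \<xi> S)) \<partial>marks_law) =
    ennreal (survival lifetime p q (True, S))"
  using assms(1,3)
proof (induction n arbitrary: S)
  case 0
  interpret prob_space marks_law by (rule prob_space_marks_law)
  show ?case by (simp add: emeasure_space_1)
next
  case (Suc n)
  have "(\<integral>\<^sup>+\<xi>. ennreal (survival lifetime p q (run lifetime x (Suc n) \<xi> S)) \<partial>marks_law) =
    (\<integral>\<^sup>+m. (if ring_time S m \<le> lifetime
       then \<integral>\<^sup>+\<xi>. ennreal (survival lifetime p q (run lifetime x n \<xi> (child (turn x S m) S m))) \<partial>marks_law
       else ennreal (survival lifetime p q (False, S))) \<partial>mark_law)"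
    by (rule nn_integral_run_Suc[OF measurable_compose[OF measurable_survival measurable_ennreal]])
  also have "\<dots> = (\<integral>\<^sup>+m. ennreal (if ring_time S m \<le> lifetime then survival lifetime p q (True, child (turn x S m) S m)
      else survival lifetime p q (False, S)) \<partial>mark_law)"
  proof (intro nn_integral_cong)
    fix m
    have "snd (snd (child b S m)) = ring_time S m" for b by (simp add: child_def)
    then show "(if ring_time S m \<le> lifetime
       then \<integral>\<^sup>+\<xi>. ennreal (survival lifetime p q (run lifetime x n \<xi> (child (turn x S m) S m))) \<partial>marks_law
       else ennreal (survival lifetime p q (False, S))) =
      ennreal (if ring_time S m \<le> lifetime then survival lifetime p q (True, child (turn x S m) S m)
      else survival lifetime p q (False, S))"
      using Suc.IH[OF child_mem[OF Suc.prems(1)], of m] by simp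
  qed
  also have "\<dots> = ennreal (survival lifetime p q (True, S))"
    using Suc.prems assms by (intro survival_step)
  finally show ?case .
qed

section \<open>Almost sure termination of the recursion\<close>

lemma run_alive_time:
  "snd (snd S) \<le> lifetime \<Longrightarrow> fst (run lifetime x n \<xi> S) \<Longrightarrow> snd (snd (snd (run lifetime x n \<xi> S))) \<le> lifetime"
proof (induction n arbitrary: \<xi> S)
  case (Suc n)
  have "snd (snd (child b S m)) = ring_time S m" for b m by (simp add: child_def)
  with Suc show ?case by (simp split: if_splits)
qed simp

text \<open>The extent of a cell in the unit cube is at most the dimension d. So each waiting time
  lowers the mean of \<open>exp (- time)\<close> by a factor of at most \<open>d / (d + 1)\<close>,
  whatever the shape of the cell.\<close>

lemma run_alive_decay:
  fixes S :: "('d::finite) state"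
  assumes "x \<in> cell S" "\<And>j. 0 < x $ j" "\<And>j. fst (snd S) $ j \<le> 1"
  shows "(\<integral>\<^sup>+\<xi>. (case run lifetime x n \<xi> S of (alive, S') \<Rightarrow> ennreal (of_bool alive * exp (- snd (snd S')))) \<partial>marks_law)
    \<le> ennreal (exp (- snd (snd S)) * (real CARD('d) / (real CARD('d) + 1)) ^ n)"
  using assms(1,3)
proof (induction n arbitrary: S)
  case 0
  interpret prob_space marks_law by (rule prob_space_marks_law)
  show ?case by (simp add: emeasure_space_1 split_beta)
next
  case (Suc n)
  define \<kappa> where "\<kappa> = real CARD('d) / (real CARD('d) + 1)"
  obtain L U t where S: "S = (L, U, t)" by (cases S)
  define D where "D = extent (low L) U"
  have D: "0 < D" using cell_bounds(4)[of x L U] Suc.prems assms(2) by (simp add: S D_def)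
  have "U $ j - low L $ j \<le> 1" for j
  proof -
    have "U $ j \<le> 1" using Suc.prems(2)[of j] by (simp add: S)
    moreover have "0 \<le> low L $ j" by simp
    ultimately show ?thesis by linarith
  qed
  then have "D \<le> (\<Sum>j\<in>(UNIV :: 'd set). 1)" unfolding D_def extent_def by (intro sum_mono)
  then have DK: "D \<le> real CARD('d)" by simp
  have F_m: "(\<lambda>(alive, S'). ennreal (of_bool alive * exp (- snd (snd S')))) \<in>
      borel_measurable (count_space UNIV \<Otimes>\<^sub>M (state_space :: 'd state measure))"
    unfolding split_beta' by measurable
  have "(\<integral>\<^sup>+\<xi>. (case run lifetime x (Suc n) \<xi> S of (alive, S') \<Rightarrow> ennreal (of_bool alive * exp (- snd (snd S')))) \<partial>marks_law) =
    (\<integral>\<^sup>+m. (if ring_time S m \<le> lifetime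
       then \<integral>\<^sup>+\<xi>. (case run lifetime x n \<xi> (child (turn x S m) S m) of (alive, S') \<Rightarrow> ennreal (of_bool alive * exp (- snd (snd S')))) \<partial>marks_law
       else 0) \<partial>mark_law)"
    using nn_integral_run_Suc[OF F_m, of lifetime x n S] by (simp cong: if_cong)
  also have "\<dots> \<le> (\<integral>\<^sup>+m. ennreal (exp (- t) * \<kappa> ^ n) * ennreal (exp (- (fst m / D))) \<partial>mark_law)"
  proof (intro nn_integral_mono)
    fix m :: mark
    have rt: "ring_time S m = t + fst m / D" by (simp add: ring_time_def S D_def)
    have tm: "snd (snd (child b S m)) = ring_time S m" for b by (simp add: child_def)
    have "fst (snd (child b S m)) $ j \<le> 1" for b j
      using Suc.prems(2)[of j] by (auto simp: child_def min_def)
    then have "(\<integral>\<^sup>+\<xi>. (case run lifetime x n \<xi> (child (turn x S m) S m) of (alive, S') \<Rightarrow> ennreal (of_bool alive * exp (- snd (snd S')))) \<partial>marks_law)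
      \<le> ennreal (exp (- ring_time S m) * \<kappa> ^ n)"
      using Suc.IH[OF child_mem[OF Suc.prems(1)], of m] by (simp add: tm \<kappa>_def)
    also have "exp (- ring_time S m) * \<kappa> ^ n = exp (- t) * \<kappa> ^ n * exp (- (fst m / D))"
      by (simp add: rt mult_exp_exp flip: exp_add)
    finally show "(if ring_time S m \<le> lifetime
       then \<integral>\<^sup>+\<xi>. (case run lifetime x n \<xi> (child (turn x S m) S m) of (alive, S') \<Rightarrow> ennreal (of_bool alive * exp (- snd (snd S')))) \<partial>marks_law
       else 0) \<le> ennreal (exp (- t) * \<kappa> ^ n) * ennreal (exp (- (fst m / D)))"
      by (simp add: \<kappa>_def flip: ennreal_mult)
  qed
  also have "\<dots> = (\<integral>\<^sup>+e. ennreal (exponential_density 1 e) *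
      (ennreal (exp (- t) * \<kappa> ^ n) * ennreal (exp (- (e / D)))) \<partial>lborel)"
  proof -
    interpret prob_space std_uniform by (rule prob_space_std_uniform)
    show ?thesis by (subst nn_integral_mark_law) (simp_all add: emeasure_space_1)
  qed
  also have "\<dots> = ennreal (exp (- t) * \<kappa> ^ n) * (\<integral>\<^sup>+e. ennreal (exponential_density 1 e) * ennreal (exp (- (e / D))) \<partial>lborel)"
    by (subst nn_integral_cmult[symmetric]) (auto intro!: nn_integral_cong simp: mult_ac)
  also have "\<dots> \<le> ennreal (exp (- t) * \<kappa> ^ n) * ennreal \<kappa>"
    unfolding \<kappa>_def by (intro mult_left_mono exponential_transform_le D DK) simp
  also have "\<dots> = ennreal (exp (- snd (snd S)) * (real CARD('d) / (real CARD('d) + 1)) ^ Suc n)"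
    by (simp add: S \<kappa>_def mult_ac flip: ennreal_mult)
  finally show ?case .
qed

lemma init_mem: "x \<in> box 0 1 \<Longrightarrow> x \<in> cell init"
  by (auto simp: mem_box_cart hrect_def intro: less_imp_le less_trans[of _ 0])

text \<open>A run alive after n steps has weight \<open>exp (- time)\<close> at least
  \<open>exp (- lifetime)\<close>, so by Markov's inequality its probability is at most
  \<open>exp lifetime * \<kappa> ^ n\<close>, which tends to zero.\<close>

lemma AE_stops:
  assumes x: "x \<in> box 0 1" and "0 \<le> lifetime"
  shows "AE \<xi> in marks_law. stops lifetime (x :: real ^ 'd) \<xi>"
proof -
  interpret prob_space marks_law by (rule prob_space_marks_law)
  define \<kappa> where "\<kappa> = real CARD('d) / (real CARD('d) + 1)"
  have x0: "0 < x $ j" for j using x by (auto simp: mem_box_cart)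
  let ?N = "{\<xi> \<in> space marks_law. \<not> stops lifetime x \<xi>}"
  have N: "?N \<in> sets marks_law" by measurable
  have le: "emeasure marks_law ?N \<le> ennreal (exp lifetime * \<kappa> ^ n)" for n
  proof -
    have r: "(\<lambda>\<xi>. case run lifetime x n \<xi> init of (alive, S') \<Rightarrow> ennreal (of_bool alive * exp (- snd (snd S')))) \<in> borel_measurable marks_law"
      by (rule measurable_compose[OF measurable_run_init]) (simp add: split_beta')
    have "emeasure marks_law ?N = (\<integral>\<^sup>+\<xi>. indicator ?N \<xi> \<partial>marks_law)" using N by simp
    also have "\<dots> \<le> (\<integral>\<^sup>+\<xi>. ennreal (exp lifetime) * (case run lifetime x n \<xi> init of (alive, S') \<Rightarrow> ennreal (of_bool alive * exp (- snd (snd S')))) \<partial>marks_law)"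
    proof (intro nn_integral_mono)
      fix \<xi>
      obtain al S' where S': "run lifetime x n \<xi> init = (al, S')" by (cases "run lifetime x n \<xi> init")
      have "\<xi> \<in> ?N \<Longrightarrow> al" using S' by (auto simp: stops_def dest: spec[of _ n])
      moreover have "al \<Longrightarrow> snd (snd S') \<le> lifetime"
        using run_alive_time[of init lifetime x n \<xi>] assms(2) by (simp add: S')
      moreover have "snd (snd S') \<le> lifetime \<Longrightarrow> 1 \<le> ennreal (exp lifetime * exp (- snd (snd S')))"
        by (simp add: mult_exp_exp)
      ultimately show "indicator ?N \<xi> \<le> ennreal (exp lifetime) * (case run lifetime x n \<xi> init of (alive, S') \<Rightarrow> ennreal (of_bool alive * exp (- snd (snd S'))))"
        by (auto simp: S' indicator_def simp flip: ennreal_mult')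
    qed
    also have "\<dots> = ennreal (exp lifetime) * (\<integral>\<^sup>+\<xi>. (case run lifetime x n \<xi> init of (alive, S') \<Rightarrow> ennreal (of_bool alive * exp (- snd (snd S')))) \<partial>marks_law)"
      by (rule nn_integral_cmult[OF r])
    also have "\<dots> \<le> ennreal (exp lifetime) * ennreal (\<kappa> ^ n)"
      using run_alive_decay[OF init_mem[OF x] x0, of lifetime n] by (intro mult_left_mono) (simp_all add: \<kappa>_def)
    finally show ?thesis by (simp add: \<kappa>_def ennreal_mult')
  qed
  have "(\<lambda>n. ennreal (exp lifetime * \<kappa> ^ n)) \<longlonglongrightarrow> ennreal (exp lifetime * 0)"
    by (intro tendsto_ennrealI tendsto_intros LIMSEQ_realpow_zero) (auto simp: \<kappa>_def)
  then have "emeasure marks_law ?N \<le> ennreal (exp lifetime * 0)"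
    using le by (intro tendsto_lowerbound[where F = sequentially]) auto
  then have "emeasure marks_law ?N = 0" by simp
  then show ?thesis using N by (subst AE_iff_measurable[OF N refl]) 
qed

text \<open>Optional stopping: the martingale is bounded by 1 and, once the run has stopped, equals
  the indicator of the event. Dominated convergence identifies the probability with the initial
  value, which is zero for a box that leaves the cube.\<close>

lemma last_state_covers_prob:
  fixes x :: "real ^ 'd"
  assumes x: "x \<in> box 0 1" and lt: "0 \<le> lifetime" and pq: "\<And>j. p $ j \<le> x $ j" "\<And>j. x $ j \<le> q $ j"
  shows "emeasure marks_law {\<xi> \<in> space marks_law. covers p q (last_state lifetime x \<xi>)} =
    ennreal (if \<forall>j. 0 \<le> p $ j \<and> q $ j \<le> 1 then exp (- (lifetime * extent p q)) else 0)"
proof -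
  interpret prob_space marks_law by (rule prob_space_marks_law)
  have x0: "0 < x $ j" for j using x by (auto simp: mem_box_cart)
  have pq': "p $ j \<le> q $ j" for j using pq[of j] by linarith
  have e0: "0 \<le> extent p q" unfolding extent_def using pq' by (intro sum_nonneg) simp
  let ?A = "{\<xi> \<in> space marks_law. covers p q (last_state lifetime x \<xi>)}"
  have A: "?A \<in> sets marks_law"
    using measurable_compose[OF measurable_last_state measurable_covers] by (simp add: pred_def)
  have u: "(\<lambda>\<xi>. ennreal (survival lifetime p q (run lifetime x n \<xi> init))) \<in> borel_measurable marks_law" for n
    by (rule measurable_compose[OF measurable_run_init measurable_compose[OF measurable_survival measurable_ennreal]])
  have L: "(\<lambda>n. \<integral>\<^sup>+\<xi>. ennreal (survival lifetime p q (run lifetime x n \<xi> init)) \<partial>marks_law) \<longlonglongrightarrow>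
      (\<integral>\<^sup>+\<xi>. indicator ?A \<xi> \<partial>marks_law)"
  proof (rule nn_integral_dominated_convergence[where w = "\<lambda>_. 1"])
    show "AE \<xi> in marks_law. ennreal (survival lifetime p q (run lifetime x n \<xi> init)) \<le> 1" for n
      using e0 by (intro AE_I2) (auto simp: survival_def split_beta)
    show "AE \<xi> in marks_law. (\<lambda>n. ennreal (survival lifetime p q (run lifetime x n \<xi> init))) \<longlonglongrightarrow> indicator ?A \<xi>"
      using AE_stops[OF x lt] AE_space
    proof eventually_elim
      case (elim \<xi>)
      then obtain n where "\<not> fst (run lifetime x n \<xi> init)" unfolding stops_def by (auto simp only:)
      then obtain S where S: "run lifetime x n \<xi> init = (False, S)" by (cases "run lifetime x n \<xi> init") simp
      have "eventually (\<lambda>m. ennreal (survival lifetime p q (run lifetime x m \<xi> init)) = indicator ?A \<xi>) sequentially"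
        using run_stopped[OF S] last_state_eq[OF S] elim
        by (auto simp: eventually_sequentially survival_def intro!: exI[of _ n])
      then show ?case by (rule tendsto_eventually)
    qed
  qed (use A u in \<open>auto simp: emeasure_space_1\<close>)
  have eq: "(\<integral>\<^sup>+\<xi>. ennreal (survival lifetime p q (run lifetime x n \<xi> init)) \<partial>marks_law) =
      ennreal (survival lifetime p q (True, init))" for n
    by (rule run_survival[OF init_mem[OF x] x0 _ pq]) (simp add: lt)
  have "(\<integral>\<^sup>+\<xi>. indicator ?A \<xi> \<partial>marks_law) = ennreal (survival lifetime p q (True, init))"
    by (rule LIMSEQ_unique[OF L[unfolded eq] tendsto_const])
  moreover have "survival lifetime p q (True, init) = (if \<forall>j. 0 \<le> p $ j \<and> q $ j \<le> 1 then exp (- (lifetime * extent p q)) else 0)"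
    using lt by (auto simp: survival_def covers_def intro: order_trans[of "- 1" "0 :: real"])
  ultimately show ?thesis using A by simp
qed

section \<open>The corners of the cell as clipped exponential variables\<close>

abbreviation exp_law :: "real measure" where "exp_law \<equiv> density lborel (exponential_density 1)"

definition exp_vec :: "('d::finite \<Rightarrow> real) measure" where "exp_vec = Pi\<^sub>M UNIV (\<lambda>_. exp_law)"

abbreviation exp_pair :: "(('d::finite \<Rightarrow> real) \<times> ('d \<Rightarrow> real)) measure"
  where "exp_pair \<equiv> exp_vec \<Otimes>\<^sub>M exp_vec"

definition clip_lower :: "real \<Rightarrow> real ^ 'd \<Rightarrow> ('d \<Rightarrow> real) \<Rightarrow> real ^ 'd"
  where "clip_lower lifetime x A = (\<chi> j. max 0 (x $ j - A j / lifetime))"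

definition clip_upper :: "real \<Rightarrow> real ^ 'd \<Rightarrow> ('d \<Rightarrow> real) \<Rightarrow> real ^ 'd"
  where "clip_upper lifetime x A = (\<chi> j. min 1 (x $ j + A j / lifetime))"

lemma prob_space_exp_vec: "prob_space exp_vec"
  unfolding exp_vec_def by (intro prob_space_PiM prob_space_exponential1)

lemma sets_exp_vec: "sets exp_vec = sets (Pi\<^sub>M UNIV (\<lambda>_. borel))"
  unfolding exp_vec_def by (intro sets_PiM_cong) simp_all

lemma space_exp_vec [simp]: "space exp_vec = UNIV"
  by (simp add: exp_vec_def space_PiM)

lemma measurable_exp_vec [measurable]: "(\<lambda>A. A j) \<in> borel_measurable exp_vec"
  unfolding measurable_cong_sets[OF sets_exp_vec refl] by simp

lemma measurable_clip [measurable]: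
  "clip_lower lifetime x \<in> borel_measurable exp_vec" "clip_upper lifetime x \<in> borel_measurable exp_vec"
  unfolding clip_lower_def[abs_def] clip_upper_def[abs_def]
  by (rule borel_measurable_vec, simp)+

lemma emeasure_exp_law_atLeast: "emeasure exp_law {s..} = ennreal (exp (- max 0 s))"
proof -
  have "emeasure exp_law {s..} = (\<integral>\<^sup>+e. ennreal (exponential_density 1 e) * indicator {s..} e \<partial>lborel)"
    by (simp add: emeasure_density)
  also have "\<dots> = (\<integral>\<^sup>+e. ennreal (exp (- e)) * indicator {max 0 s..} e \<partial>lborel)"
    by (intro nn_integral_cong) (auto simp: exponential_density_def indicator_def)
  also have "\<dots> = ennreal (0 - (- exp (- max 0 s)))"
  proof (rule nn_integral_FTC_atLeast[where F = "\<lambda>e. - exp (- e)"])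
    show "((\<lambda>e. - exp (- e)) \<longlongrightarrow> (0::real)) at_top"
      using tendsto_minus[OF filterlim_compose[OF exp_at_bot filterlim_uminus_at_bot_at_top]] by simp
  qed (auto intro!: derivative_eq_intros)
  finally show ?thesis by simp
qed

lemma emeasure_exp_vec_atLeast: "emeasure exp_vec {A. \<forall>j. s j \<le> A j} = ennreal (exp (- (\<Sum>j\<in>UNIV. max 0 (s j))))"
proof -
  interpret product_sigma_finite "\<lambda>_ :: 'a. exp_law"
    unfolding product_sigma_finite_def
    by (auto intro!: prob_space_imp_sigma_finite prob_space_exponential1)
  have "{A. \<forall>j. s j \<le> A j} = (\<Pi>\<^sub>E j\<in>UNIV. {s j..})" by (auto simp: PiE_iff)
  then have "emeasure exp_vec {A. \<forall>j. s j \<le> A j} = (\<Prod>j\<in>UNIV. emeasure exp_law {s j..})"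
    unfolding exp_vec_def by (simp add: emeasure_PiM)
  then show ?thesis
    by (simp add: emeasure_exp_law_atLeast prod_ennreal flip: exp_sum sum_negf)
qed

text \<open>The order on pairs of vectors is componentwise, so the lower orthants generate the Borel
  sets and are closed under intersection.\<close>

lemma borel_pair_eqI:
  fixes M N :: "((real ^ 'd) \<times> (real ^ 'd)) measure"
  assumes "sets M = sets borel" "sets N = sets borel" "finite_measure M"
    and eq: "\<And>a. emeasure M {..a} = emeasure N {..a}"
  shows "M = N"
proof (rule measure_eqI_generator_eq[where \<Omega> = UNIV and E = "range atMost"
      and A = "\<lambda>i. {..((\<chi> j. real i), (\<chi> j. real i))}"])
  show "Int_stable (range atMost :: ((real ^ 'd) \<times> (real ^ 'd)) set set)"
  proof (rule Int_stableI_image)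
    fix a b :: "(real ^ 'd) \<times> (real ^ 'd)"
    have "{..a} \<inter> {..b} = {..((\<chi> j. min (fst a $ j) (fst b $ j)), (\<chi> j. min (snd a $ j) (snd b $ j)))}"
      by (auto simp: less_eq_prod_def less_eq_vec_def)
    then show "\<exists>c\<in>UNIV. {..a} \<inter> {..b} = {..c}" by blast
  qed
  have b: "sets borel = sigma_sets UNIV (range atMost :: ((real ^ 'd) \<times> (real ^ 'd)) set set)"
    by (subst borel_eq_atMost) simp
  show "sets M = sigma_sets UNIV (range atMost)" "sets N = sigma_sets UNIV (range atMost)"
    using assms b by simp_all
  show "(\<Union>i. {..((\<chi> j. real i), (\<chi> j. real i))}) = (UNIV :: ((real ^ 'd) \<times> (real ^ 'd)) set)"
  proof (intro equalityI subsetI UNIV_I)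
    fix y :: "(real ^ 'd) \<times> (real ^ 'd)"
    obtain i where i: "norm (fst y) + norm (snd y) \<le> real i" using real_arch_simple by blast
    have "fst y $ j \<le> real i" "snd y $ j \<le> real i" for j
      using component_le_norm_cart[of "fst y" j] component_le_norm_cart[of "snd y" j] i
        norm_ge_zero[of "fst y"] norm_ge_zero[of "snd y"] by linarith+
    then show "y \<in> (\<Union>i. {..((\<chi> j. real i), (\<chi> j. real i))})"
      by (intro UN_I[of i]) (auto simp: less_eq_prod_def less_eq_vec_def)
  qed
  show "emeasure M {..((\<chi> j. real i), (\<chi> j. real i))} \<noteq> \<infinity>" for i
    using finite_measure.emeasure_finite[OF assms(3)] by simp
qed (use eq in auto)

lemma last_state_mem:
  assumes "x \<in> box 0 1" "stops lifetime x \<xi>"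
  shows "x \<in> cell (last_state lifetime x \<xi>)"
proof -
  obtain n where "\<not> fst (run lifetime x n \<xi> init)" using assms(2) unfolding stops_def by (elim exE)
  then obtain S where S: "run lifetime x n \<xi> init = (False, S)" by (cases "run lifetime x n \<xi> init") simp
  then show ?thesis using run_mem[OF init_mem[OF assms(1)], of lifetime n \<xi>] last_state_eq[OF S] by simp
qed

text \<open>The joint law of the two corners is determined by the probabilities that the cell
  contains a given box, and those of the exponential model factor into tails over the faces.\<close>

lemma last_state_law:
  fixes x :: "real ^ 'd" and F :: "(real ^ 'd) \<times> (real ^ 'd) \<Rightarrow> ennreal"
  assumes x: "x \<in> box 0 1" and lt: "0 < lifetime" and F [measurable]: "F \<in> borel_measurable borel"
  shows "(\<integral>\<^sup>+\<xi>. F (low (fst (last_state lifetime x \<xi>)), fst (snd (last_state lifetime x \<xi>))) \<partial>marks_law) =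
    (\<integral>\<^sup>+S. F (clip_lower lifetime x (fst S), clip_upper lifetime x (snd S)) \<partial>exp_pair)"
proof -
  interpret M: prob_space marks_law by (rule prob_space_marks_law)
  interpret E: prob_space "exp_vec :: ('d \<Rightarrow> real) measure" by (rule prob_space_exp_vec)
  interpret W: prob_space "exp_pair :: (('d \<Rightarrow> real) \<times> ('d \<Rightarrow> real)) measure"
    by (intro prob_space_pair prob_space_exp_vec)
  have x01: "0 < x $ j" "x $ j < 1" for j using x by (auto simp: mem_box_cart)
  \<comment> \<open>The upper corner is negated so that containing a box becomes membership in a
    lower orthant.\<close>
  let ?f = "\<lambda>\<xi>. (low (fst (last_state lifetime x \<xi>)), - fst (snd (last_state lifetime x \<xi>)))"
  let ?g = "\<lambda>S. (clip_lower lifetime x (fst S), - clip_upper lifetime x (snd S))"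
  have f: "?f \<in> borel_measurable marks_law"
    unfolding borel_prod[symmetric]
    by (intro measurable_Pair measurable_compose[OF measurable_compose[OF measurable_last_state measurable_fst] measurable_low]
        borel_measurable_uminus measurable_compose[OF measurable_compose[OF measurable_last_state measurable_snd] measurable_fst])
  have g: "?g \<in> borel_measurable exp_pair"
    unfolding borel_prod[symmetric]
    by (intro measurable_Pair measurable_compose[OF measurable_fst measurable_clip(1)]
        borel_measurable_uminus measurable_compose[OF measurable_snd measurable_clip(2)])
  have "distr marks_law borel ?f = distr exp_pair borel ?g"
  proof (rule borel_pair_eqI)
    show "finite_measure (distr marks_law borel ?f)"
      by (intro M.finite_measure_distr f)
    fix a :: "(real ^ 'd) \<times> (real ^ 'd)"
    \<comment> \<open>The cell contains x almost surely, so the box may be enlarged until it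
      contains x, as \<open>last_state_covers_prob\<close> demands.\<close>
    define p q p' q' where "p = fst a" and "q = - snd a"
      and "p' = (\<chi> j. min (p $ j) (x $ j))" and "q' = (\<chi> j. max (q $ j) (x $ j))"
    have "emeasure (distr marks_law borel ?f) {..a} =
        emeasure marks_law (?f -` {..a} \<inter> space marks_law)"
      by (rule emeasure_distr[OF f]) simp
    also have "\<dots> = emeasure marks_law {\<xi> \<in> space marks_law. covers p' q' (last_state lifetime x \<xi>)}"
    proof (rule emeasure_eq_AE)
      show "AE \<xi> in marks_law. (\<xi> \<in> ?f -` {..a} \<inter> space marks_law) =
          (\<xi> \<in> {\<xi> \<in> space marks_law. covers p' q' (last_state lifetime x \<xi>)})"
        using AE_stops[OF x less_imp_le[OF lt]]
      proof eventually_elim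
        case (elim \<xi>)
        have "low (fst (last_state lifetime x \<xi>)) $ j \<le> x $ j" "x $ j \<le> fst (snd (last_state lifetime x \<xi>)) $ j" for j
          using cell_bounds(1,2)[OF last_state_mem[OF x elim] x01(1), of j] by auto
        moreover have "?f \<xi> \<in> {..a} \<longleftrightarrow> covers p q (last_state lifetime x \<xi>)"
          by (auto simp: less_eq_prod_def less_eq_vec_def covers_def p_def q_def minus_le_iff)
        ultimately show ?case
          by (auto simp: covers_def p'_def q'_def simp del: low_nth)
      qed
      show "?f -` {..a} \<inter> space marks_law \<in> sets marks_law"
        by (rule measurable_sets[OF f]) simp
      show "{\<xi> \<in> space marks_law. covers p' q' (last_state lifetime x \<xi>)} \<in> sets marks_law"
        using measurable_compose[OF measurable_last_state measurable_covers] by (simp add: pred_def)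
    qed
    also have "\<dots> = ennreal (if \<forall>j. 0 \<le> p' $ j \<and> q' $ j \<le> 1 then exp (- (lifetime * extent p' q')) else 0)"
      using lt by (intro last_state_covers_prob[OF x]) (auto simp: p'_def q'_def)
    also have "\<dots> = emeasure exp_pair (?g -` {..a} \<inter> space exp_pair)"
    proof -
      have cl: "clip_lower lifetime x A $ j \<le> p $ j \<longleftrightarrow> 0 \<le> p $ j \<and> lifetime * (x $ j - p $ j) \<le> A j" for A j
        using lt by (auto simp: clip_lower_def field_simps)
      have cu: "q $ j \<le> clip_upper lifetime x A $ j \<longleftrightarrow> q $ j \<le> 1 \<and> lifetime * (q $ j - x $ j) \<le> A j" for A j
        using lt by (auto simp: clip_upper_def field_simps)
      have sp: "space (exp_pair :: (('d \<Rightarrow> real) \<times> ('d \<Rightarrow> real)) measure) = UNIV"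
        by (simp add: space_pair_measure)
      have g_eq: "?g -` {..a} \<inter> space exp_pair = {S. \<forall>j. clip_lower lifetime x (fst S) $ j \<le> p $ j
          \<and> q $ j \<le> clip_upper lifetime x (snd S) $ j}"
        unfolding sp by (auto simp: less_eq_prod_def less_eq_vec_def p_def q_def minus_le_iff)
      have iff: "(\<forall>j. 0 \<le> p' $ j \<and> q' $ j \<le> 1) \<longleftrightarrow> (\<forall>j. 0 \<le> p $ j \<and> q $ j \<le> 1)"
        using x01 by (auto simp: p'_def q'_def less_imp_le)
      show ?thesis
      proof (cases "\<forall>j. 0 \<le> p $ j \<and> q $ j \<le> 1")
        case True
        have "?g -` {..a} \<inter> space exp_pair =
            {A. \<forall>j. lifetime * (x $ j - p $ j) \<le> A j} \<times> {A. \<forall>j. lifetime * (q $ j - x $ j) \<le> A j}"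
          unfolding g_eq cl cu using True by auto
        moreover have "{A. \<forall>j. s j \<le> A j} \<in> sets exp_vec" for s :: "'d \<Rightarrow> real"
        proof -
          have "{A \<in> space exp_vec. \<forall>j. s j \<le> A j} \<in> sets exp_vec" by measurable
          then show ?thesis by simp
        qed
        ultimately have "emeasure exp_pair (?g -` {..a} \<inter> space exp_pair) =
          ennreal (exp (- (\<Sum>j\<in>UNIV. max 0 (lifetime * (x $ j - p $ j))))) *
          ennreal (exp (- (\<Sum>j\<in>UNIV. max 0 (lifetime * (q $ j - x $ j)))))"
          by (simp add: E.emeasure_pair_measure_Times emeasure_exp_vec_atLeast)
        also have "\<dots> = ennreal (exp (- (\<Sum>j\<in>UNIV. max 0 (lifetime * (x $ j - p $ j)) + max 0 (lifetime * (q $ j - x $ j)))))"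
          by (simp add: sum.distrib mult_exp_exp flip: ennreal_mult)
        also have "(\<Sum>j\<in>UNIV. max 0 (lifetime * (x $ j - p $ j)) + max 0 (lifetime * (q $ j - x $ j))) = lifetime * extent p' q'"
          unfolding extent_def sum_distrib_left
        proof (intro sum.cong refl)
          fix j
          have m: "max 0 (lifetime * y) = lifetime * max 0 y" for y
            using lt by (simp add: max_mult_distrib_left)
          show "max 0 (lifetime * (x $ j - p $ j)) + max 0 (lifetime * (q $ j - x $ j)) = lifetime * (q' $ j - p' $ j)"
            unfolding m by (auto simp: p'_def q'_def max_def min_def algebra_simps)
        qed
        finally show ?thesis using True iff by simp
      next
        case False
        then have "?g -` {..a} \<inter> space exp_pair = {}" unfolding g_eq cl cu by auto
        then show ?thesis using False iff by simp
      qed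
    qed
    also have "\<dots> = emeasure (distr exp_pair borel ?g) {..a}"
      by (rule emeasure_distr[OF g, symmetric]) simp
    finally show "emeasure (distr marks_law borel ?f) {..a} = emeasure (distr exp_pair borel ?g) {..a}" .
  qed simp_all
  then have "(\<integral>\<^sup>+y. F (fst y, - snd y) \<partial>distr marks_law borel ?f) = (\<integral>\<^sup>+y. F (fst y, - snd y) \<partial>distr exp_pair borel ?g)"
    by simp
  moreover have "(\<lambda>y. F (fst y, - snd y)) \<in> borel_measurable borel"
    by (intro measurable_compose[OF _ F] borel_measurable_continuous_onI continuous_intros)
  ultimately show ?thesis
    using nn_integral_distr[OF f] nn_integral_distr[OF g] by simp
qed

section \<open>Taylor expansion in Hoelder classes\<close>

text \<open>
  The part of degree \<open>k\<close> of the Taylor polynomial of \<open>G \<nu>\<close> at \<open>x\<close>, summed over sequences of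
  coordinates instead of multi-indices.
\<close>

primrec tay :: "(('d::finite \<Rightarrow> nat) \<Rightarrow> real ^ 'd \<Rightarrow> real) \<Rightarrow> real ^ 'd \<Rightarrow> nat \<Rightarrow> ('d \<Rightarrow> nat) \<Rightarrow> real ^ 'd \<Rightarrow> real"
  where
    "tay G x 0 \<nu> h = G \<nu> x"
  | "tay G x (Suc k) \<nu> h = (\<Sum>j\<in>UNIV. h $ j * tay G x k (\<nu>(j := Suc (\<nu> j))) h) / real (Suc k)"

lemma tay_scale: "tay G x k \<nu> (c *\<^sub>R h) = c ^ k * tay G x k \<nu> h"
  by (induction k arbitrary: \<nu>) (simp_all add: sum_distrib_left mult_ac)

lemma continuous_on_tay: "continuous_on S (tay G x k \<nu>)"
  by (induction k arbitrary: \<nu>) (auto intro!: continuous_intros)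

lemma tay_bound: "\<exists>C\<ge>0. \<forall>h. \<bar>tay G x k \<nu> h\<bar> \<le> C * norm h ^ k"
proof (induction k arbitrary: \<nu>)
  case 0
  show ?case by (intro exI[of _ "\<bar>G \<nu> x\<bar>"]) simp
next
  case (Suc k)
  have "\<forall>j. \<exists>C\<ge>0. \<forall>h. \<bar>tay G x k (\<nu>(j := Suc (\<nu> j))) h\<bar> \<le> C * norm h ^ k" using Suc by blast
  then obtain C where C: "\<And>j. 0 \<le> C j" "\<And>j h. \<bar>tay G x k (\<nu>(j := Suc (\<nu> j))) h\<bar> \<le> C j * norm h ^ k"
    by metis
  show ?case
  proof (intro exI[of _ "sum C UNIV"] conjI allI)
    show "0 \<le> sum C UNIV" by (intro sum_nonneg C)
    fix h :: "real ^ 'a"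
    have "\<bar>tay G x (Suc k) \<nu> h\<bar> \<le> \<bar>\<Sum>j\<in>UNIV. h $ j * tay G x k (\<nu>(j := Suc (\<nu> j))) h\<bar>"
      by (simp add: divide_le_eq mult_le_cancel_left1)
    also have "\<dots> \<le> (\<Sum>j\<in>UNIV. \<bar>h $ j * tay G x k (\<nu>(j := Suc (\<nu> j))) h\<bar>)" by (rule sum_abs)
    also have "\<dots> \<le> (\<Sum>j\<in>UNIV. norm h * (C j * norm h ^ k))"
      unfolding abs_mult by (intro sum_mono mult_mono C component_le_norm_cart) auto
    also have "\<dots> = sum C UNIV * norm h ^ Suc k"
      by (simp only: sum_distrib_right power_Suc) (simp only: mult_ac)
    finally show "\<bar>tay G x (Suc k) \<nu> h\<bar> \<le> sum C UNIV * norm h ^ Suc k" .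
  qed
qed

lemma sum_incr:
  fixes \<nu> :: "'d::finite \<Rightarrow> nat"
  shows "sum (\<nu>(j := Suc (\<nu> j))) UNIV = Suc (sum \<nu> UNIV)"
  by (simp add: sum.remove[of UNIV j])

text \<open>Induction on m, the number of derivatives that \<open>G \<nu>\<close> still has. Along
  the segment from x to \<open>x + h\<close> the remainder is zero at the start, and its derivative
  is a combination of the remainders of the first partial derivatives; the mean value inequality
  gains one power of \<open>norm h\<close>.\<close>

lemma taylor_remainder:
  fixes x :: "real ^ 'd"
  assumes G: "partials_upto K g G" and x: "x \<in> unit_cube" and \<theta>: "0 < \<theta>" and C0: "0 < C0"
    and H: "\<And>\<nu> y y'. sum \<nu> UNIV = K \<Longrightarrow> y \<in> unit_cube \<Longrightarrow> y' \<in> unit_cube \<Longrightarrow>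
      \<bar>G \<nu> y - G \<nu> y'\<bar> \<le> C0 * norm (y - y') powr \<theta>"
  shows "m \<le> K \<Longrightarrow> sum \<nu> UNIV = K - m \<Longrightarrow> \<exists>C\<ge>0. \<forall>h. x + h \<in> unit_cube \<longrightarrow>
      \<bar>G \<nu> (x + h) - (\<Sum>k\<le>m. tay G x k \<nu> h)\<bar> \<le> C * norm h powr (real m + \<theta>)"
proof (induction m arbitrary: \<nu>)
  case 0
  show ?case
  proof (intro exI[of _ C0] conjI allI impI)
    fix h assume "x + h \<in> unit_cube"
    with H[of \<nu> "x + h" x] 0 x
    show "\<bar>G \<nu> (x + h) - (\<Sum>k\<le>0. tay G x k \<nu> h)\<bar> \<le> C0 * norm h powr (real 0 + \<theta>)" by simp
  qed (use C0 in simp)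
next
  case (Suc m)
  let ?\<nu> = "\<lambda>j. \<nu>(j := Suc (\<nu> j))"
  have "sum (?\<nu> j) UNIV = K - m" for j using Suc.prems unfolding sum_incr by simp
  then have "\<forall>j. \<exists>C\<ge>0. \<forall>h. x + h \<in> unit_cube \<longrightarrow>
      \<bar>G (?\<nu> j) (x + h) - (\<Sum>k\<le>m. tay G x k (?\<nu> j) h)\<bar> \<le> C * norm h powr (real m + \<theta>)"
    using Suc by simp
  then obtain C where C: "\<And>j. 0 \<le> C j" "\<And>j h. x + h \<in> unit_cube \<Longrightarrow>
      \<bar>G (?\<nu> j) (x + h) - (\<Sum>k\<le>m. tay G x k (?\<nu> j) h)\<bar> \<le> C j * norm h powr (real m + \<theta>)"
    by metis
  show ?case
  proof (intro exI[of _ "sum C UNIV"] conjI allI impI)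
    show "0 \<le> sum C UNIV" by (intro sum_nonneg C)
    fix h assume xh: "x + h \<in> unit_cube"
    have cube: "x + t *\<^sub>R h \<in> unit_cube" if "t \<in> {0..1}" for t
    proof -
      have "(1 - t) *\<^sub>R x + t *\<^sub>R (x + h) \<in> unit_cube"
        using that x xh by (intro convexD_alt) (auto simp: convex_box)
      then show ?thesis by (simp add: algebra_simps)
    qed
    \<comment> \<open>The remainder along the segment; by homogeneity the term of degree k carries
      the factor \<open>t ^ k\<close>.\<close>
    define \<psi> where "\<psi> t = G \<nu> (x + t *\<^sub>R h) - (\<Sum>k\<le>Suc m. t ^ k * tay G x k \<nu> h)" for t
    define \<psi>' where "\<psi>' t = (\<Sum>j\<in>UNIV. h $ j * (G (?\<nu> j) (x + t *\<^sub>R h) - (\<Sum>k\<le>m. t ^ k * tay G x k (?\<nu> j) h)))" for t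
    have der: "(\<psi> has_field_derivative \<psi>' t) (at t within {0..1})" if t: "t \<in> {0..1}" for t
    proof -
      have "(G \<nu> has_derivative (\<lambda>h. \<Sum>j\<in>UNIV. G (?\<nu> j) (x + t *\<^sub>R h') * h $ j)) (at (x + t *\<^sub>R h') within unit_cube)"
        if "x + t *\<^sub>R h' \<in> unit_cube" for h'
        using G Suc.prems that unfolding partials_upto_def by simp
      from has_derivative_subset[OF this[OF cube[OF t]], of "(\<lambda>t. x + t *\<^sub>R h) ` {0..1}"] cube
      have d1: "(G \<nu> has_derivative (\<lambda>h'. \<Sum>j\<in>UNIV. G (?\<nu> j) (x + t *\<^sub>R h) * h' $ j))
          (at (x + t *\<^sub>R h) within (\<lambda>t. x + t *\<^sub>R h) ` {0..1})" by blast
      have d2: "((\<lambda>t. x + t *\<^sub>R h) has_derivative (\<lambda>s. s *\<^sub>R h)) (at t within {0..1})"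
        by (auto intro!: derivative_eq_intros)
      have "((\<lambda>t. G \<nu> (x + t *\<^sub>R h)) has_derivative (\<lambda>s. \<Sum>j\<in>UNIV. G (?\<nu> j) (x + t *\<^sub>R h) * (s *\<^sub>R h) $ j)) (at t within {0..1})"
        by (rule has_derivative_in_compose[OF d2 d1])
      then have d3: "((\<lambda>t. G \<nu> (x + t *\<^sub>R h)) has_field_derivative (\<Sum>j\<in>UNIV. h $ j * G (?\<nu> j) (x + t *\<^sub>R h))) (at t within {0..1})"
        unfolding has_field_derivative_def
        by (rule has_derivative_eq_rhs) (simp add: fun_eq_iff sum_distrib_left sum_distrib_right mult_ac)
      have "((\<lambda>t. \<Sum>k\<le>Suc m. t ^ k * tay G x k \<nu> h) has_field_derivative
          (\<Sum>k\<le>Suc m. real k * t ^ (k - 1) * tay G x k \<nu> h)) (at t within {0..1})"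
        by (rule DERIV_sum) (auto intro!: derivative_eq_intros)
      also have "(\<Sum>k\<le>Suc m. real k * t ^ (k - 1) * tay G x k \<nu> h) =
          (\<Sum>k\<le>m. t ^ k * (\<Sum>j\<in>UNIV. h $ j * tay G x k (?\<nu> j) h))"
        by (subst sum.atMost_Suc_shift) (simp del: of_nat_Suc sum.atMost_Suc)
      also have "\<dots> = (\<Sum>j\<in>UNIV. h $ j * (\<Sum>k\<le>m. t ^ k * tay G x k (?\<nu> j) h))"
        by (simp add: sum_distrib_left mult_ac) (rule sum.swap)
      finally have d4: "((\<lambda>t. \<Sum>k\<le>Suc m. t ^ k * tay G x k \<nu> h) has_field_derivative
          (\<Sum>j\<in>UNIV. h $ j * (\<Sum>k\<le>m. t ^ k * tay G x k (?\<nu> j) h))) (at t within {0..1})" .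
      show ?thesis unfolding \<psi>_def[abs_def] \<psi>'_def right_diff_distrib sum_subtractf
        by (rule DERIV_diff[OF d3 d4])
    qed
    have bnd: "norm (\<psi>' t) \<le> sum C UNIV * norm h powr (real (Suc m) + \<theta>)" if t: "t \<in> {0..1}" for t
    proof -
      have "norm (\<psi>' t) \<le> (\<Sum>j\<in>UNIV. \<bar>h $ j * (G (?\<nu> j) (x + t *\<^sub>R h) - (\<Sum>k\<le>m. tay G x k (?\<nu> j) (t *\<^sub>R h)))\<bar>)"
        unfolding \<psi>'_def tay_scale real_norm_def by (rule sum_abs)
      also have "\<dots> \<le> (\<Sum>j\<in>UNIV. norm h * (C j * norm (t *\<^sub>R h) powr (real m + \<theta>)))"
        unfolding abs_mult by (intro sum_mono mult_mono C cube t component_le_norm_cart) auto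
      also have "\<dots> \<le> (\<Sum>j\<in>UNIV. norm h * (C j * norm h powr (real m + \<theta>)))"
        using t \<theta> by (intro sum_mono mult_left_mono powr_mono2 C) (auto simp: mult_left_le_one_le)
      also have "\<dots> = sum C UNIV * (norm h * norm h powr (real m + \<theta>))"
        by (simp only: sum_distrib_right) (simp only: mult_ac)
      also have "\<dots> = sum C UNIV * norm h powr (real (Suc m) + \<theta>)"
        by (simp add: powr_mult_base add_ac)
      finally show ?thesis .
    qed
    have "norm (\<psi> 1 - \<psi> 0) \<le> sum C UNIV * norm h powr (real (Suc m) + \<theta>) * norm (1 - 0 :: real)"
      by (rule field_differentiable_bound[OF _ der bnd]) auto
    moreover have "\<psi> 0 = 0" by (simp add: \<psi>_def sum.atMost_Suc_shift del: sum.atMost_Suc)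
    ultimately show "\<bar>G \<nu> (x + h) - (\<Sum>k\<le>Suc m. tay G x k \<nu> h)\<bar> \<le> sum C UNIV * norm h powr (real (Suc m) + \<theta>)"
      by (simp add: \<psi>_def del: sum.atMost_Suc)
  qed
qed

lemma holder_order_bounds: "0 < \<beta> \<Longrightarrow> \<beta> \<le> real (holder_order \<beta>) + 1" "0 < \<beta> \<Longrightarrow> real (holder_order \<beta>) < \<beta>"
  unfolding holder_order_def by linarith+

lemma powr_le_powr_bounded:
  fixes y M :: real
  assumes "0 \<le> y" "y \<le> M" "0 < b" "b \<le> a"
  shows "y powr a \<le> M powr (a - b) * y powr b"
proof -
  have "y powr a = y powr (a - b) * y powr b" by (simp flip: powr_add)
  also have "\<dots> \<le> M powr (a - b) * y powr b"
    using assms by (intro mult_right_mono powr_mono2) auto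
  finally show ?thesis .
qed

lemma norm_diff_unit_cube:
  fixes x h :: "real ^ 'd"
  assumes "x \<in> unit_cube" "x + h \<in> unit_cube"
  shows "norm h \<le> real CARD('d)"
proof -
  have "\<bar>h $ j\<bar> \<le> 1" for j
  proof -
    have "0 \<le> x $ j" "x $ j \<le> 1" "0 \<le> x $ j + h $ j" "x $ j + h $ j \<le> 1"
      using assms by (auto simp: mem_box_cart)
    then show ?thesis by linarith
  qed
  then have "(\<Sum>j\<in>UNIV. \<bar>h $ j\<bar>) \<le> (\<Sum>j\<in>(UNIV :: 'd set). 1)" by (intro sum_mono)
  with norm_le_l1_cart[of h] show ?thesis by simp
qed

text \<open>Smoothness b may exceed the exponent \<beta> wanted. The surplus Taylor terms have
  degree at least \<beta> and are moved into the remainder, which is possible because increments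
  within the cube are bounded.\<close>

lemma holder_taylor:
  fixes g :: "real ^ 'd \<Rightarrow> real"
  assumes g: "g \<in> holder_class b" and \<beta>: "0 < \<beta>" "\<beta> \<le> b" and x: "x \<in> unit_cube"
  obtains T :: "nat \<Rightarrow> real ^ 'd \<Rightarrow> real" and C where
    "\<And>h. T 0 h = g x" "\<And>k c h. T k (c *\<^sub>R h) = c ^ k * T k h" "\<And>k. T k \<in> borel_measurable borel"
    "0 \<le> C" "\<And>k h. k \<le> holder_order \<beta> \<Longrightarrow> \<bar>T k h\<bar> \<le> C * norm h ^ k"
    "\<And>h. x + h \<in> unit_cube \<Longrightarrow> \<bar>g (x + h) - (\<Sum>k\<le>holder_order \<beta>. T k h)\<bar> \<le> C * norm h powr \<beta>"
proof -
  define K' where "K' = holder_order b"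
  define K where "K = holder_order \<beta>"
  have b: "0 < b" using \<beta> by simp
  have KK': "K \<le> K'" unfolding K_def K'_def holder_order_def using \<beta> by (intro nat_mono ceiling_mono) simp
  obtain G C0 where G: "partials_upto K' g G" "0 < C0"
    "\<And>\<nu> y y'. sum \<nu> UNIV = K' \<Longrightarrow> y \<in> unit_cube \<Longrightarrow> y' \<in> unit_cube \<Longrightarrow>
      \<bar>G \<nu> y - G \<nu> y'\<bar> \<le> C0 * norm (y - y') powr (b - K')"
    using g unfolding holder_class_def K'_def by auto
  let ?z = "(\<lambda>_. 0) :: 'd \<Rightarrow> nat"
  have G0: "G ?z y = g y" if "y \<in> unit_cube" for y using G(1) that by (auto simp: partials_upto_def)
  have "0 < b - real K'" using holder_order_bounds(2)[OF b] by (simp add: K'_def)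
  from taylor_remainder[OF G(1) x this G(2,3), of K' ?z]
  obtain C1 where C1: "0 \<le> C1" "\<And>h. x + h \<in> unit_cube \<Longrightarrow>
      \<bar>G ?z (x + h) - (\<Sum>k\<le>K'. tay G x k ?z h)\<bar> \<le> C1 * norm h powr b" by auto
  obtain c where c: "\<And>k. 0 \<le> c k" "\<And>k h. \<bar>tay G x k ?z h\<bar> \<le> c k * norm h ^ k"
    using tay_bound[of G x _ ?z] by metis
  define M where "M = real CARD('d)"
  \<comment> \<open>The three parts bound the remainder of order b, the surplus Taylor terms, and
    the terms that are kept.\<close>
  define C where "C = C1 * M powr (b - \<beta>) + (\<Sum>k\<le>K'. c k * M powr (real k - \<beta>)) + (\<Sum>k\<le>K'. c k)"
  show thesis
  proof (rule that[of "\<lambda>k. tay G x k ?z" C])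
    show "tay G x 0 ?z h = g x" for h using G0[OF x] by simp
    show "tay G x k ?z (c *\<^sub>R h) = c ^ k * tay G x k ?z h" for k c h by (rule tay_scale)
    show "tay G x k ?z \<in> borel_measurable borel" for k
      by (intro borel_measurable_continuous_onI continuous_on_tay)
    show "0 \<le> C" unfolding C_def by (intro add_nonneg_nonneg sum_nonneg mult_nonneg_nonneg C1 c) auto
    show "\<bar>tay G x k ?z h\<bar> \<le> C * norm h ^ k" if "k \<le> holder_order \<beta>" for k h
    proof -
      have "c k \<le> (\<Sum>k\<le>K'. c k)" using that KK' c by (intro member_le_sum) (auto simp: K_def)
      also have "\<dots> \<le> C" unfolding C_def
        by (simp add: C1 c sum_nonneg add_nonneg_nonneg)
      finally show ?thesis using c(2)[of k h] by (meson mult_right_mono norm_ge_zero order_trans zero_le_power)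
    qed
    show "\<bar>g (x + h) - (\<Sum>k\<le>holder_order \<beta>. tay G x k ?z h)\<bar> \<le> C * norm h powr \<beta>" if h: "x + h \<in> unit_cube" for h
    proof -
      have hM: "norm h \<le> M" unfolding M_def by (rule norm_diff_unit_cube[OF x h])
      have split: "(\<Sum>k\<le>K'. tay G x k ?z h) = (\<Sum>k\<le>K. tay G x k ?z h) + (\<Sum>k\<in>{K<..K'}. tay G x k ?z h)"
        using KK' by (subst sum.union_disjoint[symmetric]) (auto intro!: sum.cong)
      have "\<bar>g (x + h) - (\<Sum>k\<le>K. tay G x k ?z h)\<bar> \<le>
          \<bar>G ?z (x + h) - (\<Sum>k\<le>K'. tay G x k ?z h)\<bar> + \<bar>\<Sum>k\<in>{K<..K'}. tay G x k ?z h\<bar>"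
        unfolding split G0[OF h] by linarith
      also have "\<bar>\<Sum>k\<in>{K<..K'}. tay G x k ?z h\<bar> \<le> (\<Sum>k\<in>{K<..K'}. c k * M powr (real k - \<beta>) * norm h powr \<beta>)"
      proof (rule order_trans[OF sum_abs], rule sum_mono)
        fix k assume k: "k \<in> {K<..K'}"
        then have "real K + 1 \<le> real k" by auto
        then have k\<beta>: "\<beta> \<le> real k" using holder_order_bounds(1)[OF \<beta>(1)] by (simp add: K_def)
        have "\<bar>tay G x k ?z h\<bar> \<le> c k * norm h powr real k"
          using c(2)[of k h] k\<beta> \<beta> by (subst powr_realpow') auto
        also have "\<dots> \<le> c k * (M powr (real k - \<beta>) * norm h powr \<beta>)"
          by (intro mult_left_mono powr_le_powr_bounded hM \<beta> k\<beta> c) simp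
        finally show "\<bar>tay G x k ?z h\<bar> \<le> c k * M powr (real k - \<beta>) * norm h powr \<beta>" by simp
      qed
      also have "\<dots> \<le> (\<Sum>k\<le>K'. c k * M powr (real k - \<beta>) * norm h powr \<beta>)"
        using c by (intro sum_mono2) auto
      also have "\<bar>G ?z (x + h) - (\<Sum>k\<le>K'. tay G x k ?z h)\<bar> \<le> C1 * (M powr (b - \<beta>) * norm h powr \<beta>)"
        using C1(2)[OF h] powr_le_powr_bounded[OF norm_ge_zero hM \<beta>] C1(1) by (meson mult_left_mono order_trans)
      finally have "\<bar>g (x + h) - (\<Sum>k\<le>K. tay G x k ?z h)\<bar> \<le>
          (C1 * M powr (b - \<beta>) + (\<Sum>k\<le>K'. c k * M powr (real k - \<beta>))) * norm h powr \<beta>"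
        unfolding distrib_right sum_distrib_right by (simp only: mult_ac)
      also have "\<dots> \<le> C * norm h powr \<beta>"
        unfolding C_def using c by (intro mult_right_mono) (auto intro: sum_nonneg)
      finally show ?thesis by (simp add: K_def)
    qed
  qed
qed

lemma holder_continuous:
  assumes g: "g \<in> holder_class b" and b: "0 < b"
  shows "continuous_on unit_cube (g :: real ^ 'd \<Rightarrow> real)"
  unfolding continuous_on_def
proof
  fix x :: "real ^ 'd" assume x: "x \<in> unit_cube"
  \<comment> \<open>With an exponent of at most 1 the Taylor polynomial is constant, and the
    expansion is a Hoelder estimate at x.\<close>
  define \<beta> where "\<beta> = min 1 b"
  have \<beta>: "0 < \<beta>" "\<beta> \<le> b" using b by (auto simp: \<beta>_def)
  have ho: "holder_order \<beta> = 0" by (simp add: holder_order_def \<beta>_def)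
  obtain T :: "nat \<Rightarrow> real ^ 'd \<Rightarrow> real" and C where TC: "\<And>h. T 0 h = g x"
    "\<And>h. x + h \<in> unit_cube \<Longrightarrow> \<bar>g (x + h) - (\<Sum>k\<le>holder_order \<beta>. T k h)\<bar> \<le> C * norm h powr \<beta>"
    using holder_taylor[OF g \<beta> x] by metis
  have "\<bar>g y - g x\<bar> \<le> C * norm (y - x) powr \<beta>" if "y \<in> unit_cube" for y
    using TC(2)[of "y - x"] TC(1)[of "y - x"] that by (simp add: ho)
  then have ev: "eventually (\<lambda>y. norm (g y - g x) \<le> C * norm (y - x) powr \<beta>) (at x within unit_cube)"
    by (auto simp: eventually_at_filter)
  have "((\<lambda>y. norm (y - x)) \<longlongrightarrow> norm (x - x)) (at x within unit_cube)"
    by (intro tendsto_intros)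
  then have "((\<lambda>y. C * norm (y - x) powr \<beta>) \<longlongrightarrow> 0) (at x within unit_cube)"
    using \<beta> by (intro tendsto_mult_right_zero tendsto_zero_powrI[OF _ tendsto_const]) auto
  from Lim_null_comparison[OF ev this] show "(g \<longlongrightarrow> g x) (at x within unit_cube)"
    by (simp add: LIM_zero_iff)
qed

lemma holder_bounded:
  assumes "g \<in> holder_class b" "0 < b"
  obtains M where "0 \<le> M" "\<And>y :: real ^ 'd. y \<in> unit_cube \<Longrightarrow> \<bar>g y\<bar> \<le> M"
proof -
  have "bounded (g ` unit_cube)"
    using holder_continuous[OF assms] by (intro compact_imp_bounded compact_continuous_image) auto
  then obtain M where "\<And>y. y \<in> unit_cube \<Longrightarrow> \<bar>g y\<bar> \<le> M" by (auto simp: bounded_iff)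
  then show thesis by (intro that[of "max 0 M"]) (simp_all add: max.coboundedI2)
qed

section \<open>Averages over boxes\<close>

lemma triangle_sum:
  fixes a b :: "nat \<Rightarrow> real"
  shows "(\<Sum>k=1..K. \<Sum>i=1..k. a i * b (k - i)) = (\<Sum>i=1..K. \<Sum>j=0..K-i. a i * b j)"
proof -
  have "(\<Sum>k=1..K. \<Sum>i=1..k. a i * b (k - i)) = (\<Sum>(k, i)\<in>Sigma {1..K} (\<lambda>k. {1..k}). a i * b (k - i))"
    by (subst sum.Sigma) auto
  also have "\<dots> = (\<Sum>(i, j)\<in>Sigma {1..K} (\<lambda>i. {0..K-i}). a i * b j)"
    by (rule sum.reindex_bij_witness[where i = "\<lambda>(i, j). (i + j, i)" and j = "\<lambda>(k, i). (i, k - i)"]) auto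
  also have "\<dots> = (\<Sum>i=1..K. \<Sum>j=0..K-i. a i * b j)"
    by (subst sum.Sigma) auto
  finally show ?thesis .
qed

text \<open>On a bounded range, higher powers are absorbed into the power \<beta>; the base
  \<open>1 + s0\<close> exceeds 1, so one exponent N serves all n.\<close>

lemma power_le_powr:
  fixes \<sigma> s0 \<beta> :: real
  assumes "0 \<le> \<sigma>" "\<sigma> \<le> s0" "0 < \<beta>" "\<beta> \<le> real n" "n \<le> N"
  shows "\<sigma> ^ n \<le> (1 + s0) ^ N * \<sigma> powr \<beta>"
proof -
  have "\<sigma> ^ n = \<sigma> powr real n" using assms by (subst powr_realpow') auto
  also have "\<dots> = \<sigma> powr (real n - \<beta>) * \<sigma> powr \<beta>" by (simp flip: powr_add)
  also have "\<dots> \<le> (1 + s0) powr (real n - \<beta>) * \<sigma> powr \<beta>"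
    using assms by (intro mult_right_mono powr_mono2) auto
  also have "\<dots> \<le> (1 + s0) powr real N * \<sigma> powr \<beta>"
    using assms by (intro mult_right_mono powr_mono) auto
  also have "(1 + s0) powr real N = (1 + s0) ^ N" using assms by (intro powr_realpow) auto
  finally show ?thesis .
qed

text \<open>The series of A has no constant term, hence is of order \<sigma>. That turns the error
  of order \<open>\<beta> - 1\<close> in B into one of order \<beta>. The constant is chosen before
  \<sigma> and the factors, as the estimate is applied both to functions and to their
  averages.\<close>

lemma jet_product:
  fixes C s0 \<beta> :: real
  assumes K: "1 \<le> K" "real K < \<beta>" "\<beta> \<le> real K + 1" and C: "0 \<le> C" "0 \<le> s0"
  obtains C' where "0 \<le> C'" "\<And>\<sigma> A B a b. 0 \<le> \<sigma> \<Longrightarrow> \<sigma> \<le> s0 \<Longrightarrow>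
    (\<And>i. 1 \<le> i \<Longrightarrow> i \<le> K \<Longrightarrow> \<bar>a i\<bar> \<le> C * \<sigma> ^ i) \<Longrightarrow> (\<And>j. j < K \<Longrightarrow> \<bar>b j\<bar> \<le> C * \<sigma> ^ j) \<Longrightarrow>
    \<bar>A - (\<Sum>i=1..K. a i)\<bar> \<le> C * \<sigma> powr \<beta> \<Longrightarrow> \<bar>B - (\<Sum>j<K. b j)\<bar> \<le> C * \<sigma> powr (\<beta> - 1) \<Longrightarrow> \<bar>B\<bar> \<le> C \<Longrightarrow>
    \<bar>A * B - (\<Sum>k=1..K. \<Sum>i=1..k. a i * b (k - i))\<bar> \<le> C' * \<sigma> powr \<beta>"
proof -
  define P where "P = (1 + s0) ^ (2 * K)"
  define C' where "C' = C * C + real K * C * (1 + s0) ^ K * C + real K * (real K * (C * C * P))"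
  have P: "0 \<le> P" using C by (simp add: P_def)
  show thesis
  proof (rule that[of C'])
    show "0 \<le> C'" unfolding C'_def using C P by simp
    fix \<sigma> A B :: real and a b :: "nat \<Rightarrow> real"
    assume \<sigma>: "0 \<le> \<sigma>" "\<sigma> \<le> s0" and a: "\<And>i. 1 \<le> i \<Longrightarrow> i \<le> K \<Longrightarrow> \<bar>a i\<bar> \<le> C * \<sigma> ^ i"
      and b: "\<And>j. j < K \<Longrightarrow> \<bar>b j\<bar> \<le> C * \<sigma> ^ j"
      and A: "\<bar>A - (\<Sum>i=1..K. a i)\<bar> \<le> C * \<sigma> powr \<beta>"
      and B: "\<bar>B - (\<Sum>j<K. b j)\<bar> \<le> C * \<sigma> powr (\<beta> - 1)" "\<bar>B\<bar> \<le> C"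
    let ?a = "\<Sum>i=1..K. a i" and ?b = "\<Sum>j<K. b j" and ?t = "\<Sum>k=1..K. \<Sum>i=1..k. a i * b (k - i)"
    have "\<bar>?a\<bar> \<le> (\<Sum>i=1..K. C * (\<sigma> * (1 + s0) ^ K))"
    proof (rule order_trans[OF sum_abs], rule sum_mono)
      fix i assume i: "i \<in> {1..K}"
      have "\<sigma> ^ i = \<sigma> * \<sigma> ^ (i - 1)" using i by (simp add: power_eq_if)
      also have "\<dots> \<le> \<sigma> * (1 + s0) ^ (i - 1)" using \<sigma> by (intro mult_left_mono power_mono) auto
      also have "\<dots> \<le> \<sigma> * (1 + s0) ^ K" using \<sigma> C i by (intro mult_left_mono power_increasing) auto
      finally have "C * \<sigma> ^ i \<le> C * (\<sigma> * (1 + s0) ^ K)" using C by (intro mult_left_mono)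
      with a[of i] i show "\<bar>a i\<bar> \<le> C * (\<sigma> * (1 + s0) ^ K)" by simp
    qed
    then have a_le: "\<bar>?a\<bar> \<le> real K * C * (1 + s0) ^ K * \<sigma>" by (simp add: mult_ac)
    have 1: "\<bar>(A - ?a) * B\<bar> \<le> C * C * \<sigma> powr \<beta>"
      using mult_mono[OF A B(2)] C by (simp add: abs_mult mult_ac)
    have "\<bar>?a * (B - ?b)\<bar> \<le> (real K * C * (1 + s0) ^ K * \<sigma>) * (C * \<sigma> powr (\<beta> - 1))"
      unfolding abs_mult using a_le B(1) C \<sigma> by (intro mult_mono) auto
    also have "\<dots> = real K * C * (1 + s0) ^ K * C * (\<sigma> * \<sigma> powr (\<beta> - 1))" by simp
    also have "\<sigma> * \<sigma> powr (\<beta> - 1) = \<sigma> powr \<beta>" using \<sigma> by (simp add: powr_mult_base)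
    finally have 2: "\<bar>?a * (B - ?b)\<bar> \<le> real K * C * (1 + s0) ^ K * C * \<sigma> powr \<beta>" .
    have "?a * ?b - ?t = (\<Sum>i=1..K. (\<Sum>j<K. a i * b j) - (\<Sum>j=0..K-i. a i * b j))"
      unfolding triangle_sum sum_product by (simp add: sum_subtractf)
    also have "\<dots> = (\<Sum>i=1..K. \<Sum>j\<in>{K-i<..<K}. a i * b j)"
    proof (intro sum.cong refl)
      fix i assume "i \<in> {1..K}"
      then have un: "{..<K} = {0..K-i} \<union> {K-i<..<K}" by auto
      have "(\<Sum>j<K. a i * b j) = (\<Sum>j=0..K-i. a i * b j) + (\<Sum>j\<in>{K-i<..<K}. a i * b j)"
        unfolding un by (rule sum.union_disjoint) auto
      then show "(\<Sum>j<K. a i * b j) - (\<Sum>j=0..K-i. a i * b j) = (\<Sum>j\<in>{K-i<..<K}. a i * b j)" by simp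
    qed
    finally have diff: "?a * ?b - ?t = (\<Sum>i=1..K. \<Sum>j\<in>{K-i<..<K}. a i * b j)" .
    have "\<bar>?a * ?b - ?t\<bar> \<le> (\<Sum>i=1..K. \<Sum>j\<in>{K-i<..<K}. \<bar>a i * b j\<bar>)"
      unfolding diff by (rule order_trans[OF sum_abs]) (intro sum_mono sum_abs)
    also have "\<dots> \<le> (\<Sum>i=1..K. \<Sum>j\<in>{K-i<..<K}. C * C * P * \<sigma> powr \<beta>)"
    proof (intro sum_mono)
      fix i j assume i: "i \<in> {1..K}" and j: "j \<in> {K-i<..<K}"
      have "\<bar>a i * b j\<bar> \<le> (C * \<sigma> ^ i) * (C * \<sigma> ^ j)"
        unfolding abs_mult using a[of i] b[of j] i j C \<sigma> by (intro mult_mono) auto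
      also have "\<dots> = C * C * \<sigma> ^ (i + j)" by (simp add: power_add)
      also have "\<dots> \<le> C * C * (P * \<sigma> powr \<beta>)"
      proof (intro mult_left_mono)
        \<comment> \<open>The products dropped have degree above K, hence at least \<beta>.\<close>
        have "K + 1 \<le> i + j" "i + j \<le> 2 * K" using i j by auto
        then have "real K + 1 \<le> real (i + j)" "i + j \<le> 2 * K" by linarith+
        then show "\<sigma> ^ (i + j) \<le> P * \<sigma> powr \<beta>"
          unfolding P_def using K \<sigma> by (intro power_le_powr) auto
      qed (use C in auto)
      finally show "\<bar>a i * b j\<bar> \<le> C * C * P * \<sigma> powr \<beta>" by simp
    qed
    also have "\<dots> \<le> (\<Sum>i=1..K. real K * (C * C * P * \<sigma> powr \<beta>))"
    proof (intro sum_mono)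
      fix i
      have "card {K-i<..<K} \<le> K" by simp
      then have "real (card {K-i<..<K}) \<le> real K" by linarith
      then show "(\<Sum>j\<in>{K-i<..<K}. C * C * P * \<sigma> powr \<beta>) \<le> real K * (C * C * P * \<sigma> powr \<beta>)"
        unfolding sum_constant using C P by (intro mult_right_mono) auto
    qed
    finally have 3: "\<bar>?a * ?b - ?t\<bar> \<le> real K * (real K * (C * C * P)) * \<sigma> powr \<beta>" by (simp add: mult_ac)
    \<comment> \<open>Error of A times B, truncated A times error of B, and the products of too high
      degree.\<close>
    have "A * B - ?t = (A - ?a) * B + ?a * (B - ?b) + (?a * ?b - ?t)" by (simp only: algebra_simps)
    then have "\<bar>A * B - ?t\<bar> \<le> \<bar>(A - ?a) * B\<bar> + \<bar>?a * (B - ?b)\<bar> + \<bar>?a * ?b - ?t\<bar>" by linarith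
    also have "\<dots> \<le> C' * \<sigma> powr \<beta>" unfolding C'_def distrib_right using 1 2 3 by linarith
    finally show "\<bar>A * B - ?t\<bar> \<le> C' * \<sigma> powr \<beta>" .
  qed
qed

section \<open>Means over a rescaled box around the origin\<close>

lemma lborel_integral_affine:
  fixes \<phi> :: "real ^ 'd \<Rightarrow> real"
  assumes [measurable]: "\<phi> \<in> borel_measurable borel" and c: "c \<noteq> 0"
  shows "(\<integral>y. \<phi> y \<partial>lborel) = \<bar>c\<bar> ^ CARD('d) * (\<integral>h. \<phi> (t + c *\<^sub>R h) \<partial>lborel)"
  by (subst lborel_affine[OF c, of t]) (simp add: integral_density integral_distr)

text \<open>A pair \<open>S\<close> stands for the box with corners \<open>- fst S\<close> and \<open>snd S\<close>.\<close>

type_synonym 'd extents = "('d \<Rightarrow> real) \<times> ('d \<Rightarrow> real)"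

definition ebox :: "('d::finite) extents \<Rightarrow> (real ^ 'd) set"
  where "ebox S = cbox (\<chi> j. - fst S j) (\<chi> j. snd S j)"

definition evol :: "('d::finite) extents \<Rightarrow> real"
  where "evol S = (\<Prod>j\<in>UNIV. fst S j + snd S j)"

definition esize :: "('d::finite) extents \<Rightarrow> real"
  where "esize S = (\<Sum>j\<in>UNIV. fst S j + snd S j)"

definition proper :: "('d::finite) extents \<Rightarrow> bool"
  where "proper S \<longleftrightarrow> (\<forall>j. 0 < fst S j \<and> 0 < snd S j)"

definition avg :: "('d::finite) extents \<Rightarrow> (real ^ 'd \<Rightarrow> real) \<Rightarrow> real"
  where "avg S g = (\<integral>h. indicator (ebox S) h * g h \<partial>lborel) / evol S"

lemma ebox_mem: "h \<in> ebox S \<longleftrightarrow> (\<forall>j. - fst S j \<le> h $ j \<and> h $ j \<le> snd S j)"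
  by (simp add: ebox_def mem_box_cart)

lemma ebox_sets [measurable]: "ebox S \<in> sets borel"
  by (simp add: ebox_def)

lemma evol_pos: "proper S \<Longrightarrow> 0 < evol S"
  unfolding evol_def proper_def by (intro prod_pos) (auto intro: add_pos_pos)

lemma esize_nonneg: "proper S \<Longrightarrow> 0 \<le> esize S"
  unfolding esize_def proper_def by (intro sum_nonneg) (auto intro: add_nonneg_nonneg less_imp_le)

lemma ebox_norm:
  assumes "proper S" "h \<in> ebox S" shows "norm h \<le> esize S"
proof -
  have "\<bar>h $ j\<bar> \<le> fst S j + snd S j" for j
  proof -
    have "- fst S j \<le> h $ j" "h $ j \<le> snd S j" "0 < fst S j" "0 < snd S j"
      using assms by (auto simp: ebox_mem proper_def)
    then show ?thesis by linarith
  qed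
  then have "(\<Sum>j\<in>UNIV. \<bar>h $ j\<bar>) \<le> esize S" unfolding esize_def by (intro sum_mono)
  with norm_le_l1_cart[of h] show ?thesis by simp
qed

lemma emeasure_ebox:
  assumes "proper S" shows "emeasure lborel (ebox S) = ennreal (evol S)"
proof -
  have nn: "0 \<le> fst S j + snd S j" for j using assms by (auto simp: proper_def intro: add_nonneg_nonneg less_imp_le)
  have minus_le: "- fst S j \<le> snd S j" for j using nn[of j] by linarith
  have "emeasure lborel (ebox S) = (\<Prod>b\<in>Basis. ((\<chi> j. snd S j) - (\<chi> j. - fst S j)) \<bullet> b)"
    unfolding ebox_def by (intro emeasure_lborel_cbox) (use minus_le in \<open>auto simp: Basis_vec_def inner_axis\<close>)
  also have "(\<Prod>b\<in>Basis. ((\<chi> j. snd S j) - (\<chi> j. - fst S j)) \<bullet> b) = evol S"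
  proof -
    have B: "(Basis :: (real ^ 'a) set) = (\<lambda>j. axis j 1) ` UNIV" by (auto simp: Basis_vec_def)
    have "inj (\<lambda>j. axis j 1 :: real ^ 'a)" by (auto simp: inj_on_def axis_eq_axis)
    then show ?thesis unfolding B by (subst prod.reindex) (auto simp: inner_axis evol_def add.commute intro!: prod.cong)
  qed
  finally show ?thesis .
qed

lemma ebox_integrable:
  fixes g :: "real ^ 'd \<Rightarrow> real"
  assumes S: "proper S" and g: "g \<in> borel_measurable borel" and b: "\<And>h. h \<in> ebox S \<Longrightarrow> \<bar>g h\<bar> \<le> C"
  shows "integrable lborel (\<lambda>h. indicator (ebox S) h * g h)"
proof (rule Bochner_Integration.integrable_bound[where f = "\<lambda>h. C * indicator (ebox S) h"])
  show "integrable lborel (\<lambda>h. C * indicator (ebox S) h :: real)"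
    using emeasure_ebox[OF S] by (intro integrable_mult_right integrable_real_indicator) auto
  show "(\<lambda>h. indicator (ebox S) h * g h) \<in> borel_measurable lborel" using g by measurable
  show "AE h in lborel. norm (indicator (ebox S) h * g h) \<le> norm (C * indicator (ebox S) h :: real)"
    using b by (intro AE_I2) (force simp: indicator_def)
qed

lemma avg_const: "proper S \<Longrightarrow> avg S (\<lambda>_. c) = c"
  using evol_pos[of S] by (simp add: avg_def measure_def emeasure_ebox)

lemma avg_bound:
  assumes S: "proper S" and g: "g \<in> borel_measurable borel" and b: "\<And>h. h \<in> ebox S \<Longrightarrow> \<bar>g h\<bar> \<le> C"
  shows "\<bar>avg S g\<bar> \<le> C"
proof -
  have v: "0 < evol S" by (rule evol_pos[OF S])
  have i: "integrable lborel (\<lambda>h. indicator (ebox S) h * g h)" by (rule ebox_integrable[OF assms])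
  have "\<bar>\<integral>h. indicator (ebox S) h * g h \<partial>lborel\<bar> \<le> (\<integral>h. \<bar>indicator (ebox S) h * g h\<bar> \<partial>lborel)"
    by (rule integral_abs_bound)
  also have "\<dots> \<le> (\<integral>h. C * indicator (ebox S) h \<partial>lborel)"
  proof (rule integral_mono)
    show "integrable lborel (\<lambda>h. \<bar>indicator (ebox S) h * g h\<bar>)" using i by (rule integrable_abs)
    show "integrable lborel (\<lambda>h. C * indicator (ebox S) h :: real)"
      using emeasure_ebox[OF S] by (intro integrable_mult_right integrable_real_indicator) auto
    show "\<bar>indicator (ebox S) h * g h\<bar> \<le> C * indicator (ebox S) h" for h
      using b by (auto simp: indicator_def)
  qed
  also have "\<dots> = C * evol S" using v by (simp add: measure_def emeasure_ebox[OF S])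
  finally show ?thesis using v by (simp add: avg_def field_simps)
qed

lemma avg_lower:
  assumes S: "proper S" and g: "g \<in> borel_measurable borel" and b: "\<And>h. h \<in> ebox S \<Longrightarrow> c \<le> g h"
    "\<And>h. h \<in> ebox S \<Longrightarrow> \<bar>g h\<bar> \<le> C"
  shows "c \<le> avg S g"
proof -
  have "(\<integral>h. c * indicator (ebox S) h \<partial>lborel) \<le> (\<integral>h. indicator (ebox S) h * g h \<partial>lborel)"
  proof (rule integral_mono)
    show "integrable lborel (\<lambda>h. c * indicator (ebox S) h :: real)"
      using emeasure_ebox[OF S] by (intro integrable_mult_right integrable_real_indicator) auto
    show "integrable lborel (\<lambda>h. indicator (ebox S) h * g h)" by (rule ebox_integrable[OF S g b(2)])
    show "c * indicator (ebox S) h \<le> indicator (ebox S) h * g h" for h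
      using b(1) by (auto simp: indicator_def)
  qed
  then show ?thesis using evol_pos[OF S] by (simp add: avg_def measure_def emeasure_ebox[OF S] field_simps)
qed

lemma avg_diff:
  assumes S: "proper S" and "g \<in> borel_measurable borel" "g' \<in> borel_measurable borel"
    "\<And>h. h \<in> ebox S \<Longrightarrow> \<bar>g h\<bar> \<le> C" "\<And>h. h \<in> ebox S \<Longrightarrow> \<bar>g' h\<bar> \<le> C'"
  shows "avg S (\<lambda>h. g h - g' h) = avg S g - avg S g'"
  using ebox_integrable[OF S assms(2,4)] ebox_integrable[OF S assms(3,5)]
  by (simp add: avg_def right_diff_distrib diff_divide_distrib)

lemma avg_sum:
  assumes S: "proper S" and "finite I" "\<And>k. k \<in> I \<Longrightarrow> g k \<in> borel_measurable borel"
    "\<And>k h. k \<in> I \<Longrightarrow> h \<in> ebox S \<Longrightarrow> \<bar>g k h\<bar> \<le> C k"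
  shows "avg S (\<lambda>h. \<Sum>k\<in>I. w k * g k h) = (\<Sum>k\<in>I. w k * avg S (g k))"
proof -
  have i: "integrable lborel (\<lambda>h. w k * (indicator (ebox S) h * g k h))" if "k \<in> I" for k
    using ebox_integrable[OF S assms(3,4)] that by simp
  have "(\<integral>h. indicator (ebox S) h * (\<Sum>k\<in>I. w k * g k h) \<partial>lborel) =
      (\<integral>h. (\<Sum>k\<in>I. w k * (indicator (ebox S) h * g k h)) \<partial>lborel)"
    by (intro Bochner_Integration.integral_cong refl) (simp add: sum_distrib_left mult_ac)
  also have "\<dots> = (\<Sum>k\<in>I. w k * (\<integral>h. indicator (ebox S) h * g k h \<partial>lborel))"
    using i by (simp add: Bochner_Integration.integral_sum)
  finally show ?thesis by (simp add: avg_def sum_divide_distrib)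
qed

text \<open>\<open>prod.swap\<close> reflects the box in the origin, so the substitution of -h for h
  carries one average into the other.\<close>

lemma avg_swap:
  assumes g: "g \<in> borel_measurable borel" and odd: "\<And>h. g (- h) = (-1) ^ k * g h"
  shows "avg (prod.swap S) g = (-1) ^ k * avg S g"
proof -
  have "(\<integral>h. indicator (ebox (prod.swap S)) h * g h \<partial>lborel) =
      (\<integral>h. indicator (ebox (prod.swap S)) (- h) * g (- h) \<partial>lborel)"
    using g lborel_integral_affine[of "\<lambda>h. indicator (ebox (prod.swap S)) h * g h" "-1" 0] by simp
  also have "\<dots> = (\<integral>h. (-1) ^ k * (indicator (ebox S) h * g h) \<partial>lborel)"
  proof (intro Bochner_Integration.integral_cong refl)
    fix h
    have "- h \<in> ebox (prod.swap S) \<longleftrightarrow> h \<in> ebox S" by (auto simp: ebox_mem) (metis minus_le_iff neg_le_iff_le)+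
    then show "indicator (ebox (prod.swap S)) (- h) * g (- h) = (-1) ^ k * (indicator (ebox S) h * g h)"
      by (simp add: indicator_def odd)
  qed
  finally show ?thesis by (simp add: avg_def evol_def add.commute)
qed

section \<open>Expansion of the bias\<close>

lemma holder_class_cong:
  assumes "g \<in> holder_class b" "\<And>y. y \<in> unit_cube \<Longrightarrow> g y = g' y"
  shows "g' \<in> holder_class b"
  using assms unfolding holder_class_def partials_upto_def by simp

text \<open>The conditional mean of the response given that the covariate falls into D, for density
  f and regression function \<mu>.\<close>

definition cmean :: "(real ^ 'd \<Rightarrow> real) \<Rightarrow> (real ^ 'd \<Rightarrow> real) \<Rightarrow> (real ^ 'd) set \<Rightarrow> real"
  where "cmean \<mu> f D = (\<integral>y. indicator D y * (\<mu> y * f y) \<partial>lborel) / (\<integral>y. indicator D y * f y \<partial>lborel)"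

lemma integrable_on_subcube:
  fixes g :: "real ^ 'd \<Rightarrow> real"
  assumes D: "D \<in> sets borel" "D \<subseteq> unit_cube" and g: "g \<in> borel_measurable borel"
    and b: "\<And>y. y \<in> unit_cube \<Longrightarrow> \<bar>g y\<bar> \<le> C"
  shows "integrable lborel (\<lambda>y. indicator D y * g y)"
proof (rule Bochner_Integration.integrable_bound[where f = "\<lambda>y. C * indicator unit_cube y"])
  show "integrable lborel (\<lambda>y :: real ^ 'd. C * indicator unit_cube y :: real)"
    by (intro integrable_mult_right integrable_real_indicator) (auto simp: emeasure_lborel_cbox_eq)
  show "(\<lambda>y. indicator D y * g y) \<in> borel_measurable lborel" using g D by measurable
  show "AE y in lborel. norm (indicator D y * g y) \<le> norm (C * indicator unit_cube y :: real)"
    using b D(2) by (intro AE_I2) (force simp: indicator_def)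
qed

lemma emeasure_subcube:
  assumes "D \<in> sets borel" "D \<subseteq> (unit_cube :: (real ^ 'd) set)"
  shows "emeasure lborel D < \<infinity>"
proof -
  have "emeasure lborel D \<le> emeasure lborel (unit_cube :: (real ^ 'd) set)"
    using assms by (intro emeasure_mono) auto
  also have "\<dots> < \<infinity>" by (auto simp: emeasure_lborel_cbox_eq)
  finally show ?thesis .
qed

lemma density_integral_lower:
  fixes f :: "real ^ 'd \<Rightarrow> real"
  assumes D: "D \<in> sets borel" "D \<subseteq> unit_cube" and f: "f \<in> borel_measurable borel"
    "\<And>y. y \<in> unit_cube \<Longrightarrow> c0 \<le> f y" "\<And>y. y \<in> unit_cube \<Longrightarrow> \<bar>f y\<bar> \<le> Mf"
  shows "c0 * measure lborel D \<le> (\<integral>y. indicator D y * f y \<partial>lborel)"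
proof -
  have "(\<integral>y. c0 * indicator D y \<partial>lborel) \<le> (\<integral>y. indicator D y * f y \<partial>lborel)"
  proof (rule integral_mono)
    show "integrable lborel (\<lambda>y. c0 * indicator D y :: real)"
      using D emeasure_subcube[OF D] by (intro integrable_mult_right integrable_real_indicator) auto
    show "integrable lborel (\<lambda>y. indicator D y * f y)" by (rule integrable_on_subcube[OF D f(1,3)])
    show "c0 * indicator D y \<le> indicator D y * f y" for y
      using f(2) D by (auto simp: indicator_def)
  qed
  then show ?thesis using D by simp
qed

text \<open>The conditional mean is an average of values of \<mu> with positive weights. The lower
  bound on the density and the positive volume keep the denominator away from zero.\<close>

lemma cmean_dist:
  fixes f \<mu> :: "real ^ 'd \<Rightarrow> real"
  assumes D: "D \<in> sets borel" "D \<subseteq> unit_cube" "0 < measure lborel D" and f: "f \<in> borel_measurable borel"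
    "0 < c0" "\<And>y. y \<in> unit_cube \<Longrightarrow> c0 \<le> f y" "\<And>y. y \<in> unit_cube \<Longrightarrow> \<bar>f y\<bar> \<le> Mf"
    and \<mu>: "\<mu> \<in> borel_measurable borel" "\<And>y. y \<in> unit_cube \<Longrightarrow> \<bar>\<mu> y\<bar> \<le> M\<mu>"
    and E: "\<And>y. y \<in> D \<Longrightarrow> \<bar>\<mu> y - m\<bar> \<le> E"
  shows "\<bar>cmean \<mu> f D - m\<bar> \<le> E"
proof -
  let ?F = "\<integral>y. indicator D y * f y \<partial>lborel"
  have F: "0 < ?F"
    using density_integral_lower[OF D(1,2) f(1,3,4)] mult_pos_pos[OF f(2) D(3)] by linarith
  have i1: "integrable lborel (\<lambda>y. indicator D y * f y)" by (rule integrable_on_subcube[OF D(1,2) f(1,4)])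
  have i2: "integrable lborel (\<lambda>y. indicator D y * (\<mu> y * f y))"
  proof (rule integrable_on_subcube[OF D(1,2)])
    show "\<bar>\<mu> y * f y\<bar> \<le> M\<mu> * Mf" if "y \<in> unit_cube" for y
      unfolding abs_mult using that f(4)[OF that] \<mu>(2)[OF that] by (intro mult_mono) auto
  qed (use f \<mu> in measurable)
  have "cmean \<mu> f D - m = (\<integral>y. indicator D y * (\<mu> y * f y) - m * (indicator D y * f y) \<partial>lborel) / ?F"
    using F i1 i2 by (simp add: cmean_def field_simps)
  moreover have "\<bar>\<integral>y. indicator D y * (\<mu> y * f y) - m * (indicator D y * f y) \<partial>lborel\<bar> \<le> (\<integral>y. E * (indicator D y * f y) \<partial>lborel)"
  proof (rule order_trans[OF integral_abs_bound integral_mono])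
    show "integrable lborel (\<lambda>y. \<bar>indicator D y * (\<mu> y * f y) - m * (indicator D y * f y)\<bar>)"
      using i1 i2 by (intro integrable_abs Bochner_Integration.integrable_diff integrable_mult_right)
    show "integrable lborel (\<lambda>y. E * (indicator D y * f y))" using i1 by (rule integrable_mult_right)
    fix y
    show "\<bar>indicator D y * (\<mu> y * f y) - m * (indicator D y * f y)\<bar> \<le> E * (indicator D y * f y)"
    proof (cases "y \<in> D")
      case True
      then have "0 \<le> f y" using f(2,3) D(2) by (meson less_eq_real_def order_trans subsetD)
      moreover have "\<mu> y * f y - m * f y = (\<mu> y - m) * f y" by (simp add: left_diff_distrib)
      ultimately show ?thesis using True E[OF True] by (simp add: abs_mult mult_right_mono)
    qed simp
  qed
  ultimately show ?thesis using F by (simp add: pos_divide_le_eq)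
qed

lemma clip_props:
  fixes x :: "real ^ 'd"
  assumes x: "x \<in> box 0 1" and lt: "0 < lifetime" and S: "proper S"
  defines "D \<equiv> cbox (clip_lower lifetime x (fst S)) (clip_upper lifetime x (snd S))"
  shows "D \<subseteq> unit_cube" "0 < measure lborel D" "\<And>y. y \<in> D \<Longrightarrow> norm (y - x) \<le> esize S / lifetime"
    "measure lborel D = (\<Prod>j\<in>UNIV. clip_upper lifetime x (snd S) $ j - clip_lower lifetime x (fst S) $ j)"
proof -
  have x01: "0 < x $ j" "x $ j < 1" for j using x by (auto simp: mem_box_cart)
  have S0: "0 < fst S j / lifetime" "0 < snd S j / lifetime" for j
    using S lt by (auto simp: proper_def)
  have lu: "clip_lower lifetime x (fst S) $ j < x $ j" "x $ j < clip_upper lifetime x (snd S) $ j" for j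
    using x01[of j] S0[of j] by (auto simp: clip_lower_def clip_upper_def)
  show "D \<subseteq> unit_cube"
    by (auto simp: D_def mem_box_cart clip_lower_def clip_upper_def)
  have lu': "clip_lower lifetime x (fst S) $ j < clip_upper lifetime x (snd S) $ j" for j
    using lu[of j] by linarith
  have B: "(Basis :: (real ^ 'd) set) = (\<lambda>j. axis j 1) ` UNIV" by (auto simp: Basis_vec_def)
  have inj: "inj (\<lambda>j. axis j 1 :: real ^ 'd)" by (auto simp: inj_on_def axis_eq_axis)
  have "measure lborel D = (\<Prod>b\<in>Basis. (clip_upper lifetime x (snd S) - clip_lower lifetime x (fst S)) \<bullet> b)"
    unfolding D_def using lu' by (subst measure_lborel_cbox) (auto simp: B inner_axis less_imp_le)
  also have "\<dots> = (\<Prod>j\<in>UNIV. clip_upper lifetime x (snd S) $ j - clip_lower lifetime x (fst S) $ j)"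
    unfolding B by (subst prod.reindex[OF inj]) (simp add: inner_axis)
  finally show m: "measure lborel D = (\<Prod>j\<in>UNIV. clip_upper lifetime x (snd S) $ j - clip_lower lifetime x (fst S) $ j)" .
  show "0 < measure lborel D" unfolding m using lu' by (intro prod_pos) simp
  fix y assume y: "y \<in> D"
  have "\<bar>(y - x) $ j\<bar> \<le> (fst S j + snd S j) / lifetime" for j
  proof -
    have "x $ j - fst S j / lifetime \<le> y $ j" "y $ j \<le> x $ j + snd S j / lifetime"
      using y by (auto simp: D_def mem_box_cart clip_lower_def clip_upper_def dest: spec[of _ j])
    then show ?thesis using S0[of j] by (simp add: add_divide_distrib)
  qed
  then have "(\<Sum>j\<in>UNIV. \<bar>(y - x) $ j\<bar>) \<le> esize S / lifetime"
    unfolding esize_def sum_divide_distrib by (intro sum_mono)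
  with norm_le_l1_cart[of "y - x"] show "norm (y - x) \<le> esize S / lifetime" by linarith
qed

abbreviation extent_space :: "('d::finite) extents measure"
  where "extent_space \<equiv> Pi\<^sub>M UNIV (\<lambda>_. borel) \<Otimes>\<^sub>M Pi\<^sub>M UNIV (\<lambda>_. borel)"

lemma measurable_extents:
  "(\<lambda>S :: ('d::finite) extents. fst S j) \<in> borel_measurable extent_space"
  "(\<lambda>S :: ('d::finite) extents. snd S j) \<in> borel_measurable extent_space"
  by (rule measurable_compose[OF measurable_fst measurable_component_singleton[OF UNIV_I]],
      rule measurable_compose[OF measurable_snd measurable_component_singleton[OF UNIV_I]])

lemma measurable_avg:
  fixes g :: "real ^ 'd \<Rightarrow> real"
  assumes g: "g \<in> borel_measurable borel"
  shows "(\<lambda>S. avg S g) \<in> borel_measurable extent_space"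
proof -
  let ?N = "extent_space \<Otimes>\<^sub>M (lborel :: (real ^ 'd) measure)"
  have s: "(\<lambda>p. snd p $ j) \<in> borel_measurable ?N" for j :: 'd
    by (rule measurable_nth_vec) simp
  have 1: "Measurable.pred ?N (\<lambda>p. - fst (fst p) j \<le> snd p $ j)" for j :: 'd
    unfolding pred_def
    by (intro borel_measurable_le borel_measurable_uminus s measurable_compose[OF measurable_fst measurable_extents(1)])
  have 2: "Measurable.pred ?N (\<lambda>p. snd p $ j \<le> snd (fst p) j)" for j :: 'd
    unfolding pred_def
    by (intro borel_measurable_le s measurable_compose[OF measurable_fst measurable_extents(2)])
  have 3: "Measurable.pred ?N (\<lambda>p. \<forall>j. - fst (fst p) j \<le> snd p $ j \<and> snd p $ j \<le> snd (fst p) j)"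
    by (intro pred_intros_countable(1) pred_intros_logic(3) 1 2)
  have "(\<lambda>p. of_bool (\<forall>j. - fst (fst p) j \<le> snd p $ j \<and> snd p $ j \<le> snd (fst p) j) * g (snd p)) \<in> borel_measurable ?N"
    by (intro borel_measurable_times measurable_compose[OF 3] measurable_compose[OF measurable_snd])
      (use g in auto)
  also have "(\<lambda>p. of_bool (\<forall>j. - fst (fst p) j \<le> snd p $ j \<and> snd p $ j \<le> snd (fst p) j) * g (snd p)) =
      (\<lambda>(S, h). indicator (ebox S) h * g h)"
    by (auto simp: fun_eq_iff indicator_def ebox_mem)
  finally have "(\<lambda>S. \<integral>h. indicator (ebox S) h * g h \<partial>lborel) \<in> borel_measurable extent_space"
    by (rule lborel.borel_measurable_lebesgue_integral)
  then show ?thesis unfolding avg_def evol_def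
    by (intro borel_measurable_divide borel_measurable_prod borel_measurable_add measurable_extents)
qed

text \<open>\<open>quot_coeff\<close> are the coefficients of the formal quotient of the averages of the series
  \<open>\<Sum>\<^sub>k (\<Sum>\<^sub>i p i * q (k - i))\<close> and \<open>\<Sum>\<^sub>k q k\<close>, where \<open>fx\<close> is the constant term of the latter.\<close>

fun quot_coeff :: "real \<Rightarrow> (nat \<Rightarrow> real ^ 'd \<Rightarrow> real) \<Rightarrow> (nat \<Rightarrow> real ^ 'd \<Rightarrow> real) \<Rightarrow> nat \<Rightarrow> ('d::finite) extents \<Rightarrow> real"
  where "quot_coeff fx p q k S =
    (avg S (\<lambda>h. \<Sum>i=1..k. p i h * q (k - i) h) - (\<Sum>i<k. quot_coeff fx p q i S * avg S (q (k - i)))) / fx"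

declare quot_coeff.simps [simp del]

lemma quot_coeff_0: "quot_coeff fx p q 0 S = 0"
  by (subst quot_coeff.simps) (simp add: avg_def)

text \<open>The recursion of formal division, solved for the numerator: the term with
  \<open>i = k\<close> contains the average of the constant \<open>fx\<close>, and index 0
  contributes nothing because the numerator has no constant term.\<close>

lemma quot_coeff_rec:
  assumes "fx \<noteq> 0" "proper S" "q 0 = (\<lambda>_. fx)"
  shows "(\<Sum>i=1..k. quot_coeff fx p q i S * avg S (q (k - i))) = avg S (\<lambda>h. \<Sum>i=1..k. p i h * q (k - i) h)"
proof (cases "k = 0")
  case True
  then show ?thesis by (simp add: avg_def)
next
  case False
  let ?c = "\<lambda>i. quot_coeff fx p q i S * avg S (q (k - i))"
  have "{1..k} = insert k {1..<k}" using False by auto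
  then have "(\<Sum>i=1..k. ?c i) = ?c k + (\<Sum>i=1..<k. ?c i)" by simp
  also have "(\<Sum>i=1..<k. ?c i) = (\<Sum>i<k. ?c i)"
    by (rule sum.mono_neutral_left) (auto simp: quot_coeff_0 not_less_eq_eq)
  also have "?c k = quot_coeff fx p q k S * fx" using assms by (simp add: avg_const)
  also have "\<dots> = avg S (\<lambda>h. \<Sum>i=1..k. p i h * q (k - i) h) - (\<Sum>i<k. ?c i)"
    using assms(1) by (subst quot_coeff.simps) simp
  finally show ?thesis by simp
qed

section \<open>Parity and growth of the quotient coefficients\<close>

context
  fixes p q :: "nat \<Rightarrow> real ^ 'd \<Rightarrow> real" and fx :: real
  assumes p_meas: "\<And>k. p k \<in> borel_measurable borel" and q_meas: "\<And>k. q k \<in> borel_measurable borel"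
    and p_scale: "\<And>k c h. p k (c *\<^sub>R h) = c ^ k * p k h" and q_scale: "\<And>k c h. q k (c *\<^sub>R h) = c ^ k * q k h"
begin

lemma conv_meas: "(\<lambda>h. \<Sum>i=1..k. p i h * q (k - i) h) \<in> borel_measurable borel"
  by (intro borel_measurable_sum borel_measurable_times p_meas q_meas)

lemma conv_scale: "(\<Sum>i=1..k. p i (c *\<^sub>R h) * q (k - i) (c *\<^sub>R h)) = c ^ k * (\<Sum>i=1..k. p i h * q (k - i) h)"
  unfolding sum_distrib_left
proof (intro sum.cong refl)
  fix i assume "i \<in> {1..k}"
  then have "c ^ k = c ^ i * c ^ (k - i)" by (simp flip: power_add)
  then show "p i (c *\<^sub>R h) * q (k - i) (c *\<^sub>R h) = c ^ k * (p i h * q (k - i) h)"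
    by (simp add: p_scale q_scale)
qed

lemma measurable_quot_coeff: "quot_coeff fx p q k \<in> borel_measurable extent_space"
proof (induction k rule: less_induct)
  case (less k)
  have "(\<lambda>S. (avg S (\<lambda>h. \<Sum>i=1..k. p i h * q (k - i) h) - (\<Sum>i<k. quot_coeff fx p q i S * avg S (q (k - i)))) / fx)
      \<in> borel_measurable extent_space"
    by (intro borel_measurable_divide borel_measurable_diff borel_measurable_sum borel_measurable_times
        measurable_avg conv_meas q_meas less borel_measurable_const) simp
  also have "(\<lambda>S. (avg S (\<lambda>h. \<Sum>i=1..k. p i h * q (k - i) h) - (\<Sum>i<k. quot_coeff fx p q i S * avg S (q (k - i)))) / fx)
      = quot_coeff fx p q k"
    by (simp add: fun_eq_iff quot_coeff.simps[of fx p q k])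
  finally show ?case .
qed

text \<open>Each averaged form of degree k changes by the sign \<open>(-1) ^ k\<close>. The degrees
  add up to k in every term of the recursion, so the sign passes to the quotient.\<close>

lemma quot_coeff_swap: "quot_coeff fx p q k (prod.swap S) = (-1) ^ k * quot_coeff fx p q k S"
proof (induction k rule: less_induct)
  case (less k)
  have "avg (prod.swap S) (\<lambda>h. \<Sum>i=1..k. p i h * q (k - i) h) = (-1) ^ k * avg S (\<lambda>h. \<Sum>i=1..k. p i h * q (k - i) h)"
    using conv_scale[where c = "-1" and k = k] by (intro avg_swap conv_meas) simp
  moreover have "(\<Sum>i<k. quot_coeff fx p q i (prod.swap S) * avg (prod.swap S) (q (k - i))) =
      (-1) ^ k * (\<Sum>i<k. quot_coeff fx p q i S * avg S (q (k - i)))"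
    unfolding sum_distrib_left
  proof (intro sum.cong refl)
    fix i assume "i \<in> {..<k}"
    then have i: "i < k" by simp
    then have e: "(-1 :: real) ^ k = (-1) ^ i * (-1) ^ (k - i)" by (simp flip: power_add)
    have "avg (prod.swap S) (q (k - i)) = (-1) ^ (k - i) * avg S (q (k - i))"
      using q_scale[of "k - i" "-1"] by (intro avg_swap q_meas) simp
    then show "quot_coeff fx p q i (prod.swap S) * avg (prod.swap S) (q (k - i)) =
        (-1) ^ k * (quot_coeff fx p q i S * avg S (q (k - i)))"
      by (simp add: less[OF i] e)
  qed
  ultimately show ?case
    by (subst (1 2) quot_coeff.simps) (simp add: right_diff_distrib)
qed

lemma conv_bound:
  assumes C: "0 \<le> C" "\<And>k h. k \<le> K \<Longrightarrow> \<bar>p k h\<bar> \<le> C * norm h ^ k" "\<And>k h. k < K \<Longrightarrow> \<bar>q k h\<bar> \<le> C * norm h ^ k"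
    and k: "k \<le> K"
  shows "\<bar>\<Sum>i=1..k. p i h * q (k - i) h\<bar> \<le> real k * (C * C) * norm h ^ k"
proof -
  have "\<bar>\<Sum>i=1..k. p i h * q (k - i) h\<bar> \<le> (\<Sum>i=1..k. C * C * norm h ^ k)"
  proof (rule order_trans[OF sum_abs], rule sum_mono)
    fix i assume i: "i \<in> {1..k}"
    have "\<bar>p i h * q (k - i) h\<bar> \<le> (C * norm h ^ i) * (C * norm h ^ (k - i))"
      unfolding abs_mult using i k C by (intro mult_mono) auto
    also have "\<dots> = C * C * norm h ^ k" using i by (simp flip: power_add)
    finally show "\<bar>p i h * q (k - i) h\<bar> \<le> C * C * norm h ^ k" .
  qed
  then show ?thesis by simp
qed

lemma quot_coeff_bound:
  assumes C: "0 \<le> C" "\<And>k h. k \<le> K \<Longrightarrow> \<bar>p k h\<bar> \<le> C * norm h ^ k" "\<And>k h. k < K \<Longrightarrow> \<bar>q k h\<bar> \<le> C * norm h ^ k"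
  shows "k \<le> K \<Longrightarrow> \<exists>c\<ge>0. \<forall>S. proper S \<longrightarrow> \<bar>quot_coeff fx p q k S\<bar> \<le> c * esize S ^ k"
proof (induction k rule: less_induct)
  case (less k)
  then have "\<forall>i. \<exists>c. i < k \<longrightarrow> 0 \<le> c \<and> (\<forall>S. proper S \<longrightarrow> \<bar>quot_coeff fx p q i S\<bar> \<le> c * esize S ^ i)"
    by (metis less_imp_le order_trans)
  then obtain c where c: "\<And>i. i < k \<Longrightarrow> 0 \<le> c i"
    "\<And>i S. i < k \<Longrightarrow> proper S \<Longrightarrow> \<bar>quot_coeff fx p q i S\<bar> \<le> c i * esize S ^ i" by metis
  define c' where "c' = (real k * (C * C) + (\<Sum>i<k. c i * C)) / \<bar>fx\<bar>"
  show ?case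
  proof (intro exI[of _ c'] conjI allI impI)
    show "0 \<le> c'" unfolding c'_def using c C by (intro divide_nonneg_nonneg add_nonneg_nonneg sum_nonneg) auto
    fix S :: "'d extents" assume S: "proper S"
    note s0 = esize_nonneg[OF S]
    have 1: "\<bar>avg S (\<lambda>h. \<Sum>i=1..k. p i h * q (k - i) h)\<bar> \<le> real k * (C * C) * esize S ^ k"
    proof (rule avg_bound[OF S conv_meas])
      fix h assume h: "h \<in> ebox S"
      have "\<bar>\<Sum>i=1..k. p i h * q (k - i) h\<bar> \<le> real k * (C * C) * norm h ^ k"
        by (rule conv_bound[OF C less.prems])
      also have "\<dots> \<le> real k * (C * C) * esize S ^ k"
        using ebox_norm[OF S h] C by (intro mult_left_mono power_mono) auto
      finally show "\<bar>\<Sum>i=1..k. p i h * q (k - i) h\<bar> \<le> real k * (C * C) * esize S ^ k" .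
    qed
    have 2: "\<bar>\<Sum>i<k. quot_coeff fx p q i S * avg S (q (k - i))\<bar> \<le> (\<Sum>i<k. c i * C * esize S ^ k)"
    proof (rule order_trans[OF sum_abs], rule sum_mono)
      fix i assume "i \<in> {..<k}"
      then have i: "i < k" by simp
      show "\<bar>quot_coeff fx p q i S * avg S (q (k - i))\<bar> \<le> c i * C * esize S ^ k"
      \<comment> \<open>For index 0 the factor is the average of \<open>q k\<close>, for which no
        bound is assumed if \<open>k = K\<close>; but the coefficient itself is zero.\<close>
      proof (cases "i = 0")
        case True
        then show ?thesis using c(1)[OF i] C s0 by (simp add: quot_coeff_0)
      next
        case False
        then have ki: "k - i < K" using less.prems i by simp
        have "\<bar>avg S (q (k - i))\<bar> \<le> C * esize S ^ (k - i)"
        proof (rule avg_bound[OF S q_meas])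
          fix h assume h: "h \<in> ebox S"
          have "\<bar>q (k - i) h\<bar> \<le> C * norm h ^ (k - i)" using C(3)[OF ki] .
          also have "\<dots> \<le> C * esize S ^ (k - i)"
            using ebox_norm[OF S h] C by (intro mult_left_mono power_mono) auto
          finally show "\<bar>q (k - i) h\<bar> \<le> C * esize S ^ (k - i)" .
        qed
        then have "\<bar>quot_coeff fx p q i S * avg S (q (k - i))\<bar> \<le> (c i * esize S ^ i) * (C * esize S ^ (k - i))"
          unfolding abs_mult using c(1)[OF i] c(2)[OF i S] s0 by (intro mult_mono) auto
        also have "\<dots> = c i * C * esize S ^ k" using i by (simp flip: power_add)
        finally show ?thesis .
      qed
    qed
    have "\<bar>quot_coeff fx p q k S\<bar> \<le> (real k * (C * C) * esize S ^ k + (\<Sum>i<k. c i * C * esize S ^ k)) / \<bar>fx\<bar>"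
      unfolding quot_coeff.simps[of fx p q k] abs_divide using 1 2
      by (intro divide_right_mono order_trans[OF abs_triangle_ineq4] add_mono) auto
    also have "\<dots> = c' * esize S ^ k"
      by (simp add: c'_def distrib_right sum_distrib_right)
    finally show "\<bar>quot_coeff fx p q k S\<bar> \<le> c' * esize S ^ k" .
  qed
qed

end

section \<open>Bias given the cell\<close>

definition clip_box :: "real \<Rightarrow> real ^ 'd \<Rightarrow> ('d::finite) extents \<Rightarrow> (real ^ 'd) set"
  where "clip_box lifetime x S = cbox (clip_lower lifetime x (fst S)) (clip_upper lifetime x (snd S))"

lemmas clip_box_props = clip_props[folded clip_box_def]

lemma clip_box_sets [measurable]: "clip_box lifetime x S \<in> sets borel"
  by (simp add: clip_box_def)

lemma esize_pos: "proper S \<Longrightarrow> 0 < esize S"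
  unfolding esize_def proper_def by (intro sum_pos) (auto intro: add_pos_pos)

text \<open>All points of the clipped cell are within \<open>esize S / lifetime\<close> of x, so the
  Hoelder estimate for \<mu> at x passes to the conditional mean.\<close>

lemma bias_order_one:
  fixes f \<mu> :: "real ^ 'd \<Rightarrow> real"
  assumes \<mu>: "\<mu> \<in> holder_class b" "0 < b" "\<mu> \<in> borel_measurable borel"
    and f: "f \<in> borel_measurable borel" "0 < c0" "\<And>y. y \<in> unit_cube \<Longrightarrow> c0 \<le> f y" "\<And>y. y \<in> unit_cube \<Longrightarrow> \<bar>f y\<bar> \<le> Mf"
    and x: "x \<in> box 0 1"
  obtains C where "0 \<le> C" "\<And>lifetime S. 0 < lifetime \<Longrightarrow> proper S \<Longrightarrow>
    \<bar>cmean \<mu> f (clip_box lifetime x S) - \<mu> x\<bar> \<le> C * (esize S / lifetime) powr (min 1 b)"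
proof -
  define \<beta> where "\<beta> = min 1 b"
  have \<beta>: "0 < \<beta>" "\<beta> \<le> b" using \<mu> by (auto simp: \<beta>_def)
  have ho: "holder_order \<beta> = 0" by (simp add: holder_order_def \<beta>_def)
  have xc: "x \<in> unit_cube" using x box_subset_cbox by blast
  obtain T :: "nat \<Rightarrow> real ^ 'd \<Rightarrow> real" and C where TC: "\<And>h. T 0 h = \<mu> x" "0 \<le> C"
    "\<And>h. x + h \<in> unit_cube \<Longrightarrow> \<bar>\<mu> (x + h) - (\<Sum>k\<le>holder_order \<beta>. T k h)\<bar> \<le> C * norm h powr \<beta>"
    using holder_taylor[OF \<mu>(1) \<beta> xc] by metis
  obtain M\<mu> where M\<mu>: "\<And>y. y \<in> unit_cube \<Longrightarrow> \<bar>\<mu> y\<bar> \<le> M\<mu>" using holder_bounded[OF \<mu>(1,2)] by metis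
  show thesis
  proof (rule that[OF TC(2)])
    fix lifetime :: real and S :: "'d extents" assume lt: "0 < lifetime" and S: "proper S"
    note cb = clip_box_props[OF x lt S]
    show "\<bar>cmean \<mu> f (clip_box lifetime x S) - \<mu> x\<bar> \<le> C * (esize S / lifetime) powr (min 1 b)"
    proof (rule cmean_dist[OF clip_box_sets cb(1,2) f \<mu>(3) M\<mu>])
      fix y assume y: "y \<in> clip_box lifetime x S"
      have "\<bar>\<mu> y - \<mu> x\<bar> \<le> C * norm (y - x) powr \<beta>"
        using TC(3)[of "y - x"] TC(1)[of "y - x"] y cb(1) by (auto simp: ho)
      also have "\<dots> \<le> C * (esize S / lifetime) powr \<beta>"
        using cb(3)[OF y] TC(2) \<beta> by (intro mult_left_mono powr_mono2) auto
      finally show "\<bar>\<mu> y - \<mu> x\<bar> \<le> C * (esize S / lifetime) powr (min 1 b)" by (simp add: \<beta>_def)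
    qed
  qed
qed

text \<open>If no face reaches the boundary, the cell is the image of \<open>ebox S\<close> under
  scaling by \<open>1 / lifetime\<close> and translation to x. The Jacobian and the volume cancel in
  the quotient.\<close>

lemma cmean_unclipped:
  fixes f \<mu> :: "real ^ 'd \<Rightarrow> real"
  assumes "\<mu> \<in> borel_measurable borel" "f \<in> borel_measurable borel" and lt: "0 < lifetime" and S: "proper S"
    and unclipped: "\<And>j. fst S j / lifetime \<le> x $ j" "\<And>j. snd S j / lifetime \<le> 1 - x $ j"
  shows "cmean \<mu> f (clip_box lifetime x S) =
      avg S (\<lambda>h. \<mu> (x + (1 / lifetime) *\<^sub>R h) * f (x + (1 / lifetime) *\<^sub>R h)) / avg S (\<lambda>h. f (x + (1 / lifetime) *\<^sub>R h))"
    and "\<And>h. h \<in> ebox S \<Longrightarrow> x + (1 / lifetime) *\<^sub>R h \<in> clip_box lifetime x S"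
proof -
  have lo: "clip_lower lifetime x (fst S) $ j = x $ j - fst S j / lifetime" for j
    using unclipped(1)[of j] by (simp add: clip_lower_def)
  have up: "clip_upper lifetime x (snd S) $ j = x $ j + snd S j / lifetime" for j
    using unclipped(2)[of j] by (simp add: clip_upper_def)
  have mem: "x + (1 / lifetime) *\<^sub>R h \<in> clip_box lifetime x S \<longleftrightarrow> h \<in> ebox S" for h
  proof -
    have "x $ j - fst S j / lifetime \<le> x $ j + 1 / lifetime * h $ j \<longleftrightarrow> - fst S j / lifetime \<le> h $ j / lifetime"
      "x $ j + 1 / lifetime * h $ j \<le> x $ j + snd S j / lifetime \<longleftrightarrow> h $ j / lifetime \<le> snd S j / lifetime" for j
    proof -
      have e: "1 / lifetime * h $ j = h $ j / lifetime" "- fst S j / lifetime = - (fst S j / lifetime)" by simp_all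
      show "x $ j - fst S j / lifetime \<le> x $ j + 1 / lifetime * h $ j \<longleftrightarrow> - fst S j / lifetime \<le> h $ j / lifetime"
        "x $ j + 1 / lifetime * h $ j \<le> x $ j + snd S j / lifetime \<longleftrightarrow> h $ j / lifetime \<le> snd S j / lifetime"
        unfolding e by auto
    qed
    then have "x $ j - fst S j / lifetime \<le> x $ j + 1 / lifetime * h $ j \<longleftrightarrow> - fst S j \<le> h $ j"
      "x $ j + 1 / lifetime * h $ j \<le> x $ j + snd S j / lifetime \<longleftrightarrow> h $ j \<le> snd S j" for j
      using lt divide_le_cancel[of "- fst S j" lifetime "h $ j"] divide_le_cancel[of "h $ j" lifetime "snd S j"] by auto
    then show ?thesis by (simp add: clip_box_def mem_box_cart lo up ebox_mem)
  qed
  show "\<And>h. h \<in> ebox S \<Longrightarrow> x + (1 / lifetime) *\<^sub>R h \<in> clip_box lifetime x S" using mem by simp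
  have *: "(\<integral>y. indicator (clip_box lifetime x S) y * g y \<partial>lborel) =
      (1 / lifetime) ^ CARD('d) * (evol S * avg S (\<lambda>h. g (x + (1 / lifetime) *\<^sub>R h)))"
    if [measurable]: "g \<in> borel_measurable borel" for g :: "real ^ 'd \<Rightarrow> real"
  proof -
    have "(\<integral>y. indicator (clip_box lifetime x S) y * g y \<partial>lborel) = (1 / lifetime) ^ CARD('d) *
        (\<integral>h. indicator (clip_box lifetime x S) (x + (1 / lifetime) *\<^sub>R h) * g (x + (1 / lifetime) *\<^sub>R h) \<partial>lborel)"
      using lt by (subst lborel_integral_affine[where c = "1 / lifetime" and t = x]) auto
    also have "(\<lambda>h. indicator (clip_box lifetime x S) (x + (1 / lifetime) *\<^sub>R h)) = (indicator (ebox S) :: _ \<Rightarrow> real)"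
      by (simp add: fun_eq_iff indicator_def mem)
    finally show ?thesis using evol_pos[OF S] by (simp add: avg_def)
  qed
  have "(\<lambda>y. \<mu> y * f y) \<in> borel_measurable borel" using assms(1,2) by measurable
  from *[OF this] *[OF assms(2)] show "cmean \<mu> f (clip_box lifetime x S) =
      avg S (\<lambda>h. \<mu> (x + (1 / lifetime) *\<^sub>R h) * f (x + (1 / lifetime) *\<^sub>R h)) / avg S (\<lambda>h. f (x + (1 / lifetime) *\<^sub>R h))"
    using evol_pos[OF S] lt by (simp add: cmean_def)
qed

lemma holder_order_pred: "1 < \<beta> \<Longrightarrow> holder_order (\<beta> - 1) = holder_order \<beta> - 1" "1 < \<beta> \<Longrightarrow> 1 \<le> holder_order \<beta>"
  unfolding holder_order_def by linarith+

text \<open>By the choice of \<open>quot_coeff\<close>, the average of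
  \<open>(\<mu> - \<mu> x) * f\<close> and the product of the candidate polynomial with the average
  of f have the same terms up to degree K. So they differ by order \<beta>, and division by the
  average of f, which is at least c0, gives the bias. This works for unclipped cells. The
  coefficients ignore clipping, which is harmless because a clipped cell is large relative to its
  lifetime.\<close>

lemma bias_expansion_smooth:
  fixes f \<mu> :: "real ^ 'd \<Rightarrow> real"
  assumes \<mu>: "\<mu> \<in> holder_class b\<mu>" "\<beta> \<le> b\<mu>" "\<mu> \<in> borel_measurable borel"
    and fh: "f \<in> holder_class bf" "\<beta> - 1 \<le> bf"
    and f: "f \<in> borel_measurable borel" "0 < c0" "\<And>y. y \<in> unit_cube \<Longrightarrow> c0 \<le> f y"
    and x: "x \<in> box 0 1" and \<beta>: "1 < \<beta>"
  defines "K \<equiv> holder_order \<beta>"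
  obtains c :: "nat \<Rightarrow> 'd extents \<Rightarrow> real" and C where "0 \<le> C" "\<And>k. c k \<in> borel_measurable extent_space"
    "\<And>k S. k \<le> K \<Longrightarrow> proper S \<Longrightarrow> \<bar>c k S\<bar> \<le> C * esize S ^ k"
    "\<And>k S. c k (prod.swap S) = (-1) ^ k * c k S"
    "\<And>lifetime S. 0 < lifetime \<Longrightarrow> proper S \<Longrightarrow>
      \<bar>cmean \<mu> f (clip_box lifetime x S) - \<mu> x - (\<Sum>k=1..K. c k S * (1 / lifetime) ^ k)\<bar> \<le> C * (esize S / lifetime) powr \<beta>"
proof -
  have \<beta>0: "0 < \<beta>" "0 < \<beta> - 1" using \<beta> by auto
  have bpos: "0 < b\<mu>" "0 < bf" using \<mu>(2) fh(2) \<beta> by auto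
  have K1: "1 \<le> K" and Kp: "holder_order (\<beta> - 1) = K - 1" unfolding K_def using holder_order_pred[OF \<beta>] by auto
  have K\<beta>: "real K < \<beta>" "\<beta> \<le> real K + 1" using holder_order_bounds[OF \<beta>0(1)] by (auto simp: K_def)
  have xc: "x \<in> unit_cube" using x box_subset_cbox by blast
  have x01: "0 < x $ j" "x $ j < 1" for j using x by (auto simp: mem_box_cart)
  obtain p Cp where p: "\<And>h. p 0 h = \<mu> x" "\<And>k c h. p k (c *\<^sub>R h) = c ^ k * p k h" "\<And>k. p k \<in> borel_measurable borel"
    "0 \<le> Cp" "\<And>k h. k \<le> K \<Longrightarrow> \<bar>p k h\<bar> \<le> Cp * norm h ^ k"
    "\<And>h. x + h \<in> unit_cube \<Longrightarrow> \<bar>\<mu> (x + h) - (\<Sum>k\<le>K. p k h)\<bar> \<le> Cp * norm h powr \<beta>"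
  proof -
    show thesis by (rule holder_taylor[OF \<mu>(1) \<beta>0(1) \<mu>(2) xc, folded K_def]) (fact that)
  qed
  obtain q Cq where q: "\<And>h. q 0 h = f x" "\<And>k c h. q k (c *\<^sub>R h) = c ^ k * q k h" "\<And>k. q k \<in> borel_measurable borel"
    "0 \<le> Cq" "\<And>k h. k \<le> K - 1 \<Longrightarrow> \<bar>q k h\<bar> \<le> Cq * norm h ^ k"
    "\<And>h. x + h \<in> unit_cube \<Longrightarrow> \<bar>f (x + h) - (\<Sum>k\<le>K - 1. q k h)\<bar> \<le> Cq * norm h powr (\<beta> - 1)"
  proof -
    show thesis by (rule holder_taylor[OF fh(1) \<beta>0(2) fh(2) xc, unfolded Kp]) (fact that)
  qed
  obtain M\<mu> where M\<mu>: "0 \<le> M\<mu>" "\<And>y. y \<in> unit_cube \<Longrightarrow> \<bar>\<mu> y\<bar> \<le> M\<mu>" using holder_bounded[OF \<mu>(1) bpos(1)] by metis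
  obtain Mf where Mf: "0 \<le> Mf" "\<And>y. y \<in> unit_cube \<Longrightarrow> \<bar>f y\<bar> \<le> Mf" using holder_bounded[OF fh(1) bpos(2)] by metis
  have fx: "f x \<noteq> 0" using f(2) f(3)[OF xc] by linarith
  have q0: "q 0 = (\<lambda>_. f x)" using q(1) by auto
  define c where "c k S = quot_coeff (f x) p q k S" for k S
  define Cpq where "Cpq = Cp + Cq"
  have pb: "\<bar>p k h\<bar> \<le> Cpq * norm h ^ k" if "k \<le> K" for k h
  proof -
    have "Cp * norm h ^ k \<le> Cpq * norm h ^ k" using q(4) by (intro mult_right_mono) (auto simp: Cpq_def)
    with p(5)[OF that, of h] show ?thesis by simp
  qed
  have qb: "\<bar>q k h\<bar> \<le> Cpq * norm h ^ k" if "k < K" for k h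
  proof -
    have "Cq * norm h ^ k \<le> Cpq * norm h ^ k" using p(4) by (intro mult_right_mono) (auto simp: Cpq_def)
    moreover have "k \<le> K - 1" using that by simp
    ultimately show ?thesis using q(5)[of k h] by linarith
  qed
  have Cpq0: "0 \<le> Cpq" using p q by (simp add: Cpq_def)
  note ctx = p(3) q(3) p(2) q(2)
  have "\<forall>k. \<exists>c'. k \<le> K \<longrightarrow> 0 \<le> c' \<and> (\<forall>S. proper S \<longrightarrow> \<bar>c k S\<bar> \<le> c' * esize S ^ k)"
    unfolding c_def using quot_coeff_bound[OF ctx Cpq0 pb qb, where fx = "f x"] by blast
  then obtain ck where ck: "\<And>k. k \<le> K \<Longrightarrow> 0 \<le> ck k"
    "\<And>k S. k \<le> K \<Longrightarrow> proper S \<Longrightarrow> \<bar>c k S\<bar> \<le> ck k * esize S ^ k" by metis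
  define Cc where "Cc = sum ck {..K}"
  have Cc0: "0 \<le> Cc" unfolding Cc_def using ck(1) by (intro sum_nonneg) auto
  have cb: "\<bar>c k S\<bar> \<le> Cc * esize S ^ k" if "k \<le> K" "proper S" for k S
  proof -
    have "ck k \<le> Cc" unfolding Cc_def using that ck(1) by (intro member_le_sum) auto
    then have "ck k * esize S ^ k \<le> Cc * esize S ^ k"
      using esize_nonneg[OF that(2)] by (intro mult_right_mono) auto
    with ck(2)[OF that] show ?thesis by simp
  qed
  \<comment> \<open>There are two extents per coordinate, and after rescaling each is at most 1 if
    the cell is not clipped.\<close>
  define s0 where "s0 = 2 * real CARD('d)"
  \<comment> \<open>One constant for both uses of the product estimate: pointwise, and for the
    quotient coefficients against the averaged density.\<close>
  define CJ where "CJ = Cpq + Cc + Mf"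
  have CJ: "0 \<le> CJ" "Cpq \<le> CJ" "Cc \<le> CJ" "Mf \<le> CJ" "Cp \<le> CJ" "Cq \<le> CJ"
    using Cpq0 Cc0 Mf p(4) q(4) by (auto simp: CJ_def Cpq_def)
  obtain C' where C'0: "0 \<le> C'" and C': "\<And>\<sigma> A B a b. 0 \<le> \<sigma> \<Longrightarrow> \<sigma> \<le> s0 \<Longrightarrow>
    (\<And>i. 1 \<le> i \<Longrightarrow> i \<le> K \<Longrightarrow> \<bar>a i\<bar> \<le> CJ * \<sigma> ^ i) \<Longrightarrow> (\<And>j. j < K \<Longrightarrow> \<bar>b j\<bar> \<le> CJ * \<sigma> ^ j) \<Longrightarrow>
    \<bar>A - (\<Sum>i=1..K. a i)\<bar> \<le> CJ * \<sigma> powr \<beta> \<Longrightarrow> \<bar>B - (\<Sum>j<K. b j)\<bar> \<le> CJ * \<sigma> powr (\<beta> - 1) \<Longrightarrow> \<bar>B\<bar> \<le> CJ \<Longrightarrow>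
    \<bar>A * B - (\<Sum>k=1..K. \<Sum>i=1..k. a i * b (k - i))\<bar> \<le> C' * \<sigma> powr \<beta>"
    using jet_product[OF K1 K\<beta> CJ(1), of s0] by (auto simp: s0_def)
  have unclipped: "\<bar>cmean \<mu> f (clip_box lifetime x S) - \<mu> x - (\<Sum>k=1..K. c k S * (1 / lifetime) ^ k)\<bar>
      \<le> 2 * C' / c0 * (esize S / lifetime) powr \<beta>"
    if lt: "0 < lifetime" and S: "proper S" and u: "\<And>j. fst S j / lifetime \<le> x $ j" "\<And>j. snd S j / lifetime \<le> 1 - x $ j"
    for lifetime S
  proof -
    define \<sigma> where "\<sigma> = esize S / lifetime"
    define e where "e = 1 / lifetime"
    have e: "0 < e" using lt by (simp add: e_def)
    have \<sigma>0: "0 \<le> \<sigma>" using esize_nonneg[OF S] lt by (simp add: \<sigma>_def)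
    have \<sigma>e: "\<sigma> = e * esize S" by (simp add: \<sigma>_def e_def)
    have \<sigma>s: "\<sigma> \<le> s0"
    proof -
      have "\<sigma> = (\<Sum>j\<in>UNIV. fst S j / lifetime + snd S j / lifetime)"
        by (simp add: \<sigma>_def esize_def sum_divide_distrib add_divide_distrib)
      also have "\<dots> \<le> (\<Sum>j\<in>(UNIV :: 'd set). 2)"
      proof (rule sum_mono)
        fix j show "fst S j / lifetime + snd S j / lifetime \<le> 2" using u[of j] x01[of j] by linarith
      qed
      finally show ?thesis by (simp add: s0_def)
    qed
    have in_cube: "x + e *\<^sub>R h \<in> unit_cube" and nrm: "norm (e *\<^sub>R h) \<le> \<sigma>" if h: "h \<in> ebox S" for h
    proof -
      have "x + e *\<^sub>R h \<in> clip_box lifetime x S"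
        using cmean_unclipped(2)[OF \<mu>(3) f(1) lt S u h] by (simp add: e_def)
      then show "x + e *\<^sub>R h \<in> unit_cube" "norm (e *\<^sub>R h) \<le> \<sigma>"
        using clip_box_props(1)[OF x lt S] clip_box_props(3)[OF x lt S, of "x + e *\<^sub>R h"] by (auto simp: \<sigma>_def)
    qed
    define A where "A h = \<mu> (x + e *\<^sub>R h) - \<mu> x" for h
    define F where "F h = f (x + e *\<^sub>R h)" for h
    have [measurable]: "A \<in> borel_measurable borel" "F \<in> borel_measurable borel"
      unfolding A_def[abs_def] F_def[abs_def] using \<mu>(3) f(1) by measurable
    have Ab: "\<bar>A h\<bar> \<le> 2 * M\<mu>" and Fb: "\<bar>F h\<bar> \<le> Mf" and Fl: "c0 \<le> F h" if "h \<in> ebox S" for h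
      using M\<mu>(2)[OF in_cube[OF that]] M\<mu>(2)[OF xc] Mf(2)[OF in_cube[OF that]] f(3)[OF in_cube[OF that]]
      unfolding A_def F_def by linarith+
    have AFb: "\<bar>A h * F h\<bar> \<le> 2 * M\<mu> * Mf" if "h \<in> ebox S" for h
      unfolding abs_mult using Ab[OF that] Fb[OF that] by (intro mult_mono) auto
    let ?r = "\<lambda>k h. \<Sum>i=1..k. p i h * q (k - i) h"
    have Ae: "\<bar>A h - (\<Sum>k=1..K. p k (e *\<^sub>R h))\<bar> \<le> CJ * \<sigma> powr \<beta>" if h: "h \<in> ebox S" for h
    proof -
      have "{..K} = insert 0 {1..K}" by auto
      then have "(\<Sum>k\<le>K. p k (e *\<^sub>R h)) = \<mu> x + (\<Sum>k=1..K. p k (e *\<^sub>R h))" by (simp add: p(1))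
      then have "\<bar>A h - (\<Sum>k=1..K. p k (e *\<^sub>R h))\<bar> \<le> Cp * norm (e *\<^sub>R h) powr \<beta>"
        using p(6)[OF in_cube[OF h]] by (simp add: A_def)
      also have "\<dots> \<le> CJ * \<sigma> powr \<beta>"
        using nrm[OF h] CJ \<beta> p(4) by (intro mult_mono powr_mono2) auto
      finally show ?thesis .
    qed
    have Fe: "\<bar>F h - (\<Sum>k<K. q k (e *\<^sub>R h))\<bar> \<le> CJ * \<sigma> powr (\<beta> - 1)" if h: "h \<in> ebox S" for h
    proof -
      have "{..K - 1} = {..<K}" using K1 by auto
      then have "\<bar>F h - (\<Sum>k<K. q k (e *\<^sub>R h))\<bar> \<le> Cq * norm (e *\<^sub>R h) powr (\<beta> - 1)"
        using q(6)[OF in_cube[OF h]] by (simp add: F_def)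
      also have "\<dots> \<le> CJ * \<sigma> powr (\<beta> - 1)"
        using nrm[OF h] CJ \<beta> q(4) by (intro mult_mono powr_mono2) auto
      finally show ?thesis .
    qed
    have scale_le: "C1 * norm (e *\<^sub>R h) ^ k \<le> CJ * \<sigma> ^ k" if "h \<in> ebox S" "C1 \<le> CJ" for h k C1
      using nrm[OF that(1)] that(2) CJ(1) by (intro mult_mono power_mono) auto
    \<comment> \<open>First use of the product estimate, pointwise in h, with the Taylor terms of
      \<mu> and f.\<close>
    have D: "\<bar>A h * F h - (\<Sum>k=1..K. e ^ k * ?r k h)\<bar> \<le> C' * \<sigma> powr \<beta>" if h: "h \<in> ebox S" for h
    proof -
      have r: "(\<Sum>i=1..k. p i (e *\<^sub>R h) * q (k - i) (e *\<^sub>R h)) = e ^ k * ?r k h" for k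
        by (rule conv_scale[OF ctx])
      have "\<bar>A h * F h - (\<Sum>k=1..K. \<Sum>i=1..k. p i (e *\<^sub>R h) * q (k - i) (e *\<^sub>R h))\<bar> \<le> C' * \<sigma> powr \<beta>"
      proof (rule C'[OF \<sigma>0 \<sigma>s _ _ Ae[OF h] Fe[OF h]])
        show "\<bar>p i (e *\<^sub>R h)\<bar> \<le> CJ * \<sigma> ^ i" if "i \<le> K" for i
          using pb[OF that, of "e *\<^sub>R h"] scale_le[OF h CJ(2), of i] by linarith
        show "\<bar>q i (e *\<^sub>R h)\<bar> \<le> CJ * \<sigma> ^ i" if "i < K" for i
          using qb[OF that, of "e *\<^sub>R h"] scale_le[OF h CJ(2), of i] by linarith
        show "\<bar>F h\<bar> \<le> CJ" using Fb[OF h] CJ(4) by linarith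
      qed
      then show ?thesis unfolding r .
    qed
    have pw: "C1 * norm h ^ k \<le> C1 * esize S ^ k" if "h \<in> ebox S" "0 \<le> C1" for h k C1
      using ebox_norm[OF S that(1)] that(2) by (intro mult_left_mono power_mono) auto
    have rb: "\<bar>?r k h\<bar> \<le> real k * (Cpq * Cpq) * esize S ^ k" if "k \<le> K" "h \<in> ebox S" for k h
      using conv_bound[OF ctx Cpq0 pb qb that(1), of h] pw[OF that(2), of "real k * (Cpq * Cpq)" k] Cpq0 by simp
    have avg_r: "avg S (\<lambda>h. \<Sum>k=1..K. e ^ k * ?r k h) = (\<Sum>k=1..K. e ^ k * avg S (?r k))"
      by (rule avg_sum[OF S]) (use conv_meas[OF ctx] rb in auto)
    have N: "\<bar>avg S (\<lambda>h. A h * F h) - (\<Sum>k=1..K. e ^ k * avg S (?r k))\<bar> \<le> C' * \<sigma> powr \<beta>"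
    proof -
      have m: "(\<lambda>h. \<Sum>k=1..K. e ^ k * ?r k h) \<in> borel_measurable borel"
        by (intro borel_measurable_sum borel_measurable_times conv_meas[OF ctx] borel_measurable_const)
      have "\<bar>\<Sum>k=1..K. e ^ k * ?r k h\<bar> \<le> (\<Sum>k=1..K. e ^ k * (real k * (Cpq * Cpq) * esize S ^ k))" if "h \<in> ebox S" for h
      proof (rule order_trans[OF sum_abs], rule sum_mono)
        fix k assume "k \<in> {1..K}"
        then show "\<bar>e ^ k * ?r k h\<bar> \<le> e ^ k * (real k * (Cpq * Cpq) * esize S ^ k)"
          using rb[of k h] that e by (simp only: abs_mult) (intro mult_mono; simp)
      qed
      then have "avg S (\<lambda>h. A h * F h - (\<Sum>k=1..K. e ^ k * ?r k h)) = avg S (\<lambda>h. A h * F h) - avg S (\<lambda>h. \<Sum>k=1..K. e ^ k * ?r k h)"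
        using AFb by (intro avg_diff[OF S _ m]) measurable
      moreover have "\<bar>avg S (\<lambda>h. A h * F h - (\<Sum>k=1..K. e ^ k * ?r k h))\<bar> \<le> C' * \<sigma> powr \<beta>"
        using D by (intro avg_bound[OF S]) (use m in measurable)
      ultimately show ?thesis unfolding avg_r by simp
    qed
    have F1: "\<bar>avg S F\<bar> \<le> Mf" "c0 \<le> avg S F"
      using Fb Fl by (auto intro!: avg_bound[OF S] avg_lower[OF S])
    have qbs: "\<bar>q k h\<bar> \<le> Cpq * esize S ^ k" if "k < K" "h \<in> ebox S" for k h
      using qb[OF that(1), of h] pw[OF that(2) Cpq0, of k] by linarith
    have avgq: "\<bar>avg S (q k)\<bar> \<le> Cpq * esize S ^ k" if "k < K" for k
      by (rule avg_bound[OF S q(3) qbs[OF that]])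
    have Favg: "\<bar>avg S F - (\<Sum>k<K. e ^ k * avg S (q k))\<bar> \<le> CJ * \<sigma> powr (\<beta> - 1)"
    proof -
      have m: "(\<lambda>h. \<Sum>k<K. e ^ k * q k h) \<in> borel_measurable borel"
        by (intro borel_measurable_sum borel_measurable_times q(3) borel_measurable_const)
      have "\<bar>\<Sum>k<K. e ^ k * q k h\<bar> \<le> (\<Sum>k<K. e ^ k * (Cpq * esize S ^ k))" if "h \<in> ebox S" for h
      proof (rule order_trans[OF sum_abs], rule sum_mono)
        fix k assume "k \<in> {..<K}"
        then show "\<bar>e ^ k * q k h\<bar> \<le> e ^ k * (Cpq * esize S ^ k)"
          using qbs[of k h] that e by (simp only: abs_mult) (intro mult_mono; simp)
      qed
      then have "avg S (\<lambda>h. F h - (\<Sum>k<K. e ^ k * q k h)) = avg S F - avg S (\<lambda>h. \<Sum>k<K. e ^ k * q k h)"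
        using Fb by (intro avg_diff[OF S _ m]) measurable
      moreover have "avg S (\<lambda>h. \<Sum>k<K. e ^ k * q k h) = (\<Sum>k<K. e ^ k * avg S (q k))"
        by (rule avg_sum[OF S]) (use q(3) qbs in auto)
      moreover have "\<bar>avg S (\<lambda>h. F h - (\<Sum>k<K. e ^ k * q k h))\<bar> \<le> CJ * \<sigma> powr (\<beta> - 1)"
        using Fe unfolding q(2) by (intro avg_bound[OF S]) (use m in measurable)
      ultimately show ?thesis by simp
    qed
    let ?c = "\<Sum>k=1..K. c k S * e ^ k"
    \<comment> \<open>Second use, with numbers: the first factor is the polynomial itself, without
      error, and the second is the averaged density.\<close>
    have "\<bar>?c * avg S F - (\<Sum>k=1..K. \<Sum>i=1..k. (c i S * e ^ i) * (e ^ (k - i) * avg S (q (k - i))))\<bar> \<le> C' * \<sigma> powr \<beta>"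
    proof (rule C'[OF \<sigma>0 \<sigma>s _ _ _ Favg])
      show "\<bar>c i S * e ^ i\<bar> \<le> CJ * \<sigma> ^ i" if "i \<le> K" for i
      proof -
        have "\<bar>c i S * e ^ i\<bar> = \<bar>c i S\<bar> * e ^ i" using e by (simp add: abs_mult)
        also have "\<dots> \<le> CJ * esize S ^ i * e ^ i"
          using cb[OF that S] mult_right_mono[OF CJ(3), of "esize S ^ i"] e esize_nonneg[OF S]
          by (intro mult_right_mono) auto
        finally show ?thesis by (simp add: \<sigma>e power_mult_distrib mult_ac)
      qed
      show "\<bar>e ^ i * avg S (q i)\<bar> \<le> CJ * \<sigma> ^ i" if "i < K" for i
      proof -
        have "\<bar>e ^ i * avg S (q i)\<bar> = e ^ i * \<bar>avg S (q i)\<bar>" using e by (simp add: abs_mult)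
        also have "\<dots> \<le> e ^ i * (CJ * esize S ^ i)"
          using avgq[OF that] mult_right_mono[OF CJ(2), of "esize S ^ i"] e esize_nonneg[OF S]
          by (intro mult_left_mono) auto
        finally show ?thesis by (simp add: \<sigma>e power_mult_distrib mult_ac)
      qed
      show "\<bar>avg S F\<bar> \<le> CJ" using F1(1) CJ(4) by linarith
    qed (use CJ in simp)
    also have "(\<Sum>k=1..K. \<Sum>i=1..k. (c i S * e ^ i) * (e ^ (k - i) * avg S (q (k - i)))) = (\<Sum>k=1..K. e ^ k * avg S (?r k))"
    proof (intro sum.cong refl)
      fix k
      have "(\<Sum>i=1..k. (c i S * e ^ i) * (e ^ (k - i) * avg S (q (k - i)))) = e ^ k * (\<Sum>i=1..k. c i S * avg S (q (k - i)))"
        unfolding sum_distrib_left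
      proof (intro sum.cong refl)
        fix i assume "i \<in> {1..k}"
        then have "e ^ k = e ^ i * e ^ (k - i)" by (simp flip: power_add)
        then show "(c i S * e ^ i) * (e ^ (k - i) * avg S (q (k - i))) = e ^ k * (c i S * avg S (q (k - i)))" by simp
      qed
      also have "(\<Sum>i=1..k. c i S * avg S (q (k - i))) = avg S (?r k)"
        unfolding c_def by (rule quot_coeff_rec[where q = q and fx = "f x" and S = S, OF fx S q0])
      finally show "(\<Sum>i=1..k. (c i S * e ^ i) * (e ^ (k - i) * avg S (q (k - i)))) = e ^ k * avg S (?r k)" .
    qed
    finally have E: "\<bar>avg S (\<lambda>h. A h * F h) - ?c * avg S F\<bar> \<le> 2 * C' * \<sigma> powr \<beta>" using N by linarith
    have Fpos: "0 < avg S F" using F1(2) f(2) by linarith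
    have "avg S (\<lambda>h. A h * F h) = avg S (\<lambda>h. \<mu> (x + e *\<^sub>R h) * F h) - \<mu> x * avg S F"
    proof -
      have "avg S (\<lambda>h. \<mu> (x + e *\<^sub>R h) * F h - \<mu> x * F h) = avg S (\<lambda>h. \<mu> (x + e *\<^sub>R h) * F h) - avg S (\<lambda>h. \<mu> x * F h)"
      proof (rule avg_diff[OF S])
        show "(\<lambda>h. \<mu> (x + e *\<^sub>R h) * F h) \<in> borel_measurable borel" using \<mu>(3) by measurable
        show "(\<lambda>h. \<mu> x * F h) \<in> borel_measurable borel" by measurable
        show "\<bar>\<mu> (x + e *\<^sub>R h) * F h\<bar> \<le> M\<mu> * Mf" if "h \<in> ebox S" for h
          unfolding abs_mult using M\<mu>(2)[OF in_cube[OF that]] Fb[OF that] by (intro mult_mono) auto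
        show "\<bar>\<mu> x * F h\<bar> \<le> M\<mu> * Mf" if "h \<in> ebox S" for h
          unfolding abs_mult using M\<mu>(2)[OF xc] Fb[OF that] by (intro mult_mono) auto
      qed
      moreover have "avg S (\<lambda>h. \<mu> x * F h) = \<mu> x * avg S F"
        by (simp add: avg_def mult.left_commute)
      ultimately show ?thesis by (simp add: A_def left_diff_distrib)
    qed
    then have "cmean \<mu> f (clip_box lifetime x S) - \<mu> x - ?c = (avg S (\<lambda>h. A h * F h) - ?c * avg S F) / avg S F"
      using Fpos cmean_unclipped(1)[OF \<mu>(3) f(1) lt S u] by (simp add: F_def[abs_def] e_def field_simps)
    then have "\<bar>cmean \<mu> f (clip_box lifetime x S) - \<mu> x - ?c\<bar> \<le> (2 * C' * \<sigma> powr \<beta>) / c0"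
      using E F1(2) Fpos f(2) by (simp only: abs_divide) (intro frac_le; simp)
    then show ?thesis by (simp add: e_def \<sigma>_def)
  qed
  \<comment> \<open>The smallest distance of x from a face of the cube.\<close>
  define m where "m = Min (range (\<lambda>j. min (x $ j) (1 - x $ j)))"
  have m: "m \<le> x $ j" "m \<le> 1 - x $ j" for j
  proof -
    have "m \<le> min (x $ j) (1 - x $ j)" unfolding m_def by (intro Min_le) auto
    then show "m \<le> x $ j" "m \<le> 1 - x $ j" by auto
  qed
  have m0: "0 < m" unfolding m_def using x01 by (subst Min_gr_iff) auto
  define C2 where "C2 = 2 * M\<mu> / m powr \<beta> + (\<Sum>k=1..K. Cc / m powr (\<beta> - real k))"
  have C20: "0 \<le> C2" unfolding C2_def using M\<mu>(1) Cc0 by (intro add_nonneg_nonneg sum_nonneg) auto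
  have clipped: "\<bar>cmean \<mu> f (clip_box lifetime x S) - \<mu> x - (\<Sum>k=1..K. c k S * (1 / lifetime) ^ k)\<bar>
      \<le> C2 * (esize S / lifetime) powr \<beta>"
    if lt: "0 < lifetime" and S: "proper S" and \<sigma>m: "m \<le> esize S / lifetime" for lifetime S
  proof -
    define \<sigma> where "\<sigma> = esize S / lifetime"
    have \<sigma>: "0 < \<sigma>" "m \<le> \<sigma>" using \<sigma>m m0 by (auto simp: \<sigma>_def)
    \<comment> \<open>Since \<sigma> is at least m, lower powers are dominated by the power \<beta>;
      exponent 0 takes care of bounded quantities.\<close>
    have k: "\<sigma> powr a \<le> \<sigma> powr \<beta> / m powr (\<beta> - a)" if "a \<le> \<beta>" for a
    proof -
      have "\<sigma> powr \<beta> = \<sigma> powr a * \<sigma> powr (\<beta> - a)" by (simp flip: powr_add)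
      also have "\<dots> \<ge> \<sigma> powr a * m powr (\<beta> - a)" using \<sigma> m0 that by (intro mult_left_mono powr_mono2) auto
      finally show ?thesis using m0 by (simp add: pos_le_divide_eq)
    qed
    note cbp = clip_box_props[OF x lt S]
    have "\<bar>cmean \<mu> f (clip_box lifetime x S) - \<mu> x\<bar> \<le> 2 * M\<mu>"
    proof (rule cmean_dist[OF clip_box_sets cbp(1,2) f Mf(2) \<mu>(3) M\<mu>(2)])
      fix y assume "y \<in> clip_box lifetime x S"
      then show "\<bar>\<mu> y - \<mu> x\<bar> \<le> 2 * M\<mu>" using M\<mu>(2)[of y] M\<mu>(2)[OF xc] cbp(1) by force
    qed
    also have "\<dots> \<le> 2 * M\<mu> * (\<sigma> powr \<beta> / m powr \<beta>)"
    proof -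
      have "1 \<le> \<sigma> powr \<beta> / m powr \<beta>" using k[of 0] \<beta>0 \<sigma> by simp
      from mult_left_mono[OF this, of "2 * M\<mu>"] show ?thesis using M\<mu>(1) by simp
    qed
    finally have 1: "\<bar>cmean \<mu> f (clip_box lifetime x S) - \<mu> x\<bar> \<le> 2 * M\<mu> / m powr \<beta> * \<sigma> powr \<beta>" by simp
    have 2: "\<bar>\<Sum>k=1..K. c k S * (1 / lifetime) ^ k\<bar> \<le> (\<Sum>k=1..K. Cc / m powr (\<beta> - real k) * \<sigma> powr \<beta>)"
    proof (rule order_trans[OF sum_abs], rule sum_mono)
      fix k' assume k': "k' \<in> {1..K}"
      then have "real k' \<le> real K" by simp
      then have k\<beta>: "real k' \<le> \<beta>" using K\<beta> by linarith
      have "\<bar>c k' S * (1 / lifetime) ^ k'\<bar> = \<bar>c k' S\<bar> * (1 / lifetime) ^ k'" using lt by (simp add: abs_mult)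
      also have "\<dots> \<le> Cc * esize S ^ k' * (1 / lifetime) ^ k'"
        using cb[of k' S] k' S lt by (intro mult_right_mono) auto
      also have "\<dots> = Cc * \<sigma> powr real k'" using \<sigma> by (simp add: powr_realpow \<sigma>_def power_divide)
      also have "\<dots> \<le> Cc * (\<sigma> powr \<beta> / m powr (\<beta> - real k'))" by (intro mult_left_mono k k\<beta> Cc0)
      finally show "\<bar>c k' S * (1 / lifetime) ^ k'\<bar> \<le> Cc / m powr (\<beta> - real k') * \<sigma> powr \<beta>" by simp
    qed
    have "\<bar>cmean \<mu> f (clip_box lifetime x S) - \<mu> x - (\<Sum>k=1..K. c k S * (1 / lifetime) ^ k)\<bar> \<le>
        2 * M\<mu> / m powr \<beta> * \<sigma> powr \<beta> + (\<Sum>k=1..K. Cc / m powr (\<beta> - real k) * \<sigma> powr \<beta>)"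
      using 1 2 by linarith
    also have "\<dots> = C2 * \<sigma> powr \<beta>" by (simp only: C2_def distrib_right sum_distrib_right)
    finally show ?thesis by (simp add: \<sigma>_def)
  qed
  show thesis
  proof (rule that[of "Cc + 2 * C' / c0 + C2" c])
    show "0 \<le> Cc + 2 * C' / c0 + C2" using Cc0 C20 C'0 f(2) by simp
    show "c k \<in> borel_measurable extent_space" for k
      unfolding c_def[abs_def] using measurable_quot_coeff[OF ctx] .
    show "c k (prod.swap S) = (-1) ^ k * c k S" for k S
      unfolding c_def by (rule quot_coeff_swap[OF ctx])
    show "\<bar>c k S\<bar> \<le> (Cc + 2 * C' / c0 + C2) * esize S ^ k" if "k \<le> K" "proper S" for k S
    proof -
      have "Cc * esize S ^ k \<le> (Cc + 2 * C' / c0 + C2) * esize S ^ k"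
        using esize_nonneg[OF that(2)] C'0 C20 f(2) by (intro mult_right_mono) auto
      with cb[OF that] show ?thesis by linarith
    qed
    fix lifetime :: real and S :: "'d extents" assume lt: "0 < lifetime" and S: "proper S"
    let ?t = "(esize S / lifetime) powr \<beta>"
    have le: "2 * C' / c0 * ?t \<le> (Cc + 2 * C' / c0 + C2) * ?t" "C2 * ?t \<le> (Cc + 2 * C' / c0 + C2) * ?t"
    proof -
      have "2 * C' / c0 \<le> Cc + 2 * C' / c0 + C2" "C2 \<le> Cc + 2 * C' / c0 + C2"
        using Cc0 C'0 C20 f(2) by auto
      from mult_right_mono[OF this(1) powr_ge_zero] mult_right_mono[OF this(2) powr_ge_zero]
      show "2 * C' / c0 * ?t \<le> (Cc + 2 * C' / c0 + C2) * ?t" "C2 * ?t \<le> (Cc + 2 * C' / c0 + C2) * ?t" .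
    qed
    show "\<bar>cmean \<mu> f (clip_box lifetime x S) - \<mu> x - (\<Sum>k=1..K. c k S * (1 / lifetime) ^ k)\<bar>
      \<le> (Cc + 2 * C' / c0 + C2) * ?t"
    \<comment> \<open>Every single extent is at most \<open>esize S\<close>, so below the threshold
      m no face is clipped.\<close>
    proof (cases "m \<le> esize S / lifetime")
      case True
      from clipped[OF lt S this] le(2) show ?thesis by linarith
    next
      case False
      have "fst S j / lifetime \<le> esize S / lifetime" "snd S j / lifetime \<le> esize S / lifetime" for j
      proof -
        have "fst S j + snd S j \<le> esize S"
          unfolding esize_def using S by (intro member_le_sum) (auto simp: proper_def intro: add_nonneg_nonneg less_imp_le)
        moreover have "0 < fst S j" "0 < snd S j" using S by (auto simp: proper_def)
        ultimately show "fst S j / lifetime \<le> esize S / lifetime" "snd S j / lifetime \<le> esize S / lifetime"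
          using lt by (auto intro!: divide_right_mono)
      qed
      then have "fst S j / lifetime \<le> x $ j" "snd S j / lifetime \<le> 1 - x $ j" for j
        using False m[of j] by (meson le_less_trans less_imp_le not_le order_trans)+
      from unclipped[OF lt S this] le(1) show ?thesis by linarith
    qed
  qed
qed

section \<open>Moments of the cell\<close>

lemma prob_space_exp_pair: "prob_space (exp_pair :: (('d::finite \<Rightarrow> real) \<times> ('d \<Rightarrow> real)) measure)"
  by (intro prob_space_pair prob_space_exp_vec)

lemma sets_exp_pair: "sets (exp_pair :: (('d::finite \<Rightarrow> real) \<times> ('d \<Rightarrow> real)) measure) = sets extent_space"
  by (intro sets_pair_measure_cong sets_exp_vec)

lemma nn_integral_exp_vec_prod:
  assumes h: "h \<in> borel_measurable borel"
  shows "(\<integral>\<^sup>+A. (\<Prod>j\<in>UNIV. h (A j)) \<partial>(exp_vec :: ('d::finite \<Rightarrow> real) measure)) = (\<integral>\<^sup>+a. h a \<partial>exp_law) ^ CARD('d)"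
proof -
  interpret product_sigma_finite "\<lambda>_ :: 'd. exp_law"
    unfolding product_sigma_finite_def
    by (auto intro!: prob_space_imp_sigma_finite prob_space_exponential1)
  show ?thesis unfolding exp_vec_def
    by (subst product_nn_integral_prod) (use h in auto)
qed

lemma nn_integral_exp_pair_prod:
  fixes h :: "real \<Rightarrow> ennreal"
  assumes h: "h \<in> borel_measurable borel"
  shows "(\<integral>\<^sup>+S. (\<Prod>j\<in>UNIV. h (fst S j)) * (\<Prod>j\<in>UNIV. h (snd S j)) \<partial>(exp_pair :: (('d::finite \<Rightarrow> real) \<times> ('d \<Rightarrow> real)) measure)) =
    (\<integral>\<^sup>+a. h a \<partial>exp_law) ^ CARD('d) * (\<integral>\<^sup>+a. h a \<partial>exp_law) ^ CARD('d)"
proof -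
  interpret E: prob_space "exp_vec :: ('d \<Rightarrow> real) measure" by (rule prob_space_exp_vec)
  have m: "(\<lambda>A. \<Prod>j\<in>UNIV. h (A j)) \<in> borel_measurable (exp_vec :: ('d \<Rightarrow> real) measure)"
    by (intro borel_measurable_prod_ennreal measurable_compose[OF measurable_exp_vec h])
  show ?thesis
    by (subst E.nn_integral_fst[symmetric])
      (auto simp: nn_integral_cmult[OF m] nn_integral_multc[OF m] nn_integral_exp_vec_prod[OF h]
        intro!: borel_measurable_times_ennreal measurable_compose[OF measurable_fst m] measurable_compose[OF measurable_snd m])
qed

lemma nn_integral_exp_half: "(\<integral>\<^sup>+a. ennreal (exp (a / 2)) \<partial>exp_law) = 2"
proof -
  have "(\<integral>\<^sup>+a. ennreal (exp (a / 2)) \<partial>exp_law) = (\<integral>\<^sup>+a. ennreal (exponential_density 1 a) * ennreal (exp (a / 2)) \<partial>lborel)"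
    by (rule nn_integral_density) auto
  also have "\<dots> = (\<integral>\<^sup>+a. ennreal (exp (- (a / 2))) * indicator {0..} a \<partial>lborel)"
    by (intro nn_integral_cong) (auto simp: exponential_density_def indicator_def mult_exp_exp simp flip: ennreal_mult')
  also have "\<dots> = ennreal (0 - (- 2 * exp (- (0 / 2))))"
  proof (rule nn_integral_FTC_atLeast[where F = "\<lambda>a. - 2 * exp (- (a / 2))"])
    have "filterlim (\<lambda>e::real. e * (1 / 2)) at_top at_top"
      using filterlim_tendsto_pos_mult_at_top[OF tendsto_const _ filterlim_ident, of "1 / 2"] by (simp add: mult.commute)
    then have "((\<lambda>e::real. exp (- (e / 2))) \<longlongrightarrow> 0) at_top"
      by (intro filterlim_compose[OF exp_at_bot] filterlim_compose[OF filterlim_uminus_at_bot_at_top]) simp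
    from tendsto_mult_right_zero[OF this, of "- 2"]
    show "((\<lambda>a::real. - 2 * exp (- (a / 2))) \<longlongrightarrow> 0) at_top" .
  qed (auto intro!: derivative_eq_intros)
  finally show ?thesis by simp
qed

text \<open>\<open>esize\<close> is a sum of 2 d independent standard exponential variables, each of
  which has exponential moment 2 at 1/2.\<close>

lemma nn_integral_exp_esize: "(\<integral>\<^sup>+S. ennreal (exp (esize S / 2)) \<partial>(exp_pair :: (('d::finite \<Rightarrow> real) \<times> ('d \<Rightarrow> real)) measure)) = ennreal (4 ^ CARD('d))"
proof -
  have "ennreal (exp (esize S / 2)) = (\<Prod>j\<in>UNIV. ennreal (exp (fst S j / 2))) * (\<Prod>j\<in>UNIV. ennreal (exp (snd S j / 2)))"
    for S :: "('d \<Rightarrow> real) \<times> ('d \<Rightarrow> real)"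
    by (simp add: prod_ennreal esize_def sum.distrib add_divide_distrib exp_add exp_sum sum_divide_distrib ennreal_mult' prod_nonneg)
  then have "(\<integral>\<^sup>+S. ennreal (exp (esize S / 2)) \<partial>(exp_pair :: (('d \<Rightarrow> real) \<times> ('d \<Rightarrow> real)) measure)) = 2 ^ CARD('d) * 2 ^ CARD('d)"
    using nn_integral_exp_pair_prod[of "\<lambda>a. ennreal (exp (a / 2))", where ?'d = 'd] by (simp add: nn_integral_exp_half)
  also have "\<dots> = ennreal (4 ^ CARD('d))"
    by (simp flip: power_mult_distrib ennreal_numeral ennreal_power ennreal_mult')
  finally show ?thesis .
qed

text \<open>One exponential moment controls all powers: \<open>(1 + s / (2 * n)) ^ n\<close> is at
  most \<open>exp (s / 2)\<close>, and \<open>1 + s\<close> is at most \<open>2 * n + s\<close>,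
  which is where the factor \<open>(2 * n) ^ n\<close> comes from.\<close>

lemma powr_le_exp_half:
  fixes p :: real
  assumes "0 \<le> p"
  obtains C where "0 < C" "\<And>s. 0 \<le> s \<Longrightarrow> s powr p \<le> C * exp (s / 2)"
proof -
  define n where "n = Suc (nat \<lceil>p\<rceil>)"
  have pn: "p \<le> real n" unfolding n_def using assms by linarith
  have n0: "0 < real n" by (simp add: n_def)
  show thesis
  proof (rule that[of "(2 * real n) ^ n"])
    show "0 < (2 * real n) ^ n" using n0 by simp
    fix s :: real assume s: "0 \<le> s"
    have "s powr p \<le> (1 + s) powr p" using s assms by (intro powr_mono2) auto
    also have "\<dots> \<le> (1 + s) powr real n" using s pn by (intro powr_mono) auto
    also have "\<dots> = (1 + s) ^ n" using s by (intro powr_realpow) auto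
    also have "\<dots> \<le> (2 * real n * (1 + s / 2 / real n)) ^ n"
      using s n0 by (intro power_mono) (auto simp: field_simps n_def)
    also have "\<dots> = (2 * real n) ^ n * (1 + s / 2 / real n) ^ n" by (rule power_mult_distrib)
    also have "\<dots> \<le> (2 * real n) ^ n * exp (s / 2)"
      using s n0 by (intro mult_left_mono exp_ge_one_plus_x_over_n_power_n) (auto simp: n_def)
    finally show "s powr p \<le> (2 * real n) ^ n * exp (s / 2)" .
  qed
qed

lemma AE_exp_law_pos: "AE a in exp_law. 0 < a"
proof -
  have "AE a in lborel. 0 < exponential_density 1 a \<longrightarrow> 0 < a"
    using AE_lborel_singleton[of 0] by eventually_elim (auto simp: exponential_density_def not_less)
  then show ?thesis by (subst AE_density) auto
qed

lemma AE_proper: "AE S in (exp_pair :: (('d::finite \<Rightarrow> real) \<times> ('d \<Rightarrow> real)) measure). proper S"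
proof -
  interpret E: prob_space "exp_vec :: ('d \<Rightarrow> real) measure" by (rule prob_space_exp_vec)
  have *: "AE A in (exp_vec :: ('d \<Rightarrow> real) measure). \<forall>j. 0 < A j"
    unfolding exp_vec_def
    by (subst AE_all_countable) (auto intro!: AE_PiM_component AE_exp_law_pos prob_space_exponential1)
  interpret P: pair_sigma_finite "exp_vec :: ('d \<Rightarrow> real) measure" "exp_vec :: ('d \<Rightarrow> real) measure"
    by unfold_locales
  show ?thesis
  proof (rule P.AE_pair_measure)
    have "Measurable.pred extent_space (\<lambda>S. 0 < fst S j)" "Measurable.pred extent_space (\<lambda>S. 0 < snd S j)" for j :: 'd
      unfolding pred_def
      by (rule borel_measurable_less[OF borel_measurable_const measurable_extents(1)],
          rule borel_measurable_less[OF borel_measurable_const measurable_extents(2)])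
    then have "Measurable.pred exp_pair (\<lambda>S. \<forall>j :: 'd. 0 < fst S j \<and> 0 < snd S j)"
      unfolding measurable_cong_sets[OF sets_exp_pair refl]
      by (intro pred_intros_countable(1) pred_intros_logic(3))
    then show "{S \<in> space exp_pair. proper (S :: 'd extents)} \<in> sets exp_pair"
      unfolding pred_def proper_def .
    show "AE A in exp_vec. AE B in exp_vec. proper (A :: 'd \<Rightarrow> real, B)"
      using * by eventually_elim (use * in \<open>eventually_elim, auto simp: proper_def\<close>)
  qed
qed

section \<open>The inverse volume of the cell\<close>

lemma nn_integral_exp_inv_sqrt: "(\<integral>\<^sup>+a. ennreal (1 + a powr (- 1 / 2)) \<partial>exp_law) < \<infinity>"
proof -
  interpret prob_space exp_law by (rule prob_space_exponential1)
  let ?g = "\<lambda>a::real. if a \<in> {0..} then a powr (1 / 2 - 1) / exp a else 0"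
  have g: "(?g has_integral Gamma (1 / 2)) UNIV"
    using Gamma_integral_real[of "1 / 2"] by (subst has_integral_restrict_UNIV) simp
  have "(\<integral>\<^sup>+a. ennreal (a powr (- 1 / 2)) \<partial>exp_law) = (\<integral>\<^sup>+a. ennreal (exponential_density 1 a) * ennreal (a powr (- 1 / 2)) \<partial>lborel)"
    by (rule nn_integral_density) auto
  also have "\<dots> = (\<integral>\<^sup>+a. ennreal (?g a) \<partial>lborel)"
    by (intro nn_integral_cong) (auto simp: exponential_density_def exp_minus field_simps simp flip: ennreal_mult')
  also have "\<dots> = ennreal (Gamma (1 / 2))"
    using g by (intro nn_integral_has_integral_lborel) auto
  finally have "(\<integral>\<^sup>+a. ennreal (a powr (- 1 / 2)) \<partial>exp_law) = ennreal (Gamma (1 / 2))" .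
  then have "(\<integral>\<^sup>+a. ennreal 1 + ennreal (a powr (- 1 / 2)) \<partial>exp_law) < \<infinity>"
    using emeasure_space_1 by (subst nn_integral_add) (auto simp: less_top)
  then show ?thesis by (simp add: ennreal_plus)
qed

text \<open>The inverse of an exponential variable has infinite mean, its inverse square root has
  not. The inequality between arithmetic and geometric mean bounds the inverse of
  \<open>A + B\<close> by a product of two inverse square roots, which also separates the
  independent variables.\<close>

lemma inverse_side_le:
  fixes A B lifetime x m :: real
  assumes "0 < A" "0 < B" "0 < lifetime" "0 < m" "m \<le> x" "m \<le> 1 - x"
  shows "1 / (min 1 (x + B / lifetime) - max 0 (x - A / lifetime)) \<le>
    (lifetime + 1 / m) * ((1 + A powr (- 1 / 2)) * (1 + B powr (- 1 / 2)))"
proof -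
  let ?s = "min 1 (x + B / lifetime) - max 0 (x - A / lifetime)"
  have AB: "0 < A / lifetime" "0 < B / lifetime" using assms by auto
  have one: "1 \<le> (1 + A powr (- 1 / 2)) * (1 + B powr (- 1 / 2))"
    using mult_mono[of 1 "1 + A powr (- 1 / 2)" 1 "1 + B powr (- 1 / 2)"] by simp
  show ?thesis
  proof (cases "x - A / lifetime < 0 \<or> 1 < x + B / lifetime")
    case True
    \<comment> \<open>A side clipped at one end reaches from that boundary at least to x.\<close>
    moreover have "m \<le> min 1 (x + b) - max 0 (x - a)" if "0 < a" "0 < b" "x - a < 0 \<or> 1 < x + b" for a b
      using that assms by (auto simp: min_def max_def)
    ultimately have "m \<le> ?s" using AB by blast
    then have "1 / ?s \<le> 1 / m" using assms by (intro frac_le) auto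
    also have "\<dots> \<le> (lifetime + 1 / m) * 1" using assms by simp
    also have "\<dots> \<le> (lifetime + 1 / m) * ((1 + A powr (- 1 / 2)) * (1 + B powr (- 1 / 2)))"
      using one assms by (intro mult_left_mono) auto
    finally show ?thesis .
  next
    case False
    then have s: "?s = (A + B) / lifetime" by (simp add: add_divide_distrib)
    have pA: "A powr (1 / 2) = sqrt A" "B powr (1 / 2) = sqrt B" using assms by (auto simp: powr_half_sqrt)
    have "sqrt A * sqrt B \<le> (A + B) / 2"
      using arith_geo_mean_sqrt[of A B] assms by (simp add: real_sqrt_mult)
    also have "\<dots> \<le> A + B" using assms by simp
    finally have le: "sqrt A * sqrt B \<le> A + B" .
    have "1 / ?s = lifetime * (1 / (A + B))" unfolding s using assms by simp
    also have "\<dots> \<le> lifetime * (1 / (sqrt A * sqrt B))"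
      using le assms by (intro mult_left_mono divide_left_mono) auto
    also have "1 / (sqrt A * sqrt B) = A powr (- 1 / 2) * B powr (- 1 / 2)"
      using assms powr_minus_divide[of A "1 / 2"] powr_minus_divide[of B "1 / 2"] by (simp add: pA)
    also have "lifetime * (A powr (- 1 / 2) * B powr (- 1 / 2)) \<le>
        (lifetime + 1 / m) * ((1 + A powr (- 1 / 2)) * (1 + B powr (- 1 / 2)))"
      using assms by (intro mult_mono) auto
    finally show ?thesis .
  qed
qed

text \<open>The volume is a product over coordinates, so the bound for a single side factors over 2
  d independent variables.\<close>

lemma inverse_volume_bound:
  fixes x :: "real ^ 'd"
  assumes x: "x \<in> box 0 1" and l0: "0 < l0"
  obtains C where "0 \<le> C" "\<And>lifetime. l0 \<le> lifetime \<Longrightarrow>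
    (\<integral>\<^sup>+S. ennreal (1 / measure lborel (clip_box lifetime x S)) \<partial>exp_pair) \<le> ennreal (C * lifetime ^ CARD('d))"
proof -
  have x01: "0 < x $ j" "x $ j < 1" for j using x by (auto simp: mem_box_cart)
  define m where "m = Min (range (\<lambda>j. min (x $ j) (1 - x $ j)))"
  have m: "m \<le> x $ j" "m \<le> 1 - x $ j" for j
  proof -
    have "m \<le> min (x $ j) (1 - x $ j)" unfolding m_def by (intro Min_le) auto
    then show "m \<le> x $ j" "m \<le> 1 - x $ j" by auto
  qed
  have m0: "0 < m" unfolding m_def using x01 by (subst Min_gr_iff) auto
  define h where "h a = ennreal (1 + a powr (- 1 / 2))" for a :: real
  have h: "h \<in> borel_measurable borel" unfolding h_def[abs_def] by measurable
  define \<kappa> where "\<kappa> = enn2real (\<integral>\<^sup>+a. h a \<partial>exp_law)"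
  have \<kappa>: "(\<integral>\<^sup>+a. h a \<partial>exp_law) = ennreal \<kappa>" "0 \<le> \<kappa>"
    using nn_integral_exp_inv_sqrt by (auto simp: \<kappa>_def h_def less_top)
  \<comment> \<open>The lower bound l0 on the lifetime turns the additive \<open>1 / m\<close> into
    a multiple of the lifetime.\<close>
  define C where "C = (1 + 1 / (m * l0)) ^ CARD('d) * (\<kappa> ^ CARD('d) * \<kappa> ^ CARD('d))"
  show thesis
  proof (rule that[of C])
    show "0 \<le> C" unfolding C_def using m0 l0 \<kappa>(2) by simp
    fix lifetime :: real assume l: "l0 \<le> lifetime"
    then have lt: "0 < lifetime" using l0 by simp
    have "(\<integral>\<^sup>+S. ennreal (1 / measure lborel (clip_box lifetime x S)) \<partial>exp_pair) \<le>
      (\<integral>\<^sup>+S. ennreal ((lifetime + 1 / m) ^ CARD('d)) * ((\<Prod>j\<in>UNIV. h (fst S j)) * (\<Prod>j\<in>UNIV. h (snd S j))) \<partial>(exp_pair :: 'd extents measure))"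
    proof (rule nn_integral_mono_AE)
      show "AE S in exp_pair. ennreal (1 / measure lborel (clip_box lifetime x S)) \<le>
        ennreal ((lifetime + 1 / m) ^ CARD('d)) * ((\<Prod>j\<in>UNIV. h (fst S j)) * (\<Prod>j\<in>UNIV. h (snd S j)))"
        using AE_proper
      proof eventually_elim
        case (elim S)
        have side: "0 \<le> clip_upper lifetime x (snd S) $ j - clip_lower lifetime x (fst S) $ j" for j
        proof -
          have "0 \<le> min 1 (x $ j + b) - max 0 (x $ j - a)" if "0 < a" "0 < b" for a b
            using that x01[of j] by (auto simp: min_def max_def)
          moreover have "0 < fst S j / lifetime" "0 < snd S j / lifetime" using elim lt by (auto simp: proper_def)
          ultimately show ?thesis by (simp only: clip_upper_def clip_lower_def vec_lambda_beta)
        qed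
        have "1 / measure lborel (clip_box lifetime x S) = (\<Prod>j\<in>UNIV. 1 / (clip_upper lifetime x (snd S) $ j - clip_lower lifetime x (fst S) $ j))"
          unfolding clip_box_props(4)[OF x lt elim] by (simp add: prod_dividef)
        also have "\<dots> \<le> (\<Prod>j\<in>UNIV. (lifetime + 1 / m) * ((1 + fst S j powr (- 1 / 2)) * (1 + snd S j powr (- 1 / 2))))"
        proof (rule prod_mono, rule conjI)
          fix j
          show "0 \<le> 1 / (clip_upper lifetime x (snd S) $ j - clip_lower lifetime x (fst S) $ j)" using side[of j] by simp
          show "1 / (clip_upper lifetime x (snd S) $ j - clip_lower lifetime x (fst S) $ j) \<le>
              (lifetime + 1 / m) * ((1 + fst S j powr (- 1 / 2)) * (1 + snd S j powr (- 1 / 2)))"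
            using inverse_side_le[of "fst S j" "snd S j" lifetime m "x $ j"] elim lt m0 m[of j]
            by (simp add: clip_upper_def clip_lower_def proper_def)
        qed
        also have "\<dots> = (lifetime + 1 / m) ^ CARD('d) * ((\<Prod>j\<in>UNIV. 1 + fst S j powr (- 1 / 2)) * (\<Prod>j\<in>UNIV. 1 + snd S j powr (- 1 / 2)))"
          by (simp add: prod.distrib)
        finally have le: "1 / measure lborel (clip_box lifetime x S) \<le> (lifetime + 1 / m) ^ CARD('d) *
            ((\<Prod>j\<in>UNIV. 1 + fst S j powr (- 1 / 2)) * (\<Prod>j\<in>UNIV. 1 + snd S j powr (- 1 / 2)))" .
        have hp: "(\<Prod>j\<in>UNIV. h (A j)) = ennreal (\<Prod>j\<in>UNIV. 1 + A j powr (- 1 / 2))" for A :: "'d \<Rightarrow> real"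
          unfolding h_def by (rule prod_ennreal) simp
        have nn: "0 \<le> (\<Prod>j\<in>UNIV. 1 + A j powr (- 1 / 2))" for A :: "'d \<Rightarrow> real"
          by (rule prod_nonneg) simp
        have "0 \<le> (lifetime + 1 / m) ^ CARD('d)" using lt m0 by simp
        then have "ennreal ((lifetime + 1 / m) ^ CARD('d)) * ((\<Prod>j\<in>UNIV. h (fst S j)) * (\<Prod>j\<in>UNIV. h (snd S j))) =
          ennreal ((lifetime + 1 / m) ^ CARD('d) *
            ((\<Prod>j\<in>UNIV. 1 + fst S j powr (- 1 / 2)) * (\<Prod>j\<in>UNIV. 1 + snd S j powr (- 1 / 2))))"
          unfolding hp by (simp only: ennreal_mult'[OF nn] ennreal_mult')
        with le show ?case by (simp only: ennreal_leI)
      qed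
    qed
    also have "\<dots> = ennreal ((lifetime + 1 / m) ^ CARD('d)) * (ennreal \<kappa> ^ CARD('d) * ennreal \<kappa> ^ CARD('d))"
    proof -
      have m: "(\<lambda>A. \<Prod>j\<in>UNIV. h (A j)) \<in> borel_measurable (exp_vec :: ('d \<Rightarrow> real) measure)"
        by (intro borel_measurable_prod_ennreal measurable_compose[OF measurable_exp_vec h])
      have "(\<lambda>S :: 'd extents. (\<Prod>j\<in>UNIV. h (fst S j)) * (\<Prod>j\<in>UNIV. h (snd S j))) \<in> borel_measurable exp_pair"
        by (intro borel_measurable_times_ennreal measurable_compose[OF measurable_fst m] measurable_compose[OF measurable_snd m])
      then show ?thesis by (simp add: nn_integral_cmult nn_integral_exp_pair_prod[OF h] \<kappa>(1))
    qed
    also have "\<dots> = ennreal ((lifetime + 1 / m) ^ CARD('d) * (\<kappa> ^ CARD('d) * \<kappa> ^ CARD('d)))"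
      using lt m0 \<kappa>(2) by (simp add: ennreal_power ennreal_mult')
    also have "\<dots> \<le> ennreal (C * lifetime ^ CARD('d))"
    proof (rule ennreal_leI)
      have "1 / m = 1 / (m * l0) * l0" using l0 by simp
      also have "\<dots> \<le> 1 / (m * l0) * lifetime" using l l0 m0 by (intro mult_left_mono) auto
      finally have "lifetime + 1 / m \<le> (1 + 1 / (m * l0)) * lifetime" by (simp add: distrib_right)
      then have "(lifetime + 1 / m) ^ CARD('d) \<le> ((1 + 1 / (m * l0)) * lifetime) ^ CARD('d)"
        using lt m0 by (intro power_mono) auto
      also have "\<dots> = (1 + 1 / (m * l0)) ^ CARD('d) * lifetime ^ CARD('d)" by (rule power_mult_distrib)
      finally have "(lifetime + 1 / m) ^ CARD('d) * (\<kappa> ^ CARD('d) * \<kappa> ^ CARD('d)) \<le>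
          (1 + 1 / (m * l0)) ^ CARD('d) * lifetime ^ CARD('d) * (\<kappa> ^ CARD('d) * \<kappa> ^ CARD('d))"
        using \<kappa>(2) by (intro mult_right_mono) auto
      then show "(lifetime + 1 / m) ^ CARD('d) * (\<kappa> ^ CARD('d) * \<kappa> ^ CARD('d)) \<le> C * lifetime ^ CARD('d)"
        by (simp only: C_def mult_ac)
    qed
    finally show "(\<integral>\<^sup>+S. ennreal (1 / measure lborel (clip_box lifetime x S)) \<partial>exp_pair) \<le> ennreal (C * lifetime ^ CARD('d))" .
  qed
qed

section \<open>Local averages\<close>

lemma sum_Pow_card:
  fixes \<phi> :: "nat \<Rightarrow> real"
  assumes "finite I"
  shows "(\<Sum>A\<in>Pow I. \<phi> (card A)) = (\<Sum>k\<le>card I. real (card I choose k) * \<phi> k)"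
proof -
  have "(\<Sum>A\<in>Pow I. \<phi> (card A)) = (\<Sum>k\<le>card I. \<Sum>A\<in>{A \<in> Pow I. card A = k}. \<phi> (card A))"
    using assms by (intro sum.group[symmetric]) (auto intro: card_mono)
  also have "\<dots> = (\<Sum>k\<le>card I. real (card I choose k) * \<phi> k)"
    using assms n_subsets[of I] by (intro sum.cong refl) simp
  finally show ?thesis .
qed

text \<open>This is the mean of \<open>1 / (N + 1)\<close> for binomial N. Dividing a binomial
  coefficient by \<open>k + 1\<close> raises both of its entries by one, up to the factor
  \<open>n + 1\<close>, and a binomial sum without its first term remains.\<close>

lemma binomial_inverse_moment:
  fixes p :: real
  assumes p: "0 < p" "p \<le> 1"
  shows "(\<Sum>k\<le>n. real (n choose k) * (p ^ k * (1 - p) ^ (n - k) / (real k + 1))) \<le> 1 / ((real n + 1) * p)"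
proof -
  have "(\<Sum>k\<le>n. real (n choose k) * (p ^ k * (1 - p) ^ (n - k) / (real k + 1))) =
      (\<Sum>k\<le>n. real (Suc n choose Suc k) * p ^ Suc k * (1 - p) ^ (Suc n - Suc k)) / ((real n + 1) * p)"
    unfolding sum_divide_distrib
  proof (intro sum.cong refl)
    fix k
    have "real (Suc k * (Suc n choose Suc k)) = real (Suc n * (n choose k))"
      by (simp only: Suc_times_binomial_eq mult.commute)
    then have "(real k + 1) * real (Suc n choose Suc k) = (real n + 1) * real (n choose k)"
      by (simp only: of_nat_mult of_nat_Suc add.commute)
    then have "real (Suc n choose Suc k) = (real n + 1) * real (n choose k) / (real k + 1)"
      by (simp add: field_simps)
    then show "real (n choose k) * (p ^ k * (1 - p) ^ (n - k) / (real k + 1)) =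
        real (Suc n choose Suc k) * p ^ Suc k * (1 - p) ^ (Suc n - Suc k) / ((real n + 1) * p)"
      using p by (simp del: binomial_Suc_Suc)
  qed
  \<comment> \<open>Shifting the index exhibits the left side as the binomial expansion without the
    term of index 0.\<close>
  also have "(\<Sum>k\<le>n. real (Suc n choose Suc k) * p ^ Suc k * (1 - p) ^ (Suc n - Suc k)) \<le>
      (\<Sum>k\<le>Suc n. real (Suc n choose k) * p ^ k * (1 - p) ^ (Suc n - k))"
    using p by (subst sum.atMost_Suc_shift) (simp del: binomial_Suc_Suc)
  also have "\<dots> = (p + (1 - p)) ^ Suc n" by (rule binomial_ring[symmetric])
  finally show ?thesis using p by (simp add: divide_right_mono)
qed

text \<open>By Bernoulli \<open>n * p\<close> is at most \<open>(1 + p) ^ n\<close>, and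
  \<open>(1 + p) * (1 - p)\<close> is at most 1. The left side is the probability that the cell
  contains no observation.\<close>

lemma power_one_minus_le:
  fixes p :: real
  assumes "0 < p" "p \<le> 1" "1 \<le> n"
  shows "(1 - p) ^ n \<le> 1 / (real n * p)"
proof -
  have "real n * p * (1 - p) ^ n \<le> (1 + p) ^ n * (1 - p) ^ n"
    using Bernoulli_inequality[of p n] assms by (intro mult_right_mono) auto
  also have "\<dots> = (1 - p * p) ^ n" by (simp add: algebra_simps flip: power_mult_distrib)
  also have "\<dots> \<le> 1" using assms by (intro power_le_one) (auto simp: mult_le_one)
  finally show ?thesis using assms by (simp add: field_simps)
qed

text \<open>Expansion over the set of indices whose observation lies in A. For a fixed set and a
  fixed pair of indices, the integrand is a product over independent coordinates; distinct indices
  contribute zero because W has mean zero. What is left is the inverse moment of a binomial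
  count.\<close>

lemma subset_average_variance:
  fixes P :: "'a measure" and W :: "'a \<Rightarrow> real"
  assumes P: "prob_space P" and A: "A \<in> sets P" and W: "W \<in> borel_measurable P" "integrable P (\<lambda>z. (W z)\<^sup>2)"
    and W0: "\<And>z. z \<notin> A \<Longrightarrow> W z = 0" and mean: "(\<integral>z. W z \<partial>P) = 0" and p: "0 < measure P A" and I: "finite I"
  shows "integrable (Pi\<^sub>M I (\<lambda>_. P)) (\<lambda>z. ((\<Sum>i\<in>I. W (z i)) / (\<Sum>i\<in>I. indicator A (z i)))\<^sup>2)"
    "(\<integral>z. ((\<Sum>i\<in>I. W (z i)) / (\<Sum>i\<in>I. indicator A (z i)))\<^sup>2 \<partial>Pi\<^sub>M I (\<lambda>_. P)) \<le>
      2 * (\<integral>z. (W z)\<^sup>2 \<partial>P) / ((real (card I) + 1) * (measure P A)\<^sup>2)"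
proof -
  interpret P: prob_space P by fact
  interpret PI: product_sigma_finite "\<lambda>_ :: 'b. P" by unfold_locales
  define v where "v = (\<integral>z. (W z)\<^sup>2 \<partial>P)"
  define p where "p = measure P A"
  have p01: "0 < p" "p \<le> 1" using p by (auto simp: p_def)
  have v0: "0 \<le> v" unfolding v_def by (rule Bochner_Integration.integral_nonneg) simp
  have Wi: "integrable P W" using W by (rule P.square_integrable_imp_integrable)
  have Ai: "integrable P (indicator A :: 'a \<Rightarrow> real)" using A by (intro integrable_real_indicator) (auto simp: P.emeasure_eq_measure)
  have WA: "W z * indicator A z = W z" "indicator A z * W z = W z" for z using W0[of z] by (auto simp: indicator_def)
  \<comment> \<open>The factors detect membership: zero off A for j in A0, zero on A for the others.
    At i and k the indicator is multiplied or replaced by W, which itself vanishes off A.\<close>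
  define g where "g A0 i k j z = (if j \<in> A0 then (if j = i then W z else indicator A z) * (if j = k then W z else indicator A z)
      else 1 - indicator A z)" for A0 :: "'b set" and i k j z
  have gi: "integrable P (g A0 i k j)" for A0 i k j
  proof -
    have "integrable P (\<lambda>z. W z * W z)" using W(2) by (simp add: power2_eq_square)
    moreover have "integrable P (\<lambda>z. indicator A z * indicator A z :: real)" using Ai by (simp flip: indicator_inter_arith)
    ultimately show ?thesis using Wi Ai by (cases "j \<in> A0"; cases "j = i"; cases "j = k") (simp_all add: g_def[abs_def] WA)
  qed
  have g_diag: "(\<integral>z. g A0 i i j z \<partial>P) = (if j \<in> A0 then if j = i then v else p else 1 - p)" for A0 i j
  proof -
    have "(\<integral>z. indicator A z * indicator A z \<partial>P) = (p :: real)" using A by (simp flip: indicator_inter_arith add: p_def)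
    moreover have "(\<integral>z. 1 - indicator A z \<partial>P) = (1 - p :: real)" using A Ai by (simp add: p_def P.prob_space)
    ultimately show ?thesis by (simp add: g_def v_def power2_eq_square)
  qed
  have g_off: "(\<integral>z. g A0 i k i z \<partial>P) = 0" if "i \<noteq> k" "i \<in> A0" for A0 i k
    using that mean by (simp add: g_def WA)
  let ?E = "\<lambda>A0 i k. \<integral>z. (\<Prod>j\<in>I. g A0 i k j (z j)) \<partial>Pi\<^sub>M I (\<lambda>_. P)"
  have Eprod: "?E A0 i k = (\<Prod>j\<in>I. \<integral>z. g A0 i k j z \<partial>P)" for A0 i k
    by (rule PI.product_integral_prod[OF I gi])
  have E_off: "?E A0 i k = 0" if "A0 \<subseteq> I" "i \<in> A0" "i \<noteq> k" for A0 i k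
    unfolding Eprod using that I g_off[of i k A0] by (auto simp: prod_zero_iff)
  have E_diag: "?E A0 i i = v * p ^ (card A0 - 1) * (1 - p) ^ (card I - card A0)" if "A0 \<subseteq> I" "i \<in> A0" for A0 i
  proof -
    have fin: "finite A0" using that I finite_subset by blast
    have "(\<Prod>j\<in>I. \<integral>z. g A0 i i j z \<partial>P) = (\<Prod>j\<in>A0. if j = i then v else p) * (\<Prod>j\<in>I - A0. 1 - p)"
      unfolding g_diag using that I
      by (subst prod.subset_diff[OF that(1) I]) (simp add: mult.commute)
    also have "(\<Prod>j\<in>A0. if j = i then v else p) = v * (\<Prod>j\<in>A0 - {i}. p)"
      using that fin by (subst prod.remove[of _ i]) (auto intro!: prod.cong)
    finally show ?thesis unfolding Eprod using that fin by (simp add: card_Diff_subset)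
  qed
  have expand: "((\<Sum>i\<in>I. W (z i)) / (\<Sum>i\<in>I. indicator A (z i)))\<^sup>2 =
      (\<Sum>A0\<in>Pow I. \<Sum>i\<in>A0. \<Sum>k\<in>A0. (1 / (real (card A0))\<^sup>2) * (\<Prod>j\<in>I. g A0 i k j (z j)))" for z
  proof -
    define A1 where "A1 = {i \<in> I. z i \<in> A}"
    have A1: "A1 \<subseteq> I" "finite A1" using I by (auto simp: A1_def)
    \<comment> \<open>The product vanishes unless A0 is exactly the set of indices that hit A; so
      just one subset survives.\<close>
    have zero: "(\<Prod>j\<in>I. g A0 i k j (z j)) = 0" if "A0 \<subseteq> I" "A0 \<noteq> A1" for A0 i k
    proof -
      note ne = that
      have "\<exists>j\<in>I. g A0 i k j (z j) = 0"
      proof (cases "A0 \<subseteq> A1")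
        case True
        then obtain j where "j \<in> A1" "j \<notin> A0" using ne by blast
        then show ?thesis by (intro bexI[of _ j]) (auto simp: g_def A1_def)
      next
        case False
        then obtain j where "j \<in> A0" "j \<notin> A1" by blast
        then show ?thesis using that W0 by (intro bexI[of _ j]) (auto simp: g_def A1_def)
      qed
      then show ?thesis using I by (simp add: prod_zero_iff)
    qed
    have one: "(\<Prod>j\<in>I. g A1 i k j (z j)) = W (z i) * W (z k)" if "i \<in> A1" "k \<in> A1" for i k
    proof -
      have "(\<Prod>j\<in>I. g A1 i k j (z j)) = (\<Prod>j\<in>I. (if j = i then W (z i) else 1) * (if j = k then W (z k) else 1))"
        using that by (intro prod.cong refl) (auto simp: g_def A1_def)
      then show ?thesis using that A1 I by (simp add: prod.distrib subset_iff)
    qed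
    have "(\<Sum>A0\<in>Pow I. \<Sum>i\<in>A0. \<Sum>k\<in>A0. (1 / (real (card A0))\<^sup>2) * (\<Prod>j\<in>I. g A0 i k j (z j))) =
        (\<Sum>A0\<in>{A1}. \<Sum>i\<in>A0. \<Sum>k\<in>A0. (1 / (real (card A0))\<^sup>2) * (\<Prod>j\<in>I. g A0 i k j (z j)))"
    proof (intro sum.mono_neutral_right ballI)
      fix A0 assume "A0 \<in> Pow I - {A1}"
      then have "A0 \<subseteq> I" "A0 \<noteq> A1" by auto
      then have "(\<Prod>j\<in>I. g A0 i k j (z j)) = 0" for i k by (rule zero)
      then show "(\<Sum>i\<in>A0. \<Sum>k\<in>A0. (1 / (real (card A0))\<^sup>2) * (\<Prod>j\<in>I. g A0 i k j (z j))) = 0"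
        by simp
    qed (use I A1 in auto)
    also have "\<dots> = (\<Sum>i\<in>A1. \<Sum>k\<in>A1. (1 / (real (card A1))\<^sup>2) * (W (z i) * W (z k)))"
      by (simp add: one)
    also have "\<dots> = ((\<Sum>i\<in>A1. W (z i)) / real (card A1))\<^sup>2"
      by (simp add: power2_eq_square sum_product sum_divide_distrib)
    also have "(\<Sum>i\<in>A1. W (z i)) = (\<Sum>i\<in>I. W (z i))"
      using I W0 by (intro sum.mono_neutral_left) (auto simp: A1_def)
    also have "real (card A1) = (\<Sum>i\<in>I. indicator A (z i))"
      using I by (simp add: A1_def indicator_def Int_def)
    finally show ?thesis by simp
  qed
  have ii: "integrable (Pi\<^sub>M I (\<lambda>_. P)) (\<lambda>z. \<Prod>j\<in>I. g A0 i k j (z j))" for A0 i k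
    by (rule PI.product_integrable_prod[OF I gi])
  show "integrable (Pi\<^sub>M I (\<lambda>_. P)) (\<lambda>z. ((\<Sum>i\<in>I. W (z i)) / (\<Sum>i\<in>I. indicator A (z i)))\<^sup>2)"
    unfolding expand by (intro Bochner_Integration.integrable_sum integrable_mult_right ii)
  have "(\<integral>z. ((\<Sum>i\<in>I. W (z i)) / (\<Sum>i\<in>I. indicator A (z i)))\<^sup>2 \<partial>Pi\<^sub>M I (\<lambda>_. P)) =
      (\<Sum>A0\<in>Pow I. \<Sum>i\<in>A0. \<Sum>k\<in>A0. (1 / (real (card A0))\<^sup>2) * ?E A0 i k)"
    unfolding expand
    by (subst Bochner_Integration.integral_sum, (intro Bochner_Integration.integrable_sum integrable_mult_right ii)?)+ simp
  also have "\<dots> \<le> (\<Sum>A0\<in>Pow I. 2 * v / p * (p ^ card A0 * (1 - p) ^ (card I - card A0) / (real (card A0) + 1)))"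
  proof (rule sum_mono)
    fix A0 assume "A0 \<in> Pow I"
    then have A0: "A0 \<subseteq> I" "finite A0" using I finite_subset by auto
    let ?k = "card A0"
    have "(\<Sum>i\<in>A0. \<Sum>k\<in>A0. (1 / (real ?k)\<^sup>2) * ?E A0 i k) = (\<Sum>i\<in>A0. (1 / (real ?k)\<^sup>2) * (v * p ^ (?k - 1) * (1 - p) ^ (card I - ?k)))"
    proof (intro sum.cong refl)
      fix i assume i: "i \<in> A0"
      have "(\<Sum>k\<in>A0. (1 / (real ?k)\<^sup>2) * ?E A0 i k) = (\<Sum>k\<in>{i}. (1 / (real ?k)\<^sup>2) * ?E A0 i k)"
        using A0 i E_off by (intro sum.mono_neutral_right) auto
      then show "(\<Sum>k\<in>A0. (1 / (real ?k)\<^sup>2) * ?E A0 i k) = (1 / (real ?k)\<^sup>2) * (v * p ^ (?k - 1) * (1 - p) ^ (card I - ?k))"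
        using E_diag[OF A0(1) i] by simp
    qed
    also have "\<dots> = real ?k / (real ?k)\<^sup>2 * (v * p ^ (?k - 1) * (1 - p) ^ (card I - ?k))" by simp
    also have "\<dots> \<le> 2 * v / p * (p ^ ?k * (1 - p) ^ (card I - ?k) / (real ?k + 1))"
    proof (cases "?k = 0")
      case False
      have pk: "p ^ ?k = p * p ^ (?k - 1)" using False by (simp add: power_eq_if)
      have "real ?k / (real ?k)\<^sup>2 = 1 / real ?k" by (simp add: power2_eq_square)
      \<comment> \<open>The passage from \<open>1 / k\<close> to \<open>1 / (k + 1)\<close> costs
        the factor 2 and leads to the computable moment.\<close>
      also have "\<dots> \<le> 2 / (real ?k + 1)" using False by (simp add: field_simps)
      finally have "real ?k / (real ?k)\<^sup>2 * (v * p ^ (?k - 1) * (1 - p) ^ (card I - ?k)) \<le>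
          2 / (real ?k + 1) * (v * p ^ (?k - 1) * (1 - p) ^ (card I - ?k))"
        using v0 p01 by (intro mult_right_mono) auto
      also have "\<dots> = 2 * v / p * (p ^ ?k * (1 - p) ^ (card I - ?k) / (real ?k + 1))"
        unfolding pk using p01 by simp
      finally show ?thesis .
    qed (use v0 p01 in simp)
    finally show "(\<Sum>i\<in>A0. \<Sum>k\<in>A0. (1 / (real ?k)\<^sup>2) * ?E A0 i k) \<le>
        2 * v / p * (p ^ ?k * (1 - p) ^ (card I - ?k) / (real ?k + 1))" .
  qed
  also have "\<dots> = 2 * v / p * (\<Sum>k\<le>card I. real (card I choose k) * (p ^ k * (1 - p) ^ (card I - k) / (real k + 1)))"
    unfolding sum_distrib_left[symmetric]
    by (subst sum_Pow_card[OF I, of "\<lambda>k. p ^ k * (1 - p) ^ (card I - k) / (real k + 1)"]) simp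
  also have "\<dots> \<le> 2 * v / p * (1 / ((real (card I) + 1) * p))"
    using v0 p01 by (intro mult_left_mono binomial_inverse_moment) auto
  finally show "(\<integral>z. ((\<Sum>i\<in>I. W (z i)) / (\<Sum>i\<in>I. indicator A (z i)))\<^sup>2 \<partial>Pi\<^sub>M I (\<lambda>_. P)) \<le>
      2 * (\<integral>z. (W z)\<^sup>2 \<partial>P) / ((real (card I) + 1) * (measure P A)\<^sup>2)"
    by (simp add: v_def p_def power2_eq_square mult_ac)
qed

text \<open>Two sources of error: the fluctuation of a nonempty average, with constant 2, and the
  empty cell, on which the estimate is 0 and the error is the square of \<theta>, with constant 1.
  Together they give the factor 3.\<close>

lemma local_average_error:
  fixes P :: "'a measure" and Y :: "'a \<Rightarrow> real"
  assumes P: "prob_space P" and A: "A \<in> sets P" and Y: "Y \<in> borel_measurable P" "integrable P (\<lambda>z. (Y z)\<^sup>2)"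
    and C: "(\<integral>z. indicator A z * (Y z)\<^sup>2 \<partial>P) \<le> C * measure P A" and pA: "0 < measure P A" and n: "1 \<le> n"
  defines "\<theta> \<equiv> (\<integral>z. indicator A z * Y z \<partial>P) / measure P A"
  shows "(\<integral>\<^sup>+z. ennreal (((\<Sum>i=1..n. Y (z i) * indicator A (z i)) / (\<Sum>i=1..n. indicator A (z i)) - \<theta>)\<^sup>2)
      \<partial>Pi\<^sub>M {1..n} (\<lambda>_. P)) \<le> ennreal (3 * C / (real n * measure P A))"
proof -
  interpret P: prob_space P by fact
  interpret PI: product_sigma_finite "\<lambda>_ :: nat. P" by unfold_locales
  interpret PP: prob_space "Pi\<^sub>M {1..n} (\<lambda>_. P)" by (intro prob_space_PiM P)
  define p where "p = measure P A"
  have p01: "0 < p" "p \<le> 1" using pA by (auto simp: p_def)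
  have Yi: "integrable P Y" using Y by (rule P.square_integrable_imp_integrable)
  have Ai: "integrable P (indicator A :: 'a \<Rightarrow> real)" using A by (intro integrable_real_indicator) (auto simp: P.emeasure_eq_measure)
  have AY: "integrable P (\<lambda>z. indicator A z * Y z)" "integrable P (\<lambda>z. indicator A z * (Y z)\<^sup>2)"
    using integrable_real_mult_indicator[OF A Yi] integrable_real_mult_indicator[OF A Y(2)] by (simp_all add: mult.commute)
  \<comment> \<open>The response centred within the cell; it has mean zero under the unconditional
    law.\<close>
  define W where "W z = indicator A z * Y z - \<theta> * indicator A z" for z
  have \<theta>p: "(\<integral>z. indicator A z * Y z \<partial>P) = \<theta> * p" using pA by (simp add: \<theta>_def p_def)
  have W2: "(W z)\<^sup>2 = indicator A z * (Y z)\<^sup>2 - 2 * \<theta> * (indicator A z * Y z) + \<theta>\<^sup>2 * indicator A z" for z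
    by (auto simp: W_def indicator_def power2_eq_square algebra_simps)
  have W2i: "integrable P (\<lambda>z. (W z)\<^sup>2)" unfolding W2
    using AY Ai by (intro Bochner_Integration.integrable_add Bochner_Integration.integrable_diff integrable_mult_right)
  have W_m: "W \<in> borel_measurable P" unfolding W_def[abs_def] using A Y(1) by measurable
  have mean: "(\<integral>z. W z \<partial>P) = 0"
    unfolding W_def using AY Ai A \<theta>p by (simp add: p_def)
  have v: "(\<integral>z. (W z)\<^sup>2 \<partial>P) = (\<integral>z. indicator A z * (Y z)\<^sup>2 \<partial>P) - \<theta>\<^sup>2 * p"
    unfolding W2 using AY Ai A \<theta>p by (simp add: p_def power2_eq_square)
  \<comment> \<open>That the variance is nonnegative bounds the squared mean by C, as needed for the
    empty cell.\<close>
  have "0 \<le> (\<integral>z. (W z)\<^sup>2 \<partial>P)" by (rule Bochner_Integration.integral_nonneg) simp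
  then have "\<theta>\<^sup>2 * p \<le> C * p" using v C by (simp add: p_def)
  then have \<theta>C: "\<theta>\<^sup>2 \<le> C" using p01 by simp
  have C0: "0 \<le> C" using \<theta>C zero_le_power2[of \<theta>] by linarith
  have vC: "(\<integral>z. (W z)\<^sup>2 \<partial>P) \<le> C * p" using v C p01 by (simp add: p_def) (meson diff_le_eq le_add_same_cancel1 mult_nonneg_nonneg order_trans zero_le_power2 less_imp_le)
  let ?N = "\<lambda>z. \<Sum>i=1..n. indicator A (z i) :: real"
  let ?Q = "\<lambda>z. ((\<Sum>i=1..n. W (z i)) / ?N z)\<^sup>2"
  let ?Z = "\<lambda>z. \<theta>\<^sup>2 * (\<Prod>i=1..n. 1 - indicator A (z i))"
  \<comment> \<open>The two squares never overlap: the product is 1 if the cell is empty and 0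
    otherwise, and for an empty cell the quotient is \<open>0 / 0 = 0\<close>.\<close>
  have dec: "((\<Sum>i=1..n. Y (z i) * indicator A (z i)) / ?N z - \<theta>)\<^sup>2 = ?Q z + ?Z z" for z
  proof (cases "\<exists>i\<in>{1..n}. z i \<in> A")
    case True
    then have "\<exists>i\<in>{1..n}. 1 - indicator A (z i) = (0 :: real)" by (auto simp: indicator_def)
    then have "(\<Prod>i=1..n. 1 - indicator A (z i) :: real) = 0" by (rule prod_zero[OF finite_atLeastAtMost])
    moreover have "?N z \<noteq> 0"
    proof
      assume "?N z = 0"
      then have "\<forall>i\<in>{1..n}. indicator A (z i) = (0 :: real)" by (subst (asm) sum_nonneg_eq_0_iff) auto
      with True show False by (auto simp: indicator_def)
    qed
    moreover have "(\<Sum>i=1..n. W (z i)) = (\<Sum>i=1..n. Y (z i) * indicator A (z i)) - \<theta> * ?N z"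
      by (simp add: W_def sum_subtractf sum_distrib_left mult.commute)
    ultimately show ?thesis by (simp add: diff_divide_distrib)
  next
    case False
    then have "indicator A (z i) = (0 :: real)" if "i \<in> {1..n}" for i using that by (auto simp: indicator_def)
    then show ?thesis by (simp add: W_def)
  qed
  have Zi: "integrable (Pi\<^sub>M {1..n} (\<lambda>_. P)) ?Z"
    by (intro integrable_mult_right PI.product_integrable_prod) (use Ai in auto)
  have ZE: "(\<integral>z. ?Z z \<partial>Pi\<^sub>M {1..n} (\<lambda>_. P)) = \<theta>\<^sup>2 * (1 - p) ^ n"
    using PI.product_integral_prod[of "{1..n}" "\<lambda>_ z. 1 - indicator A z :: real"] A Ai
    by (simp add: p_def P.prob_space)
  have W0: "z \<notin> A \<Longrightarrow> W z = 0" for z by (simp add: W_def)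
  note Q = subset_average_variance[OF P A W_m W2i W0 mean pA finite_atLeastAtMost[of 1 n]]
  have "(\<integral>\<^sup>+z. ennreal (((\<Sum>i=1..n. Y (z i) * indicator A (z i)) / ?N z - \<theta>)\<^sup>2) \<partial>Pi\<^sub>M {1..n} (\<lambda>_. P)) =
      ennreal (\<integral>z. ?Q z + ?Z z \<partial>Pi\<^sub>M {1..n} (\<lambda>_. P))"
    unfolding dec
  proof (rule nn_integral_eq_integral)
    show "integrable (Pi\<^sub>M {1..n} (\<lambda>_. P)) (\<lambda>z. ?Q z + ?Z z)"
      by (intro Bochner_Integration.integrable_add Q(1) Zi)
    show "AE z in Pi\<^sub>M {1..n} (\<lambda>_. P). 0 \<le> ?Q z + ?Z z"
      unfolding dec[symmetric] by simp
  qed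
  also have "(\<integral>z. ?Q z + ?Z z \<partial>Pi\<^sub>M {1..n} (\<lambda>_. P)) = (\<integral>z. ?Q z \<partial>Pi\<^sub>M {1..n} (\<lambda>_. P)) + \<theta>\<^sup>2 * (1 - p) ^ n"
    unfolding ZE[symmetric] by (intro Bochner_Integration.integral_add Q(1) Zi)
  also have "ennreal \<dots> \<le> ennreal (3 * C / (real n * measure P A))"
  proof (rule ennreal_leI)
    have "(\<integral>z. ?Q z \<partial>Pi\<^sub>M {1..n} (\<lambda>_. P)) \<le> 2 * (\<integral>z. (W z)\<^sup>2 \<partial>P) / ((real n + 1) * p\<^sup>2)"
      using Q(2) by (simp add: p_def)
    also have "\<dots> \<le> 2 * (C * p) / ((real n + 1) * p\<^sup>2)"
      using vC p01 by (intro divide_right_mono mult_left_mono) auto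
    also have "\<dots> = 2 * C / ((real n + 1) * p)" using p01 by (simp add: power2_eq_square)
    also have "\<dots> \<le> 2 * C / (real n * p)"
      using C0 p01 n by (intro divide_left_mono mult_right_mono mult_pos_pos) auto
    finally have 1: "(\<integral>z. ?Q z \<partial>Pi\<^sub>M {1..n} (\<lambda>_. P)) \<le> 2 * C / (real n * p)" .
    have "\<theta>\<^sup>2 * (1 - p) ^ n \<le> C * (1 / (real n * p))"
      using \<theta>C C0 p01 n by (intro mult_mono power_one_minus_le) auto
    then have "\<theta>\<^sup>2 * (1 - p) ^ n \<le> C / (real n * p)" by simp
    from add_mono[OF 1 this]
    have "(\<integral>z. ?Q z \<partial>Pi\<^sub>M {1..n} (\<lambda>_. P)) + \<theta>\<^sup>2 * (1 - p) ^ n \<le> 2 * C / (real n * p) + C / (real n * p)" .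
    also have "\<dots> = 3 * C / (real n * p)" unfolding add_divide_distrib[symmetric] by simp
    finally show "(\<integral>z. ?Q z \<partial>Pi\<^sub>M {1..n} (\<lambda>_. P)) + \<theta>\<^sup>2 * (1 - p) ^ n \<le> 3 * C / (real n * measure P A)"
      by (simp add: p_def)
  qed
  finally show ?thesis .
qed

section \<open>Moments of the bias\<close>

text \<open>The constant depends only on the exponent and the dimension. It comes from the
  exponential moment of \<open>esize\<close>, and integrability and both bounds follow from
  it.\<close>

lemma exp_pair_integral_bound:
  fixes q :: real
  assumes q: "0 \<le> q"
  obtains Cq where "0 \<le> Cq"
    "\<And>(g :: ('d::finite) extents \<Rightarrow> real) C. g \<in> borel_measurable exp_pair \<Longrightarrow> 0 \<le> C \<Longrightarrow>
      (\<And>S. proper S \<Longrightarrow> \<bar>g S\<bar> \<le> C * esize S powr q) \<Longrightarrow>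
      integrable exp_pair g \<and> \<bar>\<integral>S. g S \<partial>exp_pair\<bar> \<le> C * Cq \<and>
      (\<integral>\<^sup>+S. ennreal \<bar>g S\<bar> \<partial>exp_pair) \<le> ennreal (C * Cq)"
proof -
  obtain c where c: "0 < c" "\<And>s. 0 \<le> s \<Longrightarrow> s powr q \<le> c * exp (s / 2)" using powr_le_exp_half[OF q] by metis
  show thesis
  proof (rule that[of "c * 4 ^ CARD('d)"])
    show "0 \<le> c * 4 ^ CARD('d)" using c by simp
    fix g :: "'d extents \<Rightarrow> real" and C
    assume g: "g \<in> borel_measurable exp_pair" and C: "0 \<le> C" and b: "\<And>S. proper S \<Longrightarrow> \<bar>g S\<bar> \<le> C * esize S powr q"
    have em: "(\<lambda>S :: 'd extents. ennreal (exp (esize S / 2))) \<in> borel_measurable exp_pair"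
      unfolding measurable_cong_sets[OF sets_exp_pair refl] esize_def
      by (intro measurable_compose[OF _ measurable_ennreal] borel_measurable_exp borel_measurable_divide borel_measurable_sum
          borel_measurable_add measurable_extents borel_measurable_const measurable_compose[OF _ borel_measurable_exp])
    have "(\<integral>\<^sup>+S. ennreal \<bar>g S\<bar> \<partial>exp_pair) \<le> (\<integral>\<^sup>+S. ennreal (C * c) * ennreal (exp (esize S / 2)) \<partial>(exp_pair :: 'd extents measure))"
    proof (rule nn_integral_mono_AE)
      show "AE S in exp_pair. ennreal \<bar>g S\<bar> \<le> ennreal (C * c) * ennreal (exp (esize S / 2))"
        using AE_proper
      proof eventually_elim
        case (elim S)
        have "\<bar>g S\<bar> \<le> C * (c * exp (esize S / 2))"
          using b[OF elim] mult_left_mono[OF c(2)[OF esize_nonneg[OF elim]] C] by linarith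
        then show ?case using C c by (simp add: mult.assoc flip: ennreal_mult')
      qed
    qed
    also have "\<dots> = ennreal (C * (c * 4 ^ CARD('d)))"
      unfolding nn_integral_cmult[OF em] nn_integral_exp_esize using C c
      by (subst ennreal_mult[symmetric]) (simp_all add: mult.assoc)
    finally have nn: "(\<integral>\<^sup>+S. ennreal \<bar>g S\<bar> \<partial>exp_pair) \<le> ennreal (C * (c * 4 ^ CARD('d)))" .
    then have "(\<integral>\<^sup>+S. ennreal (norm (g S)) \<partial>exp_pair) < \<infinity>" by (simp add: le_less_trans[OF _ ennreal_less_top])
    with g have i: "integrable exp_pair g" by (rule integrableI_bounded)
    have "ennreal \<bar>\<integral>S. g S \<partial>exp_pair\<bar> \<le> (\<integral>\<^sup>+S. ennreal \<bar>g S\<bar> \<partial>exp_pair)"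
      using integral_norm_bound_ennreal[OF i] by simp
    with nn have "ennreal \<bar>\<integral>S. g S \<partial>exp_pair\<bar> \<le> ennreal (C * (c * 4 ^ CARD('d)))" by (rule order_trans[rotated])
    then have "\<bar>\<integral>S. g S \<partial>exp_pair\<bar> \<le> C * (c * 4 ^ CARD('d))" using C c by simp
    with i nn show "integrable exp_pair g \<and> \<bar>\<integral>S. g S \<partial>exp_pair\<bar> \<le> C * (c * 4 ^ CARD('d)) \<and>
      (\<integral>\<^sup>+S. ennreal \<bar>g S\<bar> \<partial>exp_pair) \<le> ennreal (C * (c * 4 ^ CARD('d)))" by blast
  qed
qed

lemma measurable_box_integral:
  fixes g :: "real ^ 'd \<Rightarrow> real"
  assumes g: "g \<in> borel_measurable borel"
  shows "(\<lambda>p. \<integral>y. indicator (cbox (fst p) (snd p)) y * g y \<partial>lborel) \<in> borel_measurable borel"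
proof -
  let ?N = "(borel :: ((real ^ 'd) \<times> (real ^ 'd)) measure) \<Otimes>\<^sub>M (lborel :: (real ^ 'd) measure)"
  have f1: "(\<lambda>p. fst (fst p) $ j) \<in> borel_measurable ?N" for j
    by (rule measurable_nth_vec) (rule measurable_compose[OF measurable_fst], simp add: borel_prod[symmetric])
  have f2: "(\<lambda>p. snd (fst p) $ j) \<in> borel_measurable ?N" for j
    by (rule measurable_nth_vec) (rule measurable_compose[OF measurable_fst], simp add: borel_prod[symmetric])
  have s: "(\<lambda>p. snd p $ j) \<in> borel_measurable ?N" for j
    by (rule measurable_nth_vec) simp
  have "Measurable.pred ?N (\<lambda>p. fst (fst p) $ j \<le> snd p $ j)" "Measurable.pred ?N (\<lambda>p. snd p $ j \<le> snd (fst p) $ j)" for j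
    unfolding pred_def by (rule borel_measurable_le[OF f1 s], rule borel_measurable_le[OF s f2])
  then have 3: "Measurable.pred ?N (\<lambda>p. \<forall>j. fst (fst p) $ j \<le> snd p $ j \<and> snd p $ j \<le> snd (fst p) $ j)"
    by (intro pred_intros_countable(1) pred_intros_logic(3))
  have "(\<lambda>p. of_bool (\<forall>j. fst (fst p) $ j \<le> snd p $ j \<and> snd p $ j \<le> snd (fst p) $ j) * g (snd p)) \<in> borel_measurable ?N"
    by (intro borel_measurable_times measurable_compose[OF 3] measurable_compose[OF measurable_snd])
      (use g in auto)
  also have "(\<lambda>p. of_bool (\<forall>j. fst (fst p) $ j \<le> snd p $ j \<and> snd p $ j \<le> snd (fst p) $ j) * g (snd p)) =
      (\<lambda>(p, y). indicator (cbox (fst p) (snd p)) y * g y)"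
    by (auto simp: fun_eq_iff indicator_def mem_box_cart)
  finally show ?thesis by (rule lborel.borel_measurable_lebesgue_integral)
qed

lemma measurable_cmean_cbox:
  assumes "\<mu> \<in> borel_measurable borel" "f \<in> borel_measurable borel"
  shows "(\<lambda>p. cmean \<mu> f (cbox (fst p) (snd p))) \<in> borel_measurable borel"
proof -
  have "(\<lambda>y. \<mu> y * f y) \<in> borel_measurable borel" using assms by measurable
  then show ?thesis unfolding cmean_def by (intro borel_measurable_divide measurable_box_integral assms)
qed

lemma measurable_clip_pair:
  "(\<lambda>S. (clip_lower lifetime x (fst S), clip_upper lifetime x (snd S))) \<in> borel_measurable exp_pair"
  unfolding borel_prod[symmetric]
  by (intro measurable_Pair measurable_compose[OF measurable_fst measurable_clip(1)]
      measurable_compose[OF measurable_snd measurable_clip(2)])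

lemma measurable_cmean_clip_box:
  assumes "\<mu> \<in> borel_measurable borel" "f \<in> borel_measurable borel"
  shows "(\<lambda>S. cmean \<mu> f (clip_box lifetime x S)) \<in> borel_measurable exp_pair"
  using measurable_compose[OF measurable_clip_pair measurable_cmean_cbox[OF assms]] by (simp add: clip_box_def)

lemma bias_second_moment:
  fixes f \<mu> :: "real ^ 'd \<Rightarrow> real"
  assumes \<mu>: "\<mu> \<in> holder_class b" "0 < b" "\<mu> \<in> borel_measurable borel"
    and f: "f \<in> borel_measurable borel" "0 < c0" "\<And>y. y \<in> unit_cube \<Longrightarrow> c0 \<le> f y" "\<And>y. y \<in> unit_cube \<Longrightarrow> \<bar>f y\<bar> \<le> Mf"
    and x: "x \<in> box 0 1"
  obtains C where "0 \<le> C" "\<And>lifetime. 0 < lifetime \<Longrightarrow>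
    (\<integral>\<^sup>+S. ennreal ((cmean \<mu> f (clip_box lifetime x S) - \<mu> x)\<^sup>2) \<partial>exp_pair) \<le> ennreal (C * lifetime powr (- 2 * min 1 b))"
proof -
  obtain C where C: "0 \<le> C" "\<And>lifetime S. 0 < lifetime \<Longrightarrow> proper S \<Longrightarrow>
    \<bar>cmean \<mu> f (clip_box lifetime x S) - \<mu> x\<bar> \<le> C * (esize S / lifetime) powr (min 1 b)"
    using bias_order_one[OF \<mu> f x] by metis
  have q: "0 \<le> 2 * min 1 b" using \<mu>(2) by simp
  obtain Cq where Cq: "0 \<le> Cq" "\<And>(g :: 'd extents \<Rightarrow> real) C. g \<in> borel_measurable exp_pair \<Longrightarrow> 0 \<le> C \<Longrightarrow>
      (\<And>S. proper S \<Longrightarrow> \<bar>g S\<bar> \<le> C * esize S powr (2 * min 1 b)) \<Longrightarrow>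
      integrable exp_pair g \<and> \<bar>\<integral>S. g S \<partial>exp_pair\<bar> \<le> C * Cq \<and>
      (\<integral>\<^sup>+S. ennreal \<bar>g S\<bar> \<partial>exp_pair) \<le> ennreal (C * Cq)"
  proof -
    show thesis by (rule exp_pair_integral_bound[OF q]) (fact that)
  qed
  show thesis
  proof (rule that[of "C\<^sup>2 * Cq"])
    show "0 \<le> C\<^sup>2 * Cq" using Cq by simp
    fix lifetime :: real assume lt: "0 < lifetime"
    let ?g = "\<lambda>S. (cmean \<mu> f (clip_box lifetime x S) - \<mu> x)\<^sup>2"
    let ?C = "C\<^sup>2 * lifetime powr (- 2 * min 1 b)"
    have "(\<integral>\<^sup>+S. ennreal \<bar>?g S\<bar> \<partial>exp_pair) \<le> ennreal (?C * Cq)"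
    proof (rule Cq(2)[THEN conjunct2, THEN conjunct2])
      show "?g \<in> borel_measurable exp_pair"
        by (intro borel_measurable_power borel_measurable_diff measurable_cmean_clip_box \<mu>(3) f(1) borel_measurable_const)
      show "0 \<le> ?C" by simp
      fix S :: "'d extents" assume S: "proper S"
      have "\<bar>?g S\<bar> \<le> (C * (esize S / lifetime) powr (min 1 b))\<^sup>2"
        using power_mono[OF C(2)[OF lt S], of 2] by simp
      also have "\<dots> = ?C * esize S powr (2 * min 1 b)"
        using lt esize_pos[OF S] by (simp add: power_mult_distrib powr_divide powr_minus_divide power_divide powr_power mult.commute)
      finally show "\<bar>?g S\<bar> \<le> ?C * esize S powr (2 * min 1 b)" .
    qed
    then show "(\<integral>\<^sup>+S. ennreal (?g S) \<partial>exp_pair) \<le> ennreal (C\<^sup>2 * Cq * lifetime powr (- 2 * min 1 b))"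
      by (simp add: mult_ac)
  qed
qed

lemma mean_bias_expansion:
  fixes f \<mu> :: "real ^ 'd \<Rightarrow> real"
  assumes \<mu>: "\<mu> \<in> holder_class b\<mu>" "0 < b\<mu>" "\<mu> \<in> borel_measurable borel"
    and fh: "f \<in> holder_class bf" "0 < bf"
    and f: "f \<in> borel_measurable borel" "0 < c0" "\<And>y. y \<in> unit_cube \<Longrightarrow> c0 \<le> f y" "\<And>y. y \<in> unit_cube \<Longrightarrow> \<bar>f y\<bar> \<le> Mf"
    and x: "x \<in> box 0 1" and \<beta>: "\<beta> = min b\<mu> (bf + 1)"
  obtains e :: "nat \<Rightarrow> real" and C where "0 \<le> C" "\<And>k. odd k \<Longrightarrow> e k = 0"
    "\<And>lifetime. 0 < lifetime \<Longrightarrow> integrable exp_pair (\<lambda>S. cmean \<mu> f (clip_box lifetime x S) - \<mu> x)"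
    "\<And>lifetime. 0 < lifetime \<Longrightarrow> \<bar>(\<integral>S. cmean \<mu> f (clip_box lifetime x S) - \<mu> x \<partial>exp_pair) -
      (\<Sum>k=1..holder_order \<beta>. e k * (1 / lifetime) ^ k)\<bar> \<le> C * lifetime powr (- \<beta>)"
proof -
  define K where "K = holder_order \<beta>"
  have \<beta>0: "0 < \<beta>" using \<mu> fh by (simp add: \<beta>)
  have meas: "(\<lambda>S. cmean \<mu> f (clip_box lifetime x S) - \<mu> x) \<in> borel_measurable exp_pair" for lifetime
    by (intro borel_measurable_diff measurable_cmean_clip_box \<mu>(3) f(1) borel_measurable_const)
  obtain C1 where C1: "0 \<le> C1" "\<And>lifetime S. 0 < lifetime \<Longrightarrow> proper S \<Longrightarrow>
    \<bar>cmean \<mu> f (clip_box lifetime x S) - \<mu> x\<bar> \<le> C1 * (esize S / lifetime) powr (min 1 b\<mu>)"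
    using bias_order_one[OF \<mu> f x] by metis
  have bint: "integrable exp_pair (\<lambda>S. cmean \<mu> f (clip_box lifetime x S) - \<mu> x)" if lt: "0 < lifetime" for lifetime
  proof -
    have "0 \<le> min 1 b\<mu>" using \<mu>(2) by simp
    from exp_pair_integral_bound[OF this, where ?'d = 'd] obtain Cq where
      Cq: "\<And>(g :: 'd extents \<Rightarrow> real) C. g \<in> borel_measurable exp_pair \<Longrightarrow> 0 \<le> C \<Longrightarrow>
      (\<And>S. proper S \<Longrightarrow> \<bar>g S\<bar> \<le> C * esize S powr (min 1 b\<mu>)) \<Longrightarrow> integrable exp_pair g" by metis
    show ?thesis
    proof (rule Cq[OF meas, of "C1 * (1 / lifetime) powr (min 1 b\<mu>)"])
      fix S :: "'d extents" assume S: "proper S"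
      show "\<bar>cmean \<mu> f (clip_box lifetime x S) - \<mu> x\<bar> \<le> C1 * (1 / lifetime) powr (min 1 b\<mu>) * esize S powr (min 1 b\<mu>)"
        using C1(2)[OF lt S] lt esize_pos[OF S] by (simp add: powr_divide)
    qed (use C1 in simp)
  qed
  obtain c :: "nat \<Rightarrow> 'd extents \<Rightarrow> real" and C where c: "0 \<le> C" "\<And>k. c k \<in> borel_measurable extent_space"
    "\<And>k S. k \<le> K \<Longrightarrow> proper S \<Longrightarrow> \<bar>c k S\<bar> \<le> C * esize S ^ k"
    "\<And>k S. c k (prod.swap S) = (-1) ^ k * c k S"
    "\<And>lifetime S. 0 < lifetime \<Longrightarrow> proper S \<Longrightarrow>
      \<bar>cmean \<mu> f (clip_box lifetime x S) - \<mu> x - (\<Sum>k=1..K. c k S * (1 / lifetime) ^ k)\<bar> \<le> C * (esize S / lifetime) powr \<beta>"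
  proof (cases "1 < \<beta>")
    case True
    have bb: "\<beta> \<le> b\<mu>" "\<beta> - 1 \<le> bf" by (auto simp: \<beta>)
    show thesis
      by (rule bias_expansion_smooth[OF \<mu>(1) bb(1) \<mu>(3) fh(1) bb(2) f(1-3) x True, folded K_def]) (assumption | fact that)+
  next
    \<comment> \<open>Then the sum over degrees is empty and the estimate of order one is already
      the expansion; its exponent is \<beta>, because \<open>bf + 1\<close> exceeds 1.\<close>
    case False
    then have K0: "K = 0" by (simp add: K_def holder_order_def)
    have "min 1 b\<mu> = \<beta>" using False fh(2) by (simp add: \<beta> min_def split: if_splits)
    with C1(2) show thesis
      by (intro that[of C1 "\<lambda>_ _. 0"]) (simp_all add: C1(1) K0 mult_nonneg_nonneg esize_nonneg)
  qed
  have cm: "c k \<in> borel_measurable exp_pair" for k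
    using c(2) unfolding measurable_cong_sets[OF sets_exp_pair refl] .
  have cint: "integrable exp_pair (c k)" if "k \<le> K" for k
  proof -
    have "0 \<le> real k" by simp
    from exp_pair_integral_bound[OF this, where ?'d = 'd] obtain Cq where
      Cq: "\<And>(g :: 'd extents \<Rightarrow> real) C. g \<in> borel_measurable exp_pair \<Longrightarrow> 0 \<le> C \<Longrightarrow>
      (\<And>S. proper S \<Longrightarrow> \<bar>g S\<bar> \<le> C * esize S powr real k) \<Longrightarrow> integrable exp_pair g" by metis
    show ?thesis
    proof (rule Cq[OF cm c(1)])
      fix S :: "'d extents" assume S: "proper S"
      show "\<bar>c k S\<bar> \<le> C * esize S powr real k"
        using c(3)[OF that S] esize_pos[OF S] by (simp add: powr_realpow)
    qed
  qed
  \<comment> \<open>Odd coefficients are put to zero for all k, so that the parity property needs no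
    range restriction.\<close>
  define e where "e k = (if odd k then 0 else \<integral>S. c k S \<partial>exp_pair)" for k
  have ce: "(\<integral>S. c k S \<partial>exp_pair) = e k" if "k \<le> K" for k
  proof (cases "odd k")
    case True
    interpret E: prob_space "exp_vec :: ('d \<Rightarrow> real) measure" by (rule prob_space_exp_vec)
    interpret P: pair_sigma_finite "exp_vec :: ('d \<Rightarrow> real) measure" "exp_vec :: ('d \<Rightarrow> real) measure"
      by unfold_locales
    \<comment> \<open>The two factors of \<open>exp_pair\<close> have the same law, so the swap
      preserves the integral and also reverses its sign.\<close>
    have "(\<integral>S. c k S \<partial>exp_pair) = (\<integral>S. c k (prod.swap S) \<partial>exp_pair)"
      using P.integral_product_swap[OF cm[of k], symmetric, unfolded case_prod_unfold] by (simp only: prod.swap_def)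
    also have "\<dots> = - (\<integral>S. c k S \<partial>exp_pair)" using True by (simp add: c(4))
    finally show ?thesis using True by (simp add: e_def)
  qed (simp add: e_def)
  obtain Cb where Cb: "0 \<le> Cb" "\<And>(g :: 'd extents \<Rightarrow> real) C. g \<in> borel_measurable exp_pair \<Longrightarrow> 0 \<le> C \<Longrightarrow>
      (\<And>S. proper S \<Longrightarrow> \<bar>g S\<bar> \<le> C * esize S powr \<beta>) \<Longrightarrow> \<bar>\<integral>S. g S \<partial>exp_pair\<bar> \<le> C * Cb"
    using exp_pair_integral_bound[OF less_imp_le[OF \<beta>0], where ?'d = 'd] by metis
  show thesis
  proof (rule that[of "C * Cb" e, folded K_def])
    show "0 \<le> C * Cb" using c(1) Cb(1) by simp
    show "e k = 0" if "odd k" for k using that by (simp add: e_def)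
    fix lifetime :: real assume lt: "0 < lifetime"
    show "integrable exp_pair (\<lambda>S. cmean \<mu> f (clip_box lifetime x S) - \<mu> x)" by (rule bint[OF lt])
    have ci: "integrable exp_pair (\<lambda>S. \<Sum>k=1..K. c k S * (1 / lifetime) ^ k)"
      by (intro Bochner_Integration.integrable_sum integrable_mult_left cint) simp
    have "(\<Sum>k=1..K. e k * (1 / lifetime) ^ k) = (\<Sum>k=1..K. \<integral>S. c k S * (1 / lifetime) ^ k \<partial>exp_pair)"
      by (intro sum.cong refl) (simp add: ce)
    also have "\<dots> = (\<integral>S. (\<Sum>k=1..K. c k S * (1 / lifetime) ^ k) \<partial>exp_pair)"
      by (rule Bochner_Integration.integral_sum[symmetric]) (intro integrable_mult_left cint, simp)
    finally have "(\<integral>S. cmean \<mu> f (clip_box lifetime x S) - \<mu> x \<partial>exp_pair) - (\<Sum>k=1..K. e k * (1 / lifetime) ^ k) =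
      (\<integral>S. cmean \<mu> f (clip_box lifetime x S) - \<mu> x - (\<Sum>k=1..K. c k S * (1 / lifetime) ^ k) \<partial>exp_pair)"
      using bint[OF lt] ci by (simp only: Bochner_Integration.integral_diff)
    also have "\<bar>\<dots>\<bar> \<le> (C * lifetime powr (- \<beta>)) * Cb"
    proof (rule Cb(2))
      show "(\<lambda>S. cmean \<mu> f (clip_box lifetime x S) - \<mu> x - (\<Sum>k=1..K. c k S * (1 / lifetime) ^ k)) \<in> borel_measurable exp_pair"
        by (intro borel_measurable_diff[OF meas] borel_measurable_sum borel_measurable_times cm borel_measurable_const)
      show "0 \<le> C * lifetime powr (- \<beta>)" using c(1) by simp
      fix S :: "'d extents" assume S: "proper S"
      show "\<bar>cmean \<mu> f (clip_box lifetime x S) - \<mu> x - (\<Sum>k=1..K. c k S * (1 / lifetime) ^ k)\<bar> \<le> C * lifetime powr (- \<beta>) * esize S powr \<beta>"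
        using c(5)[OF lt S] lt esize_pos[OF S] by (simp add: powr_divide powr_minus_divide)
    qed
    finally show "\<bar>(\<integral>S. cmean \<mu> f (clip_box lifetime x S) - \<mu> x \<partial>exp_pair) - (\<Sum>k=1..K. e k * (1 / lifetime) ^ k)\<bar> \<le> C * Cb * lifetime powr (- \<beta>)"
      by (simp only: mult_ac)
  qed
qed

lemma debiased_mean_bias:
  fixes f \<mu> :: "real ^ 'd \<Rightarrow> real"
  assumes \<mu>: "\<mu> \<in> holder_class b\<mu>" "0 < b\<mu>" "\<mu> \<in> borel_measurable borel"
    and fh: "f \<in> holder_class bf" "0 < bf"
    and f: "f \<in> borel_measurable borel" "0 < c0" "\<And>y. y \<in> unit_cube \<Longrightarrow> c0 \<le> f y" "\<And>y. y \<in> unit_cube \<Longrightarrow> \<bar>f y\<bar> \<le> Mf"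
    and x: "x \<in> box 0 1" and \<beta>: "\<beta> = min b\<mu> (bf + 1)"
    and a: "\<forall>r\<le>J. 0 < a r" and \<omega>: "debiasing_weights J a \<omega>"
  obtains C where "0 \<le> C" "\<And>lifetime. 1 \<le> lifetime \<Longrightarrow>
    \<bar>\<Sum>r\<le>J. \<omega> r * (\<integral>S. cmean \<mu> f (clip_box (a r * lifetime) x S) - \<mu> x \<partial>exp_pair)\<bar> \<le>
      C * lifetime powr (- min (2 * real J + 2) \<beta>)"
proof -
  obtain e C where e: "0 \<le> C" "\<And>k. odd k \<Longrightarrow> e k = 0"
    "\<And>lifetime. 0 < lifetime \<Longrightarrow> integrable exp_pair (\<lambda>S. cmean \<mu> f (clip_box lifetime x S) - \<mu> x)"
    "\<And>lifetime. 0 < lifetime \<Longrightarrow> \<bar>(\<integral>S. cmean \<mu> f (clip_box lifetime x S) - \<mu> x \<partial>exp_pair) -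
      (\<Sum>k=1..holder_order \<beta>. e k * (1 / lifetime) ^ k)\<bar> \<le> C * lifetime powr (- \<beta>)"
  proof -
    show thesis by (rule mean_bias_expansion[OF \<mu> fh f x \<beta>]) (assumption | fact that)+
  qed
  let ?K = "holder_order \<beta>"
  \<comment> \<open>The factor that the weights put on degree k, as \<open>a r\<close> rescales the
    lifetime of the forest r.\<close>
  define w where "w k = (\<Sum>r\<le>J. \<omega> r * (1 / a r) ^ k)" for k
  define m where "m = min (2 * real J + 2) \<beta>"
  define D where "D = (\<Sum>r\<le>J. \<bar>\<omega> r\<bar> * (C * a r powr (- \<beta>))) + (\<Sum>k=1..?K. \<bar>e k\<bar> * \<bar>w k\<bar>)"
  show thesis
  proof (rule that[of D])
    show "0 \<le> D" unfolding D_def using e(1) by (intro add_nonneg_nonneg sum_nonneg mult_nonneg_nonneg) auto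
    fix lifetime :: real assume l: "1 \<le> lifetime"
    let ?I = "\<lambda>r. \<integral>S. cmean \<mu> f (clip_box (a r * lifetime) x S) - \<mu> x \<partial>exp_pair"
    let ?P = "\<lambda>r. \<Sum>k=1..?K. e k * (1 / (a r * lifetime)) ^ k"
    have lp: "lifetime powr - t \<le> lifetime powr - m" if "m \<le> t" for t
      using l that by (intro powr_mono) auto
    have 1: "\<bar>\<Sum>r\<le>J. \<omega> r * (?I r - ?P r)\<bar> \<le> (\<Sum>r\<le>J. \<bar>\<omega> r\<bar> * (C * a r powr (- \<beta>))) * lifetime powr - m"
      unfolding sum_distrib_right
    proof (rule order_trans[OF sum_abs], rule sum_mono)
      fix r assume r: "r \<in> {..J}"
      then have ar: "0 < a r" using a by simp
      have "\<bar>?I r - ?P r\<bar> \<le> C * (a r * lifetime) powr (- \<beta>)" using ar l by (intro e(4)) simp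
      also have "\<dots> = C * a r powr (- \<beta>) * lifetime powr (- \<beta>)" using ar l by (simp add: powr_mult)
      also have "\<dots> \<le> C * a r powr (- \<beta>) * lifetime powr - m"
        using e(1) by (intro mult_left_mono lp) (auto simp: m_def)
      finally have "\<bar>\<omega> r\<bar> * \<bar>?I r - ?P r\<bar> \<le> \<bar>\<omega> r\<bar> * (C * a r powr (- \<beta>) * lifetime powr - m)"
        by (intro mult_left_mono) auto
      then show "\<bar>\<omega> r * (?I r - ?P r)\<bar> \<le> \<bar>\<omega> r\<bar> * (C * a r powr (- \<beta>)) * lifetime powr - m"
        by (simp only: abs_mult mult.assoc)
    qed
    have "(\<Sum>r\<le>J. \<omega> r * ?P r) = (\<Sum>k=1..?K. e k * w k * (1 / lifetime) ^ k)"
      unfolding w_def sum_distrib_left sum_distrib_right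
      by (subst sum.swap) (intro sum.cong refl, simp add: power_divide power_mult_distrib)
    also have "\<bar>\<dots>\<bar> \<le> (\<Sum>k=1..?K. \<bar>e k\<bar> * \<bar>w k\<bar>) * lifetime powr - m"
      unfolding sum_distrib_right
    proof (rule order_trans[OF sum_abs], rule sum_mono)
      fix k assume k: "k \<in> {1..?K}"
      \<comment> \<open>Only even degrees from \<open>2 * J + 2\<close> on survive; since the
        lifetime is at least 1, they are dominated by the power m.\<close>
      consider "odd k" | "even k" "k \<le> 2 * J" | "even k" "2 * J + 2 \<le> k" by fastforce
      then show "\<bar>e k * w k * (1 / lifetime) ^ k\<bar> \<le> \<bar>e k\<bar> * \<bar>w k\<bar> * lifetime powr - m"
      proof cases
        case 2
        then obtain s where s: "k = 2 * s" by (elim evenE)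
        then have "s \<in> {1..J}" using 2 k by auto
        then have "w k = 0" using \<omega> by (simp add: w_def debiasing_weights_def s power_one_over)
        then show ?thesis by simp
      next
        case 3
        have "(1 / lifetime) ^ k = lifetime powr - real k"
          using l by (simp add: powr_minus_divide powr_realpow power_one_over)
        also have "\<dots> \<le> lifetime powr - m" using 3 by (intro lp) (simp add: m_def)
        finally have "\<bar>e k * w k\<bar> * (1 / lifetime) ^ k \<le> \<bar>e k * w k\<bar> * lifetime powr - m" by (intro mult_left_mono) auto
        then show ?thesis using l by (simp add: abs_mult)
      qed (simp add: e(2))
    qed
    finally have 2: "\<bar>\<Sum>r\<le>J. \<omega> r * ?P r\<bar> \<le> (\<Sum>k=1..?K. \<bar>e k\<bar> * \<bar>w k\<bar>) * lifetime powr - m" .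
    have "(\<Sum>r\<le>J. \<omega> r * ?I r) = (\<Sum>r\<le>J. \<omega> r * (?I r - ?P r)) + (\<Sum>r\<le>J. \<omega> r * ?P r)"
      by (simp add: right_diff_distrib sum_subtractf)
    then have "\<bar>\<Sum>r\<le>J. \<omega> r * ?I r\<bar> \<le> \<bar>\<Sum>r\<le>J. \<omega> r * (?I r - ?P r)\<bar> + \<bar>\<Sum>r\<le>J. \<omega> r * ?P r\<bar>" by linarith
    also have "\<dots> \<le> D * lifetime powr - m" unfolding D_def distrib_right using 1 2 by (rule add_mono)
    finally show "\<bar>\<Sum>r\<le>J. \<omega> r * ?I r\<bar> \<le> D * lifetime powr - min (2 * real J + 2) \<beta>" by (simp add: m_def)
  qed
qed

section \<open>Conditional risk of a tree\<close>

lemma AE_coord_neq: "AE y in lborel. (y :: real ^ 'd) $ j \<noteq> c"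
proof -
  have "negligible {y :: real ^ 'd. y $ j = c}" 
    using negligible_standard_hyperplane[of "axis j 1 :: real ^ 'd" c] by (simp add: inner_axis)
  moreover have "{y :: real ^ 'd. y $ j = c} \<in> sets lborel" by measurable
  ultimately have "{y :: real ^ 'd. y $ j = c} \<in> null_sets lborel"
    by (simp add: negligible_iff_null_sets null_sets_completion_iff)
  from AE_I'[OF this] show ?thesis by auto
qed

lemma hrect_sets [measurable]: "hrect L U \<in> sets borel"
proof -
  have "{y :: real ^ 'a. \<forall>j. 0 \<le> y $ j \<and> L $ j < y $ j \<and> y $ j \<le> U $ j} \<in> sets borel" by measurable
  then show ?thesis by (simp add: hrect_def)
qed

lemma AE_hrect_cbox: "AE y in lborel. y \<in> hrect L U \<longleftrightarrow> y \<in> cbox (low L) U"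
proof -
  have "AE y in lborel. \<forall>j. y $ j \<noteq> L $ j" by (subst AE_all_countable) (intro allI AE_coord_neq)
  then show ?thesis
  proof eventually_elim
    case (elim y)
    then have "L $ j \<noteq> y $ j" for j by metis
    then show ?case by (auto simp: hrect_def mem_box_cart less_le)
  qed
qed

lemma integral_hrect_cbox:
  fixes g :: "real ^ 'd \<Rightarrow> real"
  assumes g [measurable]: "g \<in> borel_measurable borel"
  shows "(\<integral>y. indicator (hrect L U) y * g y \<partial>lborel) = (\<integral>y. indicator (cbox (low L) U) y * g y \<partial>lborel)"
proof (rule integral_cong_AE)
  show "AE y in lborel. indicator (hrect L U) y * g y = indicator (cbox (low L) U) y * g y"
    using AE_hrect_cbox by eventually_elim (auto simp: indicator_def)
qed measurable

text \<open>The law is known for nonnegative integrands. It is applied to the absolute value for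
  integrability and to the positive and negative parts for the integral.\<close>

lemma last_state_law_real:
  fixes x :: "real ^ 'd" and F :: "(real ^ 'd) \<times> (real ^ 'd) \<Rightarrow> real"
  assumes x: "x \<in> box 0 1" and lt: "0 < lifetime" and F: "F \<in> borel_measurable borel"
    and i: "integrable exp_pair (\<lambda>S. F (clip_lower lifetime x (fst S), clip_upper lifetime x (snd S)))"
  defines "g \<equiv> \<lambda>\<xi>. F (low (fst (last_state lifetime x \<xi>)), fst (snd (last_state lifetime x \<xi>)))"
  shows "integrable marks_law g"
    "(\<integral>\<xi>. g \<xi> \<partial>marks_law) = (\<integral>S. F (clip_lower lifetime x (fst S), clip_upper lifetime x (snd S)) \<partial>exp_pair)"
proof -
  have law: "(\<integral>\<^sup>+\<xi>. h (g \<xi>) \<partial>marks_law) = (\<integral>\<^sup>+S. h (F (clip_lower lifetime x (fst S), clip_upper lifetime x (snd S))) \<partial>exp_pair)"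
    if "h \<in> borel_measurable borel" for h :: "real \<Rightarrow> ennreal"
    unfolding g_def by (rule last_state_law[OF x lt measurable_compose[OF F that]])
  have m: "(\<lambda>\<xi>. (low (fst (last_state lifetime x \<xi>)), fst (snd (last_state lifetime x \<xi>)))) \<in> borel_measurable marks_law"
    unfolding borel_prod[symmetric]
    by (intro measurable_Pair measurable_compose[OF measurable_compose[OF measurable_last_state measurable_fst] measurable_low]
        measurable_compose[OF measurable_compose[OF measurable_last_state measurable_snd] measurable_fst])
  have gm: "g \<in> borel_measurable marks_law" unfolding g_def by (rule measurable_compose[OF m F])
  show gi: "integrable marks_law g"
  proof (rule integrableI_bounded[OF gm])
    show "(\<integral>\<^sup>+\<xi>. ennreal (norm (g \<xi>)) \<partial>marks_law) < \<infinity>"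
      using i law[of "\<lambda>t. ennreal (norm t)"] by (simp add: integrable_iff_bounded)
  qed
  show "(\<integral>\<xi>. g \<xi> \<partial>marks_law) = (\<integral>S. F (clip_lower lifetime x (fst S), clip_upper lifetime x (snd S)) \<partial>exp_pair)"
    unfolding real_lebesgue_integral_def[OF gi] real_lebesgue_integral_def[OF i]
    using law[of ennreal] law[of "\<lambda>t. ennreal (- t)"] by simp
qed

text \<open>Each \<open>g i\<close> reads only its own coordinate, so mixed terms factor into
  products of means. Completing the diagonal gives the square of the sum of means.\<close>

lemma product_sum_square_le:
  fixes N :: "'a measure" and g :: "'i \<Rightarrow> 'a \<Rightarrow> real"
  assumes N: "prob_space N" and I: "finite I"
    and g: "\<And>i. i \<in> I \<Longrightarrow> integrable N (g i)" "\<And>i. i \<in> I \<Longrightarrow> integrable N (\<lambda>w. (g i w)\<^sup>2)"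
  shows "(\<integral>\<^sup>+w. ennreal ((\<Sum>i\<in>I. g i (w i))\<^sup>2) \<partial>Pi\<^sub>M I (\<lambda>_. N)) \<le>
    ennreal ((\<Sum>i\<in>I. \<integral>w. g i w \<partial>N)\<^sup>2 + (\<Sum>i\<in>I. \<integral>w. (g i w)\<^sup>2 \<partial>N))"
proof -
  interpret N: prob_space N by fact
  interpret PI: product_sigma_finite "\<lambda>_ :: 'i. N" by unfold_locales
  \<comment> \<open>The product of two terms, written as a product over all coordinates so that the
    product integral formula applies, also for \<open>i = k\<close>.\<close>
  define h where "h i k j w = (if j = i then g i w else 1) * (if j = k then g k w else 1)" for i k j w
  have hi: "integrable N (h i k j)" if "i \<in> I" "k \<in> I" for i k j
    using that g by (cases "j = i"; cases "j = k") (simp_all add: h_def[abs_def] power2_eq_square)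
  have expand: "(\<Sum>i\<in>I. g i (w i))\<^sup>2 = (\<Sum>i\<in>I. \<Sum>k\<in>I. \<Prod>j\<in>I. h i k j (w j))" for w
    unfolding power2_eq_square sum_product using I
    by (intro sum.cong refl) (simp add: h_def prod.distrib)
  have pi: "integrable (Pi\<^sub>M I (\<lambda>_. N)) (\<lambda>w. \<Prod>j\<in>I. h i k j (w j))" if "i \<in> I" "k \<in> I" for i k
    by (rule PI.product_integrable_prod[OF I hi[OF that]])
  let ?m = "\<lambda>i. \<integral>w. g i w \<partial>N" and ?s = "\<lambda>i. \<integral>w. (g i w)\<^sup>2 \<partial>N"
  have E: "(\<integral>w. (\<Prod>j\<in>I. h i k j (w j)) \<partial>Pi\<^sub>M I (\<lambda>_. N)) = (if i = k then ?s i else ?m i * ?m k)"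
    if ik: "i \<in> I" "k \<in> I" for i k
  proof -
    have "(\<integral>w. (\<Prod>j\<in>I. h i k j (w j)) \<partial>Pi\<^sub>M I (\<lambda>_. N)) = (\<Prod>j\<in>I. \<integral>w. h i k j w \<partial>N)"
      by (rule PI.product_integral_prod[OF I hi[OF ik]])
    also have "\<dots> = (if i = k then ?s i else ?m i * ?m k)"
    proof (cases "i = k")
      case True
      then have "(\<integral>w. h i k j w \<partial>N) = (if j = i then ?s i else 1)" for j
        by (simp add: h_def power2_eq_square N.prob_space)
      then show ?thesis using True ik I by simp
    next
      case False
      then have "(\<integral>w. h i k j w \<partial>N) = (if j = i then ?m i else 1) * (if j = k then ?m k else 1)" for j
        by (auto simp: h_def N.prob_space)
      then show ?thesis using False ik I by (simp add: prod.distrib)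
    qed
    finally show ?thesis .
  qed
  have "(\<integral>\<^sup>+w. ennreal ((\<Sum>i\<in>I. g i (w i))\<^sup>2) \<partial>Pi\<^sub>M I (\<lambda>_. N)) =
      ennreal (\<integral>w. (\<Sum>i\<in>I. g i (w i))\<^sup>2 \<partial>Pi\<^sub>M I (\<lambda>_. N))"
  proof (rule nn_integral_eq_integral)
    show "integrable (Pi\<^sub>M I (\<lambda>_. N)) (\<lambda>w. (\<Sum>i\<in>I. g i (w i))\<^sup>2)"
      unfolding expand by (intro Bochner_Integration.integrable_sum pi)
  qed simp
  also have "(\<integral>w. (\<Sum>i\<in>I. g i (w i))\<^sup>2 \<partial>Pi\<^sub>M I (\<lambda>_. N)) = (\<Sum>i\<in>I. \<Sum>k\<in>I. if i = k then ?s i else ?m i * ?m k)"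
    unfolding expand using pi by (simp add: Bochner_Integration.integral_sum E)
  \<comment> \<open>On the diagonal the nonnegative square of the mean is added.\<close>
  also have "\<dots> \<le> (\<Sum>i\<in>I. \<Sum>k\<in>I. ?m i * ?m k + (if i = k then ?s i else 0))"
    by (intro sum_mono) auto
  also have "\<dots> = (\<Sum>i\<in>I. ?m i)\<^sup>2 + (\<Sum>i\<in>I. ?s i)"
    using I by (simp add: sum.distrib power2_eq_square sum_product)
  finally show ?thesis by (simp add: ennreal_leI)
qed

text \<open>Cauchy-Schwarz with each \<bar>c i\<bar> divided into two square roots. Absolute values
  are taken because debiasing weights may be negative; no independence of the terms is
  involved.\<close>

lemma weighted_square_le:
  fixes c t :: "'i \<Rightarrow> real"
  shows "(\<Sum>i\<in>I. c i * t i)\<^sup>2 \<le> (\<Sum>i\<in>I. \<bar>c i\<bar>) * (\<Sum>i\<in>I. \<bar>c i\<bar> * (t i)\<^sup>2)"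
proof -
  have "\<bar>\<Sum>i\<in>I. c i * t i\<bar> \<le> (\<Sum>i\<in>I. sqrt \<bar>c i\<bar> * (sqrt \<bar>c i\<bar> * \<bar>t i\<bar>))"
    by (rule order_trans[OF sum_abs]) (simp add: abs_mult flip: mult.assoc)
  then have "(\<Sum>i\<in>I. c i * t i)\<^sup>2 \<le> (\<Sum>i\<in>I. sqrt \<bar>c i\<bar> * (sqrt \<bar>c i\<bar> * \<bar>t i\<bar>))\<^sup>2"
    by (metis abs_ge_zero power2_abs power_mono)
  also have "\<dots> \<le> (\<Sum>i\<in>I. (sqrt \<bar>c i\<bar>)\<^sup>2) * (\<Sum>i\<in>I. (sqrt \<bar>c i\<bar> * \<bar>t i\<bar>)\<^sup>2)"
    by (rule Cauchy_Schwarz_ineq_sum)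
  finally show ?thesis by (simp add: power_mult_distrib)
qed

lemma measurable_in_cell:
  fixes x :: "real ^ 'd"
  assumes X: "X \<in> borel_measurable M" and \<xi>: "\<xi> \<in> measurable M marks_law" and x: "x \<in> unit_cube"
  shows "(\<lambda>w. indicator (cell_of (mondrian lifetime (\<xi> w)) x) (X w) :: real) \<in> borel_measurable M"
proof -
  have S: "(\<lambda>w. last_state lifetime x (\<xi> w)) \<in> measurable M state_space"
    by (rule measurable_compose[OF \<xi> measurable_last_state])
  have L: "(\<lambda>w. fst (last_state lifetime x (\<xi> w)) $ j) \<in> borel_measurable M" for j
    by (rule measurable_nth_vec[OF measurable_compose[OF S measurable_fst]])
  have U: "(\<lambda>w. fst (snd (last_state lifetime x (\<xi> w))) $ j) \<in> borel_measurable M" for j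
    by (rule measurable_nth_vec[OF measurable_compose[OF measurable_compose[OF S measurable_snd] measurable_fst]])
  have Xj: "(\<lambda>w. X w $ j) \<in> borel_measurable M" for j by (rule measurable_nth_vec[OF X])
  have st: "Measurable.pred M (\<lambda>w. stops lifetime x (\<xi> w))" by (rule measurable_compose[OF \<xi> measurable_stops])
  have 1: "Measurable.pred M (\<lambda>w. 0 \<le> X w $ j)" for j
    unfolding pred_def by (rule borel_measurable_le[OF borel_measurable_const Xj])
  have 2: "Measurable.pred M (\<lambda>w. fst (last_state lifetime x (\<xi> w)) $ j < X w $ j)" for j
    unfolding pred_def by (rule borel_measurable_less[OF L Xj])
  have 3: "Measurable.pred M (\<lambda>w. X w $ j \<le> fst (snd (last_state lifetime x (\<xi> w))) $ j)" for j
    unfolding pred_def by (rule borel_measurable_le[OF Xj U])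
  have "Measurable.pred M (\<lambda>w. stops lifetime x (\<xi> w) \<and> (\<forall>j. 0 \<le> X w $ j \<and>
      fst (last_state lifetime x (\<xi> w)) $ j < X w $ j \<and> X w $ j \<le> fst (snd (last_state lifetime x (\<xi> w))) $ j))"
    by (intro pred_intros_logic(3) pred_intros_countable(1) st 1 2 3)
  from measurable_compose[OF this, of of_bool borel]
  have "(\<lambda>w. of_bool (stops lifetime x (\<xi> w) \<and> (\<forall>j. 0 \<le> X w $ j \<and>
      fst (last_state lifetime x (\<xi> w)) $ j < X w $ j \<and> X w $ j \<le> fst (snd (last_state lifetime x (\<xi> w))) $ j)) :: real)
      \<in> borel_measurable M" by simp
  also have "(\<lambda>w. of_bool (stops lifetime x (\<xi> w) \<and> (\<forall>j. 0 \<le> X w $ j \<and>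
      fst (last_state lifetime x (\<xi> w)) $ j < X w $ j \<and> X w $ j \<le> fst (snd (last_state lifetime x (\<xi> w))) $ j)) :: real) =
      (\<lambda>w. indicator (cell_of (mondrian lifetime (\<xi> w)) x) (X w))"
    by (rule ext) (simp add: cell_of_mondrian[OF x] indicator_def hrect_def)
  finally show ?thesis .
qed

lemma measurable_tree_estimate:
  fixes x :: "real ^ 'd" and P :: "((real ^ 'd) \<times> real) measure"
  assumes P: "sets P = sets borel" and x: "x \<in> unit_cube"
    and z: "\<And>i. i \<in> {1..n} \<Longrightarrow> (\<lambda>w. z w i) \<in> measurable M P" and \<xi>: "\<xi> \<in> measurable M marks_law"
  shows "(\<lambda>w. tree_estimate n (z w) (mondrian lifetime (\<xi> w)) x) \<in> borel_measurable M"
proof -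
  have f: "fst \<in> borel_measurable P" "snd \<in> borel_measurable P"
    unfolding measurable_cong_sets[OF P refl] borel_prod[symmetric] by simp_all
  have X: "(\<lambda>w. fst (z w i)) \<in> borel_measurable M" and Y: "(\<lambda>w. snd (z w i)) \<in> borel_measurable M" if "i \<in> {1..n}" for i
    using measurable_compose[OF z[OF that] f(1)] measurable_compose[OF z[OF that] f(2)] by simp_all
  show ?thesis unfolding tree_estimate_def
    by (intro borel_measurable_divide borel_measurable_sum borel_measurable_times Y measurable_in_cell[OF X \<xi> x])
qed

lemma run_upper_le:
  "(\<And>j. fst (snd S) $ j \<le> 1) \<Longrightarrow> fst (snd (snd (run lifetime x n \<xi> S))) $ j \<le> 1"
proof (induction n arbitrary: \<xi> S)
  case (Suc n)
  have "fst (snd (child b S m)) $ j \<le> 1" for b m j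
    using Suc.prems[of j] by (auto simp: child_def min_def)
  with Suc show ?case by simp
qed simp

lemma last_state_upper_le:
  assumes "stops lifetime x \<xi>"
  shows "fst (snd (last_state lifetime x \<xi>)) $ j \<le> 1"
proof -
  obtain n where "\<not> fst (run lifetime x n \<xi> init)" using assms unfolding stops_def by (elim exE)
  then obtain S where S: "run lifetime x n \<xi> init = (False, S)" by (cases "run lifetime x n \<xi> init") simp
  show ?thesis using run_upper_le[of init lifetime x n \<xi> j] last_state_eq[OF S] S by simp
qed

text \<open>The closed box is a function of two corners, to which the law of the corners applies; it
  differs from the half-open cell by a null set.\<close>

abbreviation last_box :: "real \<Rightarrow> real ^ 'd \<Rightarrow> (bool list \<Rightarrow> mark) \<Rightarrow> (real ^ ('d::finite)) set"
  where "last_box lifetime x \<xi> \<equiv>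
    cbox (low (fst (last_state lifetime x \<xi>))) (fst (snd (last_state lifetime x \<xi>)))"

lemma last_box_props:
  fixes x :: "real ^ 'd"
  assumes x: "x \<in> box 0 1" and st: "stops lifetime x \<xi>"
  shows "last_box lifetime x \<xi> \<subseteq> unit_cube" "cell (last_state lifetime x \<xi>) \<subseteq> unit_cube" "0 < measure lborel (last_box lifetime x \<xi>)"
proof -
  let ?L = "fst (last_state lifetime x \<xi>)" and ?U = "fst (snd (last_state lifetime x \<xi>))"
  note U = last_state_upper_le[OF st]
  show "last_box lifetime x \<xi> \<subseteq> unit_cube"
  proof
    fix y assume y: "y \<in> last_box lifetime x \<xi>"
    have "0 \<le> y $ j" "y $ j \<le> 1" for j
    proof -
      have "low ?L $ j \<le> y $ j" "y $ j \<le> ?U $ j" "0 \<le> low ?L $ j" using y by (simp_all add: mem_box_cart)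
      then show "0 \<le> y $ j" "y $ j \<le> 1" using U[of j] by linarith+
    qed
    then show "y \<in> unit_cube" by (simp add: mem_box_cart)
  qed
  show "cell (last_state lifetime x \<xi>) \<subseteq> unit_cube"
  proof
    fix y assume y: "y \<in> cell (last_state lifetime x \<xi>)"
    have "0 \<le> y $ j" "y $ j \<le> 1" for j
    proof -
      have "0 \<le> y $ j" "y $ j \<le> ?U $ j" using y by (simp_all add: hrect_def)
      then show "0 \<le> y $ j" "y $ j \<le> 1" using U[of j] by linarith+
    qed
    then show "y \<in> unit_cube" by (simp add: mem_box_cart)
  qed
  have x0: "0 < x $ j" for j using x by (auto simp: mem_box_cart)
  have lu: "low ?L $ j < ?U $ j" for j
    by (rule cell_bounds(3)[OF last_state_mem[OF x st] x0])
  have "box (low ?L) ?U \<noteq> {}" unfolding box_ne_empty(2)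
    using lu by (auto simp: Basis_vec_def inner_axis simp del: low_nth)
  then show "0 < measure lborel (last_box lifetime x \<xi>)"
    by (simp add: content_pos_lt_eq box_ne_empty(2))
qed

text \<open>Borel measurability of f and \<mu> is asked on the whole space, all else on the cube, so
  that the functions of the theorem can be replaced by their restrictions extended by zero.\<close>

locale regression_model =
  fixes P :: "((real ^ 'd) \<times> real) measure" and f \<mu> :: "real ^ 'd \<Rightarrow> real" and c0 Mf C2 :: real
  assumes P: "prob_space P" "sets P = sets borel"
    and f_meas: "f \<in> borel_measurable borel" and c0: "0 < c0" "\<And>y. y \<in> unit_cube \<Longrightarrow> c0 \<le> f y"
    and Mf: "\<And>y. y \<in> unit_cube \<Longrightarrow> \<bar>f y\<bar> \<le> Mf"
    and \<mu>_meas: "\<mu> \<in> borel_measurable borel"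
    and dens: "distributed P lborel fst (\<lambda>y. ennreal (indicator unit_cube y * f y))"
    and C2: "0 \<le> C2" "AE z in P. nn_cond_exp P (sigma_X P) (\<lambda>z. ennreal ((snd z)\<^sup>2)) z \<le> ennreal C2"
    and reg: "AE z in P. fst z \<in> unit_cube \<longrightarrow> real_cond_exp P (sigma_X P) snd z = \<mu> (fst z)"
begin

interpretation P: prob_space P by (rule P(1))

lemma meas_P: "fst \<in> borel_measurable P" "snd \<in> borel_measurable P"
  unfolding measurable_cong_sets[OF P(2) refl] borel_prod[symmetric] by simp_all

lemma sub: "subalgebra P (sigma_X P)"
  unfolding subalgebra_def using measurable_sets[OF meas_P(1)]
  by (auto simp: sets_vimage_algebra2)

interpretation F: finite_measure_subalgebra P "sigma_X P"
  by unfold_locales (rule sub)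

lemma meas_F: "D \<in> sets borel \<Longrightarrow> (\<lambda>z. indicator D (fst z) :: 'b::{zero_neq_one,topological_space}) \<in> borel_measurable (sigma_X P)"
  by (rule measurable_compose[of fst "sigma_X P" borel "indicator D"])
    (auto intro!: measurable_vimage_algebra1)

text \<open>The indicator depends on the covariate only, so the squared response may be replaced by
  its conditional expectation, which is at most C2.\<close>

lemma second_moment_on:
  assumes D: "D \<in> sets borel"
  shows "(\<integral>\<^sup>+z. indicator D (fst z) * ennreal ((snd z)\<^sup>2) \<partial>P) \<le> ennreal C2 * emeasure P (fst -` D \<inter> space P)"
proof -
  have "(\<integral>\<^sup>+z. indicator D (fst z) * ennreal ((snd z)\<^sup>2) \<partial>P) =
      (\<integral>\<^sup>+z. indicator D (fst z) * nn_cond_exp P (sigma_X P) (\<lambda>z. ennreal ((snd z)\<^sup>2)) z \<partial>P)"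
    by (intro F.nn_cond_exp_intg[symmetric] meas_F D measurable_compose[OF meas_P(2)]) measurable
  also have "\<dots> \<le> (\<integral>\<^sup>+z. ennreal C2 * indicator (fst -` D \<inter> space P) z \<partial>P)"
  proof (rule nn_integral_mono_AE)
    show "AE z in P. indicator D (fst z) * nn_cond_exp P (sigma_X P) (\<lambda>z. ennreal ((snd z)\<^sup>2)) z \<le>
        ennreal C2 * indicator (fst -` D \<inter> space P) z"
      using C2(2) AE_space by eventually_elim (auto simp: indicator_def)
  qed
  also have "\<dots> = ennreal C2 * emeasure P (fst -` D \<inter> space P)"
    using measurable_sets[OF meas_P(1) D] by (rule nn_integral_cmult_indicator)
  finally show ?thesis .
qed

lemma integrable_sq: "integrable P (\<lambda>z. (snd z)\<^sup>2)"
proof (rule integrableI_nonneg)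
  show "(\<lambda>z. (snd z)\<^sup>2) \<in> borel_measurable P" using meas_P by measurable
  have "(\<integral>\<^sup>+z. ennreal ((snd z)\<^sup>2) \<partial>P) \<le> ennreal C2 * emeasure P (fst -` UNIV \<inter> space P)"
    using second_moment_on[of UNIV] by simp
  also have "\<dots> < \<infinity>" by (simp add: P.emeasure_eq_measure ennreal_mult_less_top)
  finally show "(\<integral>\<^sup>+z. ennreal ((snd z)\<^sup>2) \<partial>P) < \<infinity>" .
qed simp

lemma prob_cell:
  assumes D: "D \<in> sets borel" "D \<subseteq> unit_cube"
  shows "measure P (fst -` D \<inter> space P) = (\<integral>y. indicator D y * f y \<partial>lborel)"
proof -
  have "0 \<le> f y" if "y \<in> D" for y
    using c0(1) c0(2)[of y] D(2) that by auto
  then have nn: "0 \<le> indicator D y * f y" for y by (auto simp: indicator_def)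
  have "emeasure P (fst -` D \<inter> space P) = (\<integral>\<^sup>+y. ennreal (indicator unit_cube y * f y) * indicator D y \<partial>lborel)"
    using D by (intro distributed_emeasure[OF dens]) simp
  also have "\<dots> = (\<integral>\<^sup>+y. ennreal (indicator D y * f y) \<partial>lborel)"
    using D(2) by (intro nn_integral_cong) (auto simp: indicator_def)
  also have "\<dots> = ennreal (\<integral>y. indicator D y * f y \<partial>lborel)"
    using nn by (intro nn_integral_eq_integral integrable_on_subcube[OF D f_meas Mf]) auto
  finally show ?thesis
    using nn by (simp add: P.emeasure_eq_measure integral_nonneg)
qed

text \<open>The indicator is a function of the covariate, so the response may be replaced by \<mu>,
  and the integral then passes to the density.\<close>

lemma mean_cell:
  assumes D: "D \<in> sets borel" "D \<subseteq> unit_cube"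
  shows "(\<integral>z. indicator (fst -` D \<inter> space P) z * snd z \<partial>P) = (\<integral>y. indicator D y * (\<mu> y * f y) \<partial>lborel)"
proof -
  have Yi: "integrable P snd" using meas_P(2) integrable_sq by (rule P.square_integrable_imp_integrable)
  have DY: "integrable P (\<lambda>z. indicator D (fst z) * snd z)"
    using integrable_real_mult_indicator[OF measurable_sets[OF meas_P(1) D(1)] Yi]
    by (rule Bochner_Integration.integrable_cong[THEN iffD1, rotated 2]) (auto simp: indicator_def)
  have "(\<integral>z. indicator (fst -` D \<inter> space P) z * snd z \<partial>P) = (\<integral>z. indicator D (fst z) * snd z \<partial>P)"
    by (intro Bochner_Integration.integral_cong refl) (auto simp: indicator_def)
  also have "\<dots> = (\<integral>z. indicator D (fst z) * real_cond_exp P (sigma_X P) snd z \<partial>P)"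
    by (rule F.real_cond_exp_intg(2)[symmetric, OF DY meas_F[OF D(1)] meas_P(2)])
  also have "\<dots> = (\<integral>z. indicator D (fst z) * \<mu> (fst z) \<partial>P)"
  proof (rule integral_cong_AE)
    show "AE z in P. indicator D (fst z) * real_cond_exp P (sigma_X P) snd z = indicator D (fst z) * \<mu> (fst z)"
      using reg by eventually_elim (use D(2) in \<open>auto simp: indicator_def\<close>)
    show "(\<lambda>z. indicator D (fst z) * real_cond_exp P (sigma_X P) snd z) \<in> borel_measurable P"
      by (intro borel_measurable_times measurable_from_subalg[OF sub meas_F[OF D(1)]] borel_measurable_cond_exp2)
    show "(\<lambda>z. indicator D (fst z) * \<mu> (fst z)) \<in> borel_measurable P"
      using D(1) by (intro borel_measurable_times measurable_compose[OF meas_P(1)] \<mu>_meas) simp_all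
  qed
  also have "\<dots> = (\<integral>y. (indicator unit_cube y * f y) * (indicator D y * \<mu> y) \<partial>lborel)"
  proof (rule distributed_integral[OF dens, symmetric])
    show "(\<lambda>y. indicator D y * \<mu> y) \<in> borel_measurable lborel" using D(1) \<mu>_meas by measurable
    show "0 \<le> indicator unit_cube y * f y" for y
      using c0(1) c0(2)[of y] by (auto simp: indicator_def)
  qed
  also have "\<dots> = (\<integral>y. indicator D y * (\<mu> y * f y) \<partial>lborel)"
    using D(2) by (intro Bochner_Integration.integral_cong refl) (auto simp: indicator_def)
  finally show ?thesis .
qed

text \<open>For fixed marks the cell is a fixed set, so the local average of an i.i.d. sample is at
  hand, and its centre is the conditional mean over the closed box.\<close>

lemma tree_error:
  assumes x: "x \<in> box 0 1" and st: "stops lifetime x \<xi>" and n: "1 \<le> n"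
  shows "(\<integral>\<^sup>+z. ennreal ((tree_estimate n z (mondrian lifetime \<xi>) x - cmean \<mu> f (last_box lifetime x \<xi>))\<^sup>2) \<partial>Pi\<^sub>M {1..n} (\<lambda>_. P)) \<le>
    ennreal (3 * C2 / (real n * c0)) * ennreal (1 / measure lborel (last_box lifetime x \<xi>))"
proof -
  have xc: "x \<in> unit_cube" using x box_subset_cbox by blast
  define D where "D = cell (last_state lifetime x \<xi>)"
  define E where "E = last_box lifetime x \<xi>"
  note pr = last_box_props[OF x st, folded D_def E_def]
  have D: "D \<in> sets borel" "D \<subseteq> unit_cube" using pr by (auto simp: D_def)
  have Eb: "E \<in> sets borel" by (simp add: E_def)
  have DE: "(\<integral>y. indicator D y * g y \<partial>lborel) = (\<integral>y. indicator E y * g y \<partial>lborel)"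
    if "g \<in> borel_measurable borel" for g :: "real ^ 'd \<Rightarrow> real"
    unfolding D_def E_def by (rule integral_hrect_cbox[OF that])
  define A where "A = fst -` D \<inter> space P"
  have A: "A \<in> sets P" unfolding A_def by (rule measurable_sets[OF meas_P(1) D(1)])
  have pA: "measure P A = (\<integral>y. indicator E y * f y \<partial>lborel)"
    unfolding A_def prob_cell[OF D] by (rule DE[OF f_meas])
  \<comment> \<open>The lower bound on the density trades the probability of the cell for its
    volume.\<close>
  have pA_le: "c0 * measure lborel E \<le> measure P A"
    unfolding pA by (rule density_integral_lower[OF Eb pr(1) f_meas c0(2) Mf])
  then have pA0: "0 < measure P A" using mult_pos_pos[OF c0(1) pr(3)] by linarith
  have muf: "(\<lambda>y. \<mu> y * f y) \<in> borel_measurable borel" using \<mu>_meas f_meas by measurable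
  have \<theta>: "(\<integral>z. indicator A z * snd z \<partial>P) / measure P A = cmean \<mu> f E"
    unfolding A_def mean_cell[OF D] prob_cell[OF D] cmean_def using DE[OF muf] DE[OF f_meas] by simp
  have sq: "(\<integral>z. indicator A z * (snd z)\<^sup>2 \<partial>P) \<le> C2 * measure P A"
  proof -
    have i: "integrable P (\<lambda>z. indicator A z * (snd z)\<^sup>2)"
      using integrable_real_mult_indicator[OF A integrable_sq] by (simp add: mult.commute)
    have "ennreal (\<integral>z. indicator A z * (snd z)\<^sup>2 \<partial>P) = (\<integral>\<^sup>+z. ennreal (indicator A z * (snd z)\<^sup>2) \<partial>P)"
      by (rule nn_integral_eq_integral[symmetric, OF i]) simp
    also have "\<dots> = (\<integral>\<^sup>+z. indicator D (fst z) * ennreal ((snd z)\<^sup>2) \<partial>P)"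
      by (intro nn_integral_cong) (auto simp: A_def indicator_def)
    also have "\<dots> \<le> ennreal C2 * emeasure P A" unfolding A_def by (rule second_moment_on[OF D(1)])
    also have "\<dots> = ennreal (C2 * measure P A)" using C2(1) by (simp add: P.emeasure_eq_measure ennreal_mult)
    finally show ?thesis using C2(1) by (simp add: mult_nonneg_nonneg)
  qed
  have eq: "tree_estimate n z (mondrian lifetime \<xi>) x =
      (\<Sum>i=1..n. snd (z i) * indicator A (z i)) / (\<Sum>i=1..n. indicator A (z i))"
    if "z \<in> space (Pi\<^sub>M {1..n} (\<lambda>_. P))" for z
  proof -
    have "z i \<in> space P" if "i \<in> {1..n}" for i
      using that \<open>z \<in> space (Pi\<^sub>M {1..n} (\<lambda>_. P))\<close> by (auto simp: space_PiM)
    then have "(indicator D (fst (z i)) :: real) = indicator A (z i)" if "i \<in> {1..n}" for i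
      using that by (auto simp: A_def indicator_def)
    then show ?thesis
      unfolding tree_estimate_def cell_of_mondrian[OF xc] using st by (simp add: D_def)
  qed
  have "(\<integral>\<^sup>+z. ennreal ((tree_estimate n z (mondrian lifetime \<xi>) x - cmean \<mu> f E)\<^sup>2) \<partial>Pi\<^sub>M {1..n} (\<lambda>_. P)) =
      (\<integral>\<^sup>+z. ennreal (((\<Sum>i=1..n. snd (z i) * indicator A (z i)) / (\<Sum>i=1..n. indicator A (z i)) -
        (\<integral>z. indicator A z * snd z \<partial>P) / measure P A)\<^sup>2) \<partial>Pi\<^sub>M {1..n} (\<lambda>_. P))"
    unfolding \<theta> by (intro nn_integral_cong) (simp only: eq)
  also have "\<dots> \<le> ennreal (3 * C2 / (real n * measure P A))"
    by (rule local_average_error[OF P(1) A meas_P(2) integrable_sq sq pA0 n])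
  also have "\<dots> \<le> ennreal (3 * C2 / (real n * c0) * (1 / measure lborel E))"
  proof (rule ennreal_leI)
    have "3 * C2 / (real n * measure P A) \<le> 3 * C2 / (real n * (c0 * measure lborel E))"
      using pA_le pA0 pr(3) c0(1) C2(1) n by (intro divide_left_mono mult_left_mono mult_pos_pos) auto
    then show "3 * C2 / (real n * measure P A) \<le> 3 * C2 / (real n * c0) * (1 / measure lborel E)"
      by (simp add: mult.assoc)
  qed
  also have "\<dots> = ennreal (3 * C2 / (real n * c0)) * ennreal (1 / measure lborel E)"
    using C2(1) c0(1) by (intro ennreal_mult) auto
  finally show ?thesis by (simp add: E_def)
qed

lemma measurable_last_pair:
  "(\<lambda>\<xi>. (low (fst (last_state lifetime x \<xi>)), fst (snd (last_state lifetime x \<xi>)))) \<in> borel_measurable marks_law"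
  unfolding borel_prod[symmetric]
  by (intro measurable_Pair measurable_compose[OF measurable_compose[OF measurable_last_state measurable_fst] measurable_low]
      measurable_compose[OF measurable_compose[OF measurable_last_state measurable_snd] measurable_fst])

lemma measurable_local_mean: "(\<lambda>\<xi>. cmean \<mu> f (last_box lifetime x \<xi>)) \<in> borel_measurable marks_law"
  using measurable_compose[OF measurable_last_pair measurable_cmean_cbox[OF \<mu>_meas f_meas]] by simp

lemma tree_error_mean:
  assumes x: "x \<in> box 0 1" and lt: "0 < lifetime" and n: "1 \<le> n"
  shows "(\<integral>\<^sup>+\<xi>. \<integral>\<^sup>+z. ennreal ((tree_estimate n z (mondrian lifetime \<xi>) x - cmean \<mu> f (last_box lifetime x \<xi>))\<^sup>2)
      \<partial>Pi\<^sub>M {1..n} (\<lambda>_. P) \<partial>marks_law) \<le>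
    ennreal (3 * C2 / (real n * c0)) * (\<integral>\<^sup>+S. ennreal (1 / measure lborel (clip_box lifetime x S)) \<partial>exp_pair)"
proof -
  let ?V = "\<lambda>p. ennreal (1 / (\<integral>y. indicator (cbox (fst p) (snd p)) y * (1 :: real) \<partial>lborel)) :: ennreal"
  have V: "?V \<in> borel_measurable (borel :: ((real ^ 'd) \<times> (real ^ 'd)) measure)"
    by (intro measurable_compose[OF _ measurable_ennreal] borel_measurable_divide measurable_box_integral borel_measurable_const)
  have m: "measure lborel (cbox l u) = (\<integral>y. indicator (cbox l u) y * (1 :: real) \<partial>lborel)" for l u :: "real ^ 'd" by simp
  have "(\<integral>\<^sup>+\<xi>. \<integral>\<^sup>+z. ennreal ((tree_estimate n z (mondrian lifetime \<xi>) x - cmean \<mu> f (last_box lifetime x \<xi>))\<^sup>2)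
      \<partial>Pi\<^sub>M {1..n} (\<lambda>_. P) \<partial>marks_law) \<le>
    (\<integral>\<^sup>+\<xi>. ennreal (3 * C2 / (real n * c0)) * ?V (low (fst (last_state lifetime x \<xi>)), fst (snd (last_state lifetime x \<xi>))) \<partial>marks_law)"
  proof (rule nn_integral_mono_AE)
    show "AE \<xi> in marks_law. (\<integral>\<^sup>+z. ennreal ((tree_estimate n z (mondrian lifetime \<xi>) x - cmean \<mu> f (last_box lifetime x \<xi>))\<^sup>2)
      \<partial>Pi\<^sub>M {1..n} (\<lambda>_. P)) \<le> ennreal (3 * C2 / (real n * c0)) * ?V (low (fst (last_state lifetime x \<xi>)), fst (snd (last_state lifetime x \<xi>)))"
      using AE_stops[OF x less_imp_le[OF lt]]
      by eventually_elim (use tree_error[OF x _ n] in \<open>simp only: m[symmetric] fst_conv snd_conv\<close>)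
  qed
  also have "\<dots> = ennreal (3 * C2 / (real n * c0)) * (\<integral>\<^sup>+\<xi>. ?V (low (fst (last_state lifetime x \<xi>)), fst (snd (last_state lifetime x \<xi>))) \<partial>marks_law)"
    by (rule nn_integral_cmult[OF measurable_compose[OF measurable_last_pair V]])
  also have "(\<integral>\<^sup>+\<xi>. ?V (low (fst (last_state lifetime x \<xi>)), fst (snd (last_state lifetime x \<xi>))) \<partial>marks_law) =
      (\<integral>\<^sup>+S. ?V (clip_lower lifetime x (fst S), clip_upper lifetime x (snd S)) \<partial>exp_pair)"
    by (rule last_state_law[OF x lt V])
  also have "\<dots> = (\<integral>\<^sup>+S. ennreal (1 / measure lborel (clip_box lifetime x S)) \<partial>exp_pair)"
    by (simp only: clip_box_def m fst_conv snd_conv)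
  finally show ?thesis .
qed

end

section \<open>Risk of the forest\<close>

context regression_model
begin

interpretation P: prob_space P by (rule P(1))

lemma local_bias_law:
  assumes x: "x \<in> box 0 1" and lt: "0 < lifetime"
    and S2: "(\<integral>\<^sup>+S. ennreal ((cmean \<mu> f (clip_box lifetime x S) - \<mu> x)\<^sup>2) \<partial>exp_pair) \<le> ennreal s" and s: "0 \<le> s"
  defines "\<Psi> \<equiv> \<lambda>\<xi>. cmean \<mu> f (last_box lifetime x \<xi>) - \<mu> x"
  shows "integrable marks_law \<Psi>" "integrable marks_law (\<lambda>\<xi>. (\<Psi> \<xi>)\<^sup>2)" "(\<integral>\<xi>. (\<Psi> \<xi>)\<^sup>2 \<partial>marks_law) \<le> s"
    "(\<integral>\<xi>. \<Psi> \<xi> \<partial>marks_law) = (\<integral>S. cmean \<mu> f (clip_box lifetime x S) - \<mu> x \<partial>exp_pair)"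
proof -
  interpret W: prob_space "exp_pair :: (('d \<Rightarrow> real) \<times> ('d \<Rightarrow> real)) measure" by (rule prob_space_exp_pair)
  let ?F = "\<lambda>p. cmean \<mu> f (cbox (fst p) (snd p)) - \<mu> x"
  let ?g = "\<lambda>S. cmean \<mu> f (clip_box lifetime x S) - \<mu> x"
  have F: "?F \<in> borel_measurable borel" "(\<lambda>p. (?F p)\<^sup>2) \<in> borel_measurable borel"
    by (intro borel_measurable_diff borel_measurable_power measurable_cmean_cbox \<mu>_meas f_meas borel_measurable_const)+
  have g: "?g \<in> borel_measurable exp_pair" "(\<lambda>S. (?g S)\<^sup>2) \<in> borel_measurable exp_pair"
    by (intro borel_measurable_diff borel_measurable_power measurable_cmean_clip_box \<mu>_meas f_meas borel_measurable_const)+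
  have gi2: "integrable exp_pair (\<lambda>S. (?g S)\<^sup>2)"
    by (rule integrableI_nonneg[OF g(2)]) (auto intro: le_less_trans[OF S2])
  have gi: "integrable exp_pair ?g" using g(1) gi2 by (rule W.square_integrable_imp_integrable)
  show "integrable marks_law \<Psi>"
    using last_state_law_real(1)[OF x lt F(1)] gi by (simp add: clip_box_def \<Psi>_def)
  show "(\<integral>\<xi>. \<Psi> \<xi> \<partial>marks_law) = (\<integral>S. ?g S \<partial>exp_pair)"
    using last_state_law_real(2)[OF x lt F(1)] gi by (simp add: clip_box_def \<Psi>_def)
  show "integrable marks_law (\<lambda>\<xi>. (\<Psi> \<xi>)\<^sup>2)"
    using last_state_law_real(1)[OF x lt F(2)] gi2 by (simp add: clip_box_def \<Psi>_def)
  have "(\<integral>\<xi>. (\<Psi> \<xi>)\<^sup>2 \<partial>marks_law) = (\<integral>S. (?g S)\<^sup>2 \<partial>exp_pair)"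
    using last_state_law_real(2)[OF x lt F(2)] gi2 by (simp add: clip_box_def \<Psi>_def)
  moreover have "ennreal (\<integral>S. (?g S)\<^sup>2 \<partial>exp_pair) \<le> ennreal s"
    using S2 nn_integral_eq_integral[OF gi2] by simp
  ultimately show "(\<integral>\<xi>. (\<Psi> \<xi>)\<^sup>2 \<partial>marks_law) \<le> s" using s by simp
qed

text \<open>The error is a combination of the deviations of the trees from their conditional means,
  plus a combination of the conditional biases. The former are dependent through the sample and are
  bounded by weighted Cauchy-Schwarz. The latter depend on the marks of one tree each; so mean and
  fluctuation separate, and the fluctuation gains the factor \<open>1 / B\<close>.\<close>

lemma forest_bound:
  fixes a \<omega> :: "nat \<Rightarrow> real" and B :: nat
  assumes x: "x \<in> box 0 1" and lt: "0 < lifetime" and a: "\<And>r. r \<le> J \<Longrightarrow> 0 < a r" and B: "1 \<le> B" and n: "1 \<le> n"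
    and \<omega>: "(\<Sum>r\<le>J. \<omega> r) = 1"
    and N: "\<And>r. r \<le> J \<Longrightarrow> (\<integral>\<^sup>+S. ennreal (1 / measure lborel (clip_box (a r * lifetime) x S)) \<partial>exp_pair) \<le> ennreal \<nu>" "0 \<le> \<nu>"
    and S2: "\<And>r. r \<le> J \<Longrightarrow> (\<integral>\<^sup>+S. ennreal ((cmean \<mu> f (clip_box (a r * lifetime) x S) - \<mu> x)\<^sup>2) \<partial>exp_pair) \<le> ennreal s" "0 \<le> s"
    and m: "\<bar>\<Sum>r\<le>J. \<omega> r * (\<integral>S. cmean \<mu> f (clip_box (a r * lifetime) x S) - \<mu> x \<partial>exp_pair)\<bar> \<le> m"
  shows "forest_sq_error J a \<omega> lifetime B n \<mu> x \<in> borel_measurable (forest_law P J B n)"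
    "(\<integral>\<^sup>+Z. ennreal (forest_sq_error J a \<omega> lifetime B n \<mu> x Z) \<partial>forest_law P J B n) \<le>
      ennreal (2 * (\<Sum>r\<le>J. \<bar>\<omega> r\<bar>)\<^sup>2 * (3 * C2 / (real n * c0) * \<nu>) + 2 * (m\<^sup>2 + (\<Sum>r\<le>J. (\<omega> r)\<^sup>2) * s / real B))"
proof -
  have xc: "x \<in> unit_cube" using x box_subset_cbox by blast
  define I where "I = {1..B} \<times> {..J}"
  let ?D = "Pi\<^sub>M {1..n} (\<lambda>_. P)" and ?M = "Pi\<^sub>M I (\<lambda>_ :: nat \<times> nat. marks_law)"
  interpret D: prob_space ?D by (intro prob_space_PiM P(1))
  interpret marks: prob_space marks_law by (rule prob_space_marks_law)
  interpret M: prob_space ?M by (intro prob_space_PiM prob_space_marks_law)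
  interpret DM: pair_sigma_finite ?D ?M by unfold_locales
  interpret MD: pair_sigma_finite marks_law ?D by unfold_locales
  \<comment> \<open>The pairs of tree and forest index are treated as one family. Its weights sum to
    1, which allows \<mu> x to be subtracted term by term.\<close>
  define c where "c i = \<omega> (snd i) / real B" for i :: "nat \<times> nat"
  define l where "l i = a (snd i) * lifetime" for i :: "nat \<times> nat"
  define est where "est i Z = tree_estimate n (fst Z) (mondrian (l i) (snd Z i)) x"
    for i and Z :: "(nat \<Rightarrow> (real ^ 'd) \<times> real) \<times> (nat \<times> nat \<Rightarrow> bool list \<Rightarrow> mark)"
  define \<Theta> where "\<Theta> i \<xi> = cmean \<mu> f (last_box (l i) x \<xi>)" for i \<xi>
  define \<Omega> where "\<Omega> = (\<Sum>r\<le>J. \<bar>\<omega> r\<bar>)"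
  have finI: "finite I" by (simp add: I_def)
  have rB: "0 < real B" using B by simp
  have sumI: "(\<Sum>i\<in>I. h (snd i) / real B) = (\<Sum>r\<le>J. h r)" for h :: "nat \<Rightarrow> real"
  proof -
    have "(\<Sum>i\<in>I. h (snd i) / real B) = (\<Sum>b=1..B. \<Sum>r\<le>J. h r / real B)"
      unfolding I_def by (subst sum.cartesian_product) (simp add: split_beta)
    also have "\<dots> = (\<Sum>r\<le>J. h r)" using rB by (simp flip: sum_divide_distrib)
    finally show ?thesis .
  qed
  have li: "0 < l i" and Ji: "snd i \<le> J" if "i \<in> I" for i
    using that a lt by (auto simp: I_def l_def)
  have law: "forest_law P J B n = ?D \<Otimes>\<^sub>M ?M" by (simp add: forest_law_def I_def)
  have deb: "debiased_forest J a \<omega> lifetime B n x Z = (\<Sum>i\<in>I. c i * est i Z)" for Z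
  proof -
    have "(\<Sum>i\<in>I. c i * est i Z) = (\<Sum>b=1..B. \<Sum>r\<le>J. c (b, r) * est (b, r) Z)"
      unfolding I_def by (subst sum.cartesian_product) (simp add: split_beta)
    also have "\<dots> = (\<Sum>r\<le>J. \<Sum>b=1..B. c (b, r) * est (b, r) Z)" by (rule sum.swap)
    also have "\<dots> = debiased_forest J a \<omega> lifetime B n x Z"
      by (simp add: debiased_forest_def debiased_estimate_def split_beta c_def est_def l_def sum_distrib_left sum_divide_distrib)
    finally show ?thesis ..
  qed
  have zm: "(\<lambda>Z. fst Z i) \<in> measurable (?D \<Otimes>\<^sub>M ?M) P" if "i \<in> {1..n}" for i
    by (rule measurable_compose[OF measurable_fst measurable_component_singleton[OF that]])
  have \<xi>m: "(\<lambda>Z. snd Z i) \<in> measurable (?D \<Otimes>\<^sub>M ?M) marks_law" if "i \<in> I" for i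
    by (rule measurable_compose[OF measurable_snd measurable_component_singleton[OF that]])
  have est_m: "est i \<in> borel_measurable (?D \<Otimes>\<^sub>M ?M)" if "i \<in> I" for i
    unfolding est_def[abs_def] by (rule measurable_tree_estimate[OF P(2) xc zm \<xi>m[OF that]])
  have \<Theta>_m: "(\<lambda>Z. \<Theta> i (snd Z i)) \<in> borel_measurable (?D \<Otimes>\<^sub>M ?M)" if "i \<in> I" for i
    unfolding \<Theta>_def by (rule measurable_compose[OF \<xi>m[OF that] measurable_local_mean])
  have \<Theta>_m': "(\<lambda>\<xi>. \<Theta> i \<xi> - \<mu> x) \<in> borel_measurable marks_law" for i
    unfolding \<Theta>_def by (intro borel_measurable_diff measurable_local_mean borel_measurable_const)
  show err_m: "forest_sq_error J a \<omega> lifetime B n \<mu> x \<in> borel_measurable (forest_law P J B n)"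
    unfolding forest_sq_error_def[abs_def] deb law
    by (intro borel_measurable_power borel_measurable_diff borel_measurable_sum borel_measurable_times est_m borel_measurable_const)
  let ?e1 = "\<lambda>i Z. (est i Z - \<Theta> i (snd Z i))\<^sup>2"
  let ?e2 = "\<lambda>\<Xi>. (\<Sum>i\<in>I. c i * (\<Theta> i (\<Xi> i) - \<mu> x))\<^sup>2"
  have cs: "(\<Sum>i\<in>I. c i) = 1" using sumI[of \<omega>] \<omega> by (simp add: c_def)
  have cabs: "(\<Sum>i\<in>I. \<bar>c i\<bar>) = \<Omega>" using sumI[of "\<lambda>r. \<bar>\<omega> r\<bar>"] rB by (simp add: c_def \<Omega>_def)
  have \<Omega>0: "0 \<le> \<Omega>" unfolding \<Omega>_def by (intro sum_nonneg) simp
  \<comment> \<open>Only the first part carries the factor \<Omega>: the second keeps its square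
    whole, so that signs and independence are not lost.\<close>
  have pw: "forest_sq_error J a \<omega> lifetime B n \<mu> x Z \<le> (\<Sum>i\<in>I. 2 * \<Omega> * \<bar>c i\<bar> * ?e1 i Z) + 2 * ?e2 (snd Z)" for Z
  proof -
    let ?u = "\<Sum>i\<in>I. c i * (est i Z - \<Theta> i (snd Z i))" and ?v = "\<Sum>i\<in>I. c i * (\<Theta> i (snd Z i) - \<mu> x)"
    have "?u + ?v = (\<Sum>i\<in>I. c i * est i Z - c i * \<mu> x)"
      unfolding sum.distrib[symmetric] by (intro sum.cong refl) (simp add: algebra_simps)
    also have "\<dots> = (\<Sum>i\<in>I. c i * est i Z) - \<mu> x"
      by (simp add: sum_subtractf cs flip: sum_distrib_right)
    finally have "forest_sq_error J a \<omega> lifetime B n \<mu> x Z = (?u + ?v)\<^sup>2" by (simp add: forest_sq_error_def deb)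
    also have "\<dots> \<le> 2 * ?u\<^sup>2 + 2 * ?v\<^sup>2"
      using zero_le_power2[of "?u - ?v"] by (simp add: power2_sum power2_diff)
    also have "?u\<^sup>2 \<le> \<Omega> * (\<Sum>i\<in>I. \<bar>c i\<bar> * ?e1 i Z)"
      unfolding cabs[symmetric] by (rule weighted_square_le)
    finally show ?thesis by (simp add: sum_distrib_left mult.assoc)
  qed
  have e1_m: "(\<lambda>Z. ennreal (2 * \<Omega> * \<bar>c i\<bar> * ?e1 i Z)) \<in> borel_measurable (?D \<Otimes>\<^sub>M ?M)" if "i \<in> I" for i
    by (intro measurable_compose[OF _ measurable_ennreal] borel_measurable_times borel_measurable_power borel_measurable_diff
        est_m \<Theta>_m that borel_measurable_const)
  have e2_m': "?e2 \<in> borel_measurable ?M"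
  proof -
    have "(\<lambda>\<Xi>. \<Theta> i (\<Xi> i) - \<mu> x) \<in> borel_measurable ?M" if "i \<in> I" for i
      by (rule measurable_compose[OF measurable_component_singleton[OF that] \<Theta>_m'])
    then show ?thesis
      by (intro borel_measurable_power borel_measurable_sum borel_measurable_times borel_measurable_const)
  qed
  have e2_m: "(\<lambda>Z. ennreal (2 * ?e2 (snd Z))) \<in> borel_measurable (?D \<Otimes>\<^sub>M ?M)"
    by (intro measurable_compose[OF _ measurable_ennreal] borel_measurable_times borel_measurable_const
        measurable_compose[OF measurable_snd e2_m'])
  have E1: "(\<integral>\<^sup>+Z. ennreal (?e1 i Z) \<partial>(?D \<Otimes>\<^sub>M ?M)) \<le> ennreal (3 * C2 / (real n * c0) * \<nu>)" if i: "i \<in> I" for i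
  proof -
    \<comment> \<open>Marks are integrated last: with them fixed the tree is fixed, and only the
      marks of tree i matter.\<close>
    define H where "H \<xi> = (\<integral>\<^sup>+z. ennreal ((tree_estimate n z (mondrian (l i) \<xi>) x - \<Theta> i \<xi>)\<^sup>2) \<partial>?D)" for \<xi>
    have Hm: "H \<in> borel_measurable marks_law"
    proof -
      have "(\<lambda>w. ennreal ((tree_estimate n (snd w) (mondrian (l i) (fst w)) x - \<Theta> i (fst w))\<^sup>2)) \<in> borel_measurable (marks_law \<Otimes>\<^sub>M ?D)"
        unfolding \<Theta>_def
        by (intro measurable_compose[OF _ measurable_ennreal] borel_measurable_power borel_measurable_diff
            measurable_tree_estimate[OF P(2) xc] measurable_fst measurable_compose[OF measurable_fst measurable_local_mean]
            measurable_compose[OF measurable_snd measurable_component_singleton])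
      from D.borel_measurable_nn_integral_fst[OF this] show ?thesis by (simp add: H_def[abs_def])
    qed
    have e1: "(\<lambda>Z. ennreal (?e1 i Z)) \<in> borel_measurable (?D \<Otimes>\<^sub>M ?M)"
      by (intro measurable_compose[OF _ measurable_ennreal] borel_measurable_power borel_measurable_diff est_m \<Theta>_m i)
    have "(\<integral>\<^sup>+Z. ennreal (?e1 i Z) \<partial>(?D \<Otimes>\<^sub>M ?M)) = (\<integral>\<^sup>+\<Xi>. \<integral>\<^sup>+z. ennreal (?e1 i (z, \<Xi>)) \<partial>?D \<partial>?M)"
      by (rule DM.nn_integral_snd[symmetric, OF e1])
    also have "\<dots> = (\<integral>\<^sup>+\<Xi>. H (\<Xi> i) \<partial>?M)" by (simp add: H_def est_def)
    also have "\<dots> = (\<integral>\<^sup>+\<xi>. H \<xi> \<partial>distr ?M marks_law (\<lambda>\<Xi>. \<Xi> i))"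
      by (rule nn_integral_distr[symmetric, OF measurable_component_singleton[OF i]]) (simp add: Hm)
    also have "distr ?M marks_law (\<lambda>\<Xi>. \<Xi> i) = marks_law"
      by (rule distr_PiM_component[OF prob_space_marks_law i])
    also have "(\<integral>\<^sup>+\<xi>. H \<xi> \<partial>marks_law) \<le> ennreal (3 * C2 / (real n * c0)) * (\<integral>\<^sup>+S. ennreal (1 / measure lborel (clip_box (l i) x S)) \<partial>exp_pair)"
      unfolding H_def \<Theta>_def by (rule tree_error_mean[OF x li[OF i] n])
    also have "\<dots> \<le> ennreal (3 * C2 / (real n * c0)) * ennreal \<nu>"
      unfolding l_def by (intro mult_left_mono N(1) Ji[OF i]) simp
    also have "\<dots> = ennreal (3 * C2 / (real n * c0) * \<nu>)"
      using C2(1) c0(1) N(2) by (intro ennreal_mult[symmetric]) auto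
    finally show ?thesis .
  qed
  have E2: "(\<integral>\<^sup>+\<Xi>. ennreal (?e2 \<Xi>) \<partial>?M) \<le> ennreal (m\<^sup>2 + (\<Sum>r\<le>J. (\<omega> r)\<^sup>2) * s / real B)"
  proof -
    let ?b = "\<lambda>r. \<integral>S. cmean \<mu> f (clip_box (a r * lifetime) x S) - \<mu> x \<partial>exp_pair"
    note lb = local_bias_law[OF x li S2(1)[OF Ji, folded l_def] S2(2), folded \<Theta>_def]
    have "(\<integral>\<^sup>+\<Xi>. ennreal (?e2 \<Xi>) \<partial>?M) \<le>
      ennreal ((\<Sum>i\<in>I. \<integral>\<xi>. c i * (\<Theta> i \<xi> - \<mu> x) \<partial>marks_law)\<^sup>2 + (\<Sum>i\<in>I. \<integral>\<xi>. (c i * (\<Theta> i \<xi> - \<mu> x))\<^sup>2 \<partial>marks_law))"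
      using lb(1,2) by (intro product_sum_square_le[OF prob_space_marks_law finI, where g = "\<lambda>i \<xi>. c i * (\<Theta> i \<xi> - \<mu> x)"])
        (simp_all add: power_mult_distrib)
    also have "\<dots> \<le> ennreal (m\<^sup>2 + (\<Sum>r\<le>J. (\<omega> r)\<^sup>2) * s / real B)"
    proof (rule ennreal_leI, rule add_mono)
      have "(\<Sum>i\<in>I. \<integral>\<xi>. c i * (\<Theta> i \<xi> - \<mu> x) \<partial>marks_law) = (\<Sum>i\<in>I. \<omega> (snd i) * ?b (snd i) / real B)"
      proof (intro sum.cong refl)
        fix i assume i: "i \<in> I"
        show "(\<integral>\<xi>. c i * (\<Theta> i \<xi> - \<mu> x) \<partial>marks_law) = \<omega> (snd i) * ?b (snd i) / real B"
          using lb(4)[OF i i] by (simp add: c_def l_def)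
      qed
      also have "\<dots> = (\<Sum>r\<le>J. \<omega> r * ?b r)" by (rule sumI)
      finally have "\<bar>\<Sum>i\<in>I. \<integral>\<xi>. c i * (\<Theta> i \<xi> - \<mu> x) \<partial>marks_law\<bar> \<le> m" using m by simp
      then show "(\<Sum>i\<in>I. \<integral>\<xi>. c i * (\<Theta> i \<xi> - \<mu> x) \<partial>marks_law)\<^sup>2 \<le> m\<^sup>2" using power_mono[OF _ abs_ge_zero, of _ m 2] by fastforce
      \<comment> \<open>The squared weight has \<open>B ^ 2\<close> below, and summation over B
        trees gives one B back.\<close>
      have "(\<Sum>i\<in>I. \<integral>\<xi>. (c i * (\<Theta> i \<xi> - \<mu> x))\<^sup>2 \<partial>marks_law) \<le> (\<Sum>i\<in>I. ((\<omega> (snd i))\<^sup>2 * s / real B) / real B)"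
      proof (rule sum_mono)
        fix i assume i: "i \<in> I"
        have "(\<integral>\<xi>. (c i * (\<Theta> i \<xi> - \<mu> x))\<^sup>2 \<partial>marks_law) = (c i)\<^sup>2 * (\<integral>\<xi>. (\<Theta> i \<xi> - \<mu> x)\<^sup>2 \<partial>marks_law)"
          by (simp add: power_mult_distrib)
        also have "\<dots> \<le> (c i)\<^sup>2 * s" using lb(3)[OF i i] by (intro mult_left_mono) auto
        finally show "(\<integral>\<xi>. (c i * (\<Theta> i \<xi> - \<mu> x))\<^sup>2 \<partial>marks_law) \<le> ((\<omega> (snd i))\<^sup>2 * s / real B) / real B"
          by (simp add: c_def power_divide power2_eq_square)
      qed
      also have "\<dots> = (\<Sum>r\<le>J. (\<omega> r)\<^sup>2 * s / real B)" by (rule sumI)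
      finally show "(\<Sum>i\<in>I. \<integral>\<xi>. (c i * (\<Theta> i \<xi> - \<mu> x))\<^sup>2 \<partial>marks_law) \<le> (\<Sum>r\<le>J. (\<omega> r)\<^sup>2) * s / real B"
        by (simp add: sum_distrib_right sum_divide_distrib)
    qed
    finally show ?thesis .
  qed
  define k where "k = 3 * C2 / (real n * c0) * \<nu>"
  have k0: "0 \<le> k" using C2(1) c0(1) N(2) by (simp add: k_def)
  have "(\<integral>\<^sup>+Z. ennreal (forest_sq_error J a \<omega> lifetime B n \<mu> x Z) \<partial>forest_law P J B n) \<le>
    (\<integral>\<^sup>+Z. (\<Sum>i\<in>I. ennreal (2 * \<Omega> * \<bar>c i\<bar> * ?e1 i Z)) + ennreal (2 * ?e2 (snd Z)) \<partial>(?D \<Otimes>\<^sub>M ?M))"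
    unfolding law
  proof (rule nn_integral_mono)
    fix Z
    have "(\<Sum>i\<in>I. ennreal (2 * \<Omega> * \<bar>c i\<bar> * ?e1 i Z)) + ennreal (2 * ?e2 (snd Z)) =
        ennreal ((\<Sum>i\<in>I. 2 * \<Omega> * \<bar>c i\<bar> * ?e1 i Z) + 2 * ?e2 (snd Z))"
      using \<Omega>0 by (simp add: sum_ennreal sum_nonneg)
    then show "ennreal (forest_sq_error J a \<omega> lifetime B n \<mu> x Z) \<le>
        (\<Sum>i\<in>I. ennreal (2 * \<Omega> * \<bar>c i\<bar> * ?e1 i Z)) + ennreal (2 * ?e2 (snd Z))"
      using pw[of Z] by (simp only: ennreal_leI)
  qed
  also have "\<dots> = (\<integral>\<^sup>+Z. (\<Sum>i\<in>I. ennreal (2 * \<Omega> * \<bar>c i\<bar> * ?e1 i Z)) \<partial>(?D \<Otimes>\<^sub>M ?M)) +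
      (\<integral>\<^sup>+Z. ennreal (2 * ?e2 (snd Z)) \<partial>(?D \<Otimes>\<^sub>M ?M))"
    by (rule nn_integral_add[OF borel_measurable_sum[OF e1_m] e2_m])
  also have "\<dots> = (\<Sum>i\<in>I. \<integral>\<^sup>+Z. ennreal (2 * \<Omega> * \<bar>c i\<bar> * ?e1 i Z) \<partial>(?D \<Otimes>\<^sub>M ?M)) +
      (\<integral>\<^sup>+Z. ennreal (2 * ?e2 (snd Z)) \<partial>(?D \<Otimes>\<^sub>M ?M))"
    by (subst nn_integral_sum[OF e1_m]) (assumption | rule refl)+
  also have "\<dots> \<le> (\<Sum>i\<in>I. ennreal (2 * \<Omega> * \<bar>c i\<bar> * k)) + ennreal (2 * (m\<^sup>2 + (\<Sum>r\<le>J. (\<omega> r)\<^sup>2) * s / real B))"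
  proof (intro add_mono sum_mono)
    fix i assume i: "i \<in> I"
    have e1: "(\<lambda>Z. ennreal (?e1 i Z)) \<in> borel_measurable (?D \<Otimes>\<^sub>M ?M)"
      by (intro measurable_compose[OF _ measurable_ennreal] borel_measurable_power borel_measurable_diff est_m \<Theta>_m i)
    have "(\<integral>\<^sup>+Z. ennreal (2 * \<Omega> * \<bar>c i\<bar> * ?e1 i Z) \<partial>(?D \<Otimes>\<^sub>M ?M)) =
        ennreal (2 * \<Omega> * \<bar>c i\<bar>) * (\<integral>\<^sup>+Z. ennreal (?e1 i Z) \<partial>(?D \<Otimes>\<^sub>M ?M))"
      using \<Omega>0 by (subst nn_integral_cmult[OF e1, symmetric]) (simp add: ennreal_mult')
    also have "\<dots> \<le> ennreal (2 * \<Omega> * \<bar>c i\<bar>) * ennreal k" by (intro mult_left_mono E1[folded k_def] i) simp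
    also have "\<dots> = ennreal (2 * \<Omega> * \<bar>c i\<bar> * k)" using \<Omega>0 k0 by (intro ennreal_mult[symmetric]) auto
    finally show "(\<integral>\<^sup>+Z. ennreal (2 * \<Omega> * \<bar>c i\<bar> * ?e1 i Z) \<partial>(?D \<Otimes>\<^sub>M ?M)) \<le> ennreal (2 * \<Omega> * \<bar>c i\<bar> * k)" .
  next
    have e2: "(\<lambda>\<Xi>. ennreal (?e2 \<Xi>)) \<in> borel_measurable ?M" by (rule measurable_compose[OF e2_m' measurable_ennreal])
    have "(\<integral>\<^sup>+Z. ennreal (2 * ?e2 (snd Z)) \<partial>(?D \<Otimes>\<^sub>M ?M)) = (\<integral>\<^sup>+\<Xi>. \<integral>\<^sup>+z. ennreal (2 * ?e2 (snd (z, \<Xi>))) \<partial>?D \<partial>?M)"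
      by (rule DM.nn_integral_snd[symmetric, OF e2_m])
    also have "\<dots> = (\<integral>\<^sup>+\<Xi>. 2 * ennreal (?e2 \<Xi>) \<partial>?M)"
      using D.emeasure_space_1 by (simp add: ennreal_mult')
    also have "\<dots> = 2 * (\<integral>\<^sup>+\<Xi>. ennreal (?e2 \<Xi>) \<partial>?M)" by (rule nn_integral_cmult[OF e2])
    also have "\<dots> \<le> 2 * ennreal (m\<^sup>2 + (\<Sum>r\<le>J. (\<omega> r)\<^sup>2) * s / real B)" by (intro mult_left_mono E2) simp
    finally show "(\<integral>\<^sup>+Z. ennreal (2 * ?e2 (snd Z)) \<partial>(?D \<Otimes>\<^sub>M ?M)) \<le> ennreal (2 * (m\<^sup>2 + (\<Sum>r\<le>J. (\<omega> r)\<^sup>2) * s / real B))"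
      by (simp only: ennreal_mult' ennreal_numeral zero_le_numeral)
  qed
  also have "(\<Sum>i\<in>I. ennreal (2 * \<Omega> * \<bar>c i\<bar> * k)) = ennreal (\<Sum>i\<in>I. 2 * \<Omega> * \<bar>c i\<bar> * k)"
    using \<Omega>0 k0 by (intro sum_ennreal) simp
  also have "(\<Sum>i\<in>I. 2 * \<Omega> * \<bar>c i\<bar> * k) = 2 * \<Omega>\<^sup>2 * k"
    by (simp only: sum_distrib_right[symmetric] sum_distrib_left[symmetric] cabs power2_eq_square mult.assoc)
  also have "ennreal (2 * \<Omega>\<^sup>2 * k) + ennreal (2 * (m\<^sup>2 + (\<Sum>r\<le>J. (\<omega> r)\<^sup>2) * s / real B)) =
      ennreal (2 * \<Omega>\<^sup>2 * k + 2 * (m\<^sup>2 + (\<Sum>r\<le>J. (\<omega> r)\<^sup>2) * s / real B))"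
    using k0 S2(2) by (intro ennreal_plus[symmetric]) (auto intro!: mult_nonneg_nonneg add_nonneg_nonneg divide_nonneg_nonneg sum_nonneg)
  finally show "(\<integral>\<^sup>+Z. ennreal (forest_sq_error J a \<omega> lifetime B n \<mu> x Z) \<partial>forest_law P J B n) \<le>
      ennreal (2 * (\<Sum>r\<le>J. \<bar>\<omega> r\<bar>)\<^sup>2 * (3 * C2 / (real n * c0) * \<nu>) + 2 * (m\<^sup>2 + (\<Sum>r\<le>J. (\<omega> r)\<^sup>2) * s / real B))"
    by (simp only: \<Omega>_def k_def)
qed

end

text \<open>The relation concerns every n from 1 on, but finitely many quotients are always bounded,
  so an eventual estimate suffices.\<close>

lemma lesssimI:
  fixes a b :: "nat \<Rightarrow> real"
  assumes "eventually (\<lambda>n. a n \<le> C * b n) sequentially" "\<forall>n\<ge>1. 0 < b n"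
  shows "a \<lesssim> b"
proof -
  obtain N where N: "\<And>n. N \<le> n \<Longrightarrow> a n \<le> C * b n" using assms(1) by (auto simp: eventually_sequentially)
  have "bdd_above ((\<lambda>n. a n / b n) ` {1..<N})" by (intro bdd_above_finite) simp
  moreover have "bdd_above ((\<lambda>n. a n / b n) ` ({1..} \<inter> {N..}))"
    using N assms(2) by (intro bdd_aboveI2[of _ _ C]) (auto simp: pos_divide_le_eq)
  ultimately have "bdd_above ((\<lambda>n. a n / b n) ` {1..<N} \<union> (\<lambda>n. a n / b n) ` ({1..} \<inter> {N..}))" by simp
  moreover have "{1..} = {1..<N} \<union> ({1..} \<inter> {N..})" by auto
  ultimately show ?thesis unfolding lesssim_def by (metis image_Un)
qed

lemma lesssimE:
  fixes a b :: "nat \<Rightarrow> real"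
  assumes "a \<lesssim> b" "\<forall>n\<ge>1. 0 < b n"
  obtains C where "1 \<le> C" "\<And>n. 1 \<le> n \<Longrightarrow> a n \<le> C * b n"
proof -
  obtain C where C: "\<And>n. 1 \<le> n \<Longrightarrow> a n / b n \<le> C"
    using assms(1) unfolding lesssim_def bdd_above_def by auto
  show thesis
  proof (rule that[of "max 1 C"])
    fix n :: nat assume n: "1 \<le> n"
    then have "a n \<le> C * b n" using C[OF n] assms(2) by (simp add: pos_divide_le_eq)
    also have "\<dots> \<le> max 1 C * b n" using assms(2) n by (intro mult_right_mono) (auto intro: less_imp_le)
    finally show "a n \<le> max 1 C * b n" .
  qed simp
qed

lemma eventually_lifetime_ge_one:
  fixes lam :: "nat \<Rightarrow> real"
  assumes "(\<lambda>n. ln (real n) ^ 3) \<lesssim> lam" "\<forall>n\<ge>1. 0 < lam n"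
  shows "eventually (\<lambda>n. 1 \<le> lam n) sequentially"
proof -
  obtain C where C: "1 \<le> C" "\<And>n. 1 \<le> n \<Longrightarrow> ln (real n) ^ 3 \<le> C * lam n" using lesssimE[OF assms] by metis
  \<comment> \<open>With a constant C of at least 1 in the lower bound, \<open>exp C \<le> n\<close>
    gives \<open>C \<le> C ^ 3 \<le> ln n ^ 3 \<le> C * lam n\<close>.\<close>
  show ?thesis
    using eventually_ge_at_top[of "max 1 (nat \<lceil>exp C\<rceil>)"]
  proof eventually_elim
    case (elim n)
    then have n: "1 \<le> n" "exp C \<le> real n" by linarith+
    then have "C \<le> ln (real n)" by (subst ln_ge_iff) auto
    then have "C ^ 3 \<le> ln (real n) ^ 3" using C(1) by (intro power_mono) auto
    moreover have "C \<le> C ^ 3" using C(1) power_increasing[of 1 3 C] by simp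
    ultimately have "C * 1 \<le> C * lam n" using C(2)[OF n(1)] by linarith
    then show ?case using C(1) by (simp only: mult_le_cancel_left)
  qed
qed

text \<open>The constant is chosen before n, the number of trees and the lifetime, so that it serves
  whole sequences. Integrability is obtained for every positive lifetime, the rate for lifetimes
  from 1 on, where smaller exponents dominate.\<close>

lemma forest_risk_bound:
  fixes P :: "((real ^ 'd) \<times> real) measure"
    and f \<mu> :: "real ^ 'd \<Rightarrow> real"
    and \<beta>\<^sub>f \<beta>\<^sub>\<mu> \<beta> :: real
    and J :: nat and a \<omega> :: "nat \<Rightarrow> real"
    and x :: "real ^ 'd"
  assumes P: "prob_space P" "sets P = sets borel"
    and density: "distributed P lborel fst (\<lambda>y. ennreal (f y) * indicator unit_cube y)"
    and density_bounded_below: "\<exists>c>0. \<forall>y\<in>unit_cube. c \<le> f y"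
    and density_holder: "\<beta>\<^sub>f > 0" "f \<in> holder_class \<beta>\<^sub>f"
    and second_moment: "\<exists>C::real. AE z in P.
          nn_cond_exp P (sigma_X P) (\<lambda>z. ennreal ((snd z)\<^sup>2)) z \<le> ennreal C"
    and regression: "AE z in P. real_cond_exp P (sigma_X P) snd z = \<mu> (fst z)"
    and regression_holder: "\<beta>\<^sub>\<mu> > 0" "\<mu> \<in> holder_class \<beta>\<^sub>\<mu>"
    and \<beta>: "\<beta> = min \<beta>\<^sub>\<mu> (\<beta>\<^sub>f + 1)"
    and a: "\<forall>r\<le>J. a r > 0"
    and \<omega>: "debiasing_weights J a \<omega>"
    and x: "x \<in> box 0 1"
  obtains C where "0 \<le> C"
    "\<And>n B lifetime. 1 \<le> n \<Longrightarrow> 1 \<le> B \<Longrightarrow> 0 < lifetime \<Longrightarrow>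
      integrable (forest_law P J B n) (forest_sq_error J a \<omega> lifetime B n \<mu> x)"
    "\<And>n B lifetime. 1 \<le> n \<Longrightarrow> 1 \<le> B \<Longrightarrow> 1 \<le> lifetime \<Longrightarrow>
      (\<integral>Z. forest_sq_error J a \<omega> lifetime B n \<mu> x Z \<partial>forest_law P J B n) \<le>
      C * (lifetime ^ CARD('d) / real n + 1 / lifetime powr (2 * min (2 * real J + 2) \<beta>) +
        1 / (lifetime powr (2 * min 1 \<beta>) * real B))"
proof -
  \<comment> \<open>Values outside the cube are arbitrary. Cutting them off gives Borel functions on
    the whole space, and changes neither the law, the Hoelder classes nor the value at x.\<close>
  define f' where "f' y = indicator unit_cube y * f y" for y
  define \<mu>' where "\<mu>' y = indicator unit_cube y * \<mu> y" for y
  have f'c: "f' y = f y" and \<mu>'c: "\<mu>' y = \<mu> y" if "y \<in> unit_cube" for y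
    using that by (auto simp: f'_def \<mu>'_def)
  have xc: "x \<in> unit_cube" using x box_subset_cbox by blast
  have f'h: "f' \<in> holder_class \<beta>\<^sub>f" by (rule holder_class_cong[OF density_holder(2)]) (simp add: f'c)
  have \<mu>'h: "\<mu>' \<in> holder_class \<beta>\<^sub>\<mu>" by (rule holder_class_cong[OF regression_holder(2)]) (simp add: \<mu>'c)
  have f'm: "f' \<in> borel_measurable borel"
    using borel_measurable_continuous_on_indicator[OF _ holder_continuous[OF density_holder(2,1)]]
    by (simp add: f'_def[abs_def])
  have \<mu>'m: "\<mu>' \<in> borel_measurable borel"
    using borel_measurable_continuous_on_indicator[OF _ holder_continuous[OF regression_holder(2,1)]]
    by (simp add: \<mu>'_def[abs_def])
  obtain c0 where c0: "0 < c0" "\<And>y. y \<in> unit_cube \<Longrightarrow> c0 \<le> f' y" using density_bounded_below by (auto simp: f'c)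
  obtain Mf where Mf: "\<And>y. y \<in> unit_cube \<Longrightarrow> \<bar>f' y\<bar> \<le> Mf" using holder_bounded[OF f'h density_holder(1)] by metis
  obtain C2 where C2: "AE z in P. nn_cond_exp P (sigma_X P) (\<lambda>z. ennreal ((snd z)\<^sup>2)) z \<le> ennreal C2"
    using second_moment by blast
  interpret regression_model P f' \<mu>' c0 Mf "max 0 C2"
  proof (rule regression_model.intro)
    have "(\<lambda>y. ennreal (f y) * indicator unit_cube y) = (\<lambda>y. ennreal (indicator unit_cube y * f' y))"
      by (auto simp: fun_eq_iff f'_def indicator_def)
    then show "distributed P lborel fst (\<lambda>y. ennreal (indicator unit_cube y * f' y))" using density by simp
    show "AE z in P. nn_cond_exp P (sigma_X P) (\<lambda>z. ennreal ((snd z)\<^sup>2)) z \<le> ennreal (max 0 C2)"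
      using C2 by eventually_elim (auto intro: order_trans ennreal_leI)
    show "AE z in P. fst z \<in> unit_cube \<longrightarrow> real_cond_exp P (sigma_X P) snd z = \<mu>' (fst z)"
      using regression by eventually_elim (simp add: \<mu>'c)
  qed (fact P c0 Mf f'm \<mu>'m max.cobounded1)+
  define d where "d = CARD('d)"
  define b1 where "b1 = min 1 \<beta>\<^sub>\<mu>"
  \<comment> \<open>Because \<open>\<beta>\<^sub>f + 1\<close> exceeds 1, it does not affect the
    minimum with 1.\<close>
  have b1: "b1 = min 1 \<beta>" using density_holder(1) by (simp add: b1_def \<beta> min_def)
  define M where "M = min (2 * real J + 2) \<beta>"
  have \<omega>1: "(\<Sum>r\<le>J. \<omega> r) = 1" using \<omega> by (simp add: debiasing_weights_def)
  obtain Cs where Cs: "0 \<le> Cs" "\<And>lifetime. 0 < lifetime \<Longrightarrow>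
    (\<integral>\<^sup>+S. ennreal ((cmean \<mu>' f' (clip_box lifetime x S) - \<mu>' x)\<^sup>2) \<partial>exp_pair) \<le> ennreal (Cs * lifetime powr (- 2 * b1))"
    using bias_second_moment[OF \<mu>'h regression_holder(1) \<mu>'m f'm c0 Mf x] by (auto simp: b1_def)
  obtain Cm where Cm: "0 \<le> Cm" "\<And>lifetime. 1 \<le> lifetime \<Longrightarrow>
    \<bar>\<Sum>r\<le>J. \<omega> r * (\<integral>S. cmean \<mu>' f' (clip_box (a r * lifetime) x S) - \<mu>' x \<partial>exp_pair)\<bar> \<le> Cm * lifetime powr (- M)"
    using debiased_mean_bias[OF \<mu>'h regression_holder(1) \<mu>'m f'h density_holder(1) f'm c0 Mf x \<beta> a \<omega>] by (auto simp: M_def)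
  \<comment> \<open>The smallest factor keeps the lifetimes \<open>a r * lifetime\<close> of the
    forests away from zero, as the bound on the inverse volume requires; the largest bounds their
    powers.\<close>
  define al where "al = Min (a ` {..J})"
  have al: "0 < al" "\<And>r. r \<le> J \<Longrightarrow> al \<le> a r" using a by (auto simp: al_def)
  define au where "au = Max (a ` {..J})"
  have au: "\<And>r. r \<le> J \<Longrightarrow> a r \<le> au" by (auto simp: au_def)
  define wa where "wa = (\<Sum>r\<le>J. a r powr (- 2 * b1))"
  have wa: "a r powr (- 2 * b1) \<le> wa" if "r \<le> J" for r
    unfolding wa_def using that by (intro member_le_sum) auto
  have wa0: "0 \<le> wa" unfolding wa_def by (intro sum_nonneg) simp
  have S2: "(\<integral>\<^sup>+S. ennreal ((cmean \<mu>' f' (clip_box (a r * lifetime) x S) - \<mu>' x)\<^sup>2) \<partial>exp_pair)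
      \<le> ennreal (Cs * wa * lifetime powr (- 2 * b1))" if r: "r \<le> J" and lt: "0 < lifetime" for r lifetime
  proof -
    have ar: "0 < a r" using a r by simp
    have "Cs * (a r * lifetime) powr (- 2 * b1) = Cs * a r powr (- 2 * b1) * lifetime powr (- 2 * b1)"
      using ar lt by (simp add: powr_mult)
    also have "\<dots> \<le> Cs * wa * lifetime powr (- 2 * b1)"
      using Cs(1) wa[OF r] by (intro mult_right_mono mult_left_mono) auto
    finally show ?thesis using Cs(2)[of "a r * lifetime"] ar lt by (meson ennreal_leI mult_pos_pos order_trans)
  qed
  have a': "\<And>r. r \<le> J \<Longrightarrow> 0 < a r" using a by simp
  define \<Omega> where "\<Omega> = (\<Sum>r\<le>J. \<bar>\<omega> r\<bar>)"
  define \<omega>2 where "\<omega>2 = (\<Sum>r\<le>J. (\<omega> r)\<^sup>2)"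
  have \<omega>20: "0 \<le> \<omega>2" unfolding \<omega>2_def by (intro sum_nonneg) simp
  have err0: "0 \<le> forest_sq_error J a \<omega> lifetime B n \<mu> x Z" for lifetime B n Z by (simp add: forest_sq_error_def)
  have err: "forest_sq_error J a \<omega> lifetime B n \<mu>' x = forest_sq_error J a \<omega> lifetime B n \<mu> x" for lifetime B n
    by (simp add: fun_eq_iff forest_sq_error_def \<mu>'c[OF xc])
  have int: "integrable (forest_law P J B n) (forest_sq_error J a \<omega> lifetime B n \<mu> x)"
    if n: "1 \<le> n" and B: "1 \<le> B" and lt: "0 < lifetime" for n B lifetime
  proof -
    have l0: "0 < al * lifetime" using al lt by simp
    \<comment> \<open>This constant may depend on the lifetime, as only finiteness is at stake here;
      a uniform one follows for lifetimes from 1 on.\<close>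
    obtain Cv where Cv: "0 \<le> Cv" "\<And>l. al * lifetime \<le> l \<Longrightarrow>
      (\<integral>\<^sup>+S. ennreal (1 / measure lborel (clip_box l x S)) \<partial>exp_pair) \<le> ennreal (Cv * l ^ CARD('d))"
      using inverse_volume_bound[OF x l0] by metis
    have N: "(\<integral>\<^sup>+S. ennreal (1 / measure lborel (clip_box (a r * lifetime) x S)) \<partial>exp_pair) \<le> ennreal (Cv * (au * lifetime) ^ CARD('d))"
      if r: "r \<le> J" for r
    proof -
      have "Cv * (a r * lifetime) ^ CARD('d) \<le> Cv * (au * lifetime) ^ CARD('d)"
        using Cv(1) a r au[OF r] lt by (intro mult_left_mono power_mono mult_right_mono) (auto intro: less_imp_le)
      then show ?thesis using Cv(2)[of "a r * lifetime"] al(2)[OF r] lt by (meson ennreal_leI less_imp_le mult_right_mono order_trans)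
    qed
    have "0 \<le> au" using au[of 0] a by (meson le0 less_imp_le order_trans)
    then have Nn: "0 \<le> Cv * (au * lifetime) ^ CARD('d)" using Cv(1) lt by simp
    have s0: "0 \<le> Cs * wa * lifetime powr (- 2 * b1)" using Cs(1) wa0 by simp
    have S2l: "(\<integral>\<^sup>+S. ennreal ((cmean \<mu>' f' (clip_box (a r * lifetime) x S) - \<mu>' x)\<^sup>2) \<partial>exp_pair)
      \<le> ennreal (Cs * wa * lifetime powr (- 2 * b1))" if "r \<le> J" for r by (rule S2[OF that lt])
    show ?thesis
    proof (rule integrableI_nonneg)
      show "forest_sq_error J a \<omega> lifetime B n \<mu> x \<in> borel_measurable (forest_law P J B n)"
        unfolding err[symmetric]
        by (rule forest_bound(1)[OF x lt]) (fact a' B n \<omega>1 N Nn S2l s0 order_refl)+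
      show "AE Z in forest_law P J B n. 0 \<le> forest_sq_error J a \<omega> lifetime B n \<mu> x Z" using err0 by simp
      show "(\<integral>\<^sup>+Z. ennreal (forest_sq_error J a \<omega> lifetime B n \<mu> x Z) \<partial>forest_law P J B n) < \<infinity>"
        unfolding err[symmetric] infinity_ennreal_def
        by (rule le_less_trans[OF forest_bound(2)[OF x lt]], (fact a' B n \<omega>1 N Nn S2l s0 order_refl)+) simp
    qed
  qed
  obtain Cv where Cv: "0 \<le> Cv" "\<And>l. al \<le> l \<Longrightarrow>
    (\<integral>\<^sup>+S. ennreal (1 / measure lborel (clip_box l x S)) \<partial>exp_pair) \<le> ennreal (Cv * l ^ CARD('d))"
    using inverse_volume_bound[OF x al(1)] by metis
  have au0: "0 \<le> au" using au[of 0] a by (meson le0 less_imp_le order_trans)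
  define K1 where "K1 = 2 * \<Omega>\<^sup>2 * (3 * max 0 C2 / c0 * (Cv * au ^ d))"
  define K2 where "K2 = 2 * Cm\<^sup>2"
  define K3 where "K3 = 2 * \<omega>2 * (Cs * wa)"
  have K0: "0 \<le> K1" "0 \<le> K2" "0 \<le> K3"
    unfolding K1_def K2_def K3_def
    using Cv(1) au0 c0(1) Cs(1) wa0 \<omega>20 by (simp_all add: mult_nonneg_nonneg)
  show thesis
  proof (rule that[of "K1 + K2 + K3"])
    show "0 \<le> K1 + K2 + K3" using K0 by simp
    show "integrable (forest_law P J B n) (forest_sq_error J a \<omega> lifetime B n \<mu> x)"
      if "1 \<le> n" "1 \<le> B" "0 < lifetime" for n B lifetime by (rule int[OF that])
    fix n B :: nat and lifetime :: real
    assume n: "1 \<le> n" and B: "1 \<le> B" and l1: "1 \<le> lifetime"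
    have lt: "0 < lifetime" using l1 by simp
    have N: "(\<integral>\<^sup>+S. ennreal (1 / measure lborel (clip_box (a r * lifetime) x S)) \<partial>exp_pair) \<le> ennreal (Cv * (au ^ d * lifetime ^ d))"
      if r: "r \<le> J" for r
    proof -
      have "al * 1 \<le> a r * lifetime" using al l1 al(2)[OF r] by (intro mult_mono) auto
      then have "(\<integral>\<^sup>+S. ennreal (1 / measure lborel (clip_box (a r * lifetime) x S)) \<partial>exp_pair) \<le> ennreal (Cv * (a r * lifetime) ^ d)"
        using Cv(2) by (simp add: d_def)
      also have "\<dots> \<le> ennreal (Cv * (au * lifetime) ^ d)"
        using Cv(1) a r au[OF r] lt by (intro ennreal_leI mult_left_mono power_mono mult_right_mono) (auto intro: less_imp_le)
      finally show ?thesis by (simp only: power_mult_distrib)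
    qed
    have Nn: "0 \<le> Cv * (au ^ d * lifetime ^ d)" using Cv(1) au0 lt by simp
    have s0: "0 \<le> Cs * wa * lifetime powr (- 2 * b1)" using Cs(1) wa0 by simp
    have S2l: "(\<integral>\<^sup>+S. ennreal ((cmean \<mu>' f' (clip_box (a r * lifetime) x S) - \<mu>' x)\<^sup>2) \<partial>exp_pair)
      \<le> ennreal (Cs * wa * lifetime powr (- 2 * b1))" if "r \<le> J" for r by (rule S2[OF that lt])
    let ?bd = "2 * \<Omega>\<^sup>2 * (3 * max 0 C2 / (real n * c0) * (Cv * (au ^ d * lifetime ^ d))) +
        2 * ((Cm * lifetime powr (- M))\<^sup>2 + \<omega>2 * (Cs * wa * lifetime powr (- 2 * b1)) / real B)"
    have bd0: "0 \<le> ?bd" 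
      using Cv(1) au0 lt Cs(1) wa0 c0(1) \<omega>20
      by (intro add_nonneg_nonneg mult_nonneg_nonneg divide_nonneg_nonneg) auto
    have "(\<integral>\<^sup>+Z. ennreal (forest_sq_error J a \<omega> lifetime B n \<mu> x Z) \<partial>forest_law P J B n) \<le> ennreal ?bd"
      unfolding \<Omega>_def \<omega>2_def err[symmetric]
      by (rule forest_bound(2)[OF x lt]) (fact a' B n \<omega>1 N Nn S2l s0 Cm(2)[OF l1])+
    then have "(\<integral>Z. forest_sq_error J a \<omega> lifetime B n \<mu> x Z \<partial>forest_law P J B n) \<le> ?bd"
      using bd0 nn_integral_eq_integral[OF int[OF n B lt]] err0 by simp
    also have "?bd = K1 * (lifetime ^ d / real n) + K2 * (1 / lifetime powr (2 * M)) + K3 * (1 / (lifetime powr (2 * b1) * real B))"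
    proof -
      have "(lifetime powr (- M))\<^sup>2 = 1 / lifetime powr (2 * M)" using lt
        by (simp add: powr_power powr_minus_divide power_one_over mult.commute)
      moreover have "lifetime powr (- 2 * b1) = 1 / lifetime powr (2 * b1)"
        using powr_minus_divide[of lifetime "2 * b1"] by simp
      ultimately show ?thesis
        unfolding K1_def K2_def K3_def power_mult_distrib using c0(1) n B by (simp add: distrib_left mult_ac)
    qed
    also have "\<dots> \<le> (K1 + K2 + K3) * (lifetime ^ d / real n) + (K1 + K2 + K3) * (1 / lifetime powr (2 * M)) +
        (K1 + K2 + K3) * (1 / (lifetime powr (2 * b1) * real B))"
      using K0 lt by (intro add_mono mult_right_mono) auto
    also have "\<dots> = (K1 + K2 + K3) * (lifetime ^ d / real n + 1 / lifetime powr (2 * M) + 1 / (lifetime powr (2 * b1) * real B))"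
      by (simp only: distrib_left)
    finally show "(\<integral>Z. forest_sq_error J a \<omega> lifetime B n \<mu> x Z \<partial>forest_law P J B n) \<le>
      (K1 + K2 + K3) * (lifetime ^ CARD('d) / real n + 1 / lifetime powr (2 * min (2 * real J + 2) \<beta>) +
        1 / (lifetime powr (2 * min 1 \<beta>) * real B))"
      by (simp only: d_def M_def b1)
  qed
qed

text \<open>The lifetime balances the sample term against the squared bias, and the number of trees
  is just large enough to bring the last term to the same order.\<close>

lemma optimal_rate:
  fixes lam :: "nat \<Rightarrow> real" and B :: "nat \<Rightarrow> nat" and \<beta> b1 :: real
  assumes d: "1 \<le> d" and \<beta>: "0 < \<beta>" and b1: "0 \<le> b1" and lam_pos: "\<forall>n\<ge>1. lam n > 0" and B_pos: "\<forall>n\<ge>1. B n \<ge> 1"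
    and lam: "lam \<asymp> (\<lambda>n. real n powr (1 / (real d + 2 * \<beta>)))"
    and B: "(\<lambda>n. real n powr ((2 * \<beta> - 2 * b1) / (real d + 2 * \<beta>))) \<lesssim> (\<lambda>n. real (B n))"
  obtains C where "\<And>n. 1 \<le> n \<Longrightarrow>
    lam n ^ d / real n + 1 / lam n powr (2 * \<beta>) + 1 / (lam n powr (2 * b1) * real (B n)) \<le>
    C * real n powr (- (2 * \<beta> / (real d + 2 * \<beta>)))"
proof -
  define D where "D = real d + 2 * \<beta>"
  have D: "0 < D" using d \<beta> by (simp add: D_def)
  have npos: "\<forall>n\<ge>1. 0 < real n powr t" for t by simp
  have lam1: "lam \<lesssim> (\<lambda>n. real n powr (1 / D))" and lam2: "(\<lambda>n. real n powr (1 / D)) \<lesssim> lam"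
    using lam by (auto simp: asymp_same_def D_def)
  obtain c1 where c1: "1 \<le> c1" "\<And>n. 1 \<le> n \<Longrightarrow> lam n \<le> c1 * real n powr (1 / D)"
    by (rule lesssimE[OF lam1 npos]) (rule that)
  obtain c2 where c2: "1 \<le> c2" "\<And>n. 1 \<le> n \<Longrightarrow> real n powr (1 / D) \<le> c2 * lam n"
    by (rule lesssimE[OF lam2 lam_pos]) (rule that)
  have B0: "\<forall>n\<ge>1. 0 < real (B n)" using B_pos by (auto simp: Suc_le_eq)
  obtain c3 where c3: "1 \<le> c3" "\<And>n. 1 \<le> n \<Longrightarrow> real n powr ((2 * \<beta> - 2 * b1) / D) \<le> c3 * real (B n)"
    by (rule lesssimE[OF B[folded D_def] B0]) (rule that)
  show thesis
  proof (rule that[of "c1 ^ d + c2 powr (2 * \<beta>) + c2 powr (2 * b1) * c3"])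
    fix n :: nat assume n: "1 \<le> n"
    let ?N = "real n" and ?T = "real n powr (- (2 * \<beta> / D))"
    have N: "0 < ?N" using n by simp
    have l: "0 < lam n" using lam_pos n by simp
    \<comment> \<open>Negative powers of the lifetime need its lower comparison with the power of n,
      the sample term the upper one.\<close>
    have inv: "1 / lam n powr t \<le> c2 powr t * ?N powr (- (t / D))" if "0 \<le> t" for t
    proof -
      have "?N powr (t / D) = (?N powr (1 / D)) powr t" by (simp add: powr_powr)
      also have "\<dots> \<le> (c2 * lam n) powr t" using c2(2)[OF n] that by (intro powr_mono2) auto
      also have "\<dots> = c2 powr t * lam n powr t" using c2(1) l by (simp add: powr_mult)
      finally have "?N powr (t / D) / (lam n powr t * ?N powr (t / D)) \<le> c2 powr t * lam n powr t / (lam n powr t * ?N powr (t / D))"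
        by (rule divide_right_mono) simp
      then show ?thesis using l N by (simp add: powr_minus_divide)
    qed
    have 1: "lam n ^ d / ?N \<le> c1 ^ d * ?T"
    proof -
      have "lam n ^ d \<le> (c1 * ?N powr (1 / D)) ^ d" using c1(2)[OF n] l by (intro power_mono) auto
      also have "\<dots> = c1 ^ d * ?N powr (real d / D)" using N by (simp add: power_mult_distrib powr_power mult.commute)
      finally have "lam n ^ d / ?N \<le> c1 ^ d * ?N powr (real d / D) / ?N" using N by (intro divide_right_mono) auto
      also have "\<dots> = c1 ^ d * (?N powr (real d / D) * ?N powr (- 1))" using N by (simp add: powr_minus_divide)
      also have "?N powr (real d / D) * ?N powr (- 1) = ?N powr (real d / D + - 1)" by (rule powr_add[symmetric])
      \<comment> \<open>The exponent of the sample term, using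
        \<open>D = real d + 2 * \<beta>\<close>.\<close>
      also have "real d / D + - 1 = - (2 * \<beta> / D)" using D by (simp add: D_def field_simps)
      finally show ?thesis .
    qed
    have 2: "1 / lam n powr (2 * \<beta>) \<le> c2 powr (2 * \<beta>) * ?T" using inv[of "2 * \<beta>"] \<beta> by simp
    have 3: "1 / (lam n powr (2 * b1) * real (B n)) \<le> c2 powr (2 * b1) * c3 * ?T"
    proof -
      let ?t = "(2 * \<beta> - 2 * b1) / D"
      have Bn: "0 < real (B n)" using B0 n by simp
      have "?N powr ?t / (real (B n) * ?N powr ?t) \<le> c3 * real (B n) / (real (B n) * ?N powr ?t)"
        using c3(2)[OF n] Bn by (intro divide_right_mono) auto
      then have B1: "1 / real (B n) \<le> c3 * ?N powr (- ?t)" using Bn N by (simp add: powr_minus_divide)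
      have "1 / (lam n powr (2 * b1) * real (B n)) = (1 / lam n powr (2 * b1)) * (1 / real (B n))" by simp
      also have "\<dots> \<le> (c2 powr (2 * b1) * ?N powr (- (2 * b1 / D))) * (c3 * ?N powr (- ?t))"
        using inv[of "2 * b1"] B1 b1 Bn c3(1) by (intro mult_mono) auto
      also have "\<dots> = c2 powr (2 * b1) * c3 * (?N powr (- (2 * b1 / D)) * ?N powr (- ?t))" by simp
      also have "?N powr (- (2 * b1 / D)) * ?N powr (- ?t) = ?N powr (- (2 * b1 / D) + - ?t)" by (rule powr_add[symmetric])
      also have "- (2 * b1 / D) + - ?t = - (2 * \<beta> / D)" by (simp add: diff_divide_distrib)
      finally show ?thesis .
    qed
    have "lam n ^ d / ?N + 1 / lam n powr (2 * \<beta>) + 1 / (lam n powr (2 * b1) * real (B n)) \<le>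
        c1 ^ d * ?T + c2 powr (2 * \<beta>) * ?T + c2 powr (2 * b1) * c3 * ?T" using 1 2 3 by (intro add_mono)
    then show "lam n ^ d / ?N + 1 / lam n powr (2 * \<beta>) + 1 / (lam n powr (2 * b1) * real (B n)) \<le>
        (c1 ^ d + c2 powr (2 * \<beta>) + c2 powr (2 * b1) * c3) * ?N powr (- (2 * \<beta> / (real d + 2 * \<beta>)))"
      by (simp only: distrib_right D_def)
  qed
qed

theorem theorem4:
  fixes P :: "((real ^ 'd) \<times> real) measure"
    and f \<mu> \<sigma>2 :: "real ^ 'd \<Rightarrow> real"
    and \<beta>\<^sub>f \<beta>\<^sub>\<mu> \<beta>\<^sub>\<sigma> \<beta> :: real
    and J :: nat and a \<omega> :: "nat \<Rightarrow> real"
    and x :: "real ^ 'd"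
    and lam :: "nat \<Rightarrow> real" and B :: "nat \<Rightarrow> nat"
  assumes P: "prob_space P" "sets P = sets borel"
    and density: "distributed P lborel fst (\<lambda>y. ennreal (f y) * indicator unit_cube y)"
    and density_bounded_below: "\<exists>c>0. \<forall>y\<in>unit_cube. c \<le> f y"
    and density_holder: "\<beta>\<^sub>f > 0" "f \<in> holder_class \<beta>\<^sub>f"
    and second_moment: "\<exists>C::real. AE z in P.
          nn_cond_exp P (sigma_X P) (\<lambda>z. ennreal ((snd z)\<^sup>2)) z \<le> ennreal C"
    and regression: "AE z in P. real_cond_exp P (sigma_X P) snd z = \<mu> (fst z)"
    and regression_holder: "\<beta>\<^sub>\<mu> > 0" "\<mu> \<in> holder_class \<beta>\<^sub>\<mu>"
    and variance: "AE z in P.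
          real_cond_exp P (sigma_X P) (\<lambda>z. (snd z - \<mu> (fst z))\<^sup>2) z = \<sigma>2 (fst z)"
    and variance_bounded_below: "\<exists>c>0. \<forall>y\<in>unit_cube. c \<le> \<sigma>2 y"
    and variance_holder: "\<beta>\<^sub>\<sigma> > 0" "\<sigma>2 \<in> holder_class \<beta>\<^sub>\<sigma>"
    and \<beta>: "\<beta> = min \<beta>\<^sub>\<mu> (\<beta>\<^sub>f + 1)"
    and a: "\<forall>r\<le>J. a r > 0" "inj_on a {..J}"
    and \<omega>: "debiasing_weights J a \<omega>"
    and x: "x \<in> box 0 1"
    and lam_pos: "\<forall>n\<ge>1. lam n > 0" and B_pos: "\<forall>n\<ge>1. B n \<ge> 1"
    and lam_lower: "(\<lambda>n. ln (real n) ^ 3) \<lesssim> lam"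
    and lam_upper: "filterlim (\<lambda>n. real n / lam n ^ CARD('d)) at_top sequentially"
    and B_lower: "(\<lambda>n. ln (real n) ^ CARD('d)) \<lesssim> (\<lambda>n. real (B n))"
  shows "(\<forall>n\<ge>1. integrable (forest_law P J (B n) n)
              (forest_sq_error J a \<omega> (lam n) (B n) n \<mu> x)) \<and>
    (\<lambda>n. \<integral>Z. forest_sq_error J a \<omega> (lam n) (B n) n \<mu> x Z \<partial>forest_law P J (B n) n) \<lesssim>
      (\<lambda>n. lam n ^ CARD('d) / real n
           + 1 / lam n powr (2 * min (2 * real J + 2) \<beta>)
           + 1 / (lam n powr (2 * min 1 \<beta>) * real (B n))) \<and>
    (J \<ge> holder_order \<beta> div 2 \<longrightarrow>
     lam \<asymp> (\<lambda>n. real n powr (1 / (real CARD('d) + 2 * \<beta>))) \<longrightarrow>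
     (\<lambda>n. real n powr ((2 * \<beta> - 2 * min 1 \<beta>) / (real CARD('d) + 2 * \<beta>))) \<lesssim> (\<lambda>n. real (B n)) \<longrightarrow>
     (\<lambda>n. \<integral>Z. forest_sq_error J a \<omega> (lam n) (B n) n \<mu> x Z \<partial>forest_law P J (B n) n) \<lesssim>
       (\<lambda>n. real n powr (- (2 * \<beta> / (real CARD('d) + 2 * \<beta>)))))"
proof -
  have \<beta>0: "0 < \<beta>" using density_holder(1) regression_holder(1) by (simp add: \<beta>)
  obtain C where C: "0 \<le> C"
    "\<And>n B lifetime. 1 \<le> n \<Longrightarrow> 1 \<le> B \<Longrightarrow> 0 < lifetime \<Longrightarrow>
      integrable (forest_law P J B n) (forest_sq_error J a \<omega> lifetime B n \<mu> x)"
    "\<And>n B lifetime. 1 \<le> n \<Longrightarrow> 1 \<le> B \<Longrightarrow> 1 \<le> lifetime \<Longrightarrow>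
      (\<integral>Z. forest_sq_error J a \<omega> lifetime B n \<mu> x Z \<partial>forest_law P J B n) \<le>
      C * (lifetime ^ CARD('d) / real n + 1 / lifetime powr (2 * min (2 * real J + 2) \<beta>) +
        1 / (lifetime powr (2 * min 1 \<beta>) * real B))"
  proof -
    show thesis
      by (rule forest_risk_bound[OF P density density_bounded_below density_holder second_moment regression
            regression_holder \<beta> a(1) \<omega> x]) (fact that)
  qed
  define E where "E n = (\<integral>Z. forest_sq_error J a \<omega> (lam n) (B n) n \<mu> x Z \<partial>forest_law P J (B n) n)" for n
  define R where "R n = lam n ^ CARD('d) / real n + 1 / lam n powr (2 * min (2 * real J + 2) \<beta>)
      + 1 / (lam n powr (2 * min 1 \<beta>) * real (B n))" for n
  have R0: "\<forall>n\<ge>1. 0 < R n"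
  proof (intro allI impI)
    fix n :: nat assume "1 \<le> n"
    then have "0 < lam n" "0 < real n" using lam_pos by auto
    then show "0 < R n" unfolding R_def by (intro add_pos_nonneg) auto
  qed
  \<comment> \<open>The risk bound needs a lifetime of at least 1, which holds for all but finitely
    many n.\<close>
  have ev: "eventually (\<lambda>n. E n \<le> C * R n) sequentially"
    using eventually_lifetime_ge_one[OF lam_lower lam_pos] eventually_ge_at_top[of 1]
  proof eventually_elim
    case (elim n)
    then show ?case unfolding E_def R_def using B_pos by (intro C(3)) auto
  qed
  have first: "\<forall>n\<ge>1. integrable (forest_law P J (B n) n) (forest_sq_error J a \<omega> (lam n) (B n) n \<mu> x)"
    using C(2) lam_pos B_pos by blast
  have second: "E \<lesssim> R" by (rule lesssimI[OF ev R0])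
  have third: "E \<lesssim> (\<lambda>n. real n powr (- (2 * \<beta> / (real CARD('d) + 2 * \<beta>))))"
    if J: "holder_order \<beta> div 2 \<le> J" and lam: "lam \<asymp> (\<lambda>n. real n powr (1 / (real CARD('d) + 2 * \<beta>)))"
      and Bn: "(\<lambda>n. real n powr ((2 * \<beta> - 2 * min 1 \<beta>) / (real CARD('d) + 2 * \<beta>))) \<lesssim> (\<lambda>n. real (B n))"
  proof -
    \<comment> \<open>Integer division loses at most 1, so \<open>holder_order \<beta>\<close> is at
      most \<open>2 * J + 1\<close>; and \<beta> exceeds its order by at most 1. Hence debiasing is
      no longer the limiting factor.\<close>
    have "holder_order \<beta> + 1 \<le> 2 * J + 2" using J by linarith
    then have "real (holder_order \<beta>) + 1 \<le> 2 * real J + 2" by linarith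
    then have "\<beta> \<le> 2 * real J + 2" using holder_order_bounds(1)[OF \<beta>0] by linarith
    then have min: "min (2 * real J + 2) \<beta> = \<beta>" by simp
    have "1 \<le> CARD('d)" by (simp add: Suc_leI)
    from optimal_rate[OF this \<beta>0 _ lam_pos B_pos lam Bn] \<beta>0
    obtain C' where C': "\<And>n. 1 \<le> n \<Longrightarrow> R n \<le> C' * real n powr (- (2 * \<beta> / (real CARD('d) + 2 * \<beta>)))"
      unfolding R_def min by auto
    show ?thesis
    proof (rule lesssimI)
      show "eventually (\<lambda>n. E n \<le> C * C' * real n powr (- (2 * \<beta> / (real CARD('d) + 2 * \<beta>)))) sequentially"
        using ev eventually_ge_at_top[of 1]
      proof eventually_elim
        case (elim n)
        have "C * R n \<le> C * (C' * real n powr (- (2 * \<beta> / (real CARD('d) + 2 * \<beta>))))"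
          using C'[OF elim(2)] C(1) by (rule mult_left_mono)
        with elim(1) show ?case by (simp add: mult.assoc)
      qed
    qed simp
  qed
  show ?thesis
    by (intro conjI impI first second[unfolded E_def[abs_def] R_def[abs_def]] third[unfolded E_def[abs_def]]) assumption+
qed

end
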